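(* Let $b=b(\epsilon)>0$ and $R=R(\epsilon)>0$ be functions of a parameter $\epsilon$ such that, as $\epsilon\to0$, $$b(\epsilon)\to0,\qquad R(\epsilon)\to\infty,\qquad \frac{1}{R(\epsilon)^2}\ln\frac{R(\epsilon)}{\sqrt{b(\epsilon)}}\to0.$$ Let $M_0(b,R)$ be the ground state energy defined in the context. Then $$\frac{M_0(b,R)}{R^3}=b\ln\frac{1}{\sqrt b}\,\big(1+o(1)\big)\quad\text{as }\epsilon\to0.$$
   Context: Let $\mathbf F(x_1,x_2,x_3)=(-x_2/2,x_1/2,0)$ and $Q_R=(-R/2,R/2)^3\subset\mathbb{R}^3$. For $u\in H^1(Q_R;\mathbb{C})$ let $$G_{Q_R}(u)=\int_{Q_R}\Big(b|(\nabla-i\mathbf F)u|^2+\frac12(1-|u|^2)^2\Big)dx,$$ and $M_0(b,R)=\inf\{G_{Q_R}(u):u\in H^1(Q_R;\mathbb{C})\}$. *)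

theory Defs
  imports "HOL-Analysis.Analysis" "HOL-Library.Landau_Symbols"
begin

definition magF :: "real^3 \<Rightarrow> real^3" where
  "magF x = vector [- (x$2) / 2, (x$1) / 2, 0]"

definition cubeQ :: "real \<Rightarrow> (real^3) set" where
  "cubeQ R = {x. \<forall>i. - R / 2 < x$i \<and> x$i < R / 2}"

definition pderiv3 :: "3 \<Rightarrow> (real^3 \<Rightarrow> real) \<Rightarrow> real^3 \<Rightarrow> real" where
  "pderiv3 j f x = frechet_derivative f (at x) (axis j 1)"

fun Ck :: "nat \<Rightarrow> (real^3 \<Rightarrow> real) \<Rightarrow> bool" where
  "Ck 0 f = continuous_on UNIV f"
| "Ck (Suc k) f = (continuous_on UNIV f \<and> f differentiable_on UNIV \<and> (\<forall>j. Ck k (pderiv3 j f)))"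

definition smooth3 :: "(real^3 \<Rightarrow> real) \<Rightarrow> bool" where
  "smooth3 f \<longleftrightarrow> (\<forall>k. Ck k f)"

definition test_fun :: "(real^3) set \<Rightarrow> (real^3 \<Rightarrow> real) \<Rightarrow> bool" where
  "test_fun Q \<phi> \<longleftrightarrow> smooth3 \<phi> \<and> compact (closure {x. \<phi> x \<noteq> 0}) \<and> closure {x. \<phi> x \<noteq> 0} \<subseteq> Q"

definition L2_on :: "(real^3) set \<Rightarrow> (real^3 \<Rightarrow> complex) \<Rightarrow> bool" where
  "L2_on Q u \<longleftrightarrow> u \<in> borel_measurable (lebesgue_on Q) \<and> integrable (lebesgue_on Q) (\<lambda>x. (cmod (u x))^2)"

definition H1_weak_grad :: "(real^3) set \<Rightarrow> (real^3 \<Rightarrow> complex) \<Rightarrow> (3 \<Rightarrow> real^3 \<Rightarrow> complex) \<Rightarrow> bool" where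
  "H1_weak_grad Q u g \<longleftrightarrow> L2_on Q u \<and> (\<forall>j. L2_on Q (g j)) \<and>
     (\<forall>j \<phi>. test_fun Q \<phi> \<longrightarrow>
        (LINT x|lebesgue_on Q. u x * complex_of_real (pderiv3 j \<phi> x))
          = - (LINT x|lebesgue_on Q. g j x * complex_of_real (\<phi> x)))"

text \<open>G_{Q_R}(u), with (\<nabla>u)_j given by the weak derivative g_j.\<close>
definition GL_energy :: "real \<Rightarrow> real \<Rightarrow> (real^3 \<Rightarrow> complex) \<Rightarrow> (3 \<Rightarrow> real^3 \<Rightarrow> complex) \<Rightarrow> ennreal" where
  "GL_energy b R u g = (\<integral>\<^sup>+ x \<in> cubeQ R.
      ennreal (b * (\<Sum>j\<in>UNIV. (cmod (g j x - \<i> * complex_of_real (magF x $ j) * u x))^2)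
               + (1 - (cmod (u x))^2)^2 / 2) \<partial>lebesgue)"

definition M0 :: "real \<Rightarrow> real \<Rightarrow> real" where
  "M0 b R = enn2real (INF ug \<in> {(u, g). H1_weak_grad (cubeQ R) u g}. GL_energy b R (fst ug) (snd ug))"

end

theory Submission
  imports Defs
begin

text \<open>Lower bound. Put \<open>D = (\<nabla> - i F) u\<close> and let \<open>J\<close> be the horizontal part of \<open>Im (cnj u D) / |u|\<^sup>2\<close>,
  truncated where \<open>|u|\<close> is small. On a horizontal circle of radius \<open>r\<close> where \<open>|u|\<close> is not small,
  the circulation of \<open>J\<close> plus \<open>pi r\<^sup>2\<close> is \<open>2 pi m\<close> with an integer \<open>m\<close>. With \<open>B\<close> the mean of
  \<open>e\<^sup>-\<^sup>i\<^sup>v (J\<^sub>1 + i J\<^sub>2)\<close> over the circle and \<open>s = Im B\<close>, the bound \<open>m\<^sup>2 \<ge> m\<close> reads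
  \<open>s\<^sup>2 \<ge> (1 - r\<^sup>2) (s / r + 1 / 2)\<close>. The linear term disappears after integration over the centres
  because \<open>e\<^sup>-\<^sup>i\<^sup>v\<close> has mean zero, so \<open>\<integral> |B|\<^sup>2 dx \<ge> (1 - r\<^sup>2) V / 2 - o(V)\<close>. On the other hand circle means solve the
  Euler-Poisson-Darboux equation, whose energy dissipation gives
  \<open>\<integral> (1 / r) \<integral> |B|\<^sup>2 dx dr \<le> (1 / 2) \<integral> |J|\<^sup>2 dx\<close> over any range of radii. Integrating over
  \<open>K sqrt b \<le> r \<le> r1\<close> produces \<open>V ln (1 / sqrt b)\<close>.

  Upper bound. The trial function is \<open>e\<^sup>-\<^sup>i\<^sup>x\<^sup>y\<^sup>/\<^sup>2 w / sqrt (|w|\<^sup>2 + b)\<close> with an explicit \<open>w\<close> that has a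
  square lattice of simple zeros, one per flux quantum; its energy density in a cell is
  \<open>b / |x|\<^sup>2\<close> near the zero, regularised at distance \<open>sqrt b\<close>.\<close>

section \<open>Energy dissipation for circle means\<close>

text \<open>The vortices of an arbitrary competitor cannot be located or counted. The lower bound
  therefore never isolates one: all horizontal circles of a given radius enter at once, and
  quantisation is used only through m^2 \<ge> m. At leading order this loses nothing, being an
  equality for m = 0 and m = 1, the degrees that a vortex lattice shows to small circles. Since curl
  F = e_3, the natural vortex density is 1 / (2 pi) per unit area; a vortex line costs 2 pi b ln (1
  / sqrt b) per unit length, and the product is the claimed density. Circles on which |u| becomes
  small are paid for by their own energy; integrated over r \<ge> K sqrt b these exceptions cost a
  fraction of order 1 / K. Discarding the linear term needs a cutoff of width proportional to R,
  with an error of relative order sqrt (ln (1 / sqrt b)) / R. This is where the third hypothesis on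
  b and R enters.\<close>

lemma integral_periodic_shift:
  fixes g :: "real \<Rightarrow> 'a::banach"
  assumes g: "continuous_on UNIV g" and per: "\<And>x. g (x + p) = g x" and p: "p \<ge> 0"
  shows "integral {0..p} (\<lambda>x. g (x + d)) = integral {0..p} g"
proof -
  have nonneg: "integral {0..p} (\<lambda>x. h (x + e)) = integral {0..p} h"
    if h: "continuous_on UNIV h" and perh: "\<And>x. h (x + p) = h x" and e: "e \<ge> 0"
    for h :: "real \<Rightarrow> 'a" and e
  proof -
    have int: "h integrable_on {s..t}" for s t
      using h by (meson continuous_on_subset integrable_continuous_real subset_UNIV)
    have shift: "integral {0..t} (\<lambda>x. h (x + e)) = integral {e..t + e} h" for t e
      using integral_shift_real_ivl[of e e "t + e" h] by simp
    have "integral {0..e} h + integral {e..p + e} h = integral {0..p + e} h"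
      using e p by (intro Henstock_Kurzweil_Integration.integral_combine int) auto
    moreover have "integral {0..p} h + integral {p..p + e} h = integral {0..p + e} h"
      using e p by (intro Henstock_Kurzweil_Integration.integral_combine int) auto
    moreover have "integral {p..p + e} h = integral {0..e} h"
      using shift[of e p] by (simp add: perh add.commute)
    ultimately have "integral {e..p + e} h = integral {0..p} h"
      by (metis add.commute add_left_cancel)
    then show ?thesis
      using shift[of p e] by simp
  qed
  show ?thesis
  proof (cases "d \<ge> 0")
    case True
    then show ?thesis using nonneg[OF g per] by blast
  next
    case False
    have "g (x + p + d) = g (x + d)" for x
      using per[of "x + d"] by (simp add: algebra_simps)
    then have "integral {0..p} (\<lambda>x. g (x + - d + d)) = integral {0..p} (\<lambda>x. g (x + d))"
      using False by (intro nonneg[where h = "\<lambda>x. g (x + d)"])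
        (auto intro!: continuous_on_compose2[OF g] continuous_intros)
    then show ?thesis by simp
  qed
qed

text \<open>The derivative in \<open>r\<close> and an integration by parts in \<open>v\<close> turn
  \<open>a r = \<integral> (1 + e\<^sup>2\<^sup>i\<^sup>v) c (2 r sin v) dv\<close> into \<open>a' r = - (2 / r) \<integral> e\<^sup>2\<^sup>i\<^sup>v c (2 r sin v) dv\<close>:
  this is the energy dissipation of the Euler-Poisson-Darboux equation.\<close>

lemma radial_dissipation_C1:
  fixes c c' :: "real \<Rightarrow> complex"
  assumes c: "\<And>x. (c has_vector_derivative c' x) (at x)"
    and c': "continuous_on UNIV c'"
    and r: "0 < r0" "r0 \<le> r1"
  shows "((\<lambda>r. (2 / r) *\<^sub>R integral {0..pi} (\<lambda>v. cis (2 * v) * c (2 * r * sin v))) has_integral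
    (integral {0..pi} (\<lambda>v. (1 + cis (2 * v)) * c (2 * r0 * sin v)) -
     integral {0..pi} (\<lambda>v. (1 + cis (2 * v)) * c (2 * r1 * sin v)))) {r0..r1}"
proof -
  let ?\<phi> = "\<lambda>r. integral {0..pi} (\<lambda>v. cis (2 * v) * c (2 * r * sin v))"
  let ?a = "\<lambda>r. integral {0..pi} (\<lambda>v. (1 + cis (2 * v)) * c (2 * r * sin v))"
  let ?b = "\<lambda>r. integral {0..pi} (\<lambda>v. (1 + cis (2 * v)) * ((2 * sin v) *\<^sub>R c' (2 * r * sin v)))"
  have cc: "continuous_on UNIV c"
    using c by (meson continuous_at_imp_continuous_on has_vector_derivative_continuous)
  note [continuous_intros] = continuous_on_compose2[OF cc] continuous_on_compose2[OF c']
  have comp: "((\<lambda>r. c (f r)) has_vector_derivative f' *\<^sub>R c' (f r)) (at r within S)"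
    if "(f has_real_derivative f') (at r within S)" for f f' r S
    using vector_diff_chain_within[of f f' r S c "c' (f r)"] that c
    by (auto simp: o_def has_real_derivative_iff_has_vector_derivative
        intro: has_vector_derivative_at_within)
  have byparts: "?b r = - (2 / r) *\<^sub>R ?\<phi> r" if "r > 0" for r
  proof -
    let ?F = "\<lambda>v. - \<i> * (cis (2 * v) - 1) * c (2 * r * sin v)"
    let ?F' = "\<lambda>v. 2 * cis (2 * v) * c (2 * r * sin v)
         + r *\<^sub>R ((1 + cis (2 * v)) * ((2 * sin v) *\<^sub>R c' (2 * r * sin v)))"
    \<comment> \<open>Differentiating \<open>c (2 * r * sin v)\<close> in r produces the factor sin
      v, in v the factor cos v. The identity trades one for the other, so that the r-derivative
      becomes an exact v-derivative up to a term without \<open>c'\<close>. The boundary terms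
      vanish because cis (2 v) = 1 at 0 and at pi.\<close>
    have trig: "(1 + cis (2 * v)) * sin v = - \<i> * (cis (2 * v) - 1) * cos v" for v
    proof -
      have "cis (2 * v) = cis v * cis v" by (simp add: cis_mult)
      then show ?thesis
        by (simp add: complex_eq_iff algebra_simps power2_eq_square)
          (use sin_cos_squared_add[of v] in algebra)
    qed
    have "(?F has_vector_derivative ?F' v) (at v within {0..pi})" for v
    proof -
      have "((\<lambda>v. cis (2 * v)) has_vector_derivative 2 *\<^sub>R (\<i> * cis (2 * v))) (at v within {0..pi})"
        unfolding cis_conv_exp
        by (auto intro!: derivative_eq_intros has_vector_derivative_real_field simp: scaleR_conv_of_real)
      moreover have "((\<lambda>v. c (2 * r * sin v)) has_vector_derivative
          (2 * r * cos v) *\<^sub>R c' (2 * r * sin v)) (at v within {0..pi})"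
        by (rule comp) (auto intro!: derivative_eq_intros)
      ultimately have "(?F has_vector_derivative
         - \<i> * (2 *\<^sub>R (\<i> * cis (2 * v))) * c (2 * r * sin v)
         + (- \<i> * (cis (2 * v) - 1)) * ((2 * r * cos v) *\<^sub>R c' (2 * r * sin v))) (at v within {0..pi})"
        by (auto intro!: derivative_eq_intros simp: algebra_simps)
      also have "- \<i> * (2 *\<^sub>R (\<i> * cis (2 * v))) * c (2 * r * sin v)
         + (- \<i> * (cis (2 * v) - 1)) * ((2 * r * cos v) *\<^sub>R c' (2 * r * sin v)) = ?F' v"
      proof -
        have "(- \<i> * (cis (2 * v) - 1)) * ((2 * r * cos v) *\<^sub>R c' (2 * r * sin v))
          = (2 * r) * (- \<i> * (cis (2 * v) - 1) * cos v) * c' (2 * r * sin v)"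
          by (simp add: scaleR_conv_of_real algebra_simps)
        also have "\<dots> = r *\<^sub>R ((1 + cis (2 * v)) * ((2 * sin v) *\<^sub>R c' (2 * r * sin v)))"
          unfolding trig[symmetric] by (simp add: scaleR_conv_of_real algebra_simps)
        finally show ?thesis by (simp add: scaleR_conv_of_real algebra_simps)
      qed
      finally show ?thesis .
    qed
    then have "(?F' has_integral ?F pi - ?F 0) {0..pi}"
      by (intro fundamental_theorem_of_calculus) auto
    then have "integral {0..pi} ?F' = 0"
      by (simp add: integral_unique)
    moreover have "integral {0..pi} ?F' = 2 * ?\<phi> r + r *\<^sub>R ?b r"
    proof -
      have "integral {0..pi} ?F' = integral {0..pi} (\<lambda>v. 2 * (cis (2 * v) * c (2 * r * sin v)))
         + integral {0..pi} (\<lambda>v. r *\<^sub>R ((1 + cis (2 * v)) * ((2 * sin v) *\<^sub>R c' (2 * r * sin v))))"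
        unfolding mult.assoc
        by (intro integral_add integrable_continuous_real continuous_intros) auto
      then show ?thesis by (simp only: integral_mult_right integral_cmul)
    qed
    ultimately have "r *\<^sub>R ?b r = - 2 * ?\<phi> r"
      by (simp add: add_eq_0_iff)
    then have "(1 / r) *\<^sub>R (r *\<^sub>R ?b r) = (1 / r) *\<^sub>R (- 2 * ?\<phi> r)" by simp
    then show ?thesis using that by (simp add: scaleR_conv_of_real)
  qed
  have deriv: "(?a has_vector_derivative ?b r) (at r within {r0..r1})" if "r \<in> {r0..r1}" for r
    unfolding cbox_interval[symmetric]
  proof (rule leibniz_rule_vector_derivative)
    fix r v assume "r \<in> cbox r0 r1" "v \<in> cbox 0 pi"
    show "((\<lambda>r. (1 + cis (2 * v)) * c (2 * r * sin v)) has_vector_derivative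
          (1 + cis (2 * v)) * ((2 * sin v) *\<^sub>R c' (2 * r * sin v))) (at r within cbox r0 r1)"
      by (intro has_vector_derivative_mult_right comp) (auto intro!: derivative_eq_intros)
  next
    show "continuous_on (cbox r0 r1 \<times> cbox 0 pi)
     (\<lambda>(r, v). (1 + cis (2 * v)) * ((2 * sin v) *\<^sub>R c' (2 * r * sin v)))"
      unfolding split_beta by (intro continuous_intros) auto
  qed (use that in \<open>auto intro!: integrable_continuous_real continuous_intros\<close>)
  have "(?b has_integral ?a r1 - ?a r0) {r0..r1}"
    using r deriv by (intro fundamental_theorem_of_calculus) auto
  then have "((\<lambda>r. - ?b r) has_integral - (?a r1 - ?a r0)) {r0..r1}"
    by (rule has_integral_neg)
  moreover have "- ?b r = (2 / r) *\<^sub>R ?\<phi> r" if "r \<in> {r0..r1}" for r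
    using byparts[of r] that r by auto
  ultimately have "((\<lambda>r. (2 / r) *\<^sub>R ?\<phi> r) has_integral - (?a r1 - ?a r0)) {r0..r1}"
    by (rule has_integral_eq[rotated])
  then show ?thesis by simp
qed

text \<open>The autocorrelation of a merely continuous f is only continuous. No derivative of c
  occurs on either side, so the C1 case extends by uniform polynomial approximation.\<close>

lemma radial_dissipation:
  fixes c :: "real \<Rightarrow> complex"
  assumes c: "continuous_on UNIV c" and r: "0 < r0" "r0 \<le> r1"
  shows "integral {r0..r1} (\<lambda>r. (2 / r) *\<^sub>R integral {0..pi} (\<lambda>v. cis (2 * v) * c (2 * r * sin v)))
    = integral {0..pi} (\<lambda>v. (1 + cis (2 * v)) * c (2 * r0 * sin v)) -
      integral {0..pi} (\<lambda>v. (1 + cis (2 * v)) * c (2 * r1 * sin v))"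
proof -
  define \<phi> where "\<phi> = (\<lambda>c r. integral {0..pi} (\<lambda>v. cis (2 * v) * (c (2 * r * sin v) :: complex)))"
  define a where "a = (\<lambda>c r. integral {0..pi} (\<lambda>v. (1 + cis (2 * v)) * (c (2 * r * sin v) :: complex)))"
  \<comment> \<open>\<open>K\<close> bounds how far the two sides together can move when c changes
    by at most one unit on [0, 2 r1]: the left integral contributes 2 / r0 times pi times the length
    of the interval, each of the two boundary terms 2 pi.\<close>
  define K where "K = 2 / r0 * pi * (r1 - r0) + 4 * pi"
  have K: "K > 0" using r by (auto simp: K_def intro!: add_nonneg_pos)
  have cont\<phi>: "continuous_on {r0..r1} (\<phi> c)" if "continuous_on UNIV c" for c
    unfolding \<phi>_def cbox_interval[symmetric]
    by (intro integral_continuous_on_param)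
      (auto intro!: continuous_intros continuous_on_compose2[OF that] simp: split_beta)
  have "norm (integral {r0..r1} (\<lambda>r. (2 / r) *\<^sub>R \<phi> c r) - (a c r0 - a c r1)) \<le> e" if e: "e > 0" for e
  proof -
    obtain g where g: "polynomial_function g" and ge: "\<And>x. x \<in> {0..2 * r1} \<Longrightarrow> norm (c x - g x) < e / K"
      using Stone_Weierstrass_polynomial_function[of "{0..2 * r1}" c "e / K"]
        continuous_on_subset[OF c subset_UNIV] e K by (metis compact_Icc divide_pos_pos)
    obtain g' where g': "polynomial_function g'" "\<And>x. (g has_vector_derivative g' x) (at x)"
      using has_vector_derivative_polynomial_function[OF g] by blast
    have cg: "continuous_on UNIV g"
      using g by (simp add: continuous_on_polymonial_function)
    note [continuous_intros] = continuous_on_compose2[OF cg] continuous_on_compose2[OF c]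
    have "integral {r0..r1} (\<lambda>r. (2 / r) *\<^sub>R \<phi> g r) = a g r0 - a g r1"
      unfolding \<phi>_def a_def
      by (rule integral_unique, rule radial_dissipation_C1[OF g'(2) _ r])
        (simp add: continuous_on_polymonial_function g'(1))
    moreover have diff: "norm (c (2 * r * sin v) - g (2 * r * sin v)) \<le> e / K"
      if "r \<in> {r0..r1}" "v \<in> {0..pi}" for r v
    proof -
      have "0 \<le> sin v" "sin v \<le> 1" using that by (auto intro: sin_ge_zero)
      then have "r * sin v \<le> r1 * 1" using that r by (intro mult_mono) auto
      with \<open>0 \<le> sin v\<close> show ?thesis using that r by (intro less_imp_le ge) auto
    qed
    have d\<phi>: "norm (\<phi> c r - \<phi> g r) \<le> pi * (e / K)" if "r \<in> {r0..r1}" for r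
    proof -
      have "\<phi> c r - \<phi> g r = integral {0..pi} (\<lambda>v. cis (2 * v) * (c (2 * r * sin v) - g (2 * r * sin v)))"
        unfolding \<phi>_def right_diff_distrib
        by (intro integral_diff[symmetric] integrable_continuous_real continuous_intros) auto
      also have "norm \<dots> \<le> (e / K) * (pi - 0)"
        using diff that by (intro integral_bound continuous_intros) (auto simp: norm_mult)
      finally show ?thesis by (simp add: mult.commute)
    qed
    have da: "norm (a c r - a g r) \<le> 2 * pi * (e / K)" if "r \<in> {r0..r1}" for r
    proof -
      have "a c r - a g r = integral {0..pi} (\<lambda>v. (1 + cis (2 * v)) * (c (2 * r * sin v) - g (2 * r * sin v)))"
        unfolding a_def right_diff_distrib
        by (intro integral_diff[symmetric] integrable_continuous_real continuous_intros) auto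
      also have "norm \<dots> \<le> (2 * (e / K)) * (pi - 0)"
      proof (intro integral_bound continuous_intros)
        fix v assume v: "v \<in> {0..pi}"
        have "norm (1 + cis (2 * v)) \<le> 2"
          using norm_triangle_ineq[of 1 "cis (2 * v)"] by simp
        then show "norm ((1 + cis (2 * v)) * (c (2 * r * sin v) - g (2 * r * sin v))) \<le> 2 * (e / K)"
          unfolding norm_mult using diff[OF that v] by (intro mult_mono) auto
      qed auto
      finally show ?thesis by (simp add: mult.commute mult.left_commute)
    qed
    have "norm (integral {r0..r1} (\<lambda>r. (2 / r) *\<^sub>R \<phi> c r) - integral {r0..r1} (\<lambda>r. (2 / r) *\<^sub>R \<phi> g r))
       \<le> (2 / r0 * (pi * (e / K))) * (r1 - r0)"
    proof -
      have "integral {r0..r1} (\<lambda>r. (2 / r) *\<^sub>R \<phi> c r) - integral {r0..r1} (\<lambda>r. (2 / r) *\<^sub>R \<phi> g r)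
        = integral {r0..r1} (\<lambda>r. (2 / r) *\<^sub>R (\<phi> c r - \<phi> g r))"
        unfolding scaleR_diff_right using r
        by (intro integral_diff[symmetric] integrable_continuous_real continuous_intros cont\<phi> c cg) auto
      also have "norm \<dots> \<le> (2 / r0 * (pi * (e / K))) * (r1 - r0)"
      proof (intro integral_bound continuous_intros cont\<phi> c cg)
        fix r assume r': "r \<in> {r0..r1}"
        have "norm ((2 / r) *\<^sub>R (\<phi> c r - \<phi> g r)) = (2 / r) * norm (\<phi> c r - \<phi> g r)"
          using r' r by simp
        also have "\<dots> \<le> 2 / r0 * (pi * (e / K))"
          using r' r d\<phi>[OF r'] by (intro mult_mono divide_left_mono) auto
        finally show "norm ((2 / r) *\<^sub>R (\<phi> c r - \<phi> g r)) \<le> 2 / r0 * (pi * (e / K))" .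
      qed (use r in auto)
      finally show ?thesis .
    qed
    moreover have "norm (a c r0 - a g r0) \<le> 2 * pi * (e / K)" "norm (a c r1 - a g r1) \<le> 2 * pi * (e / K)"
      using da r by auto
    ultimately have "norm ((integral {r0..r1} (\<lambda>r. (2 / r) *\<^sub>R \<phi> c r) - (a g r0 - a g r1))
        + ((a g r0 - a c r0) + (a c r1 - a g r1)))
       \<le> (2 / r0 * (pi * (e / K))) * (r1 - r0) + (2 * pi * (e / K) + 2 * pi * (e / K))"
      by (intro norm_triangle_mono) (simp_all add: norm_minus_commute)
    also have "(integral {r0..r1} (\<lambda>r. (2 / r) *\<^sub>R \<phi> c r) - (a g r0 - a g r1))
        + ((a g r0 - a c r0) + (a c r1 - a g r1))
       = integral {r0..r1} (\<lambda>r. (2 / r) *\<^sub>R \<phi> c r) - (a c r0 - a c r1)"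
      by simp
    also have "(2 / r0 * (pi * (e / K))) * (r1 - r0) + (2 * pi * (e / K) + 2 * pi * (e / K)) = K * (e / K)"
    proof -
      have "(2 / r0 * (pi * q)) * (r1 - r0) + (2 * pi * q + 2 * pi * q) = K * q" for q
        by (simp add: K_def algebra_simps)
      then show ?thesis .
    qed
    also have "\<dots> = e" using K by simp
    finally show ?thesis .
  qed
  then have "norm (integral {r0..r1} (\<lambda>r. (2 / r) *\<^sub>R \<phi> c r) - (a c r0 - a c r1)) \<le> 0"
    by (rule field_le_epsilon) simp
  then show ?thesis by (simp add: \<phi>_def a_def)
qed

text \<open>Two points of a circle of radius r whose angles differ by 2 v are joined by a chord of
  length 2 r sin v. Once the angle difference is a variable, the remaining angle only turns the
  chord, and integrating over it leaves a function of the chord length alone.\<close>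

lemma double_angle_integral:
  fixes C :: "complex \<Rightarrow> complex" and \<kappa> :: "real \<Rightarrow> complex" and r :: real
  assumes C: "continuous_on UNIV C" and \<kappa>: "continuous_on UNIV \<kappa>" and per: "\<And>t. \<kappa> (t + 2 * pi) = \<kappa> t"
  shows "integral {0..2 * pi} (\<lambda>s. integral {0..2 * pi} (\<lambda>t. \<kappa> (t - s) * C (r * cis s - r * cis t)))
    = 2 * integral {0..pi} (\<lambda>v. \<kappa> (2 * v) * integral {0..2 * pi} (\<lambda>s. C (complex_of_real (2 * r * sin v) * cis s)))"
proof -
  note [continuous_intros] = continuous_on_compose2[OF C] continuous_on_compose2[OF \<kappa>]
  define c where "c = (\<lambda>\<rho>::real. integral {0..2 * pi} (\<lambda>s. C (\<rho> * cis s)))"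
  have "integral {0..2 * pi} (\<lambda>s. integral {0..2 * pi} (\<lambda>t. \<kappa> (t - s) * C (r * cis s - r * cis t)))
    = integral {0..2 * pi} (\<lambda>s. integral {0..2 * pi} (\<lambda>d. \<kappa> d * C (r * cis s * (1 - cis d))))"
  proof (rule integral_cong)
    fix s
    have "integral {0..2 * pi} (\<lambda>t. \<kappa> (t - s) * C (r * cis s - r * cis t)) =
      integral {0..2 * pi} (\<lambda>d. \<kappa> (d + s - s) * C (r * cis s - r * cis (d + s)))"
    proof (rule integral_periodic_shift[symmetric])
      show "\<kappa> (t + 2 * pi - s) * C (r * cis s - r * cis (t + 2 * pi)) = \<kappa> (t - s) * C (r * cis s - r * cis t)" for t
      proof -
        have "cis (t + 2 * pi) = cis t" by (simp add: cis_mult[symmetric])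
        then show ?thesis using per[of "t - s"] by (simp add: algebra_simps)
      qed
    qed (auto intro!: continuous_intros)
    also have "integral {0..2 * pi} (\<lambda>d. \<kappa> (d + s - s) * C (r * cis s - r * cis (d + s))) =
       integral {0..2 * pi} (\<lambda>d. \<kappa> d * C (r * cis s * (1 - cis d)))"
      by (simp add: cis_mult[symmetric] algebra_simps)
    finally show "integral {0..2 * pi} (\<lambda>t. \<kappa> (t - s) * C (r * cis s - r * cis t)) =
      integral {0..2 * pi} (\<lambda>d. \<kappa> d * C (r * cis s * (1 - cis d)))" .
  qed
  also have "\<dots> = integral {0..2 * pi} (\<lambda>d. integral {0..2 * pi} (\<lambda>s. \<kappa> d * C (r * cis s * (1 - cis d))))"
    unfolding cbox_interval[symmetric]
    by (rule integral_swap_continuous) (auto intro!: continuous_intros simp: split_beta)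
  also have "\<dots> = integral {0..2 * pi} (\<lambda>d. \<kappa> d * c (2 * r * sin (d / 2)))"
  proof (rule integral_cong)
    fix d
    have "1 - cis d = complex_of_real (2 * sin (d / 2)) * cis (d / 2 - pi / 2)"
    proof -
      have "cis d = cis (d / 2) * cis (d / 2)" by (simp add: cis_mult)
      then show ?thesis
        by (simp add: complex_eq_iff cos_diff sin_diff power2_eq_square[symmetric])
          (use sin_cos_squared_add[of "d / 2"] in \<open>simp add: power2_eq_square algebra_simps\<close>)
    qed
    then have "C (r * cis s * (1 - cis d)) = C (complex_of_real (2 * r * sin (d / 2)) * cis (s + (d / 2 - pi / 2)))" for s
      by (simp only: cis_mult[symmetric] of_real_mult mult_ac)
    then have "integral {0..2 * pi} (\<lambda>s. C (r * cis s * (1 - cis d))) =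
      integral {0..2 * pi} (\<lambda>s. C (complex_of_real (2 * r * sin (d / 2)) * cis (s + (d / 2 - pi / 2))))"
      by simp
    also have "\<dots> = c (2 * r * sin (d / 2))"
      unfolding c_def
      by (rule integral_periodic_shift[where g = "\<lambda>s. C (complex_of_real (2 * r * sin (d / 2)) * cis s)"])
        (auto intro!: continuous_intros simp: cis_mult[symmetric])
    finally show "integral {0..2 * pi} (\<lambda>s. \<kappa> d * C (r * cis s * (1 - cis d))) = \<kappa> d * c (2 * r * sin (d / 2))"
      by simp
  qed
  also have "\<dots> = 2 * integral {0..pi} (\<lambda>v. \<kappa> (2 * v) * c (2 * r * sin v))"
  proof -
    have "(\<lambda>x. x / 2) ` {0..2 * pi} = {0..pi}"
      by (auto simp: image_iff intro!: bexI[of _ "2 * _"])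
    then show ?thesis
      using integral_stretch_real[of 2 0 "2 * pi" "\<lambda>d. \<kappa> d * c (2 * r * sin (d / 2))"]
      by (simp add: scaleR_conv_of_real mult.commute[of _ 2])
  qed
  finally show ?thesis by (simp add: c_def)
qed

lemma bessel_two_modes:
  fixes g :: "real \<Rightarrow> complex"
  assumes g: "continuous_on {0..2 * pi} g"
  shows "(cmod (integral {0..2 * pi} g))\<^sup>2 + (cmod (integral {0..2 * pi} (\<lambda>t. cis (- t) * g t)))\<^sup>2
    \<le> 2 * pi * integral {0..2 * pi} (\<lambda>t. (cmod (g t))\<^sup>2)"
proof -
  define a b where "a = integral {0..2 * pi} g" and "b = integral {0..2 * pi} (\<lambda>t. cis (- t) * g t)"
  define \<alpha> \<beta> where "\<alpha> = a / (2 * pi)" and "\<beta> = b / (2 * pi)"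
  have ga: "(g has_integral a) {0..2 * pi}"
    unfolding a_def by (intro integrable_integral integrable_continuous_real g)
  have gb: "((\<lambda>t. cis (- t) * g t) has_integral b) {0..2 * pi}"
    unfolding b_def by (intro integrable_integral integrable_continuous_real continuous_intros g)
  have e: "(cis has_integral 0) {0..2 * pi}"
  proof -
    have "((\<lambda>t. - \<i> * cis t) has_vector_derivative cis t) (at t within {0..2 * pi})" for t
    proof -
      have "(cis has_vector_derivative \<i> * cis t) (at t within {0..2 * pi})"
        unfolding cis_conv_exp
        by (auto intro!: derivative_eq_intros has_vector_derivative_real_field)
      from has_vector_derivative_mult_right[OF this, of "- \<i>"] show ?thesis by simp
    qed
    then have "(cis has_integral (- \<i> * cis (2 * pi)) - (- \<i> * cis 0)) {0..2 * pi}"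
      by (intro fundamental_theorem_of_calculus) auto
    then show ?thesis by simp
  qed
  have cnjI: "((\<lambda>t. cnj (h t)) has_integral cnj i) S" if "(h has_integral i) S" for h i and S :: "real set"
    using has_integral_linear[OF that bounded_linear_cnj] by (simp add: o_def)
  have const: "((\<lambda>t. z) has_integral (2 * pi - 0) *\<^sub>R z) {0..2 * pi}" for z :: complex
    using has_integral_const_real[of z 0 "2 * pi"] by simp
  have gg: "((\<lambda>t. g t * cnj (g t)) has_integral integral {0..2 * pi} (\<lambda>t. g t * cnj (g t))) {0..2 * pi}"
    by (intro integrable_integral integrable_continuous_real continuous_intros g)
  \<comment> \<open>The integrand is |g - \<alpha> - \<beta> cis|^2 multiplied out. The terms with a
    single cis integrate to 0, and nonnegativity of the rest is Bessel's inequality.\<close>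
  have "((\<lambda>t. g t * cnj (g t) - cnj \<alpha> * g t - cnj \<beta> * (cis (- t) * g t)
      - \<alpha> * cnj (g t) - \<beta> * cnj (cis (- t) * g t) + \<alpha> * cnj \<beta> * cnj (cis t) + \<beta> * cnj \<alpha> * cis t
      + (\<alpha> * cnj \<alpha> + \<beta> * cnj \<beta>))
     has_integral (integral {0..2 * pi} (\<lambda>t. g t * cnj (g t)) - cnj \<alpha> * a - cnj \<beta> * b
      - \<alpha> * cnj a - \<beta> * cnj b + \<alpha> * cnj \<beta> * cnj 0 + \<beta> * cnj \<alpha> * 0
      + (2 * pi - 0) *\<^sub>R (\<alpha> * cnj \<alpha> + \<beta> * cnj \<beta>))) {0..2 * pi}"
    by (intro has_integral_add has_integral_diff has_integral_mult_right ga gb gg e cnjI const)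
  also have "(\<lambda>t. g t * cnj (g t) - cnj \<alpha> * g t - cnj \<beta> * (cis (- t) * g t)
      - \<alpha> * cnj (g t) - \<beta> * cnj (cis (- t) * g t) + \<alpha> * cnj \<beta> * cnj (cis t) + \<beta> * cnj \<alpha> * cis t
      + (\<alpha> * cnj \<alpha> + \<beta> * cnj \<beta>)) =
     (\<lambda>t. (g t - \<alpha> - \<beta> * cis t) * cnj (g t - \<alpha> - \<beta> * cis t))"
  proof
    fix t
    have "cis t * cnj (cis t) = 1" by (simp add: cis_cnj cis_mult)
    then show "g t * cnj (g t) - cnj \<alpha> * g t - cnj \<beta> * (cis (- t) * g t)
      - \<alpha> * cnj (g t) - \<beta> * cnj (cis (- t) * g t) + \<alpha> * cnj \<beta> * cnj (cis t) + \<beta> * cnj \<alpha> * cis t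
      + (\<alpha> * cnj \<alpha> + \<beta> * cnj \<beta>) = (g t - \<alpha> - \<beta> * cis t) * cnj (g t - \<alpha> - \<beta> * cis t)"
      unfolding cis_cnj[symmetric] complex_cnj_mult complex_cnj_diff complex_cnj_cnj by algebra
  qed
  also have "(\<lambda>t. (g t - \<alpha> - \<beta> * cis t) * cnj (g t - \<alpha> - \<beta> * cis t)) =
      (\<lambda>t. of_real ((cmod (g t - \<alpha> - \<beta> * cis t))\<^sup>2))"
    by (rule ext) (rule complex_norm_square[symmetric])
  finally have main: "((\<lambda>t. complex_of_real ((cmod (g t - \<alpha> - \<beta> * cis t))\<^sup>2)) has_integral
      (integral {0..2 * pi} (\<lambda>t. g t * cnj (g t)) - cnj \<alpha> * a - cnj \<beta> * b
      - \<alpha> * cnj a - \<beta> * cnj b + (2 * pi) *\<^sub>R (\<alpha> * cnj \<alpha> + \<beta> * cnj \<beta>))) {0..2 * pi}"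
    by simp
  have GG: "integral {0..2 * pi} (\<lambda>t. g t * cnj (g t)) = of_real (integral {0..2 * pi} (\<lambda>t. (cmod (g t))\<^sup>2))"
    unfolding complex_norm_square[symmetric]
    by (intro integral_unique has_integral_of_real integrable_integral integrable_continuous_real continuous_intros g)
  have "0 \<le> Re (integral {0..2 * pi} (\<lambda>t. g t * cnj (g t)) - cnj \<alpha> * a - cnj \<beta> * b
      - \<alpha> * cnj a - \<beta> * cnj b + (2 * pi) *\<^sub>R (\<alpha> * cnj \<alpha> + \<beta> * cnj \<beta>))"
    using has_integral_Re[OF main] by (rule has_integral_nonneg) simp
  also have "\<dots> = integral {0..2 * pi} (\<lambda>t. (cmod (g t))\<^sup>2) - ((cmod a)\<^sup>2 + (cmod b)\<^sup>2) / (2 * pi)"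
    unfolding GG \<alpha>_def \<beta>_def cmod_power2 by (simp add: field_simps power2_eq_square)
  finally show ?thesis
    unfolding a_def b_def by (simp add: field_simps)
qed

section \<open>Correlations of a function along horizontal circles\<close>

definition hz :: "complex \<Rightarrow> real^3" where
  "hz z = Re z *\<^sub>R axis 1 1 + Im z *\<^sub>R axis 2 1"

abbreviation Box :: "real \<Rightarrow> (real^3) set" where
  "Box N \<equiv> cbox (vec (- N)) (vec N)"

lemma hz_nth [simp]: "hz z $ 1 = Re z" "hz z $ 2 = Im z" "hz z $ 3 = 0"
  by (simp_all add: hz_def axis_def)

lemma hz_diff: "hz (z - w) = hz z - hz w"
  by (simp add: vec_eq_iff forall_3)

lemma norm_hz [simp]: "norm (hz z) = cmod z"
  by (simp add: norm_vec_def L2_set_def sum_3 cmod_def)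

lemma continuous_on_hz [continuous_intros]:
  "continuous_on S g \<Longrightarrow> continuous_on S (\<lambda>x. hz (g x))"
  unfolding hz_def by (intro continuous_intros)

lemma mem_Box: "x \<in> Box N \<longleftrightarrow> (\<forall>i. \<bar>x $ i\<bar> \<le> N)"
  by (auto simp: mem_box_cart abs_le_iff minus_le_iff)

lemma cball_subset_Box: "cball 0 M \<subseteq> Box M"
  by (auto simp: mem_Box intro: order_trans[OF component_le_norm_cart])

text \<open>Only compactly supported functions are integrated, over a box that contains every
  shifted support. This stands in for translation invariance on all of space and keeps the domains
  compact, where continuity already gives integrability.\<close>

lemma integral_Box_translate:
  fixes f :: "real^3 \<Rightarrow> 'a::banach"
  assumes f: "\<And>x. M < norm x \<Longrightarrow> f x = 0" and N: "norm y + M \<le> N"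
  shows "integral (Box N) (\<lambda>x. f (x + y)) = integral (Box N) f"
proof -
  have sup: "integral S f = integral (Box M) f" if "Box M \<subseteq> S" for S
  proof -
    have "f x = 0" if "x \<notin> Box M" for x
      by (rule f) (use that cball_subset_Box[of M] in force)
    then have "integral S f = integral S (\<lambda>x. if x \<in> Box M then f x else 0)"
      by (intro integral_cong) auto
    also have "\<dots> = integral (S \<inter> Box M) f"
      by (simp add: integral_restrict_Int Int_commute)
    finally have "integral S f = integral (S \<inter> Box M) f" .
    with that show ?thesis by (simp add: Int_absorb1)
  qed
  have "Box N = cbox (vec (- N) + y - y) (vec N + y - y)" by simp
  then have "integral (Box N) (\<lambda>x. f (x + y)) = integral (cbox (vec (- N) + y) (vec N + y)) f"
    using integral_shift_cbox[of "vec (- N) + y" y "vec N + y" f] by simp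
  moreover have "Box M \<subseteq> cbox (vec (- N) + y) (vec N + y)"
  proof
    fix x assume "x \<in> Box M"
    moreover have "\<bar>y $ i\<bar> \<le> norm y" for i by (rule component_le_norm_cart)
    ultimately show "x \<in> cbox (vec (- N) + y) (vec N + y)"
      using N unfolding mem_Box mem_box_cart
      by (smt (verit) vec_component vector_add_component)
  qed
  moreover have "M \<le> N"
    using N norm_ge_zero[of y] by linarith
  then have "Box M \<subseteq> Box N"
    unfolding subset_iff mem_Box by (blast intro: order_trans)
  ultimately show ?thesis using sup by metis
qed

text \<open>Write the square as a double integral over two angles, exchange it with the space
  integral, and shift x by the second point of the circle: f then enters only through its
  correlation at the chord between the two points.\<close>

lemma circle_transform_L2:
  fixes f :: "real^3 \<Rightarrow> complex" and r :: real
  assumes f: "continuous_on UNIV f" and supp: "\<And>x. M < norm x \<Longrightarrow> f x = 0"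
    and k: "continuous_on UNIV k" and \<kappa>: "\<And>s t. k s * cnj (k t) = \<kappa> (t - s)"
    and N: "r + M \<le> N" and r: "r \<ge> 0"
  shows "complex_of_real (integral (Box N) (\<lambda>x. (cmod (integral {0..2 * pi} (\<lambda>s. k s * f (x + hz (r * cis s)))))\<^sup>2))
    = integral {0..2 * pi} (\<lambda>s. integral {0..2 * pi} (\<lambda>t. \<kappa> (t - s) *
        integral (Box N) (\<lambda>x. f (x + hz (r * cis s - r * cis t)) * cnj (f x))))"
proof -
  note [continuous_intros] = continuous_on_compose2[OF f] continuous_on_compose2[OF k]
  have contG: "continuous_on UNIV (\<lambda>p. integral (cbox 0 (2 * pi)) (\<lambda>t. k (snd p) *
      f (fst p + hz (r * cis (snd p))) * cnj (k t * f (fst p + hz (r * cis t)))))"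
    by (intro integral_continuous_on_param) (auto intro!: continuous_intros simp: split_beta)
  define B where "B = (\<lambda>x. integral {0..2 * pi} (\<lambda>s. k s * f (x + hz (r * cis s))))"
  have contB: "continuous_on (Box N) B"
    unfolding B_def cbox_interval[symmetric]
    by (intro integral_continuous_on_param) (auto intro!: continuous_intros simp: split_beta)
  have "complex_of_real (integral (Box N) (\<lambda>x. (cmod (B x))\<^sup>2)) = integral (Box N) (\<lambda>x. of_real ((cmod (B x))\<^sup>2))"
    by (intro integral_unique[symmetric] has_integral_of_real integrable_integral integrable_continuous
        continuous_intros contB)
  also have "\<dots> = integral (Box N) (\<lambda>x. integral {0..2 * pi} (\<lambda>s. integral {0..2 * pi}
      (\<lambda>t. k s * f (x + hz (r * cis s)) * cnj (k t * f (x + hz (r * cis t))))))"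
  proof (rule integral_cong)
    fix x
    have "complex_of_real ((cmod (B x))\<^sup>2) = B x * cnj (B x)"
      by (rule complex_norm_square)
    also have "cnj (B x) = integral {0..2 * pi} (\<lambda>t. cnj (k t * f (x + hz (r * cis t))))"
      unfolding B_def integral_cnj[symmetric] ..
    finally show "complex_of_real ((cmod (B x))\<^sup>2) = integral {0..2 * pi} (\<lambda>s. integral {0..2 * pi}
      (\<lambda>t. k s * f (x + hz (r * cis s)) * cnj (k t * f (x + hz (r * cis t)))))"
      unfolding B_def by simp
  qed
  also have "\<dots> = integral {0..2 * pi} (\<lambda>s. integral (Box N) (\<lambda>x. integral {0..2 * pi}
      (\<lambda>t. k s * f (x + hz (r * cis s)) * cnj (k t * f (x + hz (r * cis t))))))"
    unfolding cbox_interval[symmetric]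
    by (intro integral_swap_continuous, unfold split_beta) (rule continuous_on_subset[OF contG], simp)
  also have "\<dots> = integral {0..2 * pi} (\<lambda>s. integral {0..2 * pi} (\<lambda>t. integral (Box N)
      (\<lambda>x. k s * f (x + hz (r * cis s)) * cnj (k t * f (x + hz (r * cis t))))))"
    unfolding cbox_interval[symmetric]
    by (intro integral_cong integral_swap_continuous) (auto intro!: continuous_intros simp: split_beta)
  also have "\<dots> = integral {0..2 * pi} (\<lambda>s. integral {0..2 * pi} (\<lambda>t. \<kappa> (t - s) *
        integral (Box N) (\<lambda>x. f (x + hz (r * cis s - r * cis t)) * cnj (f x))))"
  proof (intro integral_cong)
    fix s t
    have "integral (Box N) (\<lambda>x. k s * f (x + hz (r * cis s)) * cnj (k t * f (x + hz (r * cis t)))) =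
       \<kappa> (t - s) * integral (Box N) (\<lambda>x. f (x + hz (r * cis s)) * cnj (f (x + hz (r * cis t))))"
      unfolding \<kappa>[symmetric] by (simp flip: integral_mult_right add: mult_ac)
    also have "integral (Box N) (\<lambda>x. f (x + hz (r * cis s)) * cnj (f (x + hz (r * cis t)))) =
      integral (Box N) (\<lambda>x. f (x + hz (r * cis s - r * cis t)) * cnj (f x))"
      using integral_Box_translate[where M = M and N = N and y = "hz (r * cis t)" and
          f = "\<lambda>x. f (x + hz (r * cis s - r * cis t)) * cnj (f x)"] supp r N
      by (simp add: hz_diff norm_mult)
    finally show "integral (Box N) (\<lambda>x. k s * f (x + hz (r * cis s)) * cnj (k t * f (x + hz (r * cis t)))) =
       \<kappa> (t - s) * integral (Box N) (\<lambda>x. f (x + hz (r * cis s - r * cis t)) * cnj (f x))" .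
  qed
  finally show ?thesis unfolding B_def .
qed

text \<open>With \<open>A\<close> and \<open>B\<close> the Fourier modes 0 and 1 of f on the circle,
  \<open>a r\<close> is half the sum of their squared norms, and \<open>radial_dissipation\<close>
  identifies the loss of \<open>a\<close> between r0 and r1 with the weighted integral of the
  squared norm of \<open>B\<close>. Dropping \<open>a r1\<close> and applying Bessel's inequality at
  radius r0 bounds the loss however far apart r0 and r1 are.\<close>

theorem circle_coefficient_bound:
  fixes f :: "real^3 \<Rightarrow> complex" and r0 r1 :: real
  assumes f: "continuous_on UNIV f" and supp: "\<And>x. M < norm x \<Longrightarrow> f x = 0"
    and r: "0 < r0" "r0 \<le> r1" and N: "r1 + M \<le> N"
  shows "integral {r0..r1} (\<lambda>r. (1 / r) * integral (Box N)
      (\<lambda>x. (cmod (integral {0..2 * pi} (\<lambda>s. cis (- s) * f (x + hz (complex_of_real r * cis s)))))\<^sup>2) :: real)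
    \<le> 2 * pi\<^sup>2 * integral (Box N) (\<lambda>x. (cmod (f x))\<^sup>2)"
proof -
  note [continuous_intros] = continuous_on_compose2[OF f]
  define A where "A = (\<lambda>(r::real) x. integral {0..2 * pi} (\<lambda>s. f (x + hz (r * cis s))))"
  define B where "B = (\<lambda>(r::real) x. integral {0..2 * pi} (\<lambda>s. cis (- s) * f (x + hz (r * cis s))))"
  define C where "C = (\<lambda>z. integral (Box N) (\<lambda>x. f (x + hz z) * cnj (f x)))"
  define c where "c = (\<lambda>\<rho>::real. integral {0..2 * pi} (\<lambda>s. C (of_real \<rho> * cis s)))"
  have C: "integral (Box N) (\<lambda>x. f (x + hz z) * cnj (f x)) = C z" for z
    by (simp add: C_def)
  have contC: "continuous_on UNIV C"
    unfolding C_def by (intro integral_continuous_on_param) (auto intro!: continuous_intros simp: split_beta)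
  have contc: "continuous_on UNIV c"
    unfolding c_def cbox_interval[symmetric]
    by (intro integral_continuous_on_param)
      (auto intro!: continuous_intros continuous_on_compose2[OF contC] simp: split_beta)
  have contA: "continuous_on UNIV (A r)" and contB: "continuous_on UNIV (B r)" for r
    unfolding A_def B_def cbox_interval[symmetric]
    by (intro integral_continuous_on_param; auto intro!: continuous_intros simp: split_beta)+
  have *: "complex_of_real (integral (Box N) (\<lambda>x. (cmod (A r x))\<^sup>2)) = 2 * integral {0..pi} (\<lambda>v. c (2 * r * sin v))"
    "complex_of_real (integral (Box N) (\<lambda>x. (cmod (B r x))\<^sup>2)) = 2 * integral {0..pi} (\<lambda>v. cis (2 * v) * c (2 * r * sin v))"
    if "r \<in> {r0..r1}" for r
  proof -
    have rN: "0 \<le> r" "r + M \<le> N" using that r N by auto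
    have cont: "continuous_on UNIV (\<lambda>s. cis (- s))" "continuous_on UNIV cis"
      by (intro continuous_intros)+
    show "complex_of_real (integral (Box N) (\<lambda>x. (cmod (A r x))\<^sup>2)) = 2 * integral {0..pi} (\<lambda>v. c (2 * r * sin v))"
      using circle_transform_L2[OF f supp, where M = M and k = "\<lambda>_. 1" and \<kappa> = "\<lambda>_. 1" and r = r and N = N]
        double_angle_integral[OF contC, where \<kappa> = "\<lambda>_. 1" and r = r] rN
      by (simp add: A_def c_def C)
    show "complex_of_real (integral (Box N) (\<lambda>x. (cmod (B r x))\<^sup>2)) = 2 * integral {0..pi} (\<lambda>v. cis (2 * v) * c (2 * r * sin v))"
      using circle_transform_L2[OF f supp cont(1), where M = M and \<kappa> = cis and r = r and N = N]
        double_angle_integral[OF contC cont(2), where r = r] rN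
      by (simp add: B_def c_def C cis_cnj cis_mult cis_mult[symmetric, of _ "2 * pi"])
  qed
  define a where "a = (\<lambda>r. integral {0..pi} (\<lambda>v. (1 + cis (2 * v)) * c (2 * r * sin v)))"
  have a: "2 * a r = complex_of_real (integral (Box N) (\<lambda>x. (cmod (A r x))\<^sup>2 + (cmod (B r x))\<^sup>2))"
    if "r \<in> {r0..r1}" for r
  proof -
    have "integral (Box N) (\<lambda>x. (cmod (A r x))\<^sup>2 + (cmod (B r x))\<^sup>2) =
      integral (Box N) (\<lambda>x. (cmod (A r x))\<^sup>2) + integral (Box N) (\<lambda>x. (cmod (B r x))\<^sup>2)"
      by (intro integral_add integrable_continuous continuous_intros
          continuous_on_subset[OF contA] continuous_on_subset[OF contB]) auto
    moreover have "a r = integral {0..pi} (\<lambda>v. c (2 * r * sin v)) + integral {0..pi} (\<lambda>v. cis (2 * v) * c (2 * r * sin v))"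
      unfolding a_def distrib_right mult_1
      by (intro integral_add integrable_continuous_real continuous_intros continuous_on_compose2[OF contc]) auto
    ultimately show ?thesis using *[OF that] by (simp add: algebra_simps)
  qed
  let ?\<phi> = "\<lambda>r. integral (Box N) (\<lambda>x. (cmod (B r x))\<^sup>2)"
  have cont\<phi>: "continuous_on {r0..r1} ?\<phi>"
    unfolding B_def cbox_interval[symmetric]
    by (intro integral_continuous_on_param; (intro continuous_intros)?; (unfold split_beta)?;
        intro continuous_intros integral_continuous_on_param) (auto simp: split_beta intro!: continuous_intros)
  have "complex_of_real (integral {r0..r1} (\<lambda>r. (1 / r) * ?\<phi> r))
     = integral {r0..r1} (\<lambda>r. of_real ((1 / r) * ?\<phi> r))"
    using r by (intro integral_unique[symmetric] has_integral_of_real integrable_integral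
        integrable_continuous_real continuous_intros cont\<phi>) auto
  also have "\<dots> = integral {r0..r1} (\<lambda>r. (2 / r) *\<^sub>R integral {0..pi} (\<lambda>v. cis (2 * v) * c (2 * r * sin v)))"
    using * by (intro integral_cong) (simp add: scaleR_conv_of_real)
  also have "\<dots> = a r0 - a r1"
    unfolding a_def by (rule radial_dissipation[OF contc r])
  finally have "complex_of_real (integral {r0..r1} (\<lambda>r. (1 / r) * ?\<phi> r)) = a r0 - a r1" .
  moreover have "a r = complex_of_real (integral (Box N) (\<lambda>x. (cmod (A r x))\<^sup>2 + (cmod (B r x))\<^sup>2) / 2)"
    if "r \<in> {r0..r1}" for r
    using a[OF that] by (auto simp: complex_eq_iff)
  ultimately have "complex_of_real (integral {r0..r1} (\<lambda>r. (1 / r) * ?\<phi> r)) =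
    complex_of_real (integral (Box N) (\<lambda>x. (cmod (A r0 x))\<^sup>2 + (cmod (B r0 x))\<^sup>2) / 2
      - integral (Box N) (\<lambda>x. (cmod (A r1 x))\<^sup>2 + (cmod (B r1 x))\<^sup>2) / 2)"
    using r by simp
  then have "integral {r0..r1} (\<lambda>r. (1 / r) * ?\<phi> r) =
     integral (Box N) (\<lambda>x. (cmod (A r0 x))\<^sup>2 + (cmod (B r0 x))\<^sup>2) / 2
      - integral (Box N) (\<lambda>x. (cmod (A r1 x))\<^sup>2 + (cmod (B r1 x))\<^sup>2) / 2"
    unfolding of_real_eq_iff .
  also have "\<dots> \<le> integral (Box N) (\<lambda>x. (cmod (A r0 x))\<^sup>2 + (cmod (B r0 x))\<^sup>2) / 2"
    by (simp add: Henstock_Kurzweil_Integration.integral_nonneg integrable_continuous continuous_intros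
          continuous_on_subset[OF contA] continuous_on_subset[OF contB])
  also have "\<dots> \<le> integral (Box N) (\<lambda>x. 2 * pi * integral {0..2 * pi} (\<lambda>s. (cmod (f (x + hz (r0 * cis s))))\<^sup>2)) / 2"
  proof -
    have "continuous_on (Box N) (\<lambda>x. integral {0..2 * pi} (\<lambda>s. (cmod (f (x + hz (r0 * cis s))))\<^sup>2))"
      unfolding cbox_interval[symmetric]
      by (intro integral_continuous_on_param) (auto intro!: continuous_intros simp: split_beta)
    then show ?thesis
      unfolding A_def B_def
      by (intro divide_right_mono integral_le bessel_two_modes integrable_continuous continuous_intros
          continuous_on_subset[OF contA[unfolded A_def]] continuous_on_subset[OF contB[unfolded B_def]]) auto
  qed
  also have "\<dots> = pi * integral (Box N) (\<lambda>x. integral {0..2 * pi} (\<lambda>s. (cmod (f (x + hz (r0 * cis s))))\<^sup>2))"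
    by simp
  also have "\<dots> = pi * integral {0..2 * pi} (\<lambda>s. integral (Box N) (\<lambda>x. (cmod (f (x + hz (r0 * cis s))))\<^sup>2))"
    unfolding cbox_interval[symmetric]
    by (subst integral_swap_continuous) (auto intro!: continuous_intros simp: split_beta)
  also have "\<dots> = pi * integral {0..2 * pi} (\<lambda>s. integral (Box N) (\<lambda>x. (cmod (f x))\<^sup>2))"
    using integral_Box_translate[where f = "\<lambda>x. (cmod (f x))\<^sup>2" and M = M and N = N] supp N r
    by (simp add: norm_mult)
  also have "\<dots> = 2 * pi\<^sup>2 * integral (Box N) (\<lambda>x. (cmod (f x))\<^sup>2)"
    by (simp add: power2_eq_square)
  finally show ?thesis unfolding B_def .
qed

section \<open>Circulation on a circle\<close>

text \<open>The truncated well in \<open>low_modulus_cost\<close> has to be differentiable where |u|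
  passes through 1.\<close>

lemma has_real_derivative_max_zero_square:
  "((\<lambda>x::real. (max 0 x)\<^sup>2) has_real_derivative 2 * max 0 x) (at x)"
proof -
  consider "x > 0" | "x < 0" | "x = 0" by linarith
  then show ?thesis
  proof cases
    case 1
    have "((\<lambda>x::real. x\<^sup>2) has_real_derivative 2 * x) (at x)"
      by (auto intro!: derivative_eq_intros)
    then have "((\<lambda>x::real. (max 0 x)\<^sup>2) has_real_derivative 2 * x) (at x)"
      by (rule has_field_derivative_transform_within_open[where S = "{0<..}"]) (use 1 in auto)
    then show ?thesis using 1 by simp
  next
    case 2
    have "((\<lambda>x::real. 0) has_real_derivative 0) (at x)"
      by (auto intro!: derivative_eq_intros)
    then have "((\<lambda>x::real. (max 0 x)\<^sup>2) has_real_derivative 0) (at x)"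
      by (rule has_field_derivative_transform_within_open[where S = "{..<0}"]) (use 2 in auto)
    then show ?thesis using 2 by simp
  next
    case 3
    have "((\<lambda>y::real. max 0 y) \<longlongrightarrow> max 0 0) (at 0)"
      by (intro tendsto_intros)
    moreover have "\<forall>\<^sub>F y in at 0. ((max 0 y)\<^sup>2 - (max 0 0)\<^sup>2) / (y - 0) = max 0 (y::real)"
      by (auto simp: eventually_at_filter power2_eq_square max_def)
    ultimately show ?thesis
      using 3 unfolding has_field_derivative_iff by (simp add: tendsto_cong)
  qed
qed

lemma abs_diff_le_integral_abs_deriv:
  fixes h h' :: "real \<Rightarrow> real"
  assumes h: "\<And>t. (h has_real_derivative h' t) (at t)" and h': "continuous_on UNIV h'"
    and s: "s \<in> {a..b}" and t: "t \<in> {a..b}"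
  shows "\<bar>h s - h t\<bar> \<le> integral {a..b} (\<lambda>t. \<bar>h' t\<bar>)"
proof -
  have int: "(\<lambda>t. \<bar>h' t\<bar>) integrable_on {p..q}" "h' integrable_on {p..q}" for p q
    by (intro integrable_continuous_real continuous_intros continuous_on_subset[OF h'] subset_UNIV)+
  have *: "\<bar>h q - h p\<bar> \<le> integral {a..b} (\<lambda>t. \<bar>h' t\<bar>)" if "p \<le> q" "p \<in> {a..b}" "q \<in> {a..b}" for p q
  proof -
    have "(h' has_integral h q - h p) {p..q}"
      using that h by (intro fundamental_theorem_of_calculus)
        (auto simp: has_real_derivative_iff_has_vector_derivative[symmetric] intro: DERIV_subset)
    then have "\<bar>h q - h p\<bar> \<le> integral {p..q} (\<lambda>t. \<bar>h' t\<bar>)"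
      using integral_norm_bound_integral[of h' "{p..q}" "\<lambda>t. \<bar>h' t\<bar>"] int by (simp add: integral_unique)
    also have "\<dots> \<le> integral {a..b} (\<lambda>t. \<bar>h' t\<bar>)"
      using that by (intro integral_subset_le int) auto
    finally show ?thesis .
  qed
  show ?thesis
    using *[of s t] *[of t s] s t by (cases "s \<le> t") (auto simp: abs_minus_commute)
qed

text \<open>For a primitive \<open>L\<close> of u' / u the product u exp (- L) has derivative zero;
  closing the curve forces exp (- L b) = 1.\<close>

lemma winding_integer:
  fixes u u' :: "real \<Rightarrow> complex"
  assumes u: "\<And>t. (u has_vector_derivative u' t) (at t)" and u': "continuous_on UNIV u'"
    and nz: "\<And>t. t \<in> {a..b} \<Longrightarrow> u t \<noteq> 0" and ab: "a \<le> b" and closed: "u b = u a"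
  shows "\<exists>m::int. integral {a..b} (\<lambda>t. Im (u' t / u t)) = 2 * pi * m"
proof -
  have cu: "continuous_on UNIV u"
    using u by (meson continuous_at_imp_continuous_on has_vector_derivative_continuous)
  have cq: "continuous_on {a..b} (\<lambda>t. u' t / u t)"
    using nz by (intro continuous_intros continuous_on_subset[OF u'] continuous_on_subset[OF cu]) auto
  define L where "L = (\<lambda>s. integral {a..s} (\<lambda>t. u' t / u t))"
  have L: "(L has_vector_derivative u' s / u s) (at s within {a..b})" if "s \<in> {a..b}" for s
    unfolding L_def by (rule integral_has_vector_derivative[OF cq that])
  have "((\<lambda>s. u s * exp (- L s)) has_derivative (\<lambda>h. 0)) (at s within {a..b})" if s: "s \<in> {a..b}" for s
  proof -
    have "((\<lambda>s. exp (- L s)) has_vector_derivative (- (u' s / u s)) * exp (- L s)) (at s within {a..b})"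
      using field_vector_diff_chain_within[of "\<lambda>s. - L s" "- (u' s / u s)" s "{a..b}" exp "exp (- L s)"]
        has_vector_derivative_minus[OF L[OF s]]
      by (simp add: o_def DERIV_exp has_field_derivative_at_within)
    from has_vector_derivative_mult[OF has_vector_derivative_at_within[OF u, of s "{a..b}"] this]
    show ?thesis using nz[OF s] by (simp add: has_vector_derivative_def)
  qed
  then have "u b * exp (- L b) = u a * exp (- L a)"
    using has_derivative_zero_constant[of "{a..b}" "\<lambda>s. u s * exp (- L s)"] ab by auto
  then have "exp (- L b) = 1"
    using closed nz[of a] ab by (simp add: L_def)
  then obtain n :: int where "Im (- L b) = of_int (2 * n) * pi"
    unfolding exp_eq_1 by blast
  moreover have "integral {a..b} (\<lambda>t. Im (u' t / u t)) = Im (L b)"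
    unfolding L_def by (intro integral_unique has_integral_Im integrable_integral integrable_continuous_real cq)
  ultimately show ?thesis
    by (intro exI[of _ "- n"]) (simp add: algebra_simps)
qed

text \<open>A Modica-Mortola argument with d = 1 - c. Either the well \<open>W\<close> stays above
  d^2 / 4 all the way round, and its integral is large, or it drops by at least 3 d^2 / 4 between
  two points, and the integral of |W'| is large. Young's inequality bounds |W'| by the energy
  density.\<close>

lemma low_modulus_cost:
  fixes u u' :: "real \<Rightarrow> complex" and p \<delta> :: "real \<Rightarrow> real"
  assumes u: "\<And>t. (u has_vector_derivative u' t) (at t)" and u': "continuous_on UNIV u'"
    and \<delta>: "continuous_on UNIV \<delta>" and bound: "\<And>t. cmod (u' t - \<i> * of_real (p t) * u t) \<le> r * \<delta> t"
    and b: "b > 0" "sqrt b \<le> r" and c: "0 < c" "c < 1"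
    and low: "t0 \<in> {0..2 * pi}" "(cmod (u t0))\<^sup>2 < c"
  shows "3 / 4 * (1 - c)\<^sup>2 \<le> 4 * r / sqrt b * integral {0..2 * pi} (\<lambda>t. b * (\<delta> t)\<^sup>2 + 2 * (1 - cmod (u t))\<^sup>2)"
proof -
  define d where "d = 1 - c"
  have d: "d > 0" using c by (simp add: d_def)
  have cu: "continuous_on UNIV u"
    using u by (meson continuous_at_imp_continuous_on has_vector_derivative_continuous)
  note [continuous_intros] = continuous_on_compose2[OF cu] continuous_on_compose2[OF u'] continuous_on_compose2[OF \<delta>]
  \<comment> \<open>The truncation at |u| = 1 keeps the factor |u| in |W'| at most 1, although u
    itself is not bounded.\<close>
  define m where "m = (\<lambda>t. max 0 (1 - (cmod (u t))\<^sup>2))"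
  define W where "W = (\<lambda>t. (m t)\<^sup>2)"
  define W' where "W' = (\<lambda>t. - (4 * m t * Re (cnj (u t) * u' t)))"
  have dW: "(W has_real_derivative W' t) (at t)" for t
  proof -
    have re: "((\<lambda>t. Re (u t)) has_real_derivative Re (u' t)) (at t)"
      and im: "((\<lambda>t. Im (u t)) has_real_derivative Im (u' t)) (at t)"
      using bounded_linear.has_vector_derivative[OF bounded_linear_Re u]
        bounded_linear.has_vector_derivative[OF bounded_linear_Im u]
      by (simp_all add: has_real_derivative_iff_has_vector_derivative)
    have "((\<lambda>t. 1 - ((Re (u t))\<^sup>2 + (Im (u t))\<^sup>2)) has_real_derivative - 2 * Re (cnj (u t) * u' t)) (at t)"
      by (rule derivative_eq_intros re im refl)+ (simp add: algebra_simps)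
    then have "((\<lambda>t. 1 - (cmod (u t))\<^sup>2) has_real_derivative - 2 * Re (cnj (u t) * u' t)) (at t)"
      by (simp add: cmod_power2)
    from DERIV_chain2[OF has_real_derivative_max_zero_square this]
    show ?thesis by (simp add: W_def W'_def m_def algebra_simps)
  qed
  have cW': "continuous_on UNIV W'"
    unfolding W'_def m_def by (intro continuous_intros) auto
  have cW: "continuous_on UNIV W"
    unfolding W_def m_def by (intro continuous_intros) auto
  have pt: "W t + \<bar>W' t\<bar> \<le> 4 * r / sqrt b * (b * (\<delta> t)\<^sup>2 + 2 * (1 - cmod (u t))\<^sup>2)" for t
  proof (cases "cmod (u t) < 1")
    case False
    then have "m t = 0" using power_mono[of 1 "cmod (u t)" 2] by (simp add: m_def)
    then show ?thesis using b order.trans[OF real_sqrt_ge_zero b(2)]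
      by (simp add: W_def W'_def)
  next
    case True
    define z where "z = 1 - cmod (u t)"
    have z: "z > 0" "z \<le> 1" using True by (auto simp: z_def)
    have m: "0 \<le> m t" "m t \<le> 2 * z"
    proof -
      have "1 - (cmod (u t))\<^sup>2 = z * (2 - z)" by (simp add: z_def power2_eq_square algebra_simps)
      also have "\<dots> \<le> z * 2" using z by (intro mult_left_mono) auto
      finally show "m t \<le> 2 * z" using z by (simp add: m_def)
    qed (simp add: m_def)
    \<comment> \<open>The gauge term i p u is orthogonal to u, so the covariant derivative controls
      the change of |u|.\<close>
    have re: "Re (cnj (u t) * u' t) = Re (cnj (u t) * (u' t - \<i> * of_real (p t) * u t))"
      by (simp add: algebra_simps)
    have "\<bar>Re (cnj (u t) * u' t)\<bar> \<le> cmod (u t) * cmod (u' t - \<i> * of_real (p t) * u t)"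
      unfolding re using abs_Re_le_cmod by (metis complex_mod_cnj norm_mult)
    also have "\<dots> \<le> 1 * (r * \<delta> t)"
      using True bound[of t] by (intro mult_mono) auto
    finally have re: "\<bar>Re (cnj (u t) * u' t)\<bar> \<le> r * \<delta> t" by simp
    have "\<bar>W' t\<bar> = 4 * m t * \<bar>Re (cnj (u t) * u' t)\<bar>"
      using m by (simp only: W'_def abs_minus_cancel abs_mult abs_of_nonneg abs_numeral)
    also have "\<dots> \<le> 4 * (2 * z) * (r * \<delta> t)"
      using m z re by (intro mult_mono) auto
    also have "\<dots> = 4 * r / sqrt b * (2 * (sqrt b * \<delta> t) * z)"
      using b by (simp add: field_simps)
    also have "\<dots> \<le> 4 * r / sqrt b * ((sqrt b * \<delta> t)\<^sup>2 + z\<^sup>2)"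
      using b order.trans[OF real_sqrt_ge_zero b(2)] sum_squares_bound[of "sqrt b * \<delta> t" z]
      by (intro mult_left_mono) auto
    also have "(sqrt b * \<delta> t)\<^sup>2 = b * (\<delta> t)\<^sup>2" using b by (simp add: power_mult_distrib)
    finally have "\<bar>W' t\<bar> \<le> 4 * r / sqrt b * (b * (\<delta> t)\<^sup>2 + z\<^sup>2)" .
    moreover have "W t \<le> 4 * r / sqrt b * z\<^sup>2"
    proof -
      have "W t \<le> (2 * z)\<^sup>2" unfolding W_def using m by (intro power_mono) auto
      also have "\<dots> = 4 * 1 * z\<^sup>2" by (simp add: power2_eq_square)
      also have "\<dots> \<le> 4 * (r / sqrt b) * z\<^sup>2"
        using b by (intro mult_right_mono mult_left_mono) auto
      finally show ?thesis by simp
    qed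
    moreover have "k * (b * (\<delta> t)\<^sup>2 + z\<^sup>2) + k * z\<^sup>2 = k * (b * (\<delta> t)\<^sup>2 + 2 * z\<^sup>2)" for k
      by (simp add: distrib_left)
    ultimately show ?thesis unfolding z_def[symmetric] by (metis add.commute add_mono)
  qed
  have int: "W integrable_on {0..2 * pi}" "(\<lambda>t. \<bar>W' t\<bar>) integrable_on {0..2 * pi}"
    by (intro integrable_continuous_real continuous_intros continuous_on_subset[OF cW'] continuous_on_subset[OF cW] subset_UNIV)+
  have pos: "0 \<le> integral {0..2 * pi} W" "0 \<le> integral {0..2 * pi} (\<lambda>t. \<bar>W' t\<bar>)"
    using int by (auto intro!: Henstock_Kurzweil_Integration.integral_nonneg simp: W_def)
  have "3 / 4 * d\<^sup>2 \<le> integral {0..2 * pi} W + integral {0..2 * pi} (\<lambda>t. \<bar>W' t\<bar>)"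
  proof (cases "\<forall>t\<in>{0..2 * pi}. W t \<ge> d\<^sup>2 / 4")
    case True
    have "3 * d\<^sup>2 \<le> 2 * pi * d\<^sup>2"
      using pi_gt3 by (intro mult_right_mono) auto
    then have "3 / 4 * d\<^sup>2 \<le> (2 * pi - 0) * (d\<^sup>2 / 4)" by simp
    also have "\<dots> = integral {0..2 * pi} (\<lambda>t. d\<^sup>2 / 4)" by simp
    also have "\<dots> \<le> integral {0..2 * pi} W"
      using True int by (intro integral_le) auto
    finally show ?thesis using pos by linarith
  next
    case False
    then obtain t1 where t1: "t1 \<in> {0..2 * pi}" "W t1 < d\<^sup>2 / 4" by force
    have "d \<le> m t0" using low by (simp add: m_def d_def)
    then have "d\<^sup>2 \<le> W t0" unfolding W_def using d by (intro power_mono) auto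
    moreover have "\<bar>W t0 - W t1\<bar> \<le> integral {0..2 * pi} (\<lambda>t. \<bar>W' t\<bar>)"
      by (rule abs_diff_le_integral_abs_deriv[OF dW cW' low(1) t1(1)])
    ultimately show ?thesis using t1 pos by linarith
  qed
  also have "\<dots> = integral {0..2 * pi} (\<lambda>t. W t + \<bar>W' t\<bar>)"
    using int by (simp add: integral_add)
  also have "\<dots> \<le> integral {0..2 * pi} (\<lambda>t. 4 * r / sqrt b * (b * (\<delta> t)\<^sup>2 + 2 * (1 - cmod (u t))\<^sup>2))"
    by (intro integral_le integrable_add int pt integrable_continuous_real continuous_intros) auto
  finally show ?thesis by (simp add: d_def)
qed

text \<open>When \<open>|u|\<^sup>2 \<ge> c\<close> on the whole circle, \<open>y + pi r\<^sup>2 = 2 pi m\<close> with an integer \<open>m\<close>, and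
  \<open>m\<^sup>2 \<ge> m\<close> gives the inequality; otherwise the subtracted term already exceeds the rest.\<close>

lemma circulation_inequality:
  fixes u u' :: "real \<Rightarrow> complex" and p \<delta> :: "real \<Rightarrow> real"
  assumes u: "\<And>t. (u has_vector_derivative u' t) (at t)" and u': "continuous_on UNIV u'"
    and \<delta>: "continuous_on UNIV \<delta>" and bound: "\<And>t. cmod (u' t - \<i> * of_real (p t) * u t) \<le> r * \<delta> t"
    and closed: "u (2 * pi) = u 0" and p: "(p has_integral pi * r\<^sup>2) {0..2 * pi}"
    and b: "b > 0" "sqrt b \<le> r" and r: "r \<le> 1" and c: "0 < c" "c < 1"
    and y: "y = integral {0..2 * pi} (\<lambda>t. Im (cnj (u t) * (u' t - \<i> * of_real (p t) * u t)) / max c ((cmod (u t))\<^sup>2))"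
  shows "2 * pi * (1 - r\<^sup>2) * (y + pi * r\<^sup>2) - 4 * pi\<^sup>2 / (1 - c)\<^sup>2 *
      (4 * r / sqrt b * integral {0..2 * pi} (\<lambda>t. b * (\<delta> t)\<^sup>2 + 2 * (1 - cmod (u t))\<^sup>2)) \<le> y\<^sup>2"
proof -
  let ?\<beta> = "4 * r / sqrt b * integral {0..2 * pi} (\<lambda>t. b * (\<delta> t)\<^sup>2 + 2 * (1 - cmod (u t))\<^sup>2)"
  have r0: "r > 0" using b by (meson less_le_trans real_sqrt_gt_zero)
  have r1: "0 \<le> 1 - r\<^sup>2" "1 - r\<^sup>2 \<le> 1" using r r0 by (auto simp: power_le_one)
  have cu: "continuous_on UNIV u"
    using u by (meson continuous_at_imp_continuous_on has_vector_derivative_continuous)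
  note [continuous_intros] = continuous_on_compose2[OF cu] continuous_on_compose2[OF u'] continuous_on_compose2[OF \<delta>]
  show ?thesis
  proof (cases "\<forall>t\<in>{0..2 * pi}. c \<le> (cmod (u t))\<^sup>2")
    case True
    then have nz: "u t \<noteq> 0" if "t \<in> {0..2 * pi}" for t using that c by force
    obtain m :: int where m: "integral {0..2 * pi} (\<lambda>t. Im (u' t / u t)) = 2 * pi * m"
      using winding_integer[OF u u' nz _ closed] pi_ge_zero by (metis mult_nonneg_nonneg zero_le_numeral)
    have "(\<lambda>t. Im (u' t / u t)) integrable_on {0..2 * pi}"
      using nz by (intro integrable_continuous_real continuous_intros) auto
    then have "((\<lambda>t. Im (u' t / u t)) has_integral 2 * pi * m) {0..2 * pi}"
      unfolding m[symmetric] by (rule integrable_integral)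
    then have "((\<lambda>t. Im (u' t / u t) - p t) has_integral 2 * pi * m - pi * r\<^sup>2) {0..2 * pi}"
      by (intro has_integral_diff p)
    moreover have "Im (u' t / u t) - p t = Im (cnj (u t) * (u' t - \<i> * of_real (p t) * u t)) / max c ((cmod (u t))\<^sup>2)"
      if t: "t \<in> {0..2 * pi}" for t
    proof -
      have "max c ((cmod (u t))\<^sup>2) = (cmod (u t))\<^sup>2" using True t by (simp add: max_def)
      moreover have "u' t / u t = cnj (u t) * u' t / of_real ((cmod (u t))\<^sup>2)"
        unfolding complex_norm_square using nz[OF t] by (simp add: field_simps)
      then have "Im (u' t / u t) = Im (cnj (u t) * u' t) / (cmod (u t))\<^sup>2"
        by (simp only: Im_divide_of_real)
      moreover have "Im (cnj (u t) * (u' t - \<i> * of_real (p t) * u t)) = Im (cnj (u t) * u' t) - p t * (cmod (u t))\<^sup>2"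
        unfolding cmod_power2 by (simp add: algebra_simps power2_eq_square)
      ultimately show ?thesis using nz[OF t] by (simp add: diff_divide_distrib)
    qed
    ultimately have "((\<lambda>t. Im (cnj (u t) * (u' t - \<i> * of_real (p t) * u t)) / max c ((cmod (u t))\<^sup>2))
        has_integral 2 * pi * m - pi * r\<^sup>2) {0..2 * pi}"
      by (rule has_integral_eq[rotated])
    then have ym: "y = 2 * pi * m - pi * r\<^sup>2" unfolding y by (rule integral_unique)
    have "real_of_int m \<le> (real_of_int m)\<^sup>2"
    proof (cases "m \<le> 0")
      case True
      then show ?thesis by (meson of_int_le_0_iff order_trans zero_le_power2)
    next
      case False
      then show ?thesis by (intro self_le_power) auto
    qed
    \<comment> \<open>With y = 2 pi m - pi r^2, the factor 1 - r^2 is the one that cancels the mixed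
      terms m r^2; what remains is m^2 - m and the nonnegative r^4 / 4.\<close>
    then have "0 \<le> 4 * pi\<^sup>2 * ((real_of_int m)\<^sup>2 - m + (r\<^sup>2)\<^sup>2 / 4)"
      by (intro mult_nonneg_nonneg) auto
    also have "\<dots> = y\<^sup>2 - 2 * pi * (1 - r\<^sup>2) * (y + pi * r\<^sup>2)"
      unfolding ym by (simp add: power2_eq_square field_simps)
    finally have "2 * pi * (1 - r\<^sup>2) * (y + pi * r\<^sup>2) \<le> y\<^sup>2" by simp
    moreover have "0 \<le> 4 * pi\<^sup>2 / (1 - c)\<^sup>2 * ?\<beta>"
      using b r0 by (intro mult_nonneg_nonneg Henstock_Kurzweil_Integration.integral_nonneg
          integrable_continuous_real continuous_intros) auto
    ultimately show ?thesis by linarith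
  next
    case False
    then obtain t0 where t0: "t0 \<in> {0..2 * pi}" "(cmod (u t0))\<^sup>2 < c" by force
    have "3 / 4 * (1 - c)\<^sup>2 \<le> ?\<beta>"
      by (rule low_modulus_cost[OF u u' \<delta> bound b c t0])
    then have "4 * pi\<^sup>2 / (1 - c)\<^sup>2 * (3 / 4 * (1 - c)\<^sup>2) \<le> 4 * pi\<^sup>2 / (1 - c)\<^sup>2 * ?\<beta>"
      by (intro mult_left_mono) auto
    then have "3 * pi\<^sup>2 \<le> 4 * pi\<^sup>2 / (1 - c)\<^sup>2 * ?\<beta>" using c by (simp add: field_simps)
    \<comment> \<open>No integer is available here. Completing the square in y costs at most pi^2
      and the area term at most 2 pi^2, which the low modulus cost covers.\<close>
    moreover have "2 * pi * (1 - r\<^sup>2) * (y + pi * r\<^sup>2) - 3 * pi\<^sup>2 \<le> y\<^sup>2"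
    proof -
      have "(1 - r\<^sup>2)\<^sup>2 \<le> 1" using r1 by (simp add: power_le_one)
      then have 1: "pi\<^sup>2 * (1 - r\<^sup>2)\<^sup>2 \<le> pi\<^sup>2 * 1" by (intro mult_left_mono) auto
      have "(1 - r\<^sup>2) * r\<^sup>2 \<le> 1 * 1" using r1 by (intro mult_mono) auto
      then have 2: "2 * pi\<^sup>2 * ((1 - r\<^sup>2) * r\<^sup>2) \<le> 2 * pi\<^sup>2 * 1" by (intro mult_left_mono) auto
      have "0 \<le> (y - pi * (1 - r\<^sup>2))\<^sup>2" by simp
      also have "\<dots> = y\<^sup>2 - 2 * pi * (1 - r\<^sup>2) * y + pi\<^sup>2 * (1 - r\<^sup>2)\<^sup>2"
        by (simp add: power2_eq_square algebra_simps)
      finally have "2 * pi * (1 - r\<^sup>2) * y \<le> y\<^sup>2 + pi\<^sup>2" using 1 by linarith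
      moreover have "2 * pi * (1 - r\<^sup>2) * (y + pi * r\<^sup>2) = 2 * pi * (1 - r\<^sup>2) * y + 2 * pi\<^sup>2 * ((1 - r\<^sup>2) * r\<^sup>2)"
        by (simp add: power2_eq_square algebra_simps)
      ultimately show ?thesis using 2 by linarith
    qed
    ultimately show ?thesis by linarith
  qed
qed

section \<open>The lower bound for differentiable configurations\<close>

text \<open>The supremum norm makes the level sets cubes. The slope is 1 / l and the plateau has
  half-side a - l.\<close>

definition cutoff :: "real \<Rightarrow> real \<Rightarrow> real^3 \<Rightarrow> real" where
  "cutoff a l x = max 0 (min 1 ((a - infnorm x) / l))"

lemma cutoff_bounds: "0 \<le> cutoff a l x" "cutoff a l x \<le> 1"
  by (auto simp: cutoff_def)

lemma cutoff_eq_0: "l > 0 \<Longrightarrow> a \<le> infnorm x \<Longrightarrow> cutoff a l x = 0"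
  using divide_nonpos_pos[of "a - infnorm x" l] by (simp add: cutoff_def)

lemma cutoff_eq_1: "l > 0 \<Longrightarrow> infnorm x \<le> a - l \<Longrightarrow> cutoff a l x = 1"
  by (simp add: cutoff_def max_def min_def field_simps)

lemma continuous_on_cutoff [continuous_intros]:
  "continuous_on S g \<Longrightarrow> continuous_on S (\<lambda>x. cutoff a l (g x))"
  unfolding cutoff_def divide_inverse by (intro continuous_intros continuous_on_infnorm)

lemma cutoff_lipschitz:
  assumes "l > 0" shows "\<bar>cutoff a l x - cutoff a l y\<bar> \<le> norm (x - y) / l"
proof -
  have "\<bar>cutoff a l x - cutoff a l y\<bar> \<le> \<bar>(a - infnorm x) / l - (a - infnorm y) / l\<bar>"
    unfolding cutoff_def by linarith
  also have "\<dots> = \<bar>infnorm y - infnorm x\<bar> / l"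
    using assms by (simp add: diff_divide_distrib[symmetric] abs_divide)
  also have "\<dots> \<le> norm (x - y) / l"
    using assms order_trans[OF absdiff_infnorm infnorm_le_norm, of y x]
    by (intro divide_right_mono) (auto simp: norm_minus_commute)
  finally show ?thesis .
qed

lemma infnorm_le_iff_Box: "infnorm x \<le> N \<longleftrightarrow> x \<in> Box N"
proof
  assume "infnorm x \<le> N"
  then show "x \<in> Box N"
    unfolding mem_Box using component_le_infnorm_cart order_trans by blast
next
  assume "x \<in> Box N"
  then show "infnorm x \<le> N"
    unfolding infnorm_def mem_Box
    by (intro cSup_least) (auto simp: Basis_vec_def inner_axis)
qed

lemma infnorm_less_cubeQ: "infnorm x < L / 2 \<Longrightarrow> x \<in> cubeQ L"
  unfolding cubeQ_def using component_le_infnorm_cart[of x]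
  by (auto simp: abs_le_iff) (smt (verit) component_le_infnorm_cart abs_le_iff field_sum_of_halves)+

lemma infnorm_circle: "infnorm (x + hz (complex_of_real r * cis s)) \<le> infnorm x + \<bar>r\<bar>"
proof -
  have "infnorm (x + hz (complex_of_real r * cis s)) \<le> infnorm x + infnorm (hz (complex_of_real r * cis s))"
    by (rule infnorm_triangle)
  also have "infnorm (hz (complex_of_real r * cis s)) \<le> norm (hz (complex_of_real r * cis s))"
    by (rule infnorm_le_norm)
  finally show ?thesis by (simp add: norm_mult)
qed

text \<open>A change of variables moves the translation from f to the cutoff. Because cis (- s) has
  mean zero over the circle, the unshifted cutoff may be subtracted for free, and the difference of
  the two cutoffs is at most r / l.\<close>

lemma cutoff_circle_bound:
  fixes f :: "real^3 \<Rightarrow> complex" and r :: real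
  assumes f: "continuous_on UNIV f" and supp: "\<And>x. M < norm x \<Longrightarrow> f x = 0"
    and N: "r + M \<le> N" and r: "0 \<le> r" and l: "l > 0"
  shows "cmod (integral (Box N) (\<lambda>x. cutoff a l x *\<^sub>R
      integral {0..2 * pi} (\<lambda>s. cis (- s) * f (x + hz (complex_of_real r * cis s)))))
    \<le> 2 * pi * (r / l) * integral (Box N) (\<lambda>x. cmod (f x))"
proof -
  note [continuous_intros] = continuous_on_compose2[OF f]
  let ?e = "\<lambda>s. hz (complex_of_real r * cis s)"
  let ?g = "\<lambda>s. integral (Box N) (\<lambda>y. cis (- s) * (cutoff a l (y - ?e s) - cutoff a l y) *\<^sub>R f y)"
  have "integral (Box N) (\<lambda>x. cutoff a l x *\<^sub>R integral {0..2 * pi} (\<lambda>s. cis (- s) * f (x + ?e s)))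
     = integral (Box N) (\<lambda>x. integral {0..2 * pi} (\<lambda>s. cutoff a l x *\<^sub>R (cis (- s) * f (x + ?e s))))"
    by simp
  also have "\<dots> = integral {0..2 * pi} (\<lambda>s. integral (Box N) (\<lambda>x. cutoff a l x *\<^sub>R (cis (- s) * f (x + ?e s))))"
    unfolding cbox_interval[symmetric]
    by (intro integral_swap_continuous) (auto intro!: continuous_intros simp: split_beta)
  also have "\<dots> = integral {0..2 * pi} (\<lambda>s. integral (Box N) (\<lambda>y. cis (- s) * cutoff a l (y - ?e s) *\<^sub>R f y))"
  proof (rule integral_cong)
    fix s
    show "integral (Box N) (\<lambda>x. cutoff a l x *\<^sub>R (cis (- s) * f (x + ?e s))) =
       integral (Box N) (\<lambda>y. cis (- s) * cutoff a l (y - ?e s) *\<^sub>R f y)"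
      using integral_Box_translate[where M = M and N = N and y = "?e s" and
          f = "\<lambda>y. cis (- s) * cutoff a l (y - ?e s) *\<^sub>R f y"] supp N r
      by (simp add: norm_mult)
  qed
  also have "\<dots> = integral {0..2 * pi} (\<lambda>s. integral (Box N) (\<lambda>y. cis (- s) * cutoff a l (y - ?e s) *\<^sub>R f y))
      - integral {0..2 * pi} (\<lambda>s. cis (- s) * integral (Box N) (\<lambda>y. cutoff a l y *\<^sub>R f y))"
  proof -
    have "((\<lambda>s. cis (- s)) has_integral 0) {0..2 * pi}"
    proof -
      have "((\<lambda>t. \<i> * cis (- t)) has_vector_derivative cis (- t)) (at t within {0..2 * pi})" for t
      proof -
        have "((\<lambda>t. cis (- t)) has_vector_derivative - \<i> * cis (- t)) (at t within {0..2 * pi})"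
          unfolding cis_conv_exp
          by (auto intro!: derivative_eq_intros has_vector_derivative_real_field)
        from has_vector_derivative_mult_right[OF this, of \<i>] show ?thesis by simp
      qed
      then have "((\<lambda>s. cis (- s)) has_integral (\<i> * cis (- (2 * pi))) - (\<i> * cis (- 0))) {0..2 * pi}"
        by (intro fundamental_theorem_of_calculus) auto
      then show ?thesis by (simp add: cis_cnj[symmetric])
    qed
    from has_integral_mult_left[OF this] have
      "integral {0..2 * pi} (\<lambda>s. cis (- s) * integral (Box N) (\<lambda>y. cutoff a l y *\<^sub>R f y)) = 0"
      by (intro integral_unique) auto
    then show ?thesis by simp
  qed
  also have "\<dots> = integral {0..2 * pi} (\<lambda>s. integral (Box N) (\<lambda>y. cis (- s) * cutoff a l (y - ?e s) *\<^sub>R f y)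
      - cis (- s) * integral (Box N) (\<lambda>y. cutoff a l y *\<^sub>R f y))"
    unfolding cbox_interval[symmetric]
    by (intro integral_diff[symmetric] integrable_continuous integral_continuous_on_param continuous_intros)
      (auto intro!: continuous_intros simp: split_beta)
  also have "\<dots> = integral {0..2 * pi} ?g"
  proof (rule integral_cong)
    fix s
    have "cis (- s) * integral (Box N) (\<lambda>y. cutoff a l y *\<^sub>R f y) =
      integral (Box N) (\<lambda>y. cis (- s) * cutoff a l y *\<^sub>R f y)"
      by (rule integral_mult_right[symmetric])
    then show "integral (Box N) (\<lambda>y. cis (- s) * cutoff a l (y - ?e s) *\<^sub>R f y)
      - cis (- s) * integral (Box N) (\<lambda>y. cutoff a l y *\<^sub>R f y) = ?g s"
      by (simp only: scaleR_diff_left right_diff_distrib)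
        (intro integral_diff[symmetric] integrable_continuous continuous_intros; simp)
  qed
  also have "cmod \<dots> \<le> (r / l * integral (Box N) (\<lambda>x. cmod (f x))) * (2 * pi - 0)"
  proof (intro integral_bound)
    show "continuous_on {0..2 * pi} ?g"
      by (intro integral_continuous_on_param) (auto intro!: continuous_intros simp: split_beta)
    fix s
    have "cmod (?g s) \<le> integral (Box N) (\<lambda>y. r / l * cmod (f y))"
    proof (intro integral_norm_bound_integral integrable_continuous continuous_intros)
      fix y
      have "\<bar>cutoff a l (y - ?e s) - cutoff a l y\<bar> \<le> r / l"
        using cutoff_lipschitz[OF l, of a "y - ?e s" y] r by (simp add: norm_mult)
      then show "norm (cis (- s) * (cutoff a l (y - ?e s) - cutoff a l y) *\<^sub>R f y) \<le> r / l * cmod (f y)"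
        using mult_right_mono[of _ "r / l" "cmod (f y)"] by (simp add: norm_mult)
    qed auto
    then show "cmod (?g s) \<le> r / l * integral (Box N) (\<lambda>x. cmod (f x))" by simp
  qed auto
  finally show ?thesis by (simp add: mult_ac)
qed

section \<open>Differentiable configurations and their restriction to circles\<close>

definition covD :: "(real^3 \<Rightarrow> complex) \<Rightarrow> (3 \<Rightarrow> real^3 \<Rightarrow> complex) \<Rightarrow> 3 \<Rightarrow> real^3 \<Rightarrow> complex" where
  "covD U G j x = G j x - \<i> * complex_of_real (magF x $ j) * U x"

lemma magF_nth [simp]: "magF x $ 1 = - (x $ 2) / 2" "magF x $ 2 = x $ 1 / 2" "magF x $ 3 = 0"
  by (simp_all add: magF_def)

lemma continuous_on_covD:
  assumes "continuous_on UNIV U" "\<And>j. continuous_on UNIV (G j)"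
  shows "continuous_on UNIV (covD U G j)"
proof -
  have F: "continuous_on UNIV (\<lambda>x. magF x $ j)"
    using exhaust_3[of j] by (elim disjE; simp; intro continuous_intros; simp)
  then show ?thesis
    unfolding covD_def
    by (intro continuous_on_diff continuous_on_mult continuous_on_const continuous_on_of_real F assms)
qed

lemma circle_vector_derivative:
  assumes U: "(U has_derivative (\<lambda>h. \<Sum>j\<in>UNIV. h $ j *\<^sub>R G j (x + hz (complex_of_real r * cis t))))
      (at (x + hz (complex_of_real r * cis t)))"
  shows "((\<lambda>t. U (x + hz (complex_of_real r * cis t))) has_vector_derivative
    r *\<^sub>R (- sin t *\<^sub>R G 1 (x + hz (complex_of_real r * cis t)) + cos t *\<^sub>R G 2 (x + hz (complex_of_real r * cis t)))) (at t)"
proof -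
  have "((\<lambda>t. x + hz (complex_of_real r * cis t)) has_derivative
      (\<lambda>h. (h * (- r * sin t)) *\<^sub>R axis 1 1 + (h * (r * cos t)) *\<^sub>R axis 2 1)) (at t)"
    unfolding hz_def by (auto intro!: derivative_eq_intros simp: algebra_simps)
  from has_derivative_compose[OF this U]
  show ?thesis
    unfolding has_vector_derivative_def
    by (simp add: sum_3 axis_def algebra_simps)
qed

text \<open>Stokes with curl F = e_3: the circulation is the area of the disc, wherever its centre
  lies. \<open>?P\<close> is a primitive in the angle.\<close>

lemma magF_circulation:
  "((\<lambda>t. r * (- sin t * magF (x + hz (complex_of_real r * cis t)) $ 1 + cos t * magF (x + hz (complex_of_real r * cis t)) $ 2))
    has_integral pi * r\<^sup>2) {0..2 * pi}"
proof -
  let ?P = "\<lambda>t. r / 2 * (x $ 1 * sin t - x $ 2 * cos t + r * t)"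
  have "((\<lambda>t. r * (- sin t * magF (x + hz (complex_of_real r * cis t)) $ 1 + cos t * magF (x + hz (complex_of_real r * cis t)) $ 2))
    has_integral ?P (2 * pi) - ?P 0) {0..2 * pi}"
  proof (rule fundamental_theorem_of_calculus)
    fix t
    have "r / 2 * (x $ 1 * cos t + x $ 2 * sin t + r) =
       r * (- sin t * magF (x + hz (complex_of_real r * cis t)) $ 1 + cos t * magF (x + hz (complex_of_real r * cis t)) $ 2)"
      by (simp add: field_simps) (use sin_cos_squared_add[of t] in algebra)
    moreover have "(?P has_vector_derivative r / 2 * (x $ 1 * cos t + x $ 2 * sin t + r)) (at t within {0..2 * pi})"
      unfolding has_real_derivative_iff_has_vector_derivative[symmetric]
      by (auto intro!: derivative_eq_intros)
    ultimately show "(?P has_vector_derivative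
      r * (- sin t * magF (x + hz (complex_of_real r * cis t)) $ 1 + cos t * magF (x + hz (complex_of_real r * cis t)) $ 2))
      (at t within {0..2 * pi})" by (simp only:)
  qed simp
  then show ?thesis by (simp add: power2_eq_square field_simps)
qed

text \<open>This is what mollifying an H1 function provides: \<open>U\<close> and \<open>G\<close>
  are continuous everywhere, but \<open>G\<close> is known to be the gradient of \<open>U\<close>
  only inside the open cube. The constant c is the level of |U|^2 below which the current is
  truncated.\<close>

locale smooth_config =
  fixes U :: "real^3 \<Rightarrow> complex" and G :: "3 \<Rightarrow> real^3 \<Rightarrow> complex" and b c L :: real
  assumes contU: "continuous_on UNIV U" and contG: "\<And>j. continuous_on UNIV (G j)"
    and deriv: "\<And>x. x \<in> cubeQ L \<Longrightarrow> (U has_derivative (\<lambda>h. \<Sum>j\<in>UNIV. h $ j *\<^sub>R G j x)) (at x)"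
    and b: "b > 0" and c: "0 < c" "c < 1" and L: "L > 0"
begin

definition \<delta> where "\<delta> x = sqrt ((cmod (covD U G 1 x))\<^sup>2 + (cmod (covD U G 2 x))\<^sup>2)"

text \<open>Where |U|^2 \<ge> c this is the phase gradient minus F, a gauge invariant quantity. The
  maximum keeps it continuous across the zeros of \<open>U\<close>.\<close>

definition J where "J j x = Im (cnj (U x) * covD U G j x) / max c ((cmod (U x))\<^sup>2)"

text \<open>In complex form the tangential component of the current at angle s of a circle is Im
  (cis (- s) f). The cutoff lets f be extended by zero outside the cube, as
  \<open>circle_coefficient_bound\<close> requires.\<close>

definition f where "f x = cutoff (L / 2) 1 x *\<^sub>R Complex (J 1 x) (J 2 x)"

text \<open>The potential is built on |U| rather than |U|^2: it is dominated by the true one and is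
  stable under approximation in L2, where fourth powers of |U| are not controlled. Dropping the
  vertical derivative only lowers the energy.\<close>

definition energy where
  "energy = integral (Box (L / 2)) (\<lambda>x. b * (\<delta> x)\<^sup>2 + (1 - cmod (U x))\<^sup>2 / 2)"

lemma contD: "continuous_on UNIV (covD U G j)"
  by (intro continuous_on_covD contU contG)

lemma cont\<delta>: "continuous_on UNIV \<delta>"
  unfolding \<delta>_def by (intro continuous_intros contD)

lemma contf: "continuous_on UNIV f"
  unfolding f_def J_def Complex_eq using c
  by (intro continuous_intros contD contU) (auto simp: max_def)

lemmas [continuous_intros] = continuous_on_compose2[OF contU] continuous_on_compose2[OF cont\<delta>]
  continuous_on_compose2[OF contf]

lemma \<delta>_nonneg: "0 \<le> \<delta> x" and \<delta>_sq: "(\<delta> x)\<^sup>2 = (cmod (covD U G 1 x))\<^sup>2 + (cmod (covD U G 2 x))\<^sup>2"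
  by (simp_all add: \<delta>_def)

text \<open>One factor of the maximum in the denominator absorbs |U|^2; the other survives and costs
  1 / c. This is why c is taken close to 1 in \<open>M0_lower_asymp\<close>.\<close>

lemma f_sq_le: "(cmod (f x))\<^sup>2 \<le> (\<delta> x)\<^sup>2 / c"
proof -
  define M where "M = max c ((cmod (U x))\<^sup>2)"
  have M: "M > 0" "c \<le> M" "(cmod (U x))\<^sup>2 \<le> M" using c by (auto simp: M_def)
  have J: "(J j x)\<^sup>2 \<le> (cmod (U x))\<^sup>2 * (cmod (covD U G j x))\<^sup>2 / M\<^sup>2" for j
  proof -
    have "\<bar>Im (cnj (U x) * covD U G j x)\<bar> \<le> cmod (U x) * cmod (covD U G j x)"
      using abs_Im_le_cmod[of "cnj (U x) * covD U G j x"] by (simp add: norm_mult)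
    then have "(Im (cnj (U x) * covD U G j x))\<^sup>2 \<le> (cmod (U x) * cmod (covD U G j x))\<^sup>2"
      by (metis abs_ge_zero power2_abs power_mono)
    then show ?thesis
      unfolding J_def M_def[symmetric] power_divide power_mult_distrib by (intro divide_right_mono) auto
  qed
  have "(cmod (f x))\<^sup>2 = (cutoff (L / 2) 1 x)\<^sup>2 * ((J 1 x)\<^sup>2 + (J 2 x)\<^sup>2)"
    by (simp add: f_def power_mult_distrib cmod_power2)
  also have "\<dots> \<le> 1 * ((J 1 x)\<^sup>2 + (J 2 x)\<^sup>2)"
    using cutoff_bounds[of "L / 2" 1 x] by (intro mult_right_mono power_le_one) auto
  also have "\<dots> \<le> (cmod (U x))\<^sup>2 * (cmod (covD U G 1 x))\<^sup>2 / M\<^sup>2 + (cmod (U x))\<^sup>2 * (cmod (covD U G 2 x))\<^sup>2 / M\<^sup>2"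
    using J[of 1] J[of 2] by simp
  also have "\<dots> = (cmod (U x))\<^sup>2 * ((\<delta> x)\<^sup>2 / M\<^sup>2)"
    unfolding \<delta>_sq by (simp add: distrib_left add_divide_distrib)
  also have "\<dots> \<le> M * ((\<delta> x)\<^sup>2 / M\<^sup>2)"
    using M by (intro mult_right_mono) auto
  also have "\<dots> = (\<delta> x)\<^sup>2 / M" using M by (simp add: power2_eq_square)
  also have "\<dots> \<le> (\<delta> x)\<^sup>2 / c" using M c by (intro divide_left_mono) auto
  finally show ?thesis .
qed

lemma f_eq_0: "L / 2 \<le> infnorm x \<Longrightarrow> f x = 0"
  by (simp add: f_def cutoff_eq_0)

lemma f_supp: "2 * L < norm x \<Longrightarrow> f x = 0"
proof (rule f_eq_0, rule ccontr)
  assume *: "2 * L < norm x" "\<not> L / 2 \<le> infnorm x"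
  have "norm x \<le> (\<Sum>i\<in>UNIV. \<bar>x $ i\<bar>)" by (rule norm_le_l1_cart)
  also have "\<dots> \<le> (\<Sum>i\<in>(UNIV :: 3 set). L / 2)"
    using * component_le_infnorm_cart[of x] by (intro sum_mono) (meson le_less_trans less_imp_le not_le)
  finally show False using * L by (simp add: sum_3)
qed

text \<open>This is \<open>circulation_inequality\<close> on the circle about x, with y equal to r
  times the imaginary part of the first Fourier integral of f, divided by r^2. The margin 2 is one
  unit for the radius and one for the width of the cutoff, which is therefore 1 on the whole
  circle.\<close>

lemma pointwise_lower_bound:
  assumes x: "infnorm x < L / 2 - 2" and r: "sqrt b \<le> r" "r \<le> 1"
  shows "2 * pi * (1 - r\<^sup>2) * (Im (integral {0..2 * pi} (\<lambda>s. cis (- s) * f (x + hz (complex_of_real r * cis s)))) / r + pi)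
      - 16 * pi\<^sup>2 / ((1 - c)\<^sup>2 * sqrt b * r) * integral {0..2 * pi}
         (\<lambda>s. cutoff (L / 2) 1 (x + hz (complex_of_real r * cis s)) *
           (b * (\<delta> (x + hz (complex_of_real r * cis s)))\<^sup>2 + 2 * (1 - cmod (U (x + hz (complex_of_real r * cis s))))\<^sup>2))
    \<le> (cmod (integral {0..2 * pi} (\<lambda>s. cis (- s) * f (x + hz (complex_of_real r * cis s)))))\<^sup>2"
proof -
  let ?z = "\<lambda>s. x + hz (complex_of_real r * cis s)"
  have r0: "r > 0" using b r by (meson less_le_trans real_sqrt_gt_zero)
  have inf: "infnorm (?z s) \<le> L / 2 - 1" for s
    using infnorm_circle[of x r s] x r r0 by simp
  have cut: "cutoff (L / 2) 1 (?z s) = 1" for s using inf[of s] by (intro cutoff_eq_1) auto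
  have Q: "?z s \<in> cubeQ L" for s using inf[of s] by (intro infnorm_less_cubeQ) auto
  define u where "u = (\<lambda>s. U (?z s))"
  define u' where "u' = (\<lambda>s. r *\<^sub>R (- sin s *\<^sub>R G 1 (?z s) + cos s *\<^sub>R G 2 (?z s)))"
  define p where "p = (\<lambda>t. r * (- sin t * magF (?z t) $ 1 + cos t * magF (?z t) $ 2))"
  let ?B = "integral {0..2 * pi} (\<lambda>s. cis (- s) * f (?z s))"
  define y where "y = r * Im ?B"
  have cov: "u' s - \<i> * complex_of_real (p s) * u s =
      r *\<^sub>R (- sin s *\<^sub>R covD U G 1 (?z s) + cos s *\<^sub>R covD U G 2 (?z s))" for s
    unfolding u'_def p_def u_def covD_def by (simp add: scaleR_conv_of_real algebra_simps)
  have "2 * pi * (1 - r\<^sup>2) * (y + pi * r\<^sup>2) - 4 * pi\<^sup>2 / (1 - c)\<^sup>2 *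
      (4 * r / sqrt b * integral {0..2 * pi} (\<lambda>t. b * (\<delta> (?z t))\<^sup>2 + 2 * (1 - cmod (u t))\<^sup>2)) \<le> y\<^sup>2"
  proof (rule circulation_inequality[where p = p and u = u and u' = u'])
    show "(u has_vector_derivative u' t) (at t)" for t
      unfolding u_def u'_def by (intro circle_vector_derivative deriv Q)
    show "continuous_on UNIV u'"
      unfolding u'_def
      by (intro continuous_intros continuous_on_compose2[OF contG]) auto
    show "continuous_on UNIV (\<lambda>t. \<delta> (?z t))"
      by (intro continuous_intros) auto
    show "cmod (u' t - \<i> * complex_of_real (p t) * u t) \<le> r * \<delta> (?z t)" for t
    proof -
      let ?a = "cmod (covD U G 1 (?z t))" and ?b = "cmod (covD U G 2 (?z t))"
      have "cmod (- sin t *\<^sub>R covD U G 1 (?z t) + cos t *\<^sub>R covD U G 2 (?z t)) \<le> \<bar>sin t\<bar> * ?a + \<bar>cos t\<bar> * ?b"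
        using norm_triangle_ineq[of "- sin t *\<^sub>R covD U G 1 (?z t)" "cos t *\<^sub>R covD U G 2 (?z t)"] by simp
      also have "\<dots> \<le> \<delta> (?z t)"
        unfolding \<delta>_def
      proof (rule real_le_rsqrt)
        have "A\<^sup>2 + B\<^sup>2 - (S * A + C * B)\<^sup>2 = (C * A - S * B)\<^sup>2" if "S\<^sup>2 + C\<^sup>2 = 1" for A B C S :: real
          using that by algebra
        note ident = this
        have "?a\<^sup>2 + ?b\<^sup>2 - (\<bar>sin t\<bar> * ?a + \<bar>cos t\<bar> * ?b)\<^sup>2 = (\<bar>cos t\<bar> * ?a - \<bar>sin t\<bar> * ?b)\<^sup>2"
          by (rule ident) simp
        then show "(\<bar>sin t\<bar> * ?a + \<bar>cos t\<bar> * ?b)\<^sup>2 \<le> ?a\<^sup>2 + ?b\<^sup>2"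
          using zero_le_power2[of "\<bar>cos t\<bar> * ?a - \<bar>sin t\<bar> * ?b"] by linarith
      qed
      finally show ?thesis unfolding cov using r0 by (simp add: mult_left_mono)
    qed
    show "u (2 * pi) = u 0" by (simp add: u_def)
    show "(p has_integral pi * r\<^sup>2) {0..2 * pi}"
      unfolding p_def by (rule magF_circulation)
    show "y = integral {0..2 * pi} (\<lambda>t. Im (cnj (u t) * (u' t - \<i> * complex_of_real (p t) * u t)) / max c ((cmod (u t))\<^sup>2))"
    proof -
      have "Im ?B = integral {0..2 * pi} (\<lambda>s. Im (cis (- s) * f (?z s)))"
        by (intro integral_unique[symmetric] has_integral_Im integrable_integral integrable_continuous_real
            continuous_intros) auto
      then have "y = integral {0..2 * pi} (\<lambda>s. r * Im (cis (- s) * f (?z s)))"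
        by (simp add: y_def)
      also have "(\<lambda>s. r * Im (cis (- s) * f (?z s))) =
        (\<lambda>t. Im (cnj (u t) * (u' t - \<i> * complex_of_real (p t) * u t)) / max c ((cmod (u t))\<^sup>2))"
      proof
        fix s
        show "r * Im (cis (- s) * f (?z s)) = Im (cnj (u s) * (u' s - \<i> * complex_of_real (p s) * u s)) / max c ((cmod (u s))\<^sup>2)"
        proof -
          have "r * Im (cis (- s) * (1 *\<^sub>R Complex (Im (cnj z * d1) / M) (Im (cnj z * d2) / M)))
            = Im (cnj z * (r *\<^sub>R (- sin s *\<^sub>R d1 + cos s *\<^sub>R d2))) / M" for z d1 d2 M
            by (simp add: add_divide_distrib diff_divide_distrib algebra_simps)
          then show ?thesis
            unfolding cov unfolding f_def cut J_def u_def .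
        qed
      qed
      finally show ?thesis .
    qed
  qed (use b r c in auto)
  then have h1: "(2 * pi * (1 - r\<^sup>2) * (y + pi * r\<^sup>2) - 4 * pi\<^sup>2 / (1 - c)\<^sup>2 *
      (4 * r / sqrt b * integral {0..2 * pi} (\<lambda>t. b * (\<delta> (?z t))\<^sup>2 + 2 * (1 - cmod (u t))\<^sup>2))) / r\<^sup>2 \<le> y\<^sup>2 / r\<^sup>2"
    by (intro divide_right_mono) auto
  have h2: "y\<^sup>2 / r\<^sup>2 \<le> (cmod ?B)\<^sup>2"
    using r0 abs_Im_le_cmod[of ?B] power_mono[of "\<bar>Im ?B\<bar>" "cmod ?B" 2]
    by (simp add: y_def power_mult_distrib)
  have h3: "(2 * pi * (1 - r\<^sup>2) * (y + pi * r\<^sup>2) - 4 * pi\<^sup>2 / (1 - c)\<^sup>2 * (4 * r / sqrt b * K)) / r\<^sup>2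
     = 2 * pi * (1 - r\<^sup>2) * (Im ?B / r + pi) - 16 * pi\<^sup>2 / ((1 - c)\<^sup>2 * sqrt b * r) * K" for K
  proof -
    have "(2 * pi * (1 - r\<^sup>2) * (r * I + pi * r\<^sup>2) - 4 * pi\<^sup>2 / d * (4 * r / q * K)) / r\<^sup>2
       = 2 * pi * (1 - r\<^sup>2) * (I / r + pi) - 16 * pi\<^sup>2 / (d * q * r) * K" if "d \<noteq> 0" "q \<noteq> 0" for I d q :: real
      using r0 that by (simp add: field_simps power2_eq_square)
    then show ?thesis using b c unfolding y_def by simp
  qed
  show ?thesis
    using order_trans[OF h1 h2] unfolding h3 unfolding cut u_def by simp
qed

end

section \<open>From single circles to the whole cube\<close>

lemma content_Box: "0 \<le> N \<Longrightarrow> Henstock_Kurzweil_Integration.content (Box N) = (2 * N) ^ 3"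
  by (subst content_cbox_cart) (auto simp: interval_ne_empty_cart)

lemma integral_Box_eq:
  fixes h :: "real^3 \<Rightarrow> 'a::banach"
  assumes h: "\<And>x. a \<le> infnorm x \<Longrightarrow> h x = 0" and N: "a \<le> N"
  shows "integral (Box N) h = integral (Box a) h"
proof -
  have "integral (Box N) h = integral (Box N) (\<lambda>x. if x \<in> Box a then h x else 0)"
    using h by (intro integral_cong) (auto simp: infnorm_le_iff_Box[symmetric])
  also have "\<dots> = integral (Box N \<inter> Box a) h"
    by (simp add: integral_restrict_Int Int_commute)
  also have "Box N \<inter> Box a = Box a"
    using N by (auto simp: infnorm_le_iff_Box[symmetric])
  finally show ?thesis .
qed

lemma integral_cutoff_ge:
  assumes l: "l > 0" and a: "0 \<le> a - l" "a \<le> N"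
  shows "(2 * (a - l)) ^ 3 \<le> integral (Box N) (cutoff a l)"
proof -
  have int: "cutoff a l integrable_on Box K" for K
    using integrable_continuous[of "vec (- K)" "vec K" "cutoff a l"] continuous_on_cutoff[OF continuous_on_id, of "Box K" a l]
    by simp
  define m where "m = a - l"
  have "(2 * m) ^ 3 = integral (Box m) (\<lambda>x. 1 :: real)"
    using a by (simp add: content_Box m_def[symmetric])
  also have "\<dots> \<le> integral (Box m) (cutoff a l)"
    using l by (intro integral_le int) (auto simp: cutoff_eq_1 m_def[symmetric] infnorm_le_iff_Box[symmetric])
  also have "\<dots> \<le> integral (Box N) (cutoff a l)"
  proof (intro integral_subset_le int)
    have "m \<le> N" using l a by (simp add: m_def)
    then show "Box m \<subseteq> Box N" by (auto simp: infnorm_le_iff_Box[symmetric])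
  qed (simp add: cutoff_bounds)
  finally show ?thesis by (simp only: m_def)
qed

context smooth_config
begin

lemma int_f_sq: "L / 2 \<le> N \<Longrightarrow> integral (Box N) (\<lambda>x. (cmod (f x))\<^sup>2) \<le> energy / (b * c)"
proof -
  assume N: "L / 2 \<le> N"
  have "integral (Box N) (\<lambda>x. (cmod (f x))\<^sup>2) = integral (Box (L / 2)) (\<lambda>x. (cmod (f x))\<^sup>2)"
    using N by (intro integral_Box_eq) (auto simp: f_eq_0)
  also have "\<dots> \<le> integral (Box (L / 2)) (\<lambda>x. (b * (\<delta> x)\<^sup>2 + (1 - cmod (U x))\<^sup>2 / 2) * (1 / (b * c)))"
  proof (intro integral_le integrable_continuous continuous_intros)
    fix x
    have "(\<delta> x)\<^sup>2 / c = (b * (\<delta> x)\<^sup>2) * (1 / (b * c))" using b by simp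
    also have "\<dots> \<le> (b * (\<delta> x)\<^sup>2 + (1 - cmod (U x))\<^sup>2 / 2) * (1 / (b * c))"
      using b c by (intro mult_right_mono) auto
    finally show "(cmod (f x))\<^sup>2 \<le> (b * (\<delta> x)\<^sup>2 + (1 - cmod (U x))\<^sup>2 / 2) * (1 / (b * c))"
      using f_sq_le[of x] by simp
  qed auto
  also have "\<dots> = energy / (b * c)" unfolding energy_def by simp
  finally show ?thesis .
qed

lemma energy_nonneg: "0 \<le> energy"
  unfolding energy_def using b
  by (intro Henstock_Kurzweil_Integration.integral_nonneg integrable_continuous continuous_intros) auto

text \<open>Young's inequality with a free parameter, in place of Cauchy-Schwarz, keeps the bound
  affine in the energy; \<open>GL_lower_bound\<close> relies on this.\<close>

lemma int_f: "L / 2 \<le> N \<Longrightarrow> \<mu> > 0 \<Longrightarrow>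
  integral (Box N) (\<lambda>x. cmod (f x)) \<le> (\<mu> * L ^ 3 + energy / (b * c) / \<mu>) / 2"
proof -
  assume N: "L / 2 \<le> N" and \<mu>: "\<mu> > 0"
  have "integral (Box N) (\<lambda>x. cmod (f x)) = integral (Box (L / 2)) (\<lambda>x. cmod (f x))"
    using N by (intro integral_Box_eq) (auto simp: f_eq_0)
  also have "\<dots> \<le> integral (Box (L / 2)) (\<lambda>x. \<mu> / 2 + (cmod (f x))\<^sup>2 * (1 / (2 * \<mu>)))"
  proof (intro integral_le integrable_continuous continuous_intros)
    fix x
    have "0 \<le> (\<mu> - cmod (f x))\<^sup>2" by simp
    then have "2 * \<mu> * cmod (f x) \<le> \<mu>\<^sup>2 + (cmod (f x))\<^sup>2" by (simp add: power2_eq_square algebra_simps)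
    then show "cmod (f x) \<le> \<mu> / 2 + (cmod (f x))\<^sup>2 * (1 / (2 * \<mu>))"
      using \<mu> by (simp add: field_simps power2_eq_square)
  qed auto
  also have "\<dots> = integral (Box (L / 2)) (\<lambda>x. \<mu> / 2) + integral (Box (L / 2)) (\<lambda>x. (cmod (f x))\<^sup>2 * (1 / (2 * \<mu>)))"
    by (intro integral_add integrable_continuous continuous_intros) auto
  also have "integral (Box (L / 2)) (\<lambda>x. \<mu> / 2) = L ^ 3 * (\<mu> / 2)"
    using L by (simp add: content_Box)
  also have "integral (Box (L / 2)) (\<lambda>x. (cmod (f x))\<^sup>2 * (1 / (2 * \<mu>))) =
      integral (Box (L / 2)) (\<lambda>x. (cmod (f x))\<^sup>2) * (1 / (2 * \<mu>))" by simp
  also have "\<dots> \<le> energy / (b * c) * (1 / (2 * \<mu>))"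
    using \<mu> by (intro mult_right_mono int_f_sq) auto
  finally show ?thesis by (simp add: field_simps)
qed

text \<open>The density that pays for circles of low modulus. The cutoff gives it compact support,
  so that its circle integrals can be evaluated by translation.\<close>

definition e where "e x = cutoff (L / 2) 1 x * (b * (\<delta> x)\<^sup>2 + 2 * (1 - cmod (U x))\<^sup>2)"

lemma conte: "continuous_on UNIV e"
  unfolding e_def by (intro continuous_intros) auto

lemma e_nonneg: "0 \<le> e x"
  unfolding e_def using b by (intro mult_nonneg_nonneg cutoff_bounds) auto

lemma e_supp: "2 * L < norm x \<Longrightarrow> e x = 0"
proof -
  assume *: "2 * L < norm x"
  have "L / 2 \<le> infnorm x"
  proof (rule ccontr)
    assume "\<not> L / 2 \<le> infnorm x"
    then have "norm x \<le> (\<Sum>i\<in>(UNIV :: 3 set). L / 2)"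
      using component_le_infnorm_cart[of x]
      by (intro order_trans[OF norm_le_l1_cart] sum_mono) (meson le_less_trans less_imp_le not_le)
    then show False using * L by (simp add: sum_3)
  qed
  then show ?thesis by (simp add: e_def cutoff_eq_0)
qed

lemma int_e: "L / 2 \<le> N \<Longrightarrow> integral (Box N) e \<le> 4 * energy"
proof -
  assume N: "L / 2 \<le> N"
  have "integral (Box N) e = integral (Box (L / 2)) e"
    using N by (intro integral_Box_eq) (auto simp: e_def cutoff_eq_0)
  also have "\<dots> \<le> integral (Box (L / 2)) (\<lambda>x. 4 * (b * (\<delta> x)\<^sup>2 + (1 - cmod (U x))\<^sup>2 / 2))"
  proof (intro integral_le integrable_continuous continuous_intros continuous_on_subset[OF conte])
    fix x
    have "e x \<le> 1 * (b * (\<delta> x)\<^sup>2 + 2 * (1 - cmod (U x))\<^sup>2)"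
      unfolding e_def using b by (intro mult_right_mono cutoff_bounds) auto
    also have "\<dots> \<le> 4 * (b * (\<delta> x)\<^sup>2 + (1 - cmod (U x))\<^sup>2 / 2)" using b by simp
    finally show "e x \<le> 4 * (b * (\<delta> x)\<^sup>2 + (1 - cmod (U x))\<^sup>2 / 2)" .
  qed auto
  also have "\<dots> = 4 * energy" unfolding energy_def by (rule integral_mult_right)
  finally show ?thesis .
qed

text \<open>The pointwise bound is integrated against a second cutoff, of width l. The term linear
  in Im B is controlled by \<open>cutoff_circle_bound\<close>. The density \<open>e\<close> is
  picked up once for every angle, so the exceptional circles cost 2 pi times 4
  \<open>energy\<close>.\<close>

lemma fixed_radius_bound:
  fixes r l N :: real
  defines "B \<equiv> \<lambda>x. integral {0..2 * pi} (\<lambda>s. cis (- s) * f (x + hz (complex_of_real r * cis s)))"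
  assumes r: "sqrt b \<le> r" "r \<le> 1" and l: "l > 0" and N: "N = 2 * L + 1"
  shows "2 * pi\<^sup>2 * (1 - r\<^sup>2) * (integral (Box N) (cutoff (L / 2 - 2) l) - 2 / l * integral (Box N) (\<lambda>x. cmod (f x)))
      - 128 * pi ^ 3 * energy / ((1 - c)\<^sup>2 * sqrt b * r) \<le> integral (Box N) (\<lambda>x. (cmod (B x))\<^sup>2)"
proof -
  have r0: "r > 0" using b r by (meson less_le_trans real_sqrt_gt_zero)
  have r2: "0 \<le> 1 - r\<^sup>2" using r r0 by (auto simp: power_le_one)
  let ?\<chi> = "cutoff (L / 2 - 2) l"
  let ?z = "\<lambda>x s. x + hz (complex_of_real r * cis s)"
  define K where "K = 16 * pi\<^sup>2 / ((1 - c)\<^sup>2 * sqrt b * r)"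
  have K: "K \<ge> 0" using b r0 by (simp add: K_def)
  have contB: "continuous_on UNIV B"
    unfolding B_def cbox_interval[symmetric]
    by (intro integral_continuous_on_param) (auto intro!: continuous_intros simp: split_beta)
  have contE: "continuous_on UNIV (\<lambda>x. integral {0..2 * pi} (\<lambda>s. e (?z x s)))"
    unfolding cbox_interval[symmetric]
    by (intro integral_continuous_on_param)
      (auto intro!: continuous_intros continuous_on_compose2[OF conte] simp: split_beta)
  note [continuous_intros] = continuous_on_compose2[OF contB] continuous_on_compose2[OF contE]
  have pt: "?\<chi> x * (2 * pi * (1 - r\<^sup>2) * (Im (B x) / r + pi)) - K * integral {0..2 * pi} (\<lambda>s. e (?z x s)) \<le> (cmod (B x))\<^sup>2" for x
  proof (cases "infnorm x < L / 2 - 2")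
    case True
    have epos: "0 \<le> integral {0..2 * pi} (\<lambda>s. e (?z x s))"
      by (intro Henstock_Kurzweil_Integration.integral_nonneg integrable_continuous_real e_nonneg
         continuous_on_compose2[OF conte] continuous_intros) auto
    have "2 * pi * (1 - r\<^sup>2) * (Im (B x) / r + pi) - K * integral {0..2 * pi} (\<lambda>s. e (?z x s)) \<le> (cmod (B x))\<^sup>2"
      using pointwise_lower_bound[OF True r] unfolding B_def K_def e_def .
    then have "?\<chi> x * (2 * pi * (1 - r\<^sup>2) * (Im (B x) / r + pi)) \<le>
        ?\<chi> x * ((cmod (B x))\<^sup>2 + K * integral {0..2 * pi} (\<lambda>s. e (?z x s)))"
      by (intro mult_left_mono cutoff_bounds) simp
    also have "\<dots> \<le> 1 * ((cmod (B x))\<^sup>2 + K * integral {0..2 * pi} (\<lambda>s. e (?z x s)))"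
      using K epos by (intro mult_right_mono cutoff_bounds) auto
    finally show ?thesis by simp
  next
    case False
    then have "?\<chi> x = 0" using l by (intro cutoff_eq_0) auto
    moreover have "0 \<le> K * integral {0..2 * pi} (\<lambda>s. e (?z x s))"
      by (intro mult_nonneg_nonneg K Henstock_Kurzweil_Integration.integral_nonneg integrable_continuous_real e_nonneg
         continuous_on_compose2[OF conte] continuous_intros) auto
    ultimately show ?thesis by (simp add: order_trans[OF _ zero_le_power2])
  qed
  have "integral (Box N) (\<lambda>x. ?\<chi> x * (2 * pi * (1 - r\<^sup>2) * (Im (B x) / r + pi)) - K * integral {0..2 * pi} (\<lambda>s. e (?z x s)))
    \<le> integral (Box N) (\<lambda>x. (cmod (B x))\<^sup>2)"
    using r0 by (intro integral_le integrable_continuous continuous_intros pt) auto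
  moreover have "integral (Box N) (\<lambda>x. ?\<chi> x * (2 * pi * (1 - r\<^sup>2) * (Im (B x) / r + pi)) - K * integral {0..2 * pi} (\<lambda>s. e (?z x s)))
    = 2 * pi * (1 - r\<^sup>2) / r * integral (Box N) (\<lambda>x. ?\<chi> x * Im (B x)) + 2 * pi\<^sup>2 * (1 - r\<^sup>2) * integral (Box N) ?\<chi>
       - K * integral (Box N) (\<lambda>x. integral {0..2 * pi} (\<lambda>s. e (?z x s)))"
  proof (rule integral_unique)
    have 1: "((\<lambda>x. ?\<chi> x * Im (B x)) has_integral integral (Box N) (\<lambda>x. ?\<chi> x * Im (B x))) (Box N)"
      by (intro integrable_integral integrable_continuous continuous_intros) auto
    have 2: "(?\<chi> has_integral integral (Box N) ?\<chi>) (Box N)"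
      using integrable_continuous[OF continuous_on_cutoff[OF continuous_on_id, of _ "L / 2 - 2" l]]
      by (intro integrable_integral) auto
    have 3: "((\<lambda>x. integral {0..2 * pi} (\<lambda>s. e (?z x s))) has_integral
        integral (Box N) (\<lambda>x. integral {0..2 * pi} (\<lambda>s. e (?z x s)))) (Box N)"
      by (intro integrable_integral integrable_continuous continuous_intros) auto
    have "((\<lambda>x. 2 * pi * (1 - r\<^sup>2) / r * (?\<chi> x * Im (B x)) + 2 * pi\<^sup>2 * (1 - r\<^sup>2) * ?\<chi> x
        - K * integral {0..2 * pi} (\<lambda>s. e (?z x s))) has_integral
      2 * pi * (1 - r\<^sup>2) / r * integral (Box N) (\<lambda>x. ?\<chi> x * Im (B x)) + 2 * pi\<^sup>2 * (1 - r\<^sup>2) * integral (Box N) ?\<chi>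
       - K * integral (Box N) (\<lambda>x. integral {0..2 * pi} (\<lambda>s. e (?z x s)))) (Box N)"
      by (intro has_integral_add has_integral_diff has_integral_mult_right 1 2 3)
    then show "((\<lambda>x. ?\<chi> x * (2 * pi * (1 - r\<^sup>2) * (Im (B x) / r + pi)) - K * integral {0..2 * pi} (\<lambda>s. e (?z x s))) has_integral
      2 * pi * (1 - r\<^sup>2) / r * integral (Box N) (\<lambda>x. ?\<chi> x * Im (B x)) + 2 * pi\<^sup>2 * (1 - r\<^sup>2) * integral (Box N) ?\<chi>
       - K * integral (Box N) (\<lambda>x. integral {0..2 * pi} (\<lambda>s. e (?z x s)))) (Box N)"
      by (rule has_integral_eq[rotated]) (use r0 in \<open>simp add: field_simps power2_eq_square\<close>)
  qed
  moreover have "- (2 * pi * (r / l) * integral (Box N) (\<lambda>x. cmod (f x))) \<le> integral (Box N) (\<lambda>x. ?\<chi> x * Im (B x))"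
  proof -
    have "cmod (integral (Box N) (\<lambda>x. ?\<chi> x *\<^sub>R B x)) \<le> 2 * pi * (r / l) * integral (Box N) (\<lambda>x. cmod (f x))"
      unfolding B_def using r r0 l N
      by (intro cutoff_circle_bound[OF contf f_supp]) auto
    moreover have "integral (Box N) (\<lambda>x. ?\<chi> x * Im (B x)) = Im (integral (Box N) (\<lambda>x. ?\<chi> x *\<^sub>R B x))"
    proof (rule integral_unique)
      have "((\<lambda>x. Im (?\<chi> x *\<^sub>R B x)) has_integral Im (integral (Box N) (\<lambda>x. ?\<chi> x *\<^sub>R B x))) (Box N)"
        by (intro has_integral_Im integrable_integral integrable_continuous continuous_intros) auto
      then show "((\<lambda>x. ?\<chi> x * Im (B x)) has_integral Im (integral (Box N) (\<lambda>x. ?\<chi> x *\<^sub>R B x))) (Box N)" by simp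
    qed
    ultimately show ?thesis
      using abs_Im_le_cmod[of "integral (Box N) (\<lambda>x. ?\<chi> x *\<^sub>R B x)"] by linarith
  qed
  then have "2 * pi * (1 - r\<^sup>2) / r * - (2 * pi * (r / l) * integral (Box N) (\<lambda>x. cmod (f x)))
     \<le> 2 * pi * (1 - r\<^sup>2) / r * integral (Box N) (\<lambda>x. ?\<chi> x * Im (B x))"
    using r0 r2 by (intro mult_left_mono) auto
  moreover have "K * integral (Box N) (\<lambda>x. integral {0..2 * pi} (\<lambda>s. e (?z x s))) \<le> K * (8 * pi * energy)"
  proof (intro mult_left_mono K)
    have "integral (Box N) (\<lambda>x. integral {0..2 * pi} (\<lambda>s. e (?z x s))) = integral {0..2 * pi} (\<lambda>s. integral (Box N) (\<lambda>x. e (?z x s)))"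
      unfolding cbox_interval[symmetric]
      by (intro integral_swap_continuous) (auto intro!: continuous_intros continuous_on_compose2[OF conte] simp: split_beta)
    also have "\<dots> = integral {0..2 * pi} (\<lambda>s. integral (Box N) e)"
    proof (rule integral_cong)
      fix s
      show "integral (Box N) (\<lambda>x. e (?z x s)) = integral (Box N) e"
        using e_supp r r0 N by (intro integral_Box_translate[where M = "2 * L"]) (auto simp: norm_mult)
    qed
    also have "\<dots> = 2 * pi * integral (Box N) e" by simp
    also have "\<dots> \<le> 2 * pi * (4 * energy)"
      using N L by (intro mult_left_mono int_e) auto
    finally show "integral (Box N) (\<lambda>x. integral {0..2 * pi} (\<lambda>s. e (?z x s))) \<le> 8 * pi * energy" by simp
  qed
  moreover have "K * (8 * pi * energy) = 128 * pi ^ 3 * energy / ((1 - c)\<^sup>2 * sqrt b * r)"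
    by (simp add: K_def power3_eq_cube power2_eq_square)
  moreover have "2 * pi * (1 - r\<^sup>2) / r * - (2 * pi * (r / l) * integral (Box N) (\<lambda>x. cmod (f x))) =
     2 * pi\<^sup>2 * (1 - r\<^sup>2) * (- (2 / l) * integral (Box N) (\<lambda>x. cmod (f x)))"
    using r0 by (simp add: power2_eq_square)
  moreover have "2 * pi\<^sup>2 * (1 - r\<^sup>2) * (integral (Box N) ?\<chi> - 2 / l * integral (Box N) (\<lambda>x. cmod (f x)))
    = 2 * pi\<^sup>2 * (1 - r\<^sup>2) * integral (Box N) ?\<chi> + 2 * pi\<^sup>2 * (1 - r\<^sup>2) * (- (2 / l) * integral (Box N) (\<lambda>x. cmod (f x)))"
    by (simp add: right_diff_distrib)
  ultimately show ?thesis by linarith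
qed

text \<open>Divide the bound at radius r by r and integrate. The main term yields ln (r1 / r0), the
  exceptional circles at most a multiple of 1 / r0, and \<open>circle_coefficient_bound\<close> caps
  the total by the squared norm of f, hence by the energy.\<close>

theorem smooth_lower_bound:
  assumes r: "sqrt b \<le> r0" "r0 \<le> r1" "r1 \<le> 1" and l: "0 < l" "0 \<le> L - 4 - 2 * l" and \<mu>: "\<mu> > 0"
  shows "(1 - r1\<^sup>2) * ln (r1 / r0) * ((L - 4 - 2 * l) ^ 3 - (\<mu> * L ^ 3 + energy / (b * c) / \<mu>) / l)
    \<le> energy * (1 / (b * c) + 64 * pi / ((1 - c)\<^sup>2 * sqrt b * r0))"
proof -
  \<comment> \<open>2 L bounds the Euclidean radius of the support of f, and 1 the radius of the
    circles.\<close>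
  define N where "N = 2 * L + 1"
  define X where "X = (L - 4 - 2 * l) ^ 3 - (\<mu> * L ^ 3 + energy / (b * c) / \<mu>) / l"
  have r0: "r0 > 0" using b r(1) by (meson less_le_trans real_sqrt_gt_zero)
  have rhs: "0 \<le> energy * (1 / (b * c) + 64 * pi / ((1 - c)\<^sup>2 * sqrt b * r0))"
    using b c r0 energy_nonneg by (intro mult_nonneg_nonneg add_nonneg_nonneg) auto
  have r12: "0 \<le> 1 - r1\<^sup>2" using r r0 by (auto simp: power_le_one)
  have ln0: "0 \<le> ln (r1 / r0)" using r r0 by simp
  show ?thesis
  \<comment> \<open>For negative \<open>X\<close> the left side is nonpositive. For the other sign,
    1 - r^2 can be replaced by its smallest value 1 - r1^2.\<close>
  proof (cases "X \<ge> 0")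
    case False
    then have "(1 - r1\<^sup>2) * ln (r1 / r0) * X \<le> 0"
      using r12 ln0 by (intro mult_nonneg_nonpos) auto
    then show ?thesis using rhs unfolding X_def by linarith
  next
    case True
    define \<phi> where "\<phi> = (\<lambda>r. integral (Box N) (\<lambda>x. (cmod (integral {0..2 * pi} (\<lambda>s. cis (- s) * f (x + hz (complex_of_real r * cis s)))))\<^sup>2))"
    define Q where "Q = 128 * pi ^ 3 * energy / ((1 - c)\<^sup>2 * sqrt b)"
    have Q: "Q \<ge> 0" using b energy_nonneg by (simp add: Q_def)
    have cont\<phi>: "continuous_on UNIV \<phi>"
      unfolding \<phi>_def cbox_interval[symmetric]
      by (intro integral_continuous_on_param; (intro continuous_intros)?; (unfold split_beta)?;
        intro continuous_intros integral_continuous_on_param) (auto simp: split_beta intro!: continuous_intros)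
    have XX: "X \<le> integral (Box N) (cutoff (L / 2 - 2) l) - 2 / l * integral (Box N) (\<lambda>x. cmod (f x))"
    proof -
      have "(L - 4 - 2 * l) ^ 3 = (2 * ((L / 2 - 2) - l)) ^ 3" by (simp add: algebra_simps)
      also have "\<dots> \<le> integral (Box N) (cutoff (L / 2 - 2) l)"
        using l L by (intro integral_cutoff_ge) (auto simp: N_def)
      finally have 1: "(L - 4 - 2 * l) ^ 3 \<le> integral (Box N) (cutoff (L / 2 - 2) l)" .
      have "2 / l * integral (Box N) (\<lambda>x. cmod (f x)) \<le> 2 / l * ((\<mu> * L ^ 3 + energy / (b * c) / \<mu>) / 2)"
        using l L \<mu> by (intro mult_left_mono int_f) (auto simp: N_def)
      also have "2 / l * (z / 2) = z / l" for z by simp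
      finally show ?thesis using 1 unfolding X_def by linarith
    qed
    have pt: "2 * pi\<^sup>2 * (1 - r1\<^sup>2) * X * (1 / r) - Q * (1 / r\<^sup>2) \<le> 1 / r * \<phi> r" if "r \<in> {r0..r1}" for r
    proof -
      have r': "sqrt b \<le> r" "r \<le> 1" "r > 0" using that r r0 by auto
      have "2 * pi\<^sup>2 * (1 - r1\<^sup>2) * X \<le> 2 * pi\<^sup>2 * (1 - r\<^sup>2) *
          (integral (Box N) (cutoff (L / 2 - 2) l) - 2 / l * integral (Box N) (\<lambda>x. cmod (f x)))"
        using that r' r12 True XX r
        by (intro mult_mono) (auto intro!: power_mono simp: power_le_one)
      also have "\<dots> \<le> \<phi> r + Q / r"
        using fixed_radius_bound[OF r'(1,2) l(1) N_def] unfolding \<phi>_def Q_def by (simp add: field_simps)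
      finally have "1 / r * (2 * pi\<^sup>2 * (1 - r1\<^sup>2) * X) \<le> 1 / r * (\<phi> r + Q / r)"
        using r' by (intro mult_left_mono) auto
      also have "\<dots> = 1 / r * \<phi> r + Q * (1 / r\<^sup>2)" by (simp add: distrib_left power2_eq_square)
      finally show ?thesis by (simp add: mult.commute)
    qed
    have "((\<lambda>r. 1 / r) has_integral ln r1 - ln r0) {r0..r1}"
      using r r0 by (intro fundamental_theorem_of_calculus)
        (auto simp: has_real_derivative_iff_has_vector_derivative[symmetric] intro!: derivative_eq_intros)
    moreover have "((\<lambda>r. 1 / r\<^sup>2) has_integral (- 1 / r1) - (- 1 / r0)) {r0..r1}"
      using r r0 by (intro fundamental_theorem_of_calculus)
        (auto simp: has_real_derivative_iff_has_vector_derivative[symmetric] power2_eq_square intro!: derivative_eq_intros)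
    ultimately have "((\<lambda>r. 2 * pi\<^sup>2 * (1 - r1\<^sup>2) * X * (1 / r) - Q * (1 / r\<^sup>2)) has_integral
      2 * pi\<^sup>2 * (1 - r1\<^sup>2) * X * (ln r1 - ln r0) - Q * ((- 1 / r1) - (- 1 / r0))) {r0..r1}"
      by (intro has_integral_diff has_integral_mult_right)
    moreover have "((\<lambda>r. 1 / r * \<phi> r) has_integral integral {r0..r1} (\<lambda>r. 1 / r * \<phi> r)) {r0..r1}"
      using r0 by (intro integrable_integral integrable_continuous_real continuous_intros continuous_on_subset[OF cont\<phi>]) auto
    ultimately have "2 * pi\<^sup>2 * (1 - r1\<^sup>2) * X * (ln r1 - ln r0) - Q * ((- 1 / r1) - (- 1 / r0)) \<le> integral {r0..r1} (\<lambda>r. 1 / r * \<phi> r)"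
      by (rule has_integral_le) (rule pt)
    also have "\<dots> \<le> 2 * pi\<^sup>2 * integral (Box N) (\<lambda>x. (cmod (f x))\<^sup>2)"
      unfolding \<phi>_def using r r0 by (intro circle_coefficient_bound[OF contf f_supp]) (auto simp: N_def)
    also have "\<dots> \<le> 2 * pi\<^sup>2 * (energy / (b * c))"
      using L by (intro mult_left_mono int_f_sq) (auto simp: N_def)
    finally have "2 * pi\<^sup>2 * (1 - r1\<^sup>2) * X * (ln r1 - ln r0) - Q * (1 / r0 - 1 / r1) \<le> 2 * pi\<^sup>2 * (energy / (b * c))"
      by simp
    moreover have "Q * (1 / r0 - 1 / r1) \<le> Q * (1 / r0)"
      using Q r r0 by (intro mult_left_mono) auto
    moreover have "ln r1 - ln r0 = ln (r1 / r0)" using r r0 by (simp add: ln_div)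
    moreover have "Q * (1 / r0) = 2 * pi\<^sup>2 * (energy * (64 * pi / ((1 - c)\<^sup>2 * sqrt b * r0)))"
      by (simp add: Q_def power2_eq_square power3_eq_cube)
    ultimately have "2 * pi\<^sup>2 * ((1 - r1\<^sup>2) * ln (r1 / r0) * X) \<le>
        2 * pi\<^sup>2 * (energy * (1 / (b * c) + 64 * pi / ((1 - c)\<^sup>2 * sqrt b * r0)))"
      by (simp add: distrib_left mult_ac)
    then show ?thesis unfolding X_def by (rule mult_left_le_imp_le) simp
  qed
qed

end

section \<open>Mollification\<close>

lemma pderiv3_eq: "(f has_derivative f') (at x) \<Longrightarrow> pderiv3 j f x = f' (axis j 1)"
  unfolding pderiv3_def using frechet_derivative_at by fastforce

lemma Ck_Suc_imp: "Ck (Suc k) f \<Longrightarrow> Ck k f"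
  by (induction k arbitrary: f) auto

lemma differentiable_on_UNIV_D:
  "f differentiable_on UNIV \<Longrightarrow> (f has_derivative frechet_derivative f (at x)) (at x)"
  by (simp add: differentiable_on_def frechet_derivative_works)

lemma Ck_add: "Ck k f \<Longrightarrow> Ck k g \<Longrightarrow> Ck k (\<lambda>x. f x + g x)"
proof (induction k arbitrary: f g)
  case (Suc k)
  then have d: "f differentiable_on UNIV" "g differentiable_on UNIV" by auto
  have "pderiv3 j (\<lambda>x. f x + g x) = (\<lambda>x. pderiv3 j f x + pderiv3 j g x)" for j
    by (rule ext, subst pderiv3_eq[OF has_derivative_add[OF differentiable_on_UNIV_D[OF d(1)]
          differentiable_on_UNIV_D[OF d(2)]]]) (simp add: pderiv3_def)
  moreover have "(\<lambda>x. f x + g x) differentiable_on UNIV" using d by simp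
  ultimately show ?case using Suc by (auto intro!: continuous_intros)
qed (auto intro!: continuous_intros)

lemma Ck_mult: "Ck k f \<Longrightarrow> Ck k g \<Longrightarrow> Ck k (\<lambda>x. f x * g x)"
proof (induction k arbitrary: f g)
  case (Suc k)
  then have d: "f differentiable_on UNIV" "g differentiable_on UNIV" by auto
  have "pderiv3 j (\<lambda>x. f x * g x) = (\<lambda>x. f x * pderiv3 j g x + pderiv3 j f x * g x)" for j
    by (rule ext, subst pderiv3_eq[OF has_derivative_mult[OF differentiable_on_UNIV_D[OF d(1)]
          differentiable_on_UNIV_D[OF d(2)]]]) (simp add: pderiv3_def)
  moreover have "(\<lambda>x. f x * g x) differentiable_on UNIV" using d by simp
  moreover have "Ck k f" "Ck k g" using Suc.prems by (auto intro: Ck_Suc_imp simp del: Ck.simps)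
  ultimately show ?case using Suc by (auto intro!: continuous_intros Ck_add)
qed (auto intro!: continuous_intros)

lemma Ck_const: "Ck k (\<lambda>x. c)"
proof (induction k arbitrary: c)
  case (Suc k)
  have "pderiv3 j (\<lambda>x. c) = (\<lambda>x. 0)" for j
    using pderiv3_eq[OF has_derivative_const] by (auto simp: fun_eq_iff)
  then show ?case using Suc by auto
qed auto

lemma Ck_prod: "finite I \<Longrightarrow> (\<And>i. i \<in> I \<Longrightarrow> Ck k (f i)) \<Longrightarrow> Ck k (\<lambda>x. \<Prod>i\<in>I. f i x)"
  by (induction I rule: finite_induct) (auto intro: Ck_const Ck_mult)

text \<open>The hypothesis is a whole sequence of successive derivatives because each partial
  derivative taken in the induction is a multiple of the next member.\<close>

lemma Ck_coordinate:
  fixes F :: "nat \<Rightarrow> real \<Rightarrow> real"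
  assumes F: "\<And>n t. (F n has_real_derivative F (Suc n) t) (at t)"
  shows "Ck k (\<lambda>x. F n (a * x $ i + c))"
proof (induction k arbitrary: n)
  have D: "((\<lambda>x. F n (a * x $ i + c)) has_derivative (\<lambda>h. F (Suc n) (a * x $ i + c) * (a * h $ i))) (at x)" for n x
  proof -
    have "((\<lambda>x::real^3. a * x $ i + c) has_derivative (\<lambda>h. a * h $ i)) (at x)"
      by (auto intro!: derivative_eq_intros bounded_linear_imp_has_derivative[OF bounded_linear_vec_nth])
    from has_derivative_compose[OF this F[of n "a * x $ i + c", unfolded has_field_derivative_def]]
    show ?thesis by simp
  qed
  have cont: "continuous_on UNIV (\<lambda>x. F n (a * x $ i + c))" for n
    using D by (meson continuous_at_imp_continuous_on has_derivative_continuous)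
  {
    case 0
    then show ?case using cont by simp
  next
    case (Suc k)
    have "pderiv3 j (\<lambda>x. F n (a * x $ i + c)) = (\<lambda>x. (a * axis j 1 $ i) * F (Suc n) (a * x $ i + c))" for j
      using pderiv3_eq[OF D] by (auto simp: fun_eq_iff)
    moreover have "(\<lambda>x. F n (a * x $ i + c)) differentiable_on UNIV"
      using D unfolding differentiable_on_def differentiable_def by blast
    ultimately show ?case using cont Suc by (auto intro!: Ck_mult Ck_const)
  }
qed

text \<open>The functions p (1 / t) exp (- 1 / t) are closed under differentiation, p becoming X^2
  (p - p'). Carrying the polynomial along reaches derivatives of every order by one
  induction.\<close>

definition flat :: "real poly \<Rightarrow> real \<Rightarrow> real" where
  "flat p t = (if t > 0 then poly p (1 / t) * exp (- (1 / t)) else 0)"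

lemma poly_times_exp_minus_tendsto_0: "((\<lambda>s::real. poly p s * exp (- s)) \<longlongrightarrow> 0) at_top"
proof (induction p)
  case (pCons a p)
  have "((\<lambda>s::real. poly q s * s ^ k * exp (- s)) \<longlongrightarrow> 0) at_top" for q :: "real poly" and k
  proof (induction q arbitrary: k)
    case (pCons a q)
    have "((\<lambda>s::real. a * (s ^ k / exp s) + poly q s * s ^ Suc k * exp (- s)) \<longlongrightarrow> a * 0 + 0) at_top"
      by (intro tendsto_intros tendsto_power_div_exp_0 pCons.IH)
    then show ?case by (simp add: algebra_simps exp_minus divide_inverse)
  qed simp
  from this[of "pCons a p" 0] show ?case by simp
qed simp

lemma flat_has_derivative: "(flat p has_real_derivative flat ([:0, 0, 1:] * (p - pderiv p)) t) (at t)"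
proof -
  consider "t > 0" | "t < 0" | "t = 0" by linarith
  then show ?thesis
  proof cases
    case 1
    have "((\<lambda>t. poly p (1 / t) * exp (- (1 / t))) has_real_derivative
       poly ([:0, 0, 1:] * (p - pderiv p)) (1 / t) * exp (- (1 / t))) (at t)"
      using 1 by (auto intro!: derivative_eq_intros DERIV_chain2[OF poly_DERIV]
        simp: field_simps power2_eq_square)
    then have "(flat p has_real_derivative poly ([:0, 0, 1:] * (p - pderiv p)) (1 / t) * exp (- (1 / t))) (at t)"
      by (rule has_field_derivative_transform_within_open[where S = "{0<..}"]) (use 1 in \<open>auto simp: flat_def\<close>)
    then show ?thesis using 1 by (simp add: flat_def)
  next
    case 2
    have "((\<lambda>x::real. 0) has_real_derivative 0) (at t)"
      by (auto intro!: derivative_eq_intros)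
    then have "(flat p has_real_derivative 0) (at t)"
      by (rule has_field_derivative_transform_within_open[where S = "{..<0}"]) (use 2 in \<open>auto simp: flat_def\<close>)
    then show ?thesis using 2 by (simp add: flat_def)
  next
    case 3
    \<comment> \<open>The extra factor 1 / t of the difference quotient at 0 is absorbed into the
      polynomial as \<open>pCons 0 p\<close>.\<close>
    have "((\<lambda>t. poly (pCons 0 p) (1 / t) * exp (- (1 / t))) \<longlongrightarrow> 0) (at_right 0)"
      by (rule filterlim_compose[OF poly_times_exp_minus_tendsto_0])
        (simp add: divide_inverse filterlim_inverse_at_top_right)
    then have "((\<lambda>t. (flat p t - flat p 0) / (t - 0)) \<longlongrightarrow> 0) (at_right 0)"
      by (rule Lim_transform_eventually) (auto simp: eventually_at_right_less flat_def eventually_at_filter)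
    moreover have "((\<lambda>t. (flat p t - flat p 0) / (t - 0)) \<longlongrightarrow> 0) (at_left 0)"
      by (rule Lim_transform_eventually[OF tendsto_const]) (auto simp: flat_def eventually_at_filter)
    ultimately show ?thesis
      using 3 unfolding has_field_derivative_iff by (simp add: filterlim_split_at flat_def)
  qed
qed

lemma Ck_flat: "Ck k (\<lambda>x. flat p (a * x $ i + c))"
proof -
  define q where "q = (\<lambda>n. ((\<lambda>p. [:0, 0, 1:] * (p - pderiv p)) ^^ n) p)"
  have "Ck k (\<lambda>x. (\<lambda>n. flat (q n)) 0 (a * x $ i + c))"
    by (rule Ck_coordinate) (simp only: q_def funpow.simps o_def flat_has_derivative)
  then show ?thesis by (simp add: q_def)
qed

text \<open>The product form makes the support a cube of half-side h, which fits the geometry of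
  \<open>cubeQ\<close>.\<close>

definition bump :: "real \<Rightarrow> real^3 \<Rightarrow> real" where
  "bump h z = (\<Prod>i\<in>UNIV. flat 1 (h - z $ i) * flat 1 (h + z $ i))"

lemma flat1: "flat 1 t = (if t > 0 then exp (- (1 / t)) else 0)"
  by (simp add: flat_def)

lemma bump_nonneg: "0 \<le> bump h z"
  by (auto simp: bump_def flat1 intro!: prod_nonneg)

lemma bump_eq_0: "h \<le> infnorm z \<Longrightarrow> bump h z = 0"
proof -
  assume h: "h \<le> infnorm z"
  have "\<exists>i. h \<le> \<bar>z $ i\<bar>"
  proof (rule ccontr)
    assume "\<nexists>i. h \<le> \<bar>z $ i\<bar>"
    then have "\<bar>z $ i\<bar> < h" for i by (simp add: not_le)
    moreover have "{\<bar>z $ i\<bar> |i. i \<in> UNIV} = range (\<lambda>i. \<bar>z $ i\<bar>)" by auto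
    then have "infnorm z = Max (range (\<lambda>i. \<bar>z $ i\<bar>))"
      unfolding infnorm_cart by (simp add: cSup_eq_Max)
    moreover have "Max (range (\<lambda>i. \<bar>z $ i\<bar>)) \<in> range (\<lambda>i. \<bar>z $ i\<bar>)"
      by (rule Max_in) auto
    ultimately have "infnorm z < h" by auto
    then show False using h by simp
  qed
  then obtain i where "h \<le> \<bar>z $ i\<bar>" by blast
  then have "flat 1 (h - z $ i) * flat 1 (h + z $ i) = 0"
    by (auto simp: flat1 abs_le_iff)
  then show ?thesis unfolding bump_def by (intro prod_zero) auto
qed

lemma bump_minus: "bump h (- z) = bump h z"
  by (simp add: bump_def mult.commute)

lemma Ck_bump: "Ck k (\<lambda>z. bump h (z - x))"
proof -
  have "Ck k (\<lambda>z. flat 1 (-1 * z $ i + (h + x $ i)) * flat 1 (1 * z $ i + (h - x $ i)))" for i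
    by (intro Ck_mult Ck_flat)
  then show ?thesis
    unfolding bump_def by (intro Ck_prod) (auto simp: algebra_simps)
qed

lemma continuous_bump: "continuous_on UNIV (bump h)"
  using Ck_bump[of 0 h 0] by simp

lemma bump_pos: "h > 0 \<Longrightarrow> bump h 0 > 0"
  by (auto simp: bump_def flat1 intro!: prod_pos)

section \<open>Approximation of square integrable functions by continuous ones\<close>

lemma cmod_add_sq_le: "(cmod (x + y))\<^sup>2 \<le> 2 * (cmod x)\<^sup>2 + 2 * (cmod y)\<^sup>2"
proof -
  have "(cmod (x + y))\<^sup>2 \<le> (cmod x + cmod y)\<^sup>2"
    by (intro power_mono norm_triangle_ineq) auto
  also have "\<dots> \<le> 2 * (cmod x)\<^sup>2 + 2 * (cmod y)\<^sup>2"
    using zero_le_power2[of "cmod x - cmod y"] by (simp add: power2_eq_square algebra_simps)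
  finally show ?thesis .
qed

lemma nn_L2_triangle:
  assumes [measurable]: "f \<in> borel_measurable M" "g \<in> borel_measurable M" "h \<in> borel_measurable M"
  shows "(\<integral>\<^sup>+x. ennreal ((cmod (f x - h x))\<^sup>2) \<partial>M) \<le>
    2 * (\<integral>\<^sup>+x. ennreal ((cmod (f x - g x))\<^sup>2) \<partial>M) + 2 * (\<integral>\<^sup>+x. ennreal ((cmod (g x - h x))\<^sup>2) \<partial>M)"
proof -
  have "(\<integral>\<^sup>+x. ennreal ((cmod (f x - h x))\<^sup>2) \<partial>M) \<le>
      (\<integral>\<^sup>+x. 2 * ennreal ((cmod (f x - g x))\<^sup>2) + 2 * ennreal ((cmod (g x - h x))\<^sup>2) \<partial>M)"
  proof (rule nn_integral_mono)
    fix x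
    have "(cmod (f x - h x))\<^sup>2 \<le> 2 * (cmod (f x - g x))\<^sup>2 + 2 * (cmod (g x - h x))\<^sup>2"
      using cmod_add_sq_le[of "f x - g x" "g x - h x"] by simp
    then have "ennreal ((cmod (f x - h x))\<^sup>2) \<le> ennreal (2 * (cmod (f x - g x))\<^sup>2 + 2 * (cmod (g x - h x))\<^sup>2)"
      by (rule ennreal_leI)
    then show "ennreal ((cmod (f x - h x))\<^sup>2) \<le> 2 * ennreal ((cmod (f x - g x))\<^sup>2) + 2 * ennreal ((cmod (g x - h x))\<^sup>2)"
      by (simp add: ennreal_plus ennreal_mult)
  qed
  then show ?thesis by (simp add: nn_integral_add nn_integral_cmult)
qed

definition clamp :: "real \<Rightarrow> complex \<Rightarrow> complex" where
  "clamp M z = z /\<^sub>R max 1 (cmod z / M)"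

lemma continuous_clamp: "M > 0 \<Longrightarrow> continuous_on S (clamp M)"
  unfolding clamp_def by (intro continuous_intros) auto

lemma clamp_eq: "M > 0 \<Longrightarrow> cmod z \<le> M \<Longrightarrow> clamp M z = z"
  by (simp add: clamp_def max_def field_simps)

lemma norm_clamp: "M > 0 \<Longrightarrow> cmod (clamp M z) \<le> M"
  by (auto simp: clamp_def max_def field_simps)

lemma norm_diff_clamp: "M > 0 \<Longrightarrow> cmod (z - clamp M z) \<le> cmod z"
proof -
  assume "M > 0"
  define t where "t = max 1 (cmod z / M)"
  have t: "t \<ge> 1" by (simp add: t_def)
  have "z - clamp M z = (1 - 1 / t) *\<^sub>R z"
    by (simp only: clamp_def t_def[symmetric]) (simp add: scaleR_diff_left divide_inverse)
  then have "cmod (z - clamp M z) = (1 - 1 / t) * cmod z" using t by simp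
  also have "\<dots> \<le> 1 * cmod z" using t by (intro mult_right_mono) auto
  finally show ?thesis by simp
qed

text \<open>Measurability gives continuous functions that converge almost everywhere, but without
  domination. \<open>clamp\<close> supplies it: dominated convergence is applied first as the
  truncation level grows, then along the approximating sequence at a fixed level, where the finite
  measure of S makes the constant bound integrable.\<close>

lemma L2_continuous_approx:
  assumes S: "S \<in> sets lebesgue" "emeasure lebesgue S < \<infinity>" and v: "L2_on S v" and \<kappa>: "\<kappa> > 0"
  obtains g where "continuous_on UNIV g"
    "(\<integral>\<^sup>+x. ennreal ((cmod (v x - g x))\<^sup>2) \<partial>lebesgue_on S) < ennreal \<kappa>"
proof -
  let ?M = "lebesgue_on S"
  have v_m[measurable]: "v \<in> borel_measurable ?M" using v by (simp add: L2_on_def)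
  have v_fin: "(\<integral>\<^sup>+x. ennreal ((cmod (v x))\<^sup>2) \<partial>?M) < \<infinity>"
    using v unfolding L2_on_def integrable_iff_bounded by auto
  obtain N g where N: "negligible N" and g: "\<And>n::nat. continuous_on UNIV (g n)"
    and lim: "\<And>x. x \<notin> N \<Longrightarrow> (\<lambda>n. g n x) \<longlonglongrightarrow> (if x \<in> S then v x else 0)"
    using v_m measurable_on_iff_borel_measurable[OF S(1)] unfolding measurable_on_def by blast
  have g_m[measurable]: "g n \<in> borel_measurable ?M" for n
    by (intro measurable_restrict_space1 borel_measurable_continuous_onI[THEN measurable_completion] g)
      (use borel_measurable_continuous_onI[OF g] in \<open>auto intro: measurable_completion\<close>)
  have clamp_m[measurable]: "clamp M \<in> borel_measurable borel" if "M > 0" for M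
    using that by (intro borel_measurable_continuous_onI continuous_clamp)
  have "(\<lambda>n. \<integral>\<^sup>+x. ennreal ((cmod (v x - clamp (Suc n) (v x)))\<^sup>2) \<partial>?M) \<longlonglongrightarrow> (\<integral>\<^sup>+x. 0 \<partial>?M)"
  proof (rule nn_integral_dominated_convergence[where w = "\<lambda>x. ennreal ((cmod (v x))\<^sup>2)"])
    show "AE x in ?M. ennreal ((cmod (v x - clamp (Suc n) (v x)))\<^sup>2) \<le> ennreal ((cmod (v x))\<^sup>2)" for n
      by (intro AE_I2 ennreal_leI power_mono norm_diff_clamp) auto
    show "AE x in ?M. (\<lambda>n. ennreal ((cmod (v x - clamp (Suc n) (v x)))\<^sup>2)) \<longlonglongrightarrow> 0"
    proof (rule AE_I2)
      fix x
      obtain m :: nat where m: "cmod (v x) \<le> m" using real_arch_simple by blast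
      have "\<forall>\<^sub>F n in sequentially. ennreal ((cmod (v x - clamp (Suc n) (v x)))\<^sup>2) = 0"
        using eventually_ge_at_top[of m] by eventually_elim (use m in \<open>simp add: clamp_eq\<close>)
      then show "(\<lambda>n. ennreal ((cmod (v x - clamp (Suc n) (v x)))\<^sup>2)) \<longlonglongrightarrow> 0"
        by (rule tendsto_eventually)
    qed
  qed (use v_fin in \<open>auto simp: less_top\<close>)
  then have "\<forall>\<^sub>F n in sequentially. (\<integral>\<^sup>+x. ennreal ((cmod (v x - clamp (Suc n) (v x)))\<^sup>2) \<partial>?M) < ennreal (\<kappa> / 8)"
    by (rule order_tendstoD) (use \<kappa> in simp)
  then obtain n where n: "(\<integral>\<^sup>+x. ennreal ((cmod (v x - clamp (Suc n) (v x)))\<^sup>2) \<partial>?M) < ennreal (\<kappa> / 8)"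
    using eventually_sequentially by auto
  define M where "M = real (Suc n)"
  have M: "M > 0" by (simp add: M_def)
  have "(\<lambda>k. \<integral>\<^sup>+x. ennreal ((cmod (clamp M (v x) - clamp M (g k x)))\<^sup>2) \<partial>?M) \<longlonglongrightarrow> (\<integral>\<^sup>+x. 0 \<partial>?M)"
  proof (rule nn_integral_dominated_convergence[where w = "\<lambda>x. ennreal ((2 * M)\<^sup>2)"])
    show "AE x in ?M. ennreal ((cmod (clamp M (v x) - clamp M (g k x)))\<^sup>2) \<le> ennreal ((2 * M)\<^sup>2)" for k
    proof (intro AE_I2 ennreal_leI power_mono)
      fix x show "cmod (clamp M (v x) - clamp M (g k x)) \<le> 2 * M"
        using norm_triangle_ineq4[of "clamp M (v x)" "clamp M (g k x)"] norm_clamp[OF M, of "v x"] norm_clamp[OF M, of "g k x"]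
        by linarith
    qed auto
    have "AE x in lebesgue. x \<notin> N"
      unfolding eventually_ae_filter_negligible using N by auto
    then have "AE x in ?M. x \<notin> N \<and> x \<in> S"
      using S by (auto simp: AE_restrict_space_iff)
    then show "AE x in ?M. (\<lambda>k. ennreal ((cmod (clamp M (v x) - clamp M (g k x)))\<^sup>2)) \<longlonglongrightarrow> 0"
    proof eventually_elim
      case (elim x)
      then have "(\<lambda>k. g k x) \<longlonglongrightarrow> v x" using lim[of x] by simp
      then have "(\<lambda>k. clamp M (g k x)) \<longlonglongrightarrow> clamp M (v x)"
        using continuous_on_tendsto_compose[OF continuous_clamp[OF M, of UNIV]] by auto
      then have "(\<lambda>k. ennreal ((cmod (clamp M (v x) - clamp M (g k x)))\<^sup>2)) \<longlonglongrightarrow> ennreal ((cmod (clamp M (v x) - clamp M (v x)))\<^sup>2)"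
        by (intro tendsto_intros)
      then show ?case by simp
    qed
    show "(\<integral>\<^sup>+x. ennreal ((2 * M)\<^sup>2) \<partial>?M) < \<infinity>"
      using S by (simp add: emeasure_restrict_space ennreal_mult_less_top)
  qed (use M in auto)
  then have "\<forall>\<^sub>F k in sequentially. (\<integral>\<^sup>+x. ennreal ((cmod (clamp M (v x) - clamp M (g k x)))\<^sup>2) \<partial>?M) < ennreal (\<kappa> / 8)"
    by (rule order_tendstoD) (use \<kappa> in simp)
  then obtain k where k: "(\<integral>\<^sup>+x. ennreal ((cmod (clamp M (v x) - clamp M (g k x)))\<^sup>2) \<partial>?M) < ennreal (\<kappa> / 8)"
    using eventually_sequentially by auto
  show ?thesis
  proof
    show "continuous_on UNIV (\<lambda>x. clamp M (g k x))"
      using continuous_on_compose2[OF continuous_clamp[OF M, of UNIV] g[of k]] by simp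
    have "(\<integral>\<^sup>+x. ennreal ((cmod (v x - clamp M (g k x)))\<^sup>2) \<partial>?M) \<le>
      2 * (\<integral>\<^sup>+x. ennreal ((cmod (v x - clamp M (v x)))\<^sup>2) \<partial>?M) + 2 * (\<integral>\<^sup>+x. ennreal ((cmod (clamp M (v x) - clamp M (g k x)))\<^sup>2) \<partial>?M)"
      using M by (intro nn_L2_triangle) auto
    also have "\<dots> \<le> 2 * ennreal (\<kappa> / 8) + 2 * ennreal (\<kappa> / 8)"
      using n k unfolding M_def[symmetric]
      by (intro add_mono mult_left_mono less_imp_le) auto
    also have "2 * ennreal (\<kappa> / 8) = ennreal (\<kappa> / 4)"
      using ennreal_mult'[of 2 "\<kappa> / 8"] by simp
    also have "ennreal (\<kappa> / 4) + ennreal (\<kappa> / 4) = ennreal (\<kappa> / 2)"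
      using \<kappa> by (subst ennreal_plus[symmetric]) auto
    also have "\<dots> < ennreal \<kappa>" using \<kappa> by (intro ennreal_lessI) auto
    finally show "(\<integral>\<^sup>+x. ennreal ((cmod (v x - clamp M (g k x)))\<^sup>2) \<partial>?M) < ennreal \<kappa>" .
  qed
qed

section \<open>The normalised kernel and its derivative\<close>

definition mollk :: "real \<Rightarrow> real^3 \<Rightarrow> real" where
  "mollk h z = bump h z / (LINT z|lborel. bump h z)"

lemma infnorm_less_imp_norm: "infnorm (z :: real^3) \<le> h \<Longrightarrow> norm z \<le> 3 * h"
proof -
  assume "infnorm z \<le> h"
  then have "norm z \<le> (\<Sum>i\<in>(UNIV :: 3 set). h)"
    using component_le_infnorm_cart[of z]
    by (intro order_trans[OF norm_le_l1_cart] sum_mono) (meson order_trans)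
  then show ?thesis by (simp add: sum_3)
qed

lemma integrable_bump: "integrable lborel (bump h)"
proof -
  have "integrable lborel (\<lambda>z. indicator (Box h) z *\<^sub>R bump h z)"
    by (intro borel_integrable_compact continuous_on_subset[OF continuous_bump]) auto
  also have "(\<lambda>z. indicator (Box h) z *\<^sub>R bump h z) = bump h"
    by (auto simp: fun_eq_iff indicator_def infnorm_le_iff_Box[symmetric] bump_eq_0)
  finally show ?thesis .
qed

lemma integral_bump_pos: "h > 0 \<Longrightarrow> 0 < (LINT z|lborel. bump h z)"
proof -
  assume h: "h > 0"
  have "(LINT z|lborel. bump h z) \<noteq> 0"
  proof
    assume "(LINT z|lborel. bump h z) = 0"
    then have "AE z in lborel. bump h z = 0"
      using integral_nonneg_eq_0_iff_AE[OF integrable_bump] bump_nonneg by simp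
    then have "AE z in lebesgue. bump h z = 0" by (rule AE_completion)
    then have "negligible {z. bump h z \<noteq> 0}"
      unfolding eventually_ae_filter_negligible using negligible_subset by auto
    moreover have "open {z. bump h z \<noteq> 0}"
      by (intro open_Collect_neq continuous_bump continuous_on_const)
    moreover have "0 \<in> {z. bump h z \<noteq> 0}" using bump_pos[OF h] by simp
    ultimately show False using open_not_negligible by blast
  qed
  moreover have "0 \<le> (LINT z|lborel. bump h z)" by (simp add: bump_nonneg)
  ultimately show ?thesis by simp
qed

lemma mollk_nonneg: "0 \<le> mollk h z"
  by (simp add: mollk_def bump_nonneg)

lemma mollk_eq_0: "h \<le> infnorm z \<Longrightarrow> mollk h z = 0"
  by (simp add: mollk_def bump_eq_0)

lemma mollk_minus: "mollk h (z - x) = mollk h (x - z)"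
  using bump_minus[of h "x - z"] by (simp add: mollk_def)

lemma Ck_mollk: "Ck k (\<lambda>z. mollk h (z - x))"
  using Ck_mult[OF Ck_bump Ck_const] unfolding mollk_def divide_inverse .

lemma Ck_mollk0: "Ck k (mollk h)"
  using Ck_mollk[of k h 0] by simp

lemma continuous_mollk: "continuous_on UNIV (mollk h)"
  using Ck_mollk0[of 0] by simp

lemma mollk_measurable [measurable]: "mollk h \<in> borel_measurable borel"
  by (intro borel_measurable_continuous_onI continuous_mollk)

lemma nn_integral_mollk: "h > 0 \<Longrightarrow> (\<integral>\<^sup>+z. ennreal (mollk h (z - x)) \<partial>lebesgue) = 1"
proof -
  assume h: "h > 0"
  have "(\<integral>\<^sup>+z. ennreal (mollk h (z - x)) \<partial>lebesgue) = (\<integral>\<^sup>+z. ennreal (mollk h (z - x)) \<partial>lborel)"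
    by (rule nn_integral_completion)
  also have "\<dots> = (\<integral>\<^sup>+z. ennreal (mollk h (z - x)) \<partial>distr lborel borel ((+) x))"
    by (simp add: lborel_distr_plus)
  also have "\<dots> = (\<integral>\<^sup>+z. ennreal (mollk h z) \<partial>lborel)"
    by (subst nn_integral_distr) auto
  also have "\<dots> = ennreal (LINT z|lborel. mollk h z)"
    using integrable_bump by (intro nn_integral_eq_integral) (auto simp: mollk_def[abs_def] bump_nonneg)
  also have "(LINT z|lborel. mollk h z) = 1"
    using integral_bump_pos[OF h] by (simp add: mollk_def[abs_def])
  finally show ?thesis by simp
qed

lemma has_derivative_mollk:
  "(mollk h has_derivative (\<lambda>d. \<Sum>j\<in>UNIV. d $ j * pderiv3 j (mollk h) z)) (at z)"
proof -
  have "mollk h differentiable_on UNIV" using Ck_mollk0[of 1 h] by simp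
  then have D: "(mollk h has_derivative frechet_derivative (mollk h) (at z)) (at z)"
    by (rule differentiable_on_UNIV_D)
  interpret linear "frechet_derivative (mollk h) (at z)"
    by (rule has_derivative_linear[OF D])
  have "frechet_derivative (mollk h) (at z) = (\<lambda>d. \<Sum>j\<in>UNIV. d $ j * pderiv3 j (mollk h) z)"
  proof
    fix d :: "real^3"
    have "d = (\<Sum>j\<in>UNIV. d $ j *\<^sub>R axis j 1)"
      by (simp add: vec_eq_iff axis_def if_distrib cong: if_cong)
    then have "frechet_derivative (mollk h) (at z) d = (\<Sum>j\<in>UNIV. frechet_derivative (mollk h) (at z) (d $ j *\<^sub>R axis j 1))"
      by (metis (no_types, lifting) sum sum.cong)
    then show "frechet_derivative (mollk h) (at z) d = (\<Sum>j\<in>UNIV. d $ j * pderiv3 j (mollk h) z)"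
      by (simp add: scale pderiv3_def)
  qed
  then show ?thesis using D by simp
qed

lemma continuous_pderiv_mollk: "continuous_on UNIV (pderiv3 j (mollk h))"
  using Ck_mollk0[of 1 h] by simp

lemma pderiv_mollk_eq_0: "h < infnorm z \<Longrightarrow> pderiv3 j (mollk h) z = 0"
proof -
  assume h: "h < infnorm z"
  have "open {z :: real^3. h < infnorm z}"
    by (intro open_Collect_less continuous_intros)
  then have "((\<lambda>z. 0) has_derivative (\<lambda>d. \<Sum>j\<in>UNIV. d $ j * pderiv3 j (mollk h) z)) (at z)"
    using has_derivative_transform_within_open[OF has_derivative_mollk, of "{z. h < infnorm z}" z h "\<lambda>z. 0"] h
    by (auto simp: mollk_eq_0)
  from pderiv3_eq[OF this, of j] have "(\<Sum>i\<in>UNIV. axis j 1 $ i * pderiv3 i (mollk h) z) = 0"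
    using pderiv3_eq[OF has_derivative_const] by simp
  then show ?thesis by (simp add: axis_def if_distrib[of "\<lambda>x. x * _"] cong: if_cong)
qed

lemma compact_support_bounded:
  fixes f :: "real^3 \<Rightarrow> real"
  assumes f: "continuous_on UNIV f" and supp: "\<And>z. h < infnorm z \<Longrightarrow> f z = 0"
  obtains C where "C > 0" "\<And>z. \<bar>f z\<bar> \<le> C"
proof -
  have "compact (f ` Box h)"
    by (intro compact_continuous_image continuous_on_subset[OF f]) auto
  then obtain C where C: "C > 0" "\<And>z. z \<in> Box h \<Longrightarrow> \<bar>f z\<bar> \<le> C"
    using compact_imp_bounded[of "f ` Box h"] unfolding bounded_pos by auto
  moreover have "\<bar>f z\<bar> \<le> C" for z
    using C supp[of z] by (cases "z \<in> Box h") (auto simp: infnorm_le_iff_Box[symmetric])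
  ultimately show ?thesis using that by blast
qed

lemma compact_support_uniformly_continuous:
  fixes f :: "real^3 \<Rightarrow> real"
  assumes f: "continuous_on UNIV f" and supp: "\<And>z. h < infnorm z \<Longrightarrow> f z = 0" and e: "e > 0"
  obtains d where "d > 0" "\<And>z w. norm (z - w) < d \<Longrightarrow> \<bar>f z - f w\<bar> < e"
proof -
  have "uniformly_continuous_on (Box (h + 1)) f"
    by (intro compact_uniformly_continuous continuous_on_subset[OF f]) auto
  then obtain d where d: "d > 0" "\<And>z w. z \<in> Box (h + 1) \<Longrightarrow> w \<in> Box (h + 1) \<Longrightarrow> dist w z < d \<Longrightarrow> dist (f w) (f z) < e"
    using e unfolding uniformly_continuous_on_def by metis
  show ?thesis
  proof
    show "min d 1 > 0" using d by simp
    fix z w :: "real^3" assume zw: "norm (z - w) < min d 1"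
    have inf: "\<bar>infnorm z - infnorm w\<bar> < 1"
      using zw absdiff_infnorm[of z w] infnorm_le_norm[of "z - w"] by linarith
    then have "z \<in> Box (h + 1) \<and> w \<in> Box (h + 1) \<or> h < infnorm z \<and> h < infnorm w"
      unfolding infnorm_le_iff_Box[symmetric] by linarith
    then consider "z \<in> Box (h + 1)" "w \<in> Box (h + 1)" | "h < infnorm z" "h < infnorm w"
      by blast
    then show "\<bar>f z - f w\<bar> < e"
    proof cases
      case 1
      then show ?thesis using d(2)[of w z] zw by (simp add: dist_norm)
    next
      case 2
      then show ?thesis using supp e by simp
    qed
  qed
qed

text \<open>The gradient of the kernel vanishes outside a cube and is therefore uniformly
  continuous. A remainder that is uniform in z permits differentiation under the integral in
  \<open>moll_has_derivative\<close>.\<close>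

lemma mollk_uniformly_differentiable:
  assumes e: "e > 0"
  obtains d where "d > 0"
    "\<And>z w. norm w < d \<Longrightarrow> \<bar>mollk h (z + w) - mollk h z - (\<Sum>j\<in>UNIV. w $ j * pderiv3 j (mollk h) z)\<bar> \<le> e * norm w"
proof -
  have "\<exists>d>0. \<forall>z w. norm (z - w) < d \<longrightarrow> \<bar>pderiv3 j (mollk h) z - pderiv3 j (mollk h) w\<bar> < e / 3" for j
    by (rule compact_support_uniformly_continuous[OF continuous_pderiv_mollk[of j h] pderiv_mollk_eq_0[of h _ j], where e = "e / 3" and h = h])
      (assumption, use e in simp, blast)
  then obtain d where d: "\<And>j. d j > 0"
    "\<And>j z w. norm (z - w) < d j \<Longrightarrow> \<bar>pderiv3 j (mollk h) z - pderiv3 j (mollk h) w\<bar> < e / 3"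
    by metis
  define D where "D = Min (range d)"
  have D: "D > 0" "D \<le> d j" for j
    using d(1) by (auto simp: D_def)
  show ?thesis
  proof
    show "D > 0" by (rule D)
    fix z w :: "real^3" assume w: "norm w < D"
    let ?f' = "\<lambda>y d. \<Sum>j\<in>UNIV. d $ j * pderiv3 j (mollk h) y"
    have "norm (mollk h (z + w) - mollk h z - ?f' z (z + w - z)) \<le> norm (z + w - z) * e"
    proof (rule differentiable_bound_linearization[where S = "ball z D"])
      show "z + t *\<^sub>R (z + w - z) \<in> ball z D" if "t \<in> {0..1}" for t
      proof -
        have "norm (t *\<^sub>R w) \<le> 1 * norm w" using that unfolding norm_scaleR by (intro mult_right_mono) auto
        then show ?thesis using w by (simp add: dist_norm)
      qed
      show "(mollk h has_derivative ?f' y) (at y within ball z D)" for y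
        using has_derivative_mollk has_derivative_at_withinI by blast
      show "z \<in> ball z D" using D by simp
      fix y assume y: "y \<in> ball z D"
      show "onorm (?f' y - ?f' z) \<le> e"
      proof (rule onorm_le)
        fix v :: "real^3"
        have "norm ((?f' y - ?f' z) v) = \<bar>\<Sum>j\<in>UNIV. v $ j * (pderiv3 j (mollk h) y - pderiv3 j (mollk h) z)\<bar>"
          by (simp add: right_diff_distrib sum_subtractf)
        also have "\<dots> \<le> (\<Sum>j\<in>(UNIV :: 3 set). norm v * (e / 3))"
        proof (rule order_trans[OF sum_abs sum_mono])
          fix j
          have "norm (y - z) < d j" using y D(2)[of j] by (simp add: dist_norm norm_minus_commute)
          from d(2)[OF this] show "\<bar>v $ j * (pderiv3 j (mollk h) y - pderiv3 j (mollk h) z)\<bar> \<le> norm v * (e / 3)"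
            unfolding abs_mult by (intro mult_mono component_le_norm_cart) auto
        qed
        also have "\<dots> = e * norm v" by (simp add: sum_3)
        finally show "norm ((?f' y - ?f' z) v) \<le> e * norm v" .
      qed
    qed
    then show "\<bar>mollk h (z + w) - mollk h z - ?f' z w\<bar> \<le> e * norm w"
      by (simp add: mult.commute)
  qed
qed

text \<open>The integral runs over S only, so v counts as zero outside; away from the boundary of S
  this is the usual convolution.\<close>

definition moll :: "(real^3) set \<Rightarrow> real \<Rightarrow> (real^3 \<Rightarrow> complex) \<Rightarrow> real^3 \<Rightarrow> complex" where
  "moll S h v x = (LINT z|lebesgue_on S. complex_of_real (mollk h (z - x)) * v z)"

lemma continuous_borel_lebesgue_on:
  fixes f :: "real^3 \<Rightarrow> 'b::topological_space"
  shows "continuous_on UNIV f \<Longrightarrow> f \<in> borel_measurable (lebesgue_on S)"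
  by (intro measurable_restrict_space1 measurable_completion) (auto intro: borel_measurable_continuous_onI)

lemma integrable_bounded_mult:
  fixes f :: "real^3 \<Rightarrow> real" and v :: "real^3 \<Rightarrow> complex"
  assumes v: "integrable (lebesgue_on S) v" and f: "continuous_on UNIV f" and C: "\<And>z. \<bar>f z\<bar> \<le> C"
  shows "integrable (lebesgue_on S) (\<lambda>z. complex_of_real (f z) * v z)"
proof (rule Bochner_Integration.integrable_bound)
  show "integrable (lebesgue_on S) (\<lambda>z. C * cmod (v z))" using v by simp
  have "f \<in> borel_measurable (lebesgue_on S)" by (rule continuous_borel_lebesgue_on[OF f])
  then show "(\<lambda>z. complex_of_real (f z) * v z) \<in> borel_measurable (lebesgue_on S)"
    using v by (auto intro!: borel_measurable_times)
  show "AE z in lebesgue_on S. norm (complex_of_real (f z) * v z) \<le> norm (C * cmod (v z))"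
  proof (rule AE_I2)
    fix z
    have "0 \<le> C" using C[of 0] by linarith
    then show "norm (complex_of_real (f z) * v z) \<le> norm (C * cmod (v z))"
      using C[of z] by (simp add: norm_mult mult_right_mono)
  qed
qed

text \<open>The Taylor remainder of the kernel is at most e / (A + 1) times the increment,
  uniformly; integrated against |v|, whose integral is A, it stays below e times the increment. The
  minus sign comes from the kernel argument z - x.\<close>

lemma moll_has_derivative:
  assumes v: "integrable (lebesgue_on S) v"
  shows "(moll S h v has_derivative (\<lambda>d. \<Sum>j\<in>UNIV. d $ j *\<^sub>R
      - (LINT z|lebesgue_on S. complex_of_real (pderiv3 j (mollk h) (z - x)) * v z))) (at x)"
    (is "(_ has_derivative ?D) _")
proof -
  let ?M = "lebesgue_on S"
  let ?P = "\<lambda>j. pderiv3 j (mollk h)"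
  define A where "A = (LINT z|?M. cmod (v z))"
  have A: "A \<ge> 0" by (simp add: A_def)
  obtain C where C: "\<And>z. \<bar>mollk h z\<bar> \<le> C"
    by (rule compact_support_bounded[OF continuous_mollk, of h h]) (use mollk_eq_0 in auto)
  have "\<exists>C. \<forall>z. \<bar>?P j z\<bar> \<le> C" for j
    by (rule compact_support_bounded[OF continuous_pderiv_mollk[of j h] pderiv_mollk_eq_0[of h _ j]]) auto
  then obtain C' where C': "\<And>j z. \<bar>?P j z\<bar> \<le> C' j" by metis
  have int: "integrable ?M (\<lambda>z. complex_of_real (mollk h (z - y)) * v z)" for y
    using C by (intro integrable_bounded_mult v continuous_on_compose2[OF continuous_mollk] continuous_intros) auto
  have intP: "integrable ?M (\<lambda>z. complex_of_real (?P j (z - y)) * v z)" for y j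
    using C' by (intro integrable_bounded_mult v continuous_on_compose2[OF continuous_pderiv_mollk] continuous_intros) auto
  show ?thesis
    unfolding has_derivative_at_alt
  proof (intro conjI allI impI)
    show "bounded_linear ?D"
      by (intro bounded_linear_sum bounded_linear_compose[OF bounded_linear_scaleR_left bounded_linear_vec_nth])
    fix e :: real assume e: "0 < e"
    have e': "e / (A + 1) > 0" using e A by simp
    obtain d where d: "d > 0"
      "\<And>z w. norm w < d \<Longrightarrow> \<bar>mollk h (z + w) - mollk h z - (\<Sum>j\<in>UNIV. w $ j * ?P j z)\<bar> \<le> e / (A + 1) * norm w"
      by (rule mollk_uniformly_differentiable[OF e', of h]) blast
    have "norm (moll S h v y - moll S h v x - ?D (y - x)) \<le> e * norm (y - x)" if y: "norm (y - x) < d" for y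
    proof -
      let ?q = "\<lambda>z. mollk h (z - x + (x - y)) - mollk h (z - x) - (\<Sum>j\<in>UNIV. (x - y) $ j * ?P j (z - x))"
      have "?D (y - x) = (\<Sum>j\<in>UNIV. (x - y) $ j *\<^sub>R (LINT z|?M. complex_of_real (?P j (z - x)) * v z))"
        by (intro sum.cong) (auto simp: algebra_simps)
      also have "\<dots> = (LINT z|?M. (\<Sum>j\<in>UNIV. (x - y) $ j *\<^sub>R (complex_of_real (?P j (z - x)) * v z)))"
        using intP by (subst Bochner_Integration.integral_sum) auto
      finally have "moll S h v y - moll S h v x - ?D (y - x) =
        (LINT z|?M. complex_of_real (mollk h (z - y)) * v z - complex_of_real (mollk h (z - x)) * v z
          - (\<Sum>j\<in>UNIV. (x - y) $ j *\<^sub>R (complex_of_real (?P j (z - x)) * v z)))"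
        unfolding moll_def using int intP by simp
      also have "\<dots> = (LINT z|?M. complex_of_real (?q z) * v z)"
        by (intro Bochner_Integration.integral_cong)
          (auto simp: algebra_simps scaleR_conv_of_real sum_distrib_left sum_distrib_right)
      also have "norm \<dots> \<le> (LINT z|?M. e / (A + 1) * norm (y - x) * cmod (v z))"
      proof (rule Bochner_Integration.integral_norm_bound_integral)
        show "integrable ?M (\<lambda>z. complex_of_real (?q z) * v z)"
        proof (rule integrable_bounded_mult[OF v])
          show "continuous_on UNIV ?q"
            by (intro continuous_intros continuous_on_compose2[OF continuous_mollk]
                continuous_on_compose2[OF continuous_pderiv_mollk]) auto
          show "\<bar>?q z\<bar> \<le> e / (A + 1) * norm (x - y)" for z
            using d(2)[of "x - y" "z - x"] y by (simp add: norm_minus_commute)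
        qed
        show "norm (complex_of_real (?q z) * v z) \<le> e / (A + 1) * norm (y - x) * cmod (v z)" for z
          unfolding norm_mult norm_of_real
          using d(2)[of "x - y" "z - x"] y by (intro mult_right_mono) (simp_all add: norm_minus_commute)
      qed (use v in simp)
      also have "\<dots> = e / (A + 1) * norm (y - x) * A" using v by (simp add: A_def)
      also have "\<dots> = e * norm (y - x) * (A / (A + 1))" by simp
      also have "\<dots> \<le> e * norm (y - x) * 1"
        using e A by (intro mult_left_mono) auto
      finally show ?thesis by simp
    qed
    then show "\<exists>d>0. \<forall>y. norm (y - x) < d \<longrightarrow> norm (moll S h v y - moll S h v x - ?D (y - x)) \<le> e * norm (y - x)"
      using d(1) by blast
  qed
qed

lemma continuous_moll: "integrable (lebesgue_on S) v \<Longrightarrow> continuous_on UNIV (moll S h v)"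
  using moll_has_derivative by (meson continuous_at_imp_continuous_on has_derivative_continuous)

section \<open>Convergence of mollifications on a slightly smaller cube\<close>

lemma cubeQ_eq_box: "cubeQ R = box (vec (- R / 2)) (vec (R / 2))"
  by (auto simp: cubeQ_def mem_box_cart)

lemma cubeQ_lebesgue: "cubeQ R \<in> sets lebesgue"
  by (simp add: cubeQ_eq_box)

lemma emeasure_cubeQ_finite: "emeasure lebesgue (cubeQ R) < \<infinity>"
  using emeasure_lborel_box_finite[of "vec (- R / 2)" "vec (R / 2) :: real^3"]
  by (simp add: cubeQ_eq_box less_top)

lemma finite_measure_cubeQ: "finite_measure (lebesgue_on (cubeQ R))"
  using emeasure_cubeQ_finite[of R] cubeQ_lebesgue[of R]
  by (intro finite_measureI) (simp add: emeasure_restrict_space)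

lemma cubeQ_margin: "x \<in> cubeQ (R - 1) \<Longrightarrow> infnorm (z - x) \<le> h \<Longrightarrow> h < 1 / 2 \<Longrightarrow> z \<in> cubeQ R"
proof -
  assume x: "x \<in> cubeQ (R - 1)" and z: "infnorm (z - x) \<le> h" "h < 1 / 2"
  show ?thesis unfolding cubeQ_def mem_Collect_eq
  proof
    fix i
    have "\<bar>z $ i - x $ i\<bar> < 1 / 2"
      using component_le_infnorm_cart[of "z - x" i] z by simp
    then have "z $ i - x $ i < 1 / 2" "- (z $ i - x $ i) < 1 / 2"
      unfolding abs_less_iff by blast+
    moreover have "- (R - 1) / 2 < x $ i" "x $ i < (R - 1) / 2"
      using x by (auto simp: cubeQ_def)
    ultimately show "- R / 2 < z $ i \<and> z $ i < R / 2"
      by (simp add: field_simps)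
  qed
qed

lemma cubeQ_mono: "R \<le> R' \<Longrightarrow> cubeQ R \<subseteq> cubeQ R'"
  unfolding cubeQ_def by (auto intro: order.strict_trans1 order.strict_trans2)
    (smt (verit) divide_right_mono)+

lemma nn_integral_lebesgue_on_mono:
  assumes "S \<subseteq> T" "S \<in> sets lebesgue" "T \<in> sets lebesgue"
  shows "(\<integral>\<^sup>+x. f x \<partial>lebesgue_on S) \<le> (\<integral>\<^sup>+x. f x \<partial>lebesgue_on T)"
  using assms by (auto simp: nn_integral_restrict_space indicator_def intro!: nn_integral_mono)

lemma L2_on_integrable:
  assumes v: "L2_on (cubeQ R) v"
  shows "integrable (lebesgue_on (cubeQ R)) v"
proof -
  interpret finite_measure "lebesgue_on (cubeQ R)" by (rule finite_measure_cubeQ)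
  show ?thesis
  proof (rule Bochner_Integration.integrable_bound)
    show "integrable (lebesgue_on (cubeQ R)) (\<lambda>x. 1 + (cmod (v x))\<^sup>2)"
      using v by (auto simp: L2_on_def)
    show "AE x in lebesgue_on (cubeQ R). norm (v x) \<le> norm (1 + (cmod (v x))\<^sup>2)"
    proof (rule AE_I2)
      fix x
      have "0 \<le> (1 - cmod (v x))\<^sup>2" by simp
      then have "2 * cmod (v x) \<le> 1 + (cmod (v x))\<^sup>2" by (simp add: power2_eq_square algebra_simps)
      then have "cmod (v x) \<le> 1 + (cmod (v x))\<^sup>2" using norm_ge_zero[of "v x"] by linarith
      then show "norm (v x) \<le> norm (1 + (cmod (v x))\<^sup>2)" by simp
    qed
  qed (use v in \<open>simp add: L2_on_def\<close>)
qed

lemma mollk_bounded: obtains C where "\<And>z. \<bar>mollk h z\<bar> \<le> C"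
  by (rule compact_support_bounded[OF continuous_mollk, of h h]) (use mollk_eq_0 in auto)

lemma moll_integrable:
  assumes "integrable (lebesgue_on S) v"
  shows "integrable (lebesgue_on S) (\<lambda>z. complex_of_real (mollk h (z - x)) * v z)"
proof -
  obtain C where "\<And>z. \<bar>mollk h z\<bar> \<le> C" using mollk_bounded by blast
  then show ?thesis
    by (intro integrable_bounded_mult assms continuous_on_compose2[OF continuous_mollk] continuous_intros) auto
qed

lemma moll_integrable_real:
  fixes v :: "real^3 \<Rightarrow> real"
  assumes "integrable (lebesgue_on S) v"
  shows "integrable (lebesgue_on S) (\<lambda>z. mollk h (z - x) * v z)"
proof -
  have "integrable (lebesgue_on S) (\<lambda>z. Re (complex_of_real (mollk h (z - x)) * complex_of_real (v z)))"
    using assms by (intro integrable_Re moll_integrable) auto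
  then show ?thesis by simp
qed

lemma integral_mollk_le:
  assumes S: "S \<in> sets lebesgue" and h: "h > 0" and int: "integrable (lebesgue_on S) (\<lambda>z. mollk h (z - x))"
  shows "(LINT z|lebesgue_on S. mollk h (z - x)) \<le> 1"
proof -
  have "ennreal (LINT z|lebesgue_on S. mollk h (z - x)) = (\<integral>\<^sup>+z. ennreal (mollk h (z - x)) \<partial>lebesgue_on S)"
    by (intro nn_integral_eq_integral[symmetric] int) (simp add: mollk_nonneg)
  also have "\<dots> \<le> (\<integral>\<^sup>+z. ennreal (mollk h (z - x)) \<partial>lebesgue_on UNIV)"
    using S by (intro nn_integral_lebesgue_on_mono) auto
  also have "\<dots> = 1" using nn_integral_mollk[OF h] by (simp add: nn_integral_restrict_space)
  finally show ?thesis by simp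
qed

text \<open>Jensen's inequality for a kernel of mass at most 1, obtained from the nonnegativity of
  the weighted integral of (|v| - I)^2, where I is the weighted integral of |v|.\<close>

lemma moll_pointwise_L2:
  assumes v: "L2_on (cubeQ R) v" and h: "h > 0"
  shows "(cmod (moll (cubeQ R) h v x))\<^sup>2 \<le> (LINT z|lebesgue_on (cubeQ R). mollk h (z - x) * (cmod (v z))\<^sup>2)"
proof -
  interpret finite_measure "lebesgue_on (cubeQ R)" by (rule finite_measure_cubeQ)
  let ?M = "lebesgue_on (cubeQ R)"
  let ?m = "\<lambda>z. mollk h (z - x)"
  have iv: "integrable ?M v" by (rule L2_on_integrable[OF v])
  have i0: "integrable ?M ?m" using moll_integrable_real[of "cubeQ R" "\<lambda>z. 1"] by simp
  have i1: "integrable ?M (\<lambda>z. ?m z * cmod (v z))"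
    using iv by (intro moll_integrable_real) simp
  have i2: "integrable ?M (\<lambda>z. ?m z * (cmod (v z))\<^sup>2)"
    using v by (intro moll_integrable_real) (simp add: L2_on_def)
  define I where "I = (LINT z|?M. ?m z * cmod (v z))"
  have "cmod (moll (cubeQ R) h v x) \<le> I"
    unfolding moll_def I_def
    by (rule Bochner_Integration.integral_norm_bound_integral[OF moll_integrable[OF iv] i1])
      (simp add: norm_mult mollk_nonneg)
  then have "(cmod (moll (cubeQ R) h v x))\<^sup>2 \<le> I\<^sup>2" by (intro power_mono) auto
  also have "I\<^sup>2 \<le> (LINT z|?M. ?m z * (cmod (v z))\<^sup>2)"
  proof -
    have "0 \<le> (LINT z|?M. ?m z * (cmod (v z) - I)\<^sup>2)"
      by (intro Bochner_Integration.integral_nonneg mult_nonneg_nonneg mollk_nonneg) auto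
    also have "\<dots> = (LINT z|?M. ?m z * (cmod (v z))\<^sup>2 - 2 * I * (?m z * cmod (v z)) + I\<^sup>2 * ?m z)"
      by (intro Bochner_Integration.integral_cong) (auto simp: power2_eq_square algebra_simps)
    also have "\<dots> = (LINT z|?M. ?m z * (cmod (v z))\<^sup>2) - 2 * I * I + I\<^sup>2 * (LINT z|?M. ?m z)"
      using i0 i1 i2 by (simp add: I_def)
    also have "\<dots> \<le> (LINT z|?M. ?m z * (cmod (v z))\<^sup>2) - 2 * I * I + I\<^sup>2 * 1"
      using integral_mollk_le[OF cubeQ_lebesgue h i0] by (intro add_left_mono mult_left_mono) auto
    finally show ?thesis by (simp add: power2_eq_square)
  qed
  finally show ?thesis .
qed

text \<open>Tonelli after the pointwise bound. The kernel is even, so its mass is at most 1 in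
  either variable.\<close>

lemma moll_L2_le:
  assumes v: "L2_on (cubeQ R) v" and h: "h > 0"
  shows "(\<integral>\<^sup>+x. ennreal ((cmod (moll (cubeQ R) h v x))\<^sup>2) \<partial>lebesgue_on (cubeQ R))
    \<le> (\<integral>\<^sup>+x. ennreal ((cmod (v x))\<^sup>2) \<partial>lebesgue_on (cubeQ R))"
proof -
  let ?M = "lebesgue_on (cubeQ R)"
  interpret A: finite_measure ?M by (rule finite_measure_cubeQ)
  interpret P: pair_sigma_finite ?M ?M ..
  have vm[measurable]: "v \<in> borel_measurable ?M" using v by (simp add: L2_on_def)
  have idm: "(\<lambda>x. x) \<in> borel_measurable ?M" by (intro continuous_borel_lebesgue_on continuous_intros)
  have "(\<lambda>p. snd p - fst p) \<in> borel_measurable (?M \<Otimes>\<^sub>M ?M)"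
    by (intro borel_measurable_diff measurable_compose[OF measurable_snd idm] measurable_compose[OF measurable_fst idm])
  then have [measurable]: "(\<lambda>p. mollk h (snd p - fst p)) \<in> borel_measurable (?M \<Otimes>\<^sub>M ?M)"
    by (rule measurable_compose) simp
  have "(\<integral>\<^sup>+x. ennreal ((cmod (moll (cubeQ R) h v x))\<^sup>2) \<partial>?M) \<le>
      (\<integral>\<^sup>+x. \<integral>\<^sup>+z. ennreal (mollk h (z - x)) * ennreal ((cmod (v z))\<^sup>2) \<partial>?M \<partial>?M)"
  proof (rule nn_integral_mono)
    fix x
    have "ennreal ((cmod (moll (cubeQ R) h v x))\<^sup>2) \<le> ennreal (LINT z|?M. mollk h (z - x) * (cmod (v z))\<^sup>2)"
      by (intro ennreal_leI moll_pointwise_L2 v h)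
    also have "\<dots> = (\<integral>\<^sup>+z. ennreal (mollk h (z - x) * (cmod (v z))\<^sup>2) \<partial>?M)"
      using v by (intro nn_integral_eq_integral[symmetric] moll_integrable_real) (auto simp: L2_on_def mollk_nonneg)
    finally show "ennreal ((cmod (moll (cubeQ R) h v x))\<^sup>2) \<le> (\<integral>\<^sup>+z. ennreal (mollk h (z - x)) * ennreal ((cmod (v z))\<^sup>2) \<partial>?M)"
      by (simp add: ennreal_mult mollk_nonneg)
  qed
  also have "\<dots> = (\<integral>\<^sup>+z. \<integral>\<^sup>+x. ennreal (mollk h (z - x)) * ennreal ((cmod (v z))\<^sup>2) \<partial>?M \<partial>?M)"
    by (rule P.Fubini'[symmetric]) (simp add: split_beta)
  also have "\<dots> \<le> (\<integral>\<^sup>+z. ennreal ((cmod (v z))\<^sup>2) \<partial>?M)"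
  proof (rule nn_integral_mono)
    fix z
    have m: "(\<lambda>x. mollk h (z - x)) \<in> borel_measurable ?M"
      by (intro continuous_borel_lebesgue_on continuous_on_compose2[OF continuous_mollk] continuous_intros) auto
    have "(\<integral>\<^sup>+x. ennreal (mollk h (z - x)) \<partial>?M) \<le> (\<integral>\<^sup>+x. ennreal (mollk h (z - x)) \<partial>lebesgue_on UNIV)"
      by (intro nn_integral_lebesgue_on_mono cubeQ_lebesgue) auto
    also have "\<dots> = 1" using nn_integral_mollk[OF h, of z] by (simp add: nn_integral_restrict_space mollk_minus[of h z])
    finally have "(\<integral>\<^sup>+x. ennreal (mollk h (z - x)) \<partial>?M) * ennreal ((cmod (v z))\<^sup>2) \<le> 1 * ennreal ((cmod (v z))\<^sup>2)"
      by (intro mult_right_mono) auto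
    then show "(\<integral>\<^sup>+x. ennreal (mollk h (z - x)) * ennreal ((cmod (v z))\<^sup>2) \<partial>?M) \<le> ennreal ((cmod (v z))\<^sup>2)"
      using m by (simp add: nn_integral_multc)
  qed
  finally show ?thesis .
qed

lemma bounded_L2_on_cubeQ:
  assumes g: "continuous_on UNIV g"
  shows "L2_on (cubeQ R) g"
proof -
  interpret finite_measure "lebesgue_on (cubeQ R)" by (rule finite_measure_cubeQ)
  have "compact ((\<lambda>x. (cmod (g x))\<^sup>2) ` cbox (vec (- R / 2)) (vec (R / 2)))"
    by (intro compact_continuous_image continuous_intros continuous_on_subset[OF g]) auto
  then obtain C where C: "\<And>x. x \<in> cbox (vec (- R / 2)) (vec (R / 2)) \<Longrightarrow> (cmod (g x))\<^sup>2 \<le> C"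
    using compact_imp_bounded[THEN bounded_pos[THEN iffD1]] by fastforce
  have "integrable (lebesgue_on (cubeQ R)) (\<lambda>x. (cmod (g x))\<^sup>2)"
  proof (rule integrable_const_bound)
    show "AE x in lebesgue_on (cubeQ R). norm ((cmod (g x))\<^sup>2) \<le> C"
      using C box_subset_cbox by (intro AE_I2) (auto simp: cubeQ_eq_box)
    show "(\<lambda>x. (cmod (g x))\<^sup>2) \<in> borel_measurable (lebesgue_on (cubeQ R))"
      by (intro continuous_borel_lebesgue_on continuous_intros g)
  qed
  then show ?thesis unfolding L2_on_def using continuous_borel_lebesgue_on[OF g] by blast
qed

text \<open>Near the boundary part of the kernel's mass lies outside the cube. For x in the cube of
  side R - 1 and radius below 1 / 2 all of the mass is inside, which is why one unit of side is
  given up.\<close>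

lemma moll_continuous_close:
  assumes g: "continuous_on UNIV g" and e: "e > 0"
  obtains h0 where "h0 > 0" "\<And>h x. 0 < h \<Longrightarrow> h < h0 \<Longrightarrow> x \<in> cubeQ (R - 1) \<Longrightarrow> cmod (moll (cubeQ R) h g x - g x) \<le> e"
proof -
  have "uniformly_continuous_on (cbox (vec (- R / 2)) (vec (R / 2))) g"
    by (intro compact_uniformly_continuous continuous_on_subset[OF g]) auto
  then obtain d where d: "d > 0" "\<And>z x. z \<in> cbox (vec (- R / 2)) (vec (R / 2)) \<Longrightarrow>
      x \<in> cbox (vec (- R / 2)) (vec (R / 2)) \<Longrightarrow> dist x z < d \<Longrightarrow> dist (g x) (g z) < e"
    using e unfolding uniformly_continuous_on_def by metis
  \<comment> \<open>The 3 converts the supremum norm of the support into Euclidean distance.\<close>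
  define h0 where "h0 = min (1 / 2) (d / 3)"
  show ?thesis
  proof
    show "h0 > 0" using d by (simp add: h0_def)
    fix h x assume h: "0 < h" "h < h0" and x: "x \<in> cubeQ (R - 1)"
    let ?M = "lebesgue_on (cubeQ R)"
    interpret finite_measure ?M by (rule finite_measure_cubeQ)
    have ig: "integrable ?M g" by (intro L2_on_integrable bounded_L2_on_cubeQ g)
    have i0: "integrable ?M (\<lambda>z. mollk h (z - x))" using moll_integrable_real[of "cubeQ R" "\<lambda>z. 1"] by simp
    have inQ: "z \<in> cubeQ R" if "infnorm (z - x) \<le> h" for z
      using cubeQ_margin[OF x that] h by (simp add: h0_def)
    have 1: "(LINT z|?M. mollk h (z - x)) = 1"
    proof -
      have "ennreal (LINT z|?M. mollk h (z - x)) = (\<integral>\<^sup>+z. ennreal (mollk h (z - x)) \<partial>?M)"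
        by (intro nn_integral_eq_integral[symmetric] i0) (simp add: mollk_nonneg)
      also have "\<dots> = (\<integral>\<^sup>+z. ennreal (mollk h (z - x)) * indicator (cubeQ R) z \<partial>lebesgue)"
        by (simp add: nn_integral_restrict_space cubeQ_lebesgue)
      also have "\<dots> = (\<integral>\<^sup>+z. ennreal (mollk h (z - x)) \<partial>lebesgue)"
      proof (intro nn_integral_cong)
        fix z show "ennreal (mollk h (z - x)) * indicator (cubeQ R) z = ennreal (mollk h (z - x))"
          using inQ[of z] mollk_eq_0[of h "z - x"] by (cases "infnorm (z - x) \<le> h") auto
      qed
      finally show ?thesis using nn_integral_mollk[OF h(1)] by simp
    qed
    have "moll (cubeQ R) h g x - g x = (LINT z|?M. complex_of_real (mollk h (z - x)) * g z) - (LINT z|?M. complex_of_real (mollk h (z - x)) * g x)"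
      using 1 i0 by (simp add: moll_def)
    also have "\<dots> = (LINT z|?M. complex_of_real (mollk h (z - x)) * g z - complex_of_real (mollk h (z - x)) * g x)"
      using moll_integrable[OF ig] i0 by (intro Bochner_Integration.integral_diff[symmetric]) auto
    also have "norm \<dots> \<le> (LINT z|?M. mollk h (z - x) * e)"
    proof (rule Bochner_Integration.integral_norm_bound_integral)
      show "integrable ?M (\<lambda>z. complex_of_real (mollk h (z - x)) * g z - complex_of_real (mollk h (z - x)) * g x)"
        using moll_integrable[OF ig] i0 by auto
      show "integrable ?M (\<lambda>z. mollk h (z - x) * e)" using i0 by simp
      fix z
      have "cmod (complex_of_real (mollk h (z - x)) * g z - complex_of_real (mollk h (z - x)) * g x) = mollk h (z - x) * cmod (g z - g x)"
        by (simp flip: right_diff_distrib add: norm_mult mollk_nonneg)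
      also have "\<dots> \<le> mollk h (z - x) * e"
      proof (cases "infnorm (z - x) < h")
        case True
        have "norm (z - x) \<le> 3 * h" using infnorm_less_imp_norm[of "z - x" h] True by simp
        then have "dist z x < d" using h by (simp add: dist_norm h0_def)
        moreover have "z \<in> cbox (vec (- R / 2)) (vec (R / 2))" "x \<in> cbox (vec (- R / 2)) (vec (R / 2))"
          using inQ[of z] True inQ[of x] h box_subset_cbox by (auto simp: cubeQ_eq_box infnorm_0)
        ultimately have "dist (g z) (g x) < e" using d(2) by blast
        then show ?thesis by (intro mult_left_mono mollk_nonneg) (simp add: dist_norm)
      qed (simp add: mollk_eq_0)
      finally show "cmod (complex_of_real (mollk h (z - x)) * g z - complex_of_real (mollk h (z - x)) * g x) \<le> mollk h (z - x) * e" .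
    qed
    also have "\<dots> = e" using 1 by simp
    finally show "cmod (moll (cubeQ R) h g x - g x) \<le> e" .
  qed
qed

text \<open>A comparison with a continuous g in three terms: contraction in L2, uniform closeness
  for g, and the approximation itself. The shares \<kappa> / 12, \<kappa> / 8, \<kappa> / 12 return
  with the weights 2, 4, 4 from two uses of the squared triangle inequality and add up to
  \<kappa>.\<close>

lemma moll_L2_tendsto:
  assumes v: "L2_on (cubeQ R) v" and \<kappa>: "\<kappa> > 0"
  obtains h0 where "h0 > 0" "\<And>h. 0 < h \<Longrightarrow> h < h0 \<Longrightarrow>
    (\<integral>\<^sup>+x. ennreal ((cmod (moll (cubeQ R) h v x - v x))\<^sup>2) \<partial>lebesgue_on (cubeQ (R - 1))) \<le> ennreal \<kappa>"
proof -
  let ?S = "cubeQ R" and ?T = "cubeQ (R - 1)"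
  have sub: "?T \<subseteq> ?S" by (rule cubeQ_mono) simp
  obtain g where g: "continuous_on UNIV g"
    and gv: "(\<integral>\<^sup>+x. ennreal ((cmod (v x - g x))\<^sup>2) \<partial>lebesgue_on ?S) < ennreal (\<kappa> / 12)"
    using L2_continuous_approx[OF cubeQ_lebesgue emeasure_cubeQ_finite v, of "\<kappa> / 12"] \<kappa> by auto
  define V where "V = measure lebesgue ?T"
  have V: "emeasure lebesgue ?T = ennreal V"
    using emeasure_cubeQ_finite[of "R - 1"] unfolding V_def by (intro emeasure_eq_ennreal_measure) auto
  define e where "e = sqrt (\<kappa> / (8 * (V + 1)))"
  have V0: "V \<ge> 0" by (simp add: V_def)
  have e: "e > 0" "e\<^sup>2 * V \<le> \<kappa> / 8"
    using \<kappa> V0 by (auto simp: e_def field_simps mult_left_mono)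
  obtain h0 where h0: "h0 > 0" "\<And>h x. 0 < h \<Longrightarrow> h < h0 \<Longrightarrow> x \<in> ?T \<Longrightarrow> cmod (moll ?S h g x - g x) \<le> e"
    using moll_continuous_close[OF g e(1)] by blast
  have gL: "L2_on ?S g" by (rule bounded_L2_on_cubeQ[OF g])
  have iv: "integrable (lebesgue_on ?S) v" "integrable (lebesgue_on ?S) g"
    by (intro L2_on_integrable v gL)+
  have vm: "v \<in> borel_measurable (lebesgue_on ?T)"
    using v sub cubeQ_lebesgue unfolding L2_on_def
    by (metis measurable_restrict_mono)
  have gm: "g \<in> borel_measurable (lebesgue_on ?T)"
    by (rule continuous_borel_lebesgue_on[OF g])
  have mm: "moll ?S h w \<in> borel_measurable (lebesgue_on ?T)" if "integrable (lebesgue_on ?S) w" for h w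
    by (intro continuous_borel_lebesgue_on continuous_moll that)
  show ?thesis
  proof
    show "h0 > 0" by (rule h0)
    fix h assume h: "0 < h" "h < h0"
    have 1: "(\<integral>\<^sup>+x. ennreal ((cmod (moll ?S h v x - moll ?S h g x))\<^sup>2) \<partial>lebesgue_on ?T) \<le> ennreal (\<kappa> / 12)"
    proof -
      have "integrable (lebesgue_on ?S) (\<lambda>x. (cmod (v x - g x))\<^sup>2)"
        using gv v gL order.strict_trans[OF gv ennreal_less_top] unfolding integrable_iff_bounded L2_on_def by auto
      then have L: "L2_on ?S (\<lambda>x. v x - g x)"
        using v gL unfolding L2_on_def by auto
      have "moll ?S h v x - moll ?S h g x = moll ?S h (\<lambda>x. v x - g x) x" for x
        unfolding moll_def right_diff_distrib
        by (intro Bochner_Integration.integral_diff[symmetric] moll_integrable iv)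
      then have "(\<integral>\<^sup>+x. ennreal ((cmod (moll ?S h v x - moll ?S h g x))\<^sup>2) \<partial>lebesgue_on ?T)
        \<le> (\<integral>\<^sup>+x. ennreal ((cmod (moll ?S h (\<lambda>x. v x - g x) x))\<^sup>2) \<partial>lebesgue_on ?S)"
        using nn_integral_lebesgue_on_mono[OF sub cubeQ_lebesgue cubeQ_lebesgue] by simp
      also have "\<dots> \<le> (\<integral>\<^sup>+x. ennreal ((cmod (v x - g x))\<^sup>2) \<partial>lebesgue_on ?S)"
        by (rule moll_L2_le[OF L h(1)])
      finally show ?thesis using gv by simp
    qed
    have 2: "(\<integral>\<^sup>+x. ennreal ((cmod (moll ?S h g x - g x))\<^sup>2) \<partial>lebesgue_on ?T) \<le> ennreal (\<kappa> / 8)"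
    proof -
      have "(\<integral>\<^sup>+x. ennreal ((cmod (moll ?S h g x - g x))\<^sup>2) \<partial>lebesgue_on ?T) \<le> (\<integral>\<^sup>+x. ennreal (e\<^sup>2) \<partial>lebesgue_on ?T)"
        using h0(2)[OF h] by (intro nn_integral_mono ennreal_leI power_mono) auto
      also have "\<dots> = ennreal (e\<^sup>2) * ennreal V"
        using cubeQ_lebesgue by (simp add: emeasure_restrict_space V)
      also have "\<dots> = ennreal (e\<^sup>2 * V)" using V0 by (simp add: ennreal_mult)
      finally show ?thesis using e(2) by (meson ennreal_leI order_trans)
    qed
    have 3: "(\<integral>\<^sup>+x. ennreal ((cmod (g x - v x))\<^sup>2) \<partial>lebesgue_on ?T) \<le> ennreal (\<kappa> / 12)"
    proof -
      have "(\<integral>\<^sup>+x. ennreal ((cmod (g x - v x))\<^sup>2) \<partial>lebesgue_on ?T) \<le> (\<integral>\<^sup>+x. ennreal ((cmod (g x - v x))\<^sup>2) \<partial>lebesgue_on ?S)"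
        by (rule nn_integral_lebesgue_on_mono[OF sub cubeQ_lebesgue cubeQ_lebesgue])
      then show ?thesis using gv by (simp add: norm_minus_commute)
    qed
    have "(\<integral>\<^sup>+x. ennreal ((cmod (moll ?S h v x - v x))\<^sup>2) \<partial>lebesgue_on ?T) \<le>
      2 * (\<integral>\<^sup>+x. ennreal ((cmod (moll ?S h v x - moll ?S h g x))\<^sup>2) \<partial>lebesgue_on ?T)
      + 2 * (\<integral>\<^sup>+x. ennreal ((cmod (moll ?S h g x - v x))\<^sup>2) \<partial>lebesgue_on ?T)"
      by (intro nn_L2_triangle mm iv vm)
    also have "\<dots> \<le> 2 * (\<integral>\<^sup>+x. ennreal ((cmod (moll ?S h v x - moll ?S h g x))\<^sup>2) \<partial>lebesgue_on ?T)
      + 2 * (2 * (\<integral>\<^sup>+x. ennreal ((cmod (moll ?S h g x - g x))\<^sup>2) \<partial>lebesgue_on ?T)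
           + 2 * (\<integral>\<^sup>+x. ennreal ((cmod (g x - v x))\<^sup>2) \<partial>lebesgue_on ?T))"
      by (intro add_left_mono mult_left_mono nn_L2_triangle mm iv vm gm) auto
    also have "\<dots> \<le> 2 * ennreal (\<kappa> / 12) + 2 * (2 * ennreal (\<kappa> / 8) + 2 * ennreal (\<kappa> / 12))"
      by (intro add_mono mult_left_mono 1 2 3) auto
    also have "\<dots> = ennreal (2 * (\<kappa> / 12) + 2 * (2 * (\<kappa> / 8) + 2 * (\<kappa> / 12)))"
    proof -
      have two: "2 * ennreal x = ennreal (2 * x)" if "x \<ge> 0" for x
        using ennreal_mult'[of 2 x] by simp
      show ?thesis using \<kappa> by (simp only: two ennreal_plus[symmetric] divide_nonneg_pos zero_less_numeral
            add_nonneg_nonneg mult_nonneg_nonneg zero_le_numeral less_imp_le)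
    qed
    also have "2 * (\<kappa> / 12) + 2 * (2 * (\<kappa> / 8) + 2 * (\<kappa> / 12)) = \<kappa>" by simp
    finally show "(\<integral>\<^sup>+x. ennreal ((cmod (moll ?S h v x - v x))\<^sup>2) \<partial>lebesgue_on ?T) \<le> ennreal \<kappa>" .
  qed
qed

lemma pderiv3_shift: "pderiv3 j (\<lambda>z. mollk h (z - x)) z = pderiv3 j (mollk h) (z - x)"
proof -
  have "((\<lambda>z. z - x) has_derivative (\<lambda>d. d)) (at z)"
    by (auto intro!: derivative_eq_intros)
  from has_derivative_compose[OF this has_derivative_mollk[of h "z - x"]]
  have "((\<lambda>z. mollk h (z - x)) has_derivative (\<lambda>d. \<Sum>j\<in>UNIV. d $ j * pderiv3 j (mollk h) (z - x))) (at z)" .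
  from pderiv3_eq[OF this, of j] show ?thesis
    by (simp add: axis_def if_distrib[of "\<lambda>x. x * _"] cong: if_cong)
qed

lemma test_fun_mollk:
  assumes x: "x \<in> cubeQ (R - 1)" and h: "h < 1 / 2"
  shows "test_fun (cubeQ R) (\<lambda>z. mollk h (z - x))"
proof -
  have sub: "closure {z. mollk h (z - x) \<noteq> 0} \<subseteq> {z. infnorm (z - x) \<le> h}"
  proof (rule closure_minimal)
    show "{z. mollk h (z - x) \<noteq> 0} \<subseteq> {z. infnorm (z - x) \<le> h}"
    proof
      fix z assume "z \<in> {z. mollk h (z - x) \<noteq> 0}"
      then have "\<not> h \<le> infnorm (z - x)" using mollk_eq_0 by blast
      then show "z \<in> {z. infnorm (z - x) \<le> h}" by simp
    qed
    show "closed {z. infnorm (z - x) \<le> h}"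
      by (intro closed_Collect_le continuous_intros)
  qed
  have "bounded {z. infnorm (z - x) \<le> h}"
  proof (rule boundedI)
    fix z assume "z \<in> {z. infnorm (z - x) \<le> h}"
    then have "norm (z - x) \<le> 3 * h" using infnorm_less_imp_norm by blast
    then show "norm z \<le> norm x + 3 * h" using norm_triangle_sub[of z x] by linarith
  qed
  then have "bounded (closure {z. mollk h (z - x) \<noteq> 0})"
    using sub bounded_subset by blast
  then have "compact (closure {z. mollk h (z - x) \<noteq> 0})"
    by (simp add: compact_eq_bounded_closed)
  moreover have "closure {z. mollk h (z - x) \<noteq> 0} \<subseteq> cubeQ R"
    using sub cubeQ_margin[OF x _ h] by blast
  ultimately show ?thesis
    unfolding test_fun_def smooth3_def using Ck_mollk by blast
qed

text \<open>The x-derivative of a mollification falls on the kernel, which is a test function in its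
  other variable; the defining identity of the weak gradient moves that derivative onto u. So the
  gradient of the mollified u is the mollified g wherever the shifted kernel fits inside the
  cube.\<close>

lemma smooth_approximation:
  assumes ug: "H1_weak_grad (cubeQ R) u g" and \<kappa>: "\<kappa> > 0"
  obtains U G where "continuous_on UNIV U" "\<And>j. continuous_on UNIV (G j)"
    "\<And>x. x \<in> cubeQ (R - 1) \<Longrightarrow> (U has_derivative (\<lambda>d. \<Sum>j\<in>UNIV. d $ j *\<^sub>R G j x)) (at x)"
    "(\<integral>\<^sup>+x. ennreal ((cmod (U x - u x))\<^sup>2) \<partial>lebesgue_on (cubeQ (R - 1))) \<le> ennreal \<kappa>"
    "\<And>j. (\<integral>\<^sup>+x. ennreal ((cmod (G j x - g j x))\<^sup>2) \<partial>lebesgue_on (cubeQ (R - 1))) \<le> ennreal \<kappa>"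
proof -
  let ?S = "cubeQ R"
  have u: "L2_on ?S u" and g: "\<And>j. L2_on ?S (g j)"
    and weak: "\<And>j \<phi>. test_fun ?S \<phi> \<Longrightarrow> (LINT x|lebesgue_on ?S. u x * complex_of_real (pderiv3 j \<phi> x))
          = - (LINT x|lebesgue_on ?S. g j x * complex_of_real (\<phi> x))"
    using ug unfolding H1_weak_grad_def by auto
  let ?P = "\<lambda>v h0. h0 > 0 \<and> (\<forall>h. 0 < h \<longrightarrow> h < h0 \<longrightarrow>
    (\<integral>\<^sup>+x. ennreal ((cmod (moll ?S h v x - v x))\<^sup>2) \<partial>lebesgue_on (cubeQ (R - 1))) \<le> ennreal \<kappa>)"
  have ex: "\<exists>h0. ?P v h0" if "L2_on ?S v" for v
    by (rule moll_L2_tendsto[OF that \<kappa>]) blast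
  obtain hu where hu: "?P u hu" using ex[OF u] by blast
  have "\<exists>h0. ?P (g j) h0" for j using ex[OF g[of j]] .
  then have "\<forall>j. \<exists>h0. ?P (g j) h0" ..
  then obtain hg where "\<forall>j. ?P (g j) (hg j)" by (rule choice[THEN exE])
  then have hg: "?P (g j) (hg j)" for j ..
  \<comment> \<open>One radius must serve u and all three components of g and stay within the margin
    1 / 2; it is halved below to make the inequalities strict.\<close>
  define H where "H = min (1 / 2) (min hu (Min (range hg)))"
  have pos: "hu > 0" "hg j > 0" for j
    by (rule conjunct1[OF hu], rule conjunct1[OF hg])
  then have "Min (range hg) > 0" by simp
  then have H: "H > 0" "H \<le> 1 / 2" "H \<le> hu" using pos by (simp_all add: H_def)
  have "Min (range hg) \<le> hg j" for j by (rule Min_le) auto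
  then have H': "H \<le> hg j" for j by (simp add: H_def min_le_iff_disj)
  define h where "h = H / 2"
  have h: "0 < h" "h < 1 / 2" "h < hu" "\<And>j. h < hg j"
  proof -
    show "0 < h" "h < 1 / 2" "h < hu" using H(1,2,3) by (auto simp: h_def)
    show "h < hg j" for j using H(1) H'[of j] by (simp add: h_def)
  qed
  show ?thesis
  proof
    show "continuous_on UNIV (moll ?S h u)" "continuous_on UNIV (moll ?S h (g j))" for j
      by (intro continuous_moll L2_on_integrable u g)+
    show "(\<integral>\<^sup>+x. ennreal ((cmod (moll ?S h u x - u x))\<^sup>2) \<partial>lebesgue_on (cubeQ (R - 1))) \<le> ennreal \<kappa>"
      by (rule conjunct2[OF hu, rule_format, OF h(1) h(3)])
    show "(\<integral>\<^sup>+x. ennreal ((cmod (moll ?S h (g j) x - g j x))\<^sup>2) \<partial>lebesgue_on (cubeQ (R - 1))) \<le> ennreal \<kappa>" for j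
      by (rule conjunct2[OF hg, rule_format, OF h(1) h(4)])
    fix x assume x: "x \<in> cubeQ (R - 1)"
    have "- (LINT z|lebesgue_on ?S. complex_of_real (pderiv3 j (mollk h) (z - x)) * u z) = moll ?S h (g j) x" for j
      using weak[OF test_fun_mollk[OF x h(2)], of j] unfolding pderiv3_shift moll_def by (simp add: mult.commute)
    then show "(moll ?S h u has_derivative (\<lambda>d. \<Sum>j\<in>UNIV. d $ j *\<^sub>R moll ?S h (g j) x)) (at x)"
      using moll_has_derivative[OF L2_on_integrable[OF u], of h x] by simp
  qed
qed

section \<open>Stability of the energy density under approximation\<close>

lemma square_add_le:
  fixes x y t :: real
  assumes t: "t > 0"
  shows "(x + y)\<^sup>2 \<le> (1 + t) * x\<^sup>2 + (1 + 1 / t) * y\<^sup>2"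
proof -
  have "0 \<le> (t * x - y)\<^sup>2 / t" using t by simp
  also have "(t * x - y)\<^sup>2 / t = t * x\<^sup>2 + 1 / t * y\<^sup>2 - 2 * x * y"
    using t by (simp add: power2_eq_square field_simps)
  finally show ?thesis by (simp add: power2_eq_square algebra_simps)
qed

lemma cmod_square_perturb:
  fixes z w :: complex
  assumes t: "t > 0"
  shows "(cmod z)\<^sup>2 \<le> (1 + t) * (cmod w)\<^sup>2 + (1 + 1 / t) * (cmod (z - w))\<^sup>2"
proof -
  have "(cmod z)\<^sup>2 \<le> (cmod w + cmod (z - w))\<^sup>2"
    using norm_triangle_sub[of z w] by (intro power_mono) auto
  also have "\<dots> \<le> (1 + t) * (cmod w)\<^sup>2 + (1 + 1 / t) * (cmod (z - w))\<^sup>2"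
    by (rule square_add_le[OF t])
  finally show ?thesis .
qed

definition GL_density where
  "GL_density b u g x = b * (\<Sum>j\<in>UNIV. (cmod (covD u g j x))\<^sup>2) + (1 - (cmod (u x))\<^sup>2)\<^sup>2 / 2"

lemma GL_energy_eq: "GL_energy b R u g = (\<integral>\<^sup>+x. ennreal (GL_density b u g x) \<partial>lebesgue_on (cubeQ R))"
  by (simp add: GL_energy_def GL_density_def covD_def nn_integral_restrict_space cubeQ_lebesgue)

lemma magF_bound: "x \<in> cubeQ R \<Longrightarrow> \<bar>magF x $ j\<bar> \<le> R"
proof -
  assume x: "x \<in> cubeQ R"
  have b: "\<bar>x $ i\<bar> \<le> R / 2" for i
  proof -
    have "- R / 2 < x $ i" "x $ i < R / 2" using x by (auto simp: cubeQ_def)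
    then show ?thesis by (simp add: abs_if)
  qed
  have "0 \<le> R" using b[of 1] abs_ge_zero[of "x $ 1"] by linarith
  then have "\<bar>magF x $ 1\<bar> \<le> R" "\<bar>magF x $ 2\<bar> \<le> R" "\<bar>magF x $ 3\<bar> \<le> R"
    using b[of 1] b[of 2] by (simp_all add: abs_if split: if_splits)
  then show ?thesis using exhaust_3[of j] by auto
qed

text \<open>Young's inequality with parameter t, applied to each horizontal covariant derivative and
  to 1 - |u|; the factor R^2 is the size of F on the cube. Since 1 + |u| \<ge> 1, (1 - |u|)^2 is at
  most (1 - |u|^2)^2, and the errors contain only squares of differences, which L2 convergence
  controls.\<close>

lemma GL_density_perturb:
  assumes t: "t > 0" and b: "b > 0" and x: "x \<in> cubeQ R"
  shows "b * ((cmod (covD U G 1 x))\<^sup>2 + (cmod (covD U G 2 x))\<^sup>2) + (1 - cmod (U x))\<^sup>2 / 2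
    \<le> (1 + t) * GL_density b u g x + (1 + 1 / t) * (2 * b * (cmod (G 1 x - g 1 x))\<^sup>2 +
        2 * b * (cmod (G 2 x - g 2 x))\<^sup>2 + (4 * b * R\<^sup>2 + 1 / 2) * (cmod (U x - u x))\<^sup>2)"
proof -
  define q where "q = 1 + 1 / t"
  have q: "q \<ge> 0" using t by (simp add: q_def)
  define P where "P = (cmod (U x - u x))\<^sup>2"
  have cov: "(cmod (covD U G j x))\<^sup>2 \<le> (1 + t) * (cmod (covD u g j x))\<^sup>2 + q * (2 * (cmod (G j x - g j x))\<^sup>2 + 2 * R\<^sup>2 * P)" for j
  proof -
    have e: "covD U G j x - covD u g j x = (G j x - g j x) + (- \<i> * complex_of_real (magF x $ j) * (U x - u x))"
      by (simp add: covD_def algebra_simps)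
    have "(cmod (covD U G j x - covD u g j x))\<^sup>2 \<le>
        2 * (cmod (G j x - g j x))\<^sup>2 + 2 * (cmod (- \<i> * complex_of_real (magF x $ j) * (U x - u x)))\<^sup>2"
      unfolding e by (rule cmod_add_sq_le)
    also have "(cmod (- \<i> * complex_of_real (magF x $ j) * (U x - u x)))\<^sup>2 = \<bar>magF x $ j\<bar>\<^sup>2 * P"
      by (simp add: norm_mult power_mult_distrib P_def)
    also have "\<bar>magF x $ j\<bar>\<^sup>2 * P \<le> R\<^sup>2 * P"
      using magF_bound[OF x, of j] by (intro mult_right_mono power_mono) (auto simp: P_def)
    finally have "q * (cmod (covD U G j x - covD u g j x))\<^sup>2 \<le> q * (2 * (cmod (G j x - g j x))\<^sup>2 + 2 * R\<^sup>2 * P)"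
      using q by (intro mult_left_mono) auto
    then show ?thesis
      using cmod_square_perturb[OF t, of "covD U G j x" "covD u g j x"] unfolding q_def by linarith
  qed
  have "(1 - cmod (U x))\<^sup>2 \<le> (1 + t) * (1 - cmod (u x))\<^sup>2 + q * P"
  proof -
    have "(1 - cmod (U x))\<^sup>2 \<le> (1 + t) * (1 - cmod (u x))\<^sup>2 + q * (cmod (u x) - cmod (U x))\<^sup>2"
      using square_add_le[OF t, of "1 - cmod (u x)" "cmod (u x) - cmod (U x)"] by (simp add: q_def)
    also have "(cmod (u x) - cmod (U x))\<^sup>2 \<le> P"
    proof -
      have "\<bar>cmod (u x) - cmod (U x)\<bar> \<le> cmod (U x - u x)"
        by (metis norm_minus_commute norm_triangle_ineq3)
      then show ?thesis unfolding P_def by (metis abs_ge_zero power2_abs power_mono)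
    qed
    finally show ?thesis using q by (simp add: mult_left_mono)
  qed
  moreover have "(1 + t) * (1 - cmod (u x))\<^sup>2 \<le> (1 + t) * (1 - (cmod (u x))\<^sup>2)\<^sup>2"
  proof (rule mult_left_mono)
    have "(1 - (cmod (u x))\<^sup>2)\<^sup>2 = (1 - cmod (u x))\<^sup>2 * (1 + cmod (u x))\<^sup>2"
      by (simp add: power2_eq_square algebra_simps)
    moreover have "1 \<le> (1 + cmod (u x))\<^sup>2" by (simp add: one_le_power)
    ultimately show "(1 - cmod (u x))\<^sup>2 \<le> (1 - (cmod (u x))\<^sup>2)\<^sup>2"
      by (simp add: mult_le_cancel_left1)
  qed (use t in simp)
  ultimately have pot: "(1 - cmod (U x))\<^sup>2 / 2 \<le> (1 + t) * ((1 - (cmod (u x))\<^sup>2)\<^sup>2 / 2) + q * (P / 2)"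
    by (simp add: field_simps)
  have c12: "b * ((cmod (covD U G 1 x))\<^sup>2 + (cmod (covD U G 2 x))\<^sup>2) \<le>
     b * ((1 + t) * ((cmod (covD u g 1 x))\<^sup>2 + (cmod (covD u g 2 x))\<^sup>2 + (cmod (covD u g 3 x))\<^sup>2)
       + q * (2 * (cmod (G 1 x - g 1 x))\<^sup>2 + 2 * (cmod (G 2 x - g 2 x))\<^sup>2 + 4 * R\<^sup>2 * P))"
  proof (rule mult_left_mono)
    have "0 \<le> (1 + t) * (cmod (covD u g 3 x))\<^sup>2" using t by simp
    then show "(cmod (covD U G 1 x))\<^sup>2 + (cmod (covD U G 2 x))\<^sup>2 \<le>
      (1 + t) * ((cmod (covD u g 1 x))\<^sup>2 + (cmod (covD u g 2 x))\<^sup>2 + (cmod (covD u g 3 x))\<^sup>2)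
       + q * (2 * (cmod (G 1 x - g 1 x))\<^sup>2 + 2 * (cmod (G 2 x - g 2 x))\<^sup>2 + 4 * R\<^sup>2 * P)"
      using cov[of 1] cov[of 2] by (simp add: algebra_simps)
  qed (use b in simp)
  have "(1 + t) * (b * S + W / 2) + q * (2 * b * g1 + 2 * b * g2 + (4 * b * R\<^sup>2 + 1 / 2) * P) =
      b * ((1 + t) * S + q * (2 * g1 + 2 * g2 + 4 * R\<^sup>2 * P)) + ((1 + t) * (W / 2) + q * (P / 2))" for S W g1 g2
    by (simp add: algebra_simps)
  then show ?thesis
    using add_mono[OF c12 pot] unfolding GL_density_def sum_3 q_def[symmetric] P_def[symmetric] by simp
qed

section \<open>The lower bound for weakly differentiable configurations\<close>

lemma measurable_lebesgue_on_subset: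
  "f \<in> borel_measurable (lebesgue_on S) \<Longrightarrow> T \<subseteq> S \<Longrightarrow> f \<in> borel_measurable (lebesgue_on T)"
  by (metis measurable_restrict_mono)

lemma covD_measurable:
  assumes "u \<in> borel_measurable (lebesgue_on S)" "g j \<in> borel_measurable (lebesgue_on S)"
  shows "covD u g j \<in> borel_measurable (lebesgue_on S)"
proof -
  have "continuous_on UNIV (\<lambda>x. magF x $ j)"
    using exhaust_3[of j] by (elim disjE; simp; intro continuous_intros; simp)
  then have "(\<lambda>x. complex_of_real (magF x $ j)) \<in> borel_measurable (lebesgue_on S)"
    by (intro continuous_borel_lebesgue_on continuous_on_of_real)
  then show ?thesis
    unfolding covD_def using assms by (intro borel_measurable_diff borel_measurable_times) auto
qed

lemma GL_density_measurable:
  assumes "u \<in> borel_measurable (lebesgue_on S)" "\<And>j. g j \<in> borel_measurable (lebesgue_on S)"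
  shows "GL_density b u g \<in> borel_measurable (lebesgue_on S)"
proof -
  note [measurable] = assms(1) covD_measurable[OF assms]
  show ?thesis unfolding GL_density_def by measurable
qed

lemma (in smooth_config) energy_eq_nn_integral:
  "ennreal energy = (\<integral>\<^sup>+x. ennreal (b * ((cmod (covD U G 1 x))\<^sup>2 + (cmod (covD U G 2 x))\<^sup>2) + (1 - cmod (U x))\<^sup>2 / 2)
     \<partial>lebesgue_on (cubeQ L))"
proof -
  let ?d = "\<lambda>x. b * ((cmod (covD U G 1 x))\<^sup>2 + (cmod (covD U G 2 x))\<^sup>2) + (1 - cmod (U x))\<^sup>2 / 2"
  have "((\<lambda>x. b * (\<delta> x)\<^sup>2 + (1 - cmod (U x))\<^sup>2 / 2) has_integral energy) (Box (L / 2))"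
    unfolding energy_def by (intro integrable_integral integrable_continuous continuous_intros) auto
  then have "(?d has_integral energy) (cubeQ L)"
    unfolding \<delta>_sq cubeQ_eq_box using has_integral_open_interval by fastforce
  then have "ennreal energy = (\<integral>\<^sup>+x. indicator (cubeQ L) x * ?d x \<partial>lborel)"
    using b by (intro nn_integral_has_integral_lebesgue[symmetric]) auto
  also have "\<dots> = (\<integral>\<^sup>+x. indicator (cubeQ L) x * ?d x \<partial>lebesgue)"
    by (rule nn_integral_completion[symmetric])
  also have "\<dots> = (\<integral>\<^sup>+x. ennreal (?d x) \<partial>lebesgue_on (cubeQ L))"
    by (auto simp: nn_integral_restrict_space cubeQ_lebesgue indicator_def intro!: nn_integral_cong)
  finally show ?thesis .
qed

lemma smooth_energy_le:
  assumes ug: "H1_weak_grad (cubeQ R) u g" and b: "b > 0" and c: "0 < c" "c < 1" and R: "R > 1"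
    and E: "GL_energy b R u g \<le> ennreal E" "0 \<le> E" and \<eta>: "\<eta> > 0"
  obtains U G where "smooth_config U G b c (R - 1)" "smooth_config.energy U G b (R - 1) \<le> E + \<eta>"
proof -
  \<comment> \<open>The multiplicative loss t E is kept below \<eta> / 2. The accuracy \<kappa> is
    fixed only afterwards, because its weight 1 + 1 / t grows as t shrinks.\<close>
  define t where "t = \<eta> / (2 * (E + 1))"
  have t: "t > 0" "t * E \<le> \<eta> / 2"
    using \<eta> E by (auto simp: t_def field_simps)
  define q where "q = 1 + 1 / t"
  define K where "K = 4 * b + 4 * b * R\<^sup>2 + 1 / 2"
  have q: "q > 0" and K: "K > 0" using t b by (auto simp: q_def K_def add_pos_nonneg)
  define \<kappa> where "\<kappa> = \<eta> / (2 * q * K)"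
  have \<kappa>: "\<kappa> > 0" "q * (K * \<kappa>) = \<eta> / 2" using \<eta> q K by (auto simp: \<kappa>_def)
  obtain U G where U: "continuous_on UNIV U" and G: "\<And>j. continuous_on UNIV (G j)"
    and deriv: "\<And>x. x \<in> cubeQ (R - 1) \<Longrightarrow> (U has_derivative (\<lambda>d. \<Sum>j\<in>UNIV. d $ j *\<^sub>R G j x)) (at x)"
    and Uu: "(\<integral>\<^sup>+x. ennreal ((cmod (U x - u x))\<^sup>2) \<partial>lebesgue_on (cubeQ (R - 1))) \<le> ennreal \<kappa>"
    and Gg: "\<And>j. (\<integral>\<^sup>+x. ennreal ((cmod (G j x - g j x))\<^sup>2) \<partial>lebesgue_on (cubeQ (R - 1))) \<le> ennreal \<kappa>"
    using smooth_approximation[OF ug \<kappa>(1)] by blast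
  interpret smooth_config U G b c "R - 1"
    by unfold_locales (use U G deriv b c R in auto)
  let ?M = "lebesgue_on (cubeQ (R - 1))"
  have sub: "cubeQ (R - 1) \<subseteq> cubeQ R" by (rule cubeQ_mono) simp
  have um: "u \<in> borel_measurable ?M" and gm: "g j \<in> borel_measurable ?M" for j
    using ug unfolding H1_weak_grad_def L2_on_def
    by (auto intro: measurable_lebesgue_on_subset[OF _ sub])
  have Um: "U \<in> borel_measurable ?M" and Gm: "G j \<in> borel_measurable ?M" for j
    by (intro continuous_borel_lebesgue_on U G)+
  note [measurable] = um gm Um Gm GL_density_measurable[OF um gm]
  define w where "w x = 2 * b * (cmod (G 1 x - g 1 x))\<^sup>2 +
        2 * b * (cmod (G 2 x - g 2 x))\<^sup>2 + (4 * b * R\<^sup>2 + 1 / 2) * (cmod (U x - u x))\<^sup>2" for x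
  have dens0: "0 \<le> GL_density b u g x" for x
    using b by (auto simp: GL_density_def intro!: add_nonneg_nonneg mult_nonneg_nonneg sum_nonneg)
  have w0: "0 \<le> w x" for x using b by (auto simp: w_def intro!: add_nonneg_nonneg mult_nonneg_nonneg)
  have wm[measurable]: "w \<in> borel_measurable ?M" unfolding w_def by measurable
  have w_int: "(\<integral>\<^sup>+x. ennreal (w x) \<partial>?M) \<le> ennreal (K * \<kappa>)"
  proof -
    have "(\<integral>\<^sup>+x. ennreal (w x) \<partial>?M) = (\<integral>\<^sup>+x. ennreal (2 * b) * ennreal ((cmod (G 1 x - g 1 x))\<^sup>2) +
        ennreal (2 * b) * ennreal ((cmod (G 2 x - g 2 x))\<^sup>2) + ennreal (4 * b * R\<^sup>2 + 1 / 2) * ennreal ((cmod (U x - u x))\<^sup>2) \<partial>?M)"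
      using b by (intro nn_integral_cong) (simp add: w_def ennreal_mult[symmetric] ennreal_plus[symmetric] del: ennreal_plus)
    also have "\<dots> = ennreal (2 * b) * (\<integral>\<^sup>+x. ennreal ((cmod (G 1 x - g 1 x))\<^sup>2) \<partial>?M)
        + ennreal (2 * b) * (\<integral>\<^sup>+x. ennreal ((cmod (G 2 x - g 2 x))\<^sup>2) \<partial>?M)
        + ennreal (4 * b * R\<^sup>2 + 1 / 2) * (\<integral>\<^sup>+x. ennreal ((cmod (U x - u x))\<^sup>2) \<partial>?M)"
      by (simp add: nn_integral_add nn_integral_cmult)
    also have "\<dots> \<le> ennreal (2 * b) * ennreal \<kappa> + ennreal (2 * b) * ennreal \<kappa> + ennreal (4 * b * R\<^sup>2 + 1 / 2) * ennreal \<kappa>"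
      by (intro add_mono mult_left_mono Uu Gg) auto
    also have "\<dots> = ennreal (2 * b * \<kappa> + 2 * b * \<kappa> + (4 * b * R\<^sup>2 + 1 / 2) * \<kappa>)"
      using b \<kappa> by (simp add: ennreal_mult[symmetric] ennreal_plus[symmetric] del: ennreal_plus)
    also have "2 * b * \<kappa> + 2 * b * \<kappa> + (4 * b * R\<^sup>2 + 1 / 2) * \<kappa> = K * \<kappa>"
      by (simp add: K_def algebra_simps)
    finally show ?thesis .
  qed
  have "ennreal energy \<le> (\<integral>\<^sup>+x. ennreal (1 + t) * ennreal (GL_density b u g x) + ennreal q * ennreal (w x) \<partial>?M)"
    unfolding energy_eq_nn_integral
  proof (rule nn_integral_mono)
    fix x assume "x \<in> space ?M"
    then have x: "x \<in> cubeQ R" using sub by auto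
    have "ennreal (b * ((cmod (covD U G 1 x))\<^sup>2 + (cmod (covD U G 2 x))\<^sup>2) + (1 - cmod (U x))\<^sup>2 / 2)
      \<le> ennreal ((1 + t) * GL_density b u g x + q * w x)"
      unfolding q_def w_def by (intro ennreal_leI GL_density_perturb t b x)
    also have "\<dots> = ennreal (1 + t) * ennreal (GL_density b u g x) + ennreal q * ennreal (w x)"
      using t q dens0 w0 by (simp add: ennreal_mult[symmetric] ennreal_plus[symmetric] del: ennreal_plus)
    finally show "ennreal (b * ((cmod (covD U G 1 x))\<^sup>2 + (cmod (covD U G 2 x))\<^sup>2) + (1 - cmod (U x))\<^sup>2 / 2)
      \<le> ennreal (1 + t) * ennreal (GL_density b u g x) + ennreal q * ennreal (w x)" .
  qed
  also have "\<dots> = ennreal (1 + t) * (\<integral>\<^sup>+x. ennreal (GL_density b u g x) \<partial>?M) + ennreal q * (\<integral>\<^sup>+x. ennreal (w x) \<partial>?M)"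
    by (simp add: nn_integral_add nn_integral_cmult)
  also have "\<dots> \<le> ennreal (1 + t) * ennreal E + ennreal q * ennreal (K * \<kappa>)"
  proof (intro add_mono mult_left_mono w_int)
    have "(\<integral>\<^sup>+x. ennreal (GL_density b u g x) \<partial>?M) \<le> GL_energy b R u g"
      unfolding GL_energy_eq by (rule nn_integral_lebesgue_on_mono[OF sub cubeQ_lebesgue cubeQ_lebesgue])
    then show "(\<integral>\<^sup>+x. ennreal (GL_density b u g x) \<partial>?M) \<le> ennreal E" using E by simp
  qed auto
  also have "\<dots> = ennreal ((1 + t) * E + q * (K * \<kappa>))"
    using t E q K \<kappa>(1) by (simp add: ennreal_mult[symmetric] ennreal_plus[symmetric] del: ennreal_plus)
  also have "\<dots> \<le> ennreal (E + \<eta>)"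
    using t(2) \<kappa>(2) by (intro ennreal_leI) (simp add: algebra_simps)
  finally have "energy \<le> E + \<eta>" using E \<eta> by (subst (asm) ennreal_le_iff) auto
  then show ?thesis using that smooth_config_axioms by blast
qed

text \<open>\<open>smooth_lower_bound\<close> is applied on the cube of side R - 1 to approximants
  of energy at most E + \<eta>. The inequality is affine in the energy with slope - s, so the excess
  costs at most s \<eta>, and \<eta> is arbitrary.\<close>

theorem GL_lower_bound:
  assumes ug: "H1_weak_grad (cubeQ R) u g" and b: "b > 0" and c: "0 < c" "c < 1"
    and E: "GL_energy b R u g \<le> ennreal E" "0 \<le> E"
    and r: "sqrt b \<le> r0" "r0 \<le> r1" "r1 \<le> 1" and l: "0 < l" "0 \<le> R - 5 - 2 * l" and \<mu>: "\<mu> > 0"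
  shows "(1 - r1\<^sup>2) * ln (r1 / r0) * ((R - 5 - 2 * l) ^ 3 - (\<mu> * (R - 1) ^ 3 + E / (b * c) / \<mu>) / l)
    \<le> E * (1 / (b * c) + 64 * pi / ((1 - c)\<^sup>2 * sqrt b * r0))"
proof -
  have R: "R > 1" using l by simp
  have r0: "r0 > 0" using b r(1) by (meson less_le_trans real_sqrt_gt_zero)
  define k where "k = (1 - r1\<^sup>2) * ln (r1 / r0)"
  have k: "k \<ge> 0" unfolding k_def using r r0 by (intro mult_nonneg_nonneg) (auto simp: power_le_one)
  define d where "d = 1 / (b * c) + 64 * pi / ((1 - c)\<^sup>2 * sqrt b * r0)"
  have d: "d \<ge> 0" unfolding d_def using b c r0 by (intro add_nonneg_nonneg) auto
  define s where "s = k * (1 / (b * c * \<mu> * l)) + d"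
  have s: "s \<ge> 0" unfolding s_def using k d b c \<mu> l by (intro add_nonneg_nonneg mult_nonneg_nonneg) auto
  define F where "F e = k * ((R - 5 - 2 * l) ^ 3 - (\<mu> * (R - 1) ^ 3 + e / (b * c) / \<mu>) / l) - e * d" for e
  have F_affine: "F e = F e' + s * (e' - e)" for e e'
    unfolding F_def s_def using b c \<mu> l by (simp add: field_simps)
  have "F E \<le> 0 + \<epsilon>" if \<epsilon>: "\<epsilon> > 0" for \<epsilon>
  proof -
    define \<eta> where "\<eta> = \<epsilon> / (s + 1)"
    have \<eta>: "\<eta> > 0" "s * \<eta> \<le> \<epsilon>" using \<epsilon> s by (auto simp: \<eta>_def field_simps)
    obtain U G where "smooth_config U G b c (R - 1)" and en: "smooth_config.energy U G b (R - 1) \<le> E + \<eta>"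
      using smooth_energy_le[OF ug b c R E \<eta>(1)] by blast
    interpret smooth_config U G b c "R - 1" by fact
    have "k * ((R - 1 - 4 - 2 * l) ^ 3 - (\<mu> * (R - 1) ^ 3 + energy / (b * c) / \<mu>) / l) \<le> energy * d"
      unfolding k_def d_def using smooth_lower_bound[OF r l(1) _ \<mu>] l(2) by simp
    then have "F energy \<le> 0" by (simp add: F_def)
    moreover have "F E = F energy + s * (energy - E)" by (rule F_affine)
    moreover have "s * (energy - E) \<le> s * \<eta>" using en s by (intro mult_left_mono) auto
    ultimately show ?thesis using \<eta>(2) by linarith
  qed
  then have "F E \<le> 0" by (rule field_le_epsilon)
  then show ?thesis by (simp add: F_def k_def d_def)
qed

section \<open>The vortex lattice\<close>

text \<open>The integral of the shifted v does not depend on the shift t; differentiating under the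
  integral at t = 0 gives the integral of v'. Shifts up to length 1 account for the 1 in the
  condition on N.\<close>

lemma integral_directional_derivative_eq_0:
  fixes v v' :: "real^3 \<Rightarrow> complex"
  assumes v: "continuous_on UNIV v" and v': "continuous_on UNIV v'"
    and deriv: "\<And>x. ((\<lambda>t. v (x + t *\<^sub>R e)) has_vector_derivative v' x) (at 0)"
    and supp: "\<And>x. M < norm x \<Longrightarrow> v x = 0" and e: "norm e = 1" and N: "1 + M \<le> N"
  shows "integral (Box N) v' = 0"
proof -
  let ?A = "\<lambda>t. integral (Box N) (\<lambda>x. v (x + t *\<^sub>R e))"
  have deriv': "((\<lambda>t. v (x + t *\<^sub>R e)) has_vector_derivative v' (x + t *\<^sub>R e)) (at t)" for x t
  proof -
    have "((\<lambda>s. v (x + t *\<^sub>R e + s *\<^sub>R e)) has_vector_derivative v' (x + t *\<^sub>R e)) (at 0)"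
      by (rule deriv)
    moreover have "((\<lambda>s. s - t) has_vector_derivative 1) (at t)"
      by (auto intro!: derivative_eq_intros)
    ultimately have "((\<lambda>s. v (x + t *\<^sub>R e + s *\<^sub>R e)) \<circ> (\<lambda>s. s - t) has_vector_derivative 1 *\<^sub>R v' (x + t *\<^sub>R e)) (at t)"
      by (intro vector_diff_chain_at) auto
    then show ?thesis by (simp add: o_def algebra_simps)
  qed
  have "(?A has_vector_derivative integral (Box N) (\<lambda>x. v' (x + 0 *\<^sub>R e))) (at 0 within {-1..1})"
  proof (rule leibniz_rule_vector_derivative[where fx = "\<lambda>t x. v' (x + t *\<^sub>R e)"])
    show "((\<lambda>t. v (x + t *\<^sub>R e)) has_vector_derivative v' (x + t *\<^sub>R e)) (at t within {-1..1})" for x t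
      by (rule has_vector_derivative_at_within[OF deriv'])
    show "(\<lambda>x. v (x + t *\<^sub>R e)) integrable_on Box N" for t
      by (intro integrable_continuous continuous_on_compose2[OF v] continuous_intros) auto
    show "continuous_on ({-1..1} \<times> Box N) (\<lambda>(t, x). v' (x + t *\<^sub>R e))"
      unfolding split_beta by (intro continuous_on_compose2[OF v'] continuous_intros) auto
  qed auto
  then have "(?A has_vector_derivative integral (Box N) v') (at 0 within {-1..1})" by simp
  moreover have "(?A has_vector_derivative 0) (at 0 within {-1..1})"
  proof (rule has_vector_derivative_transform[where f = "\<lambda>t. integral (Box N) v"])
    show "?A t = integral (Box N) v" if "t \<in> {-1..1}" for t
      by (rule integral_Box_translate[where M = M]) (use supp that e N in auto)
  qed auto
  ultimately show ?thesis
    using vector_derivative_unique_within_closed_interval[of "-1" 1 0 ?A] by auto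
qed

lemma test_fun_bounded_support:
  assumes "test_fun S \<phi>"
  obtains M where "M > 0" "\<And>x. M < norm x \<Longrightarrow> \<phi> x = 0"
proof -
  have "bounded (closure {x. \<phi> x \<noteq> 0})"
    using assms unfolding test_fun_def by (blast intro: compact_imp_bounded)
  then obtain M where M: "M > 0" "\<And>x. x \<in> closure {x. \<phi> x \<noteq> 0} \<Longrightarrow> norm x \<le> M"
    unfolding bounded_pos by blast
  have "\<phi> x = 0" if "M < norm x" for x
  proof (rule ccontr)
    assume "\<phi> x \<noteq> 0"
    then have "x \<in> closure {x. \<phi> x \<noteq> 0}" by (intro subsetD[OF closure_subset]) simp
    then show False using M(2)[of x] that by simp
  qed
  with M(1) show ?thesis by (rule that)
qed

lemma continuous_integrable_cubeQ:
  fixes h :: "real^3 \<Rightarrow> complex"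
  shows "continuous_on UNIV h \<Longrightarrow> integrable (lebesgue_on (cubeQ R)) h"
  by (rule L2_on_integrable[OF bounded_L2_on_cubeQ])

text \<open>The product U \<phi> has compact support, so its j-th derivative integrates to 0; the
  product rule splits this into the two sides of the defining identity.\<close>

lemma C1_imp_H1_weak_grad:
  fixes U :: "real^3 \<Rightarrow> complex"
  assumes U: "continuous_on UNIV U" and G: "\<And>j. continuous_on UNIV (G j)"
    and deriv: "\<And>x. (U has_derivative (\<lambda>d. \<Sum>j\<in>UNIV. d $ j *\<^sub>R G j x)) (at x)"
  shows "H1_weak_grad (cubeQ R) U G"
  unfolding H1_weak_grad_def
proof (intro conjI allI impI bounded_L2_on_cubeQ U G)
  fix j \<phi> assume \<phi>: "test_fun (cubeQ R) \<phi>"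
  have "Ck 1 \<phi>" using \<phi> unfolding test_fun_def smooth3_def by blast
  then have c\<phi>: "continuous_on UNIV \<phi>" and d\<phi>: "\<phi> differentiable_on UNIV" and p\<phi>: "continuous_on UNIV (pderiv3 j \<phi>)"
    by auto
  obtain M where M: "M > 0" "\<And>x. M < norm x \<Longrightarrow> \<phi> x = 0" by (rule test_fun_bounded_support[OF \<phi>]) blast
  have zero: "\<phi> x = 0" if "x \<notin> cubeQ R" for x
  proof (rule ccontr)
    assume "\<phi> x \<noteq> 0"
    then have "x \<in> closure {x. \<phi> x \<noteq> 0}" by (intro subsetD[OF closure_subset]) simp
    then show False using \<phi> that unfolding test_fun_def by auto
  qed
  have zero': "pderiv3 j \<phi> x = 0" if x: "x \<notin> cubeQ R" for x
  proof -
    have "(\<phi> has_derivative (\<lambda>d. 0)) (at x)"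
    proof (rule has_derivative_transform_within_open)
      show "((\<lambda>x. 0) has_derivative (\<lambda>d. 0)) (at x)" by (rule has_derivative_const)
      show "open (- closure {x. \<phi> x \<noteq> 0})" by (simp add: open_Compl)
      show "x \<in> - closure {x. \<phi> x \<noteq> 0}" using \<phi> x unfolding test_fun_def by auto
      show "0 = \<phi> y" if "y \<in> - closure {x. \<phi> x \<noteq> 0}" for y
      proof (rule ccontr)
        assume "0 \<noteq> \<phi> y"
        then have "y \<in> closure {x. \<phi> x \<noteq> 0}" by (intro subsetD[OF closure_subset]) simp
        then show False using that by simp
      qed
    qed
    from pderiv3_eq[OF this] show ?thesis by simp
  qed
  define N where "N = max (1 + M) \<bar>R\<bar>"
  let ?v = "\<lambda>x. U x * complex_of_real (\<phi> x)"
  let ?v' = "\<lambda>x. U x * complex_of_real (pderiv3 j \<phi> x) + G j x * complex_of_real (\<phi> x)"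
  have cv': "continuous_on UNIV ?v'"
    by (intro continuous_intros U G c\<phi> p\<phi>)
  have "integral (Box N) ?v' = 0"
  proof (rule integral_directional_derivative_eq_0[where v = ?v and e = "axis j 1" and M = M])
    show "continuous_on UNIV ?v" by (intro continuous_intros U c\<phi>)
    show "((\<lambda>t. ?v (x + t *\<^sub>R axis j 1)) has_vector_derivative ?v' x) (at 0)" for x
    proof -
      have line: "((\<lambda>t. x + t *\<^sub>R axis j 1) has_derivative (\<lambda>t. t *\<^sub>R axis j 1)) (at 0)"
        by (auto intro!: derivative_eq_intros)
      have "(U has_derivative (\<lambda>d. \<Sum>j\<in>UNIV. d $ j *\<^sub>R G j x)) (at (x + 0 *\<^sub>R axis j 1))"
        using deriv[of x] by simp
      from has_derivative_compose[OF line this]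
      have 1: "((\<lambda>t. U (x + t *\<^sub>R axis j 1)) has_vector_derivative G j x) (at 0)"
        unfolding has_vector_derivative_def
        by (simp add: axis_def if_distrib[of "\<lambda>r. (_ * r) *\<^sub>R _"] cong: if_cong)
      have D: "(\<phi> has_derivative frechet_derivative \<phi> (at x)) (at (x + 0 *\<^sub>R axis j 1))"
        using differentiable_on_UNIV_D[OF d\<phi>, of x] by simp
      interpret linear "frechet_derivative \<phi> (at x)"
        using differentiable_on_UNIV_D[OF d\<phi>, of x] by (rule has_derivative_linear)
      have "((\<lambda>t. \<phi> (x + t *\<^sub>R axis j 1)) has_vector_derivative pderiv3 j \<phi> x) (at 0)"
        using has_derivative_compose[OF line D] unfolding has_vector_derivative_def
        by (simp add: scale pderiv3_def)
      from bounded_linear.has_vector_derivative[OF bounded_linear_of_real this]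
      have 2: "((\<lambda>t. complex_of_real (\<phi> (x + t *\<^sub>R axis j 1))) has_vector_derivative complex_of_real (pderiv3 j \<phi> x)) (at 0)"
        .
      show ?thesis
        using has_vector_derivative_mult[OF 1 2] by simp
    qed
  qed (use cv' M in \<open>auto simp: N_def\<close>)
  moreover have "integral (Box N) ?v' = integral (cubeQ R) ?v'"
  proof -
    have "integral (Box N) ?v' = integral (Box N) (\<lambda>x. if x \<in> cubeQ R then ?v' x else 0)"
      using zero zero' by (intro integral_cong) auto
    also have "\<dots> = integral (Box N \<inter> cubeQ R) ?v'"
      by (simp add: integral_restrict_Int Int_commute)
    also have "Box N \<inter> cubeQ R = cubeQ R"
    proof -
      have "x \<in> Box N" if "x \<in> cubeQ R" for x
        unfolding mem_Box
      proof
        fix i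
        have "- R / 2 < x $ i" "x $ i < R / 2" using that by (auto simp: cubeQ_def)
        then show "\<bar>x $ i\<bar> \<le> N" by (simp add: N_def)
      qed
      then show ?thesis by blast
    qed
    finally show ?thesis .
  qed
  moreover have "integral (cubeQ R) ?v' = (LINT x|lebesgue_on (cubeQ R). ?v' x)"
    by (intro lebesgue_integral_eq_integral[symmetric] continuous_integrable_cubeQ cv' cubeQ_lebesgue)
  moreover have "(LINT x|lebesgue_on (cubeQ R). ?v' x) = (LINT x|lebesgue_on (cubeQ R). U x * complex_of_real (pderiv3 j \<phi> x))
      + (LINT x|lebesgue_on (cubeQ R). G j x * complex_of_real (\<phi> x))"
    by (intro Bochner_Integration.integral_add continuous_integrable_cubeQ continuous_intros U G c\<phi> p\<phi>)
  ultimately show "(LINT x|lebesgue_on (cubeQ R). U x * complex_of_real (pderiv3 j \<phi> x))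
          = - (LINT x|lebesgue_on (cubeQ R). G j x * complex_of_real (\<phi> x))"
    by (simp add: add_eq_0_iff2)
qed

text \<open>A smooth substitute for z / |z| with core size s. For s = sqrt b the kinetic and
  potential energies of a vortex core are of the same order.\<close>

definition sat :: "real \<Rightarrow> complex \<Rightarrow> complex" where
  "sat s z = z /\<^sub>R sqrt ((cmod z)\<^sup>2 + s\<^sup>2)"

definition dsat :: "real \<Rightarrow> complex \<Rightarrow> complex \<Rightarrow> complex" where
  "dsat s z v = v /\<^sub>R sqrt ((cmod z)\<^sup>2 + s\<^sup>2) - (Re (cnj z * v) / (sqrt ((cmod z)\<^sup>2 + s\<^sup>2)) ^ 3) *\<^sub>R z"

lemma sat_root_pos: "s > 0 \<Longrightarrow> sqrt ((cmod z)\<^sup>2 + s\<^sup>2) > 0"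
  by (simp add: add_nonneg_pos)

lemma sat_has_derivative:
  assumes s: "s > 0"
  shows "(sat s has_derivative dsat s z) (at z)"
proof -
  define \<rho> where "\<rho> = sqrt ((cmod z)\<^sup>2 + s\<^sup>2)"
  have \<rho>: "\<rho> > 0" unfolding \<rho>_def by (rule sat_root_pos[OF s])
  have "((\<lambda>z. (cmod z)\<^sup>2 + s\<^sup>2) has_derivative (\<lambda>v. 2 * Re (cnj z * v))) (at z)"
    unfolding cmod_power2 by (auto intro!: derivative_eq_intros simp: algebra_simps)
  then have "((\<lambda>z. sqrt ((cmod z)\<^sup>2 + s\<^sup>2)) has_derivative (\<lambda>v. 2 * Re (cnj z * v) * (inverse (sqrt ((cmod z)\<^sup>2 + s\<^sup>2)) / 2))) (at z)"
    using s by (intro has_derivative_real_sqrt) (auto intro: add_nonneg_pos)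
  then have "((\<lambda>z. inverse (sqrt ((cmod z)\<^sup>2 + s\<^sup>2))) has_derivative
      (\<lambda>v. - (inverse (sqrt ((cmod z)\<^sup>2 + s\<^sup>2)) * (2 * Re (cnj z * v) * (inverse (sqrt ((cmod z)\<^sup>2 + s\<^sup>2)) / 2)) * inverse (sqrt ((cmod z)\<^sup>2 + s\<^sup>2))))) (at z)"
    using \<rho> unfolding \<rho>_def by (intro Deriv.has_derivative_inverse) auto
  from has_derivative_scaleR[OF this has_derivative_ident]
  have "((\<lambda>z. inverse (sqrt ((cmod z)\<^sup>2 + s\<^sup>2)) *\<^sub>R z) has_derivative
      (\<lambda>v. inverse \<rho> *\<^sub>R v + (- (inverse \<rho> * (2 * Re (cnj z * v) * (inverse \<rho> / 2)) * inverse \<rho>)) *\<^sub>R z)) (at z)"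
    unfolding \<rho>_def .
  also have "(\<lambda>v. inverse \<rho> *\<^sub>R v + (- (inverse \<rho> * (2 * Re (cnj z * v) * (inverse \<rho> / 2)) * inverse \<rho>)) *\<^sub>R z) = dsat s z"
  proof
    fix v
    have "inverse \<rho> * (2 * R * (inverse \<rho> / 2)) * inverse \<rho> = R / \<rho> ^ 3" for R
      using \<rho> by (simp add: field_simps power3_eq_cube)
    then show "inverse \<rho> *\<^sub>R v + (- (inverse \<rho> * (2 * Re (cnj z * v) * (inverse \<rho> / 2)) * inverse \<rho>)) *\<^sub>R z = dsat s z v"
      unfolding dsat_def \<rho>_def[symmetric] by (simp only: scaleR_minus_left diff_conv_add_uminus)
  qed
  finally show ?thesis unfolding sat_def[abs_def] .
qed

text \<open>Only the component of v along z is reduced by the normalisation. A v orthogonal to z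
  keeps |v|^2 / (|z|^2 + s^2), the source of the logarithm.\<close>

lemma norm_dsat_sq:
  assumes s: "s > 0"
  shows "(cmod (dsat s z v))\<^sup>2 = (cmod v)\<^sup>2 / ((cmod z)\<^sup>2 + s\<^sup>2) -
    (Re (cnj z * v))\<^sup>2 * ((cmod z)\<^sup>2 + 2 * s\<^sup>2) / ((cmod z)\<^sup>2 + s\<^sup>2) ^ 3"
proof -
  define \<rho> where "\<rho> = sqrt ((cmod z)\<^sup>2 + s\<^sup>2)"
  have \<rho>: "\<rho> > 0" unfolding \<rho>_def by (rule sat_root_pos[OF s])
  have \<rho>2: "(cmod z)\<^sup>2 + s\<^sup>2 = \<rho>\<^sup>2" by (simp add: \<rho>_def)
  define a where "a = Re (cnj z * v)"
  have "(cmod (dsat s z v))\<^sup>2 = (cmod v)\<^sup>2 / \<rho>\<^sup>2 - 2 * a\<^sup>2 / \<rho> ^ 4 + a\<^sup>2 * (cmod z)\<^sup>2 / \<rho> ^ 6"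
  proof -
    have "(cmod (i *\<^sub>R v - (a * i ^ 3) *\<^sub>R z))\<^sup>2 = (cmod v)\<^sup>2 * i\<^sup>2 - 2 * a\<^sup>2 * i ^ 4 + a\<^sup>2 * (cmod z)\<^sup>2 * i ^ 6" for i
      unfolding cmod_power2 a_def by (simp add: algebra_simps power2_eq_square eval_nat_numeral)
    from this[of "inverse \<rho>"] show ?thesis
      unfolding dsat_def \<rho>_def[symmetric] a_def[symmetric] by (simp add: divide_inverse power_inverse)
  qed
  also have "\<dots> = (cmod v)\<^sup>2 / \<rho>\<^sup>2 - a\<^sup>2 * (2 * \<rho>\<^sup>2 - (cmod z)\<^sup>2) / \<rho> ^ 6"
    using \<rho> by (simp add: field_simps power2_eq_square eval_nat_numeral)
  also have "2 * \<rho>\<^sup>2 - (cmod z)\<^sup>2 = (cmod z)\<^sup>2 + 2 * s\<^sup>2" using \<rho>2 by simp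
  also have "\<rho> ^ 6 = (\<rho>\<^sup>2) ^ 3" by (simp flip: power_mult)
  finally show ?thesis unfolding \<rho>2 a_def .
qed

lemma dsat_mult_phase: "cmod p = 1 \<Longrightarrow> dsat s (p * z) (p * v) = p * dsat s z v"
proof -
  assume p: "cmod p = 1"
  then have "cnj p * p = 1" using complex_norm_square[of p] by (simp add: mult.commute)
  then have e: "cnj (p * z) * (p * v) = cnj z * v" by (metis (no_types, lifting) complex_cnj_mult mult.assoc mult.commute mult_1)
  have n: "cmod (p * z) = cmod z" using p by (simp add: norm_mult)
  show ?thesis unfolding dsat_def e n by (simp add: right_diff_distrib)
qed

lemma sat_mult_phase: "cmod p = 1 \<Longrightarrow> sat s (p * z) = p * sat s z"
  by (simp add: sat_def norm_mult)

lemma dsat_add: "dsat s z (v + w) = dsat s z v + dsat s z w"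
  unfolding dsat_def by (simp add: distrib_left scaleR_add_left add_divide_distrib algebra_simps)

lemma dsat_scaleR: "dsat s z (r *\<^sub>R v) = r *\<^sub>R dsat s z v"
  unfolding dsat_def by (simp add: scaleR_diff_right algebra_simps)

text \<open>i r z is an infinitesimal rotation, and \<open>sat\<close> commutes with rotations. In
  \<open>trial_density_le\<close> this is the term that meets the vector potential.\<close>

lemma dsat_tangential: "dsat s z (\<i> * of_real r * z) = \<i> * of_real r * sat s z"
proof -
  have "Re (cnj z * (\<i> * of_real r * z)) = 0" by (simp add: algebra_simps)
  then show ?thesis by (simp add: dsat_def sat_def)
qed

lemma norm_sat_le: "s > 0 \<Longrightarrow> cmod (sat s z) \<le> 1"
proof -
  assume s: "s > 0"
  have "cmod z \<le> sqrt ((cmod z)\<^sup>2 + s\<^sup>2)" by (rule real_le_rsqrt) simp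
  then show ?thesis using sat_root_pos[OF s, of z] by (simp add: sat_def field_simps)
qed

lemma sat_potential: "s > 0 \<Longrightarrow> (1 - (cmod (sat s z))\<^sup>2)\<^sup>2 = s ^ 4 / ((cmod z)\<^sup>2 + s\<^sup>2)\<^sup>2"
proof -
  assume s: "s > 0"
  have r: "(cmod z)\<^sup>2 + s\<^sup>2 > 0" using s by (simp add: add_nonneg_pos)
  have "(cmod (sat s z))\<^sup>2 = (cmod z)\<^sup>2 / ((cmod z)\<^sup>2 + s\<^sup>2)"
    using r by (simp add: sat_def power_mult_distrib power_divide divide_inverse power_inverse)
  then have "1 - (cmod (sat s z))\<^sup>2 = s\<^sup>2 / ((cmod z)\<^sup>2 + s\<^sup>2)"
  proof -
    have "1 - a / d = (d - a) / d" if "0 < d" for a d :: real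
      using that by (simp add: diff_divide_distrib)
    from this[OF r, of "(cmod z)\<^sup>2"] show ?thesis
      unfolding \<open>(cmod (sat s z))\<^sup>2 = _\<close> by simp
  qed
  then show ?thesis by (simp add: power_divide flip: power_mult)
qed

lemma abs_mult_cos_le_abs_sin:
  assumes "\<bar>y\<bar> \<le> pi / 2" shows "\<bar>y\<bar> * cos y \<le> \<bar>sin y\<bar>"
proof -
  have pos: "t * cos t \<le> sin t" if t: "0 \<le> t" "t \<le> pi / 2" for t
  proof -
    have "(\<lambda>t. sin t - t * cos t) 0 \<le> (\<lambda>t. sin t - t * cos t) t"
    proof (rule DERIV_nonneg_imp_nondecreasing[OF t(1)])
      fix x assume x: "0 \<le> x" "x \<le> t"
      have "((\<lambda>t. sin t - t * cos t) has_real_derivative x * sin x) (at x)"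
        by (auto intro!: derivative_eq_intros)
      moreover have "0 \<le> x * sin x" using x t by (intro mult_nonneg_nonneg sin_ge_zero) auto
      ultimately show "\<exists>y. ((\<lambda>t. sin t - t * cos t) has_real_derivative y) (at x) \<and> 0 \<le> y" by blast
    qed
    then show ?thesis by simp
  qed
  show ?thesis
  proof (cases "y \<ge> 0")
    case True
    then show ?thesis using pos[of y] assms by simp
  next
    case False
    then show ?thesis using pos[of "- y"] assms by simp
  qed
qed

text \<open>With \<open>h = - sin y + \<i> sin \<xi> cos y\<close> the quantities below are \<open>m = |h|\<^sup>2\<close>, \<open>T = |\<nabla>h|\<^sup>2\<close>, and
  \<open>A\<close>, \<open>B\<close> are the squared lengths of the real and imaginary parts of \<open>cnj h * \<nabla>h\<close>. Only \<open>B\<close>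
  produces the logarithm; the radial part \<open>A\<close> is damped outside the core.\<close>

lemma cell_kinetic:
  fixes \<xi> y s :: real
  defines "m \<equiv> (sin y)\<^sup>2 + (sin \<xi>)\<^sup>2 * (cos y)\<^sup>2"
    and "T \<equiv> (cos \<xi>)\<^sup>2 * (cos y)\<^sup>2 + (cos y)\<^sup>2 + (sin \<xi>)\<^sup>2 * (sin y)\<^sup>2"
    and "A \<equiv> (sin \<xi> * cos \<xi> * (cos y)\<^sup>2)\<^sup>2 + (sin y * cos y * (cos \<xi>)\<^sup>2)\<^sup>2"
  defines "K \<equiv> T / (m + s\<^sup>2) - A * (m + 2 * s\<^sup>2) / (m + s\<^sup>2) ^ 3"
  assumes s: "s > 0"
  shows "K \<le> 2 / (m + s\<^sup>2)"
    and "0 < \<gamma> \<Longrightarrow> \<gamma> \<le> (cos y)\<^sup>2 \<Longrightarrow> K \<le> 1 / \<gamma> / (m + s\<^sup>2) + 2 * s\<^sup>2 / (m + s\<^sup>2)\<^sup>2"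
proof -
  define B where "B = (sin y * cos y * cos \<xi>)\<^sup>2 + (sin \<xi>)\<^sup>2"
  define \<rho> where "\<rho> = m + s\<^sup>2"
  have m: "m \<ge> 0" by (simp add: m_def)
  have \<rho>: "\<rho> > 0" "s\<^sup>2 \<le> \<rho>" using m s by (auto simp: \<rho>_def add_nonneg_pos)
  have A: "A \<ge> 0" by (simp add: A_def)
  have B0: "B \<ge> 0" by (simp add: B_def)
  define a c p q where "a = (sin \<xi>)\<^sup>2" and "c = (cos \<xi>)\<^sup>2" and "p = (sin y)\<^sup>2" and "q = (cos y)\<^sup>2"
  have ac: "a + c = 1" and pq: "p + q = 1" by (simp_all add: a_def c_def p_def q_def)
  have nn: "a \<ge> 0" "c \<ge> 0" "p \<ge> 0" "q \<ge> 0" by (simp_all add: a_def c_def p_def q_def)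
  have le1: "a \<le> 1" "c \<le> 1" "p \<le> 1" "q \<le> 1" using ac pq nn by linarith+
  have forms: "m = p + a * q" "T = c * q + q + a * p" "A = a * c * q\<^sup>2 + p * q * c\<^sup>2" "B = p * q * c + a"
    by (simp_all add: m_def T_def A_def B_def a_def c_def p_def q_def power_mult_distrib)
  \<comment> \<open>This is |h|^2 |grad h|^2 = |cnj h grad h|^2, split into real and imaginary
    parts.\<close>
  have mT: "m * T = A + B"
    unfolding forms using ac pq by algebra
  have T2: "T \<le> 2"
  proof -
    have "c * q \<le> q" "a * p \<le> p" using le1 nn by (auto intro: mult_left_le_one_le mult_right_le_one_le)
    then have "T \<le> q + q + p" unfolding forms by linarith
    then show ?thesis using pq le1 by linarith
  qed
  have "K \<le> T / \<rho>"
    unfolding K_def \<rho>_def[symmetric] using A m s \<rho> by simp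
  also have "\<dots> \<le> 2 / \<rho>" using T2 \<rho> by (intro divide_right_mono) auto
  finally show "K \<le> 2 / (m + s\<^sup>2)" by (simp add: \<rho>_def)
  assume \<gamma>: "0 < \<gamma>" "\<gamma> \<le> (cos y)\<^sup>2"
  show "K \<le> 1 / \<gamma> / (m + s\<^sup>2) + 2 * s\<^sup>2 / (m + s\<^sup>2)\<^sup>2"
  proof (cases "m = 0")
    case True
    have "K \<le> 2 / s\<^sup>2" using \<open>K \<le> 2 / (m + s\<^sup>2)\<close> True by simp
    also have "\<dots> = 2 * s\<^sup>2 / (m + s\<^sup>2)\<^sup>2" using True s by (simp add: power2_eq_square)
    also have "\<dots> \<le> 1 / \<gamma> / (m + s\<^sup>2) + 2 * s\<^sup>2 / (m + s\<^sup>2)\<^sup>2" using \<gamma> m s by simp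
    finally show ?thesis .
  next
    case False
    then have m0: "m > 0" using m by simp
    \<comment> \<open>Inserting T = (A + B) / m separates the phase part, of order 1 / \<rho>, from
      the radial part, whose factor s^4 / \<rho>^3 confines it to the core.\<close>
    have "K = B / m / \<rho> + A / m * (s\<^sup>2 * s\<^sup>2 / \<rho> ^ 3)"
    proof -
      have T: "T = (A + B) / m" using mT m0 by (simp add: field_simps)
      have e: "m + 2 * s\<^sup>2 = \<rho> + s\<^sup>2" "s\<^sup>2 * s\<^sup>2 = \<rho> * \<rho> - m * (\<rho> + s\<^sup>2)"
        by (simp_all add: \<rho>_def algebra_simps)
      have "(A + B) / m / \<rho> - A * (\<rho> + S) / \<rho> ^ 3 = B / m / \<rho> + A / m * ((\<rho> * \<rho> - m * (\<rho> + S)) / \<rho> ^ 3)" for S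
        using m0 \<rho>(1) by (simp add: field_simps power3_eq_cube)
      then show ?thesis
        unfolding K_def \<rho>_def[symmetric] e T .
    qed
    also have "B / m / \<rho> \<le> 1 / \<gamma> / \<rho>"
    proof (rule divide_right_mono)
      have "q * (q * c) \<le> 1 * 1" using nn le1 by (intro mult_mono mult_le_one) auto
      then have "p * (q * (q * c)) \<le> p * 1" using nn by (intro mult_left_mono) auto
      then have "q * B \<le> m" unfolding forms by (simp add: algebra_simps)
      moreover have "\<gamma> * B \<le> q * B" using \<gamma> B0 by (intro mult_right_mono) (auto simp: q_def)
      ultimately have "\<gamma> * B \<le> m" by linarith
      then show "B / m \<le> 1 / \<gamma>" using \<gamma> m0 by (simp add: field_simps)
    qed (use \<rho> in simp)
    also have "A / m * (s\<^sup>2 * s\<^sup>2 / \<rho> ^ 3) \<le> 2 * (s\<^sup>2 / \<rho>\<^sup>2)"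
    proof (rule mult_mono)
      have "A \<le> m * T" using mT B0 by simp
      also have "\<dots> \<le> m * 2" using T2 m by (intro mult_left_mono) auto
      finally show "A / m \<le> 2" using m0 by (simp add: field_simps)
      have "s\<^sup>2 * s\<^sup>2 / \<rho> ^ 3 = s\<^sup>2 / \<rho>\<^sup>2 * (s\<^sup>2 / \<rho>)"
        using \<rho> by (simp add: power3_eq_cube power2_eq_square)
      also have "\<dots> \<le> s\<^sup>2 / \<rho>\<^sup>2 * 1" using \<rho> by (intro mult_left_mono) auto
      finally show "s\<^sup>2 * s\<^sup>2 / \<rho> ^ 3 \<le> s\<^sup>2 / \<rho>\<^sup>2" by simp
    qed (use \<rho> A m in auto)
    finally show ?thesis by (simp add: \<rho>_def)
  qed
qed

section \<open>Bounds in a single lattice cell\<close>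

definition cell_m :: "real \<Rightarrow> real \<Rightarrow> real" where
  "cell_m \<xi> y = (sin y)\<^sup>2 + (sin \<xi>)\<^sup>2 * (cos y)\<^sup>2"

text \<open>The squared gradient of \<open>sat s\<close> composed with h, as
  \<open>norm_dsat_pair\<close> confirms; \<open>cell_m\<close> is |h|^2. The cell is scaled to
  [- pi / 2, pi / 2]^2 with its zero at the origin.\<close>

definition cell_K :: "real \<Rightarrow> real \<Rightarrow> real \<Rightarrow> real" where
  "cell_K s \<xi> y = ((cos \<xi>)\<^sup>2 * (cos y)\<^sup>2 + (cos y)\<^sup>2 + (sin \<xi>)\<^sup>2 * (sin y)\<^sup>2) / (cell_m \<xi> y + s\<^sup>2)
    - ((sin \<xi> * cos \<xi> * (cos y)\<^sup>2)\<^sup>2 + (sin y * cos y * (cos \<xi>)\<^sup>2)\<^sup>2) * (cell_m \<xi> y + 2 * s\<^sup>2) / (cell_m \<xi> y + s\<^sup>2) ^ 3"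

lemma cell_K_le:
  assumes "s > 0"
  shows "cell_K s \<xi> y \<le> 2 / (cell_m \<xi> y + s\<^sup>2)"
    and "0 < \<gamma> \<Longrightarrow> \<gamma> \<le> (cos y)\<^sup>2 \<Longrightarrow> cell_K s \<xi> y \<le> 1 / \<gamma> / (cell_m \<xi> y + s\<^sup>2) + 2 * s\<^sup>2 / (cell_m \<xi> y + s\<^sup>2)\<^sup>2"
  unfolding cell_K_def cell_m_def by (rule cell_kinetic[OF assms]; assumption)+

text \<open>Two powers of cos y0 come from |sin t| \<ge> |t| cos t, two more from the factor (cos
  y)^2. The constant tends to 1 with y0, so the leading coefficient of the energy is not
  lost.\<close>

lemma cell_m_near:
  assumes y0: "0 < y0" "y0 < pi / 2" and near: "\<bar>\<xi>\<bar> \<le> y0" "\<bar>y\<bar> \<le> y0"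
  shows "cos y0 ^ 4 * (\<xi>\<^sup>2 + y\<^sup>2) \<le> cell_m \<xi> y" "(cos y0)\<^sup>2 \<le> (cos y)\<^sup>2"
proof -
  have g: "0 < cos y0" "cos y0 \<le> 1" using y0 by (auto intro: cos_gt_zero_pi)
  have c: "cos y0 \<le> cos t" if "\<bar>t\<bar> \<le> y0" for t
    using that y0 cos_monotone_0_pi_le[of "\<bar>t\<bar>" y0] by simp
  have c2: "(cos y0)\<^sup>2 \<le> (cos t)\<^sup>2" if "\<bar>t\<bar> \<le> y0" for t
    using c[OF that] g by (intro power_mono) auto
  have s2: "t\<^sup>2 * (cos y0)\<^sup>2 \<le> (sin t)\<^sup>2" if t: "\<bar>t\<bar> \<le> y0" for t
  proof -
    have "\<bar>t\<bar> * cos y0 \<le> \<bar>t\<bar> * cos t" using c[OF t] by (intro mult_left_mono) auto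
    also have "\<dots> \<le> \<bar>sin t\<bar>" using t y0 by (intro abs_mult_cos_le_abs_sin) auto
    finally have "(\<bar>t\<bar> * cos y0)\<^sup>2 \<le> \<bar>sin t\<bar>\<^sup>2" using g by (intro power_mono) auto
    then show ?thesis by (simp add: power_mult_distrib)
  qed
  have "\<xi>\<^sup>2 * (cos y0)\<^sup>2 * (cos y0)\<^sup>2 \<le> (sin \<xi>)\<^sup>2 * (cos y)\<^sup>2"
    using s2[OF near(1)] c2[OF near(2)] by (intro mult_mono) auto
  moreover have "y\<^sup>2 * (cos y0)\<^sup>2 * (cos y0)\<^sup>2 \<le> (sin y)\<^sup>2 * 1"
    using s2[OF near(2)] g by (intro mult_mono power_le_one) auto
  moreover have "cos y0 ^ 4 * \<xi>\<^sup>2 = \<xi>\<^sup>2 * (cos y0)\<^sup>2 * (cos y0)\<^sup>2" "cos y0 ^ 4 * y\<^sup>2 = y\<^sup>2 * (cos y0)\<^sup>2 * (cos y0)\<^sup>2"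
    by (simp_all add: power4_eq_xxxx power2_eq_square)
  ultimately show "cos y0 ^ 4 * (\<xi>\<^sup>2 + y\<^sup>2) \<le> cell_m \<xi> y"
    unfolding cell_m_def distrib_left by linarith
  show "(cos y0)\<^sup>2 \<le> (cos y)\<^sup>2" by (rule c2[OF near(2)])
qed

lemma cell_m_far:
  assumes y0: "0 < y0" "y0 < pi / 2" and r: "\<bar>\<xi>\<bar> \<le> pi / 2" "\<bar>y\<bar> \<le> pi / 2" and far: "y0 \<le> \<bar>\<xi>\<bar> \<or> y0 \<le> \<bar>y\<bar>"
  shows "(sin y0)\<^sup>2 * (cos y0)\<^sup>2 \<le> cell_m \<xi> y"
proof -
  have g: "0 < cos y0" "0 < sin y0" using y0 by (auto intro: cos_gt_zero_pi sin_gt_zero)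
  have s2: "(sin y0)\<^sup>2 \<le> (sin t)\<^sup>2" if "y0 \<le> \<bar>t\<bar>" "\<bar>t\<bar> \<le> pi / 2" for t
  proof -
    have "sin y0 \<le> sin \<bar>t\<bar>" using that y0 by (intro sin_monotone_2pi_le) auto
    then have "(sin y0)\<^sup>2 \<le> (sin \<bar>t\<bar>)\<^sup>2" using g by (intro power_mono) auto
    then show ?thesis by (auto simp: abs_if split: if_splits)
  qed
  show ?thesis
  proof (cases "y0 \<le> \<bar>y\<bar>")
    case True
    have "(sin y0)\<^sup>2 * (cos y0)\<^sup>2 \<le> (sin y0)\<^sup>2 * 1"
      by (intro mult_left_mono) (auto simp: abs_square_le_1)
    also have "\<dots> \<le> cell_m \<xi> y" using s2[OF True r(2)] by (simp add: cell_m_def add_increasing2)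
    finally show ?thesis .
  next
    case False
    have "cos y0 \<le> cos \<bar>y\<bar>" using False y0 by (intro cos_monotone_0_pi_le) auto
    then have "(cos y0)\<^sup>2 \<le> (cos y)\<^sup>2" using g power_mono[of "cos y0" "cos \<bar>y\<bar>" 2] by simp
    then have "(sin y0)\<^sup>2 * (cos y0)\<^sup>2 \<le> (sin \<xi>)\<^sup>2 * (cos y)\<^sup>2"
      using False far s2[OF _ r(1)] by (intro mult_mono) auto
    then show ?thesis by (simp add: cell_m_def add_increasing)
  qed
qed

text \<open>A majorant whose iterated integrals are elementary. The core term has a product in the
  denominator instead of (\<xi>^2 + y^2 + s^2)^2: it is larger, but factors into arctangents and
  stays bounded in s after integration. Only the first term is logarithmic.\<close>

definition cell_profile :: "real \<Rightarrow> real \<Rightarrow> real \<Rightarrow> real \<Rightarrow> real \<Rightarrow> real" where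
  "cell_profile A C s \<xi> y = A / (\<xi>\<^sup>2 + y\<^sup>2 + s\<^sup>2) + C * (s\<^sup>2 / ((\<xi>\<^sup>2 + s\<^sup>2) * (y\<^sup>2 + s\<^sup>2))) + C"

text \<open>Near the zero, cos y0 ^ 4 from \<open>cell_m_near\<close> and cos y0 ^ 2 from the bound
  by 1 / \<gamma> make up the sixth power in front of the logarithmic term. Elsewhere
  \<open>cell_m\<close> is bounded below and the constant C absorbs everything.\<close>

lemma cell_bound:
  assumes y0: "0 < y0" "y0 < pi / 2" and \<eta>: "\<eta> > 0"
  obtains C where "C \<ge> 0" "\<And>s \<xi> y. 0 < s \<Longrightarrow> \<bar>\<xi>\<bar> \<le> pi / 2 \<Longrightarrow> \<bar>y\<bar> \<le> pi / 2 \<Longrightarrow>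
    (1 + \<eta>) * cell_K s \<xi> y + (1 + 1 / \<eta>) + s\<^sup>2 / (cell_m \<xi> y + s\<^sup>2)\<^sup>2 \<le>
      cell_profile ((1 + \<eta>) / cos y0 ^ 6) C s \<xi> y + s\<^sup>2 * C"
proof -
  define g where "g = cos y0"
  define m0 where "m0 = (sin y0)\<^sup>2 * (cos y0)\<^sup>2"
  have g: "0 < g" using y0 by (auto simp: g_def intro: cos_gt_zero_pi)
  have m0: "0 < m0" using y0 cos_gt_zero_pi[of y0] sin_gt_zero[of y0] by (simp add: m0_def)
  define C where "C = (2 * (1 + \<eta>) + 1) / g ^ 8 + (1 + 1 / \<eta>) + (1 + \<eta>) * (2 / m0) + 1 / m0\<^sup>2"
  have Cparts: "0 \<le> (2 * (1 + \<eta>) + 1) / g ^ 8" "0 \<le> 1 + 1 / \<eta>" "0 \<le> (1 + \<eta>) * (2 / m0)" "0 \<le> 1 / m0\<^sup>2"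
    using g m0 \<eta> by auto
  show ?thesis
  proof
    show C0: "C \<ge> 0" using Cparts unfolding C_def by linarith
    fix s \<xi> y :: real assume s: "0 < s" and r: "\<bar>\<xi>\<bar> \<le> pi / 2" "\<bar>y\<bar> \<le> pi / 2"
    define \<rho> where "\<rho> = cell_m \<xi> y + s\<^sup>2"
    define q where "q = \<xi>\<^sup>2 + y\<^sup>2 + s\<^sup>2"
    define w where "w = s\<^sup>2 / ((\<xi>\<^sup>2 + s\<^sup>2) * (y\<^sup>2 + s\<^sup>2))"
    have m: "0 \<le> cell_m \<xi> y" by (simp add: cell_m_def)
    have \<rho>: "\<rho> > 0" using s m by (simp add: \<rho>_def add_nonneg_pos)
    have q: "q > 0" using s by (simp add: q_def add_nonneg_pos)
    have w: "w \<ge> 0" using s by (simp add: w_def)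
    have prof: "cell_profile ((1 + \<eta>) / cos y0 ^ 6) C s \<xi> y = (1 + \<eta>) / g ^ 6 / q + C * w + C"
      by (simp add: cell_profile_def g_def q_def w_def)
    show "(1 + \<eta>) * cell_K s \<xi> y + (1 + 1 / \<eta>) + s\<^sup>2 / (cell_m \<xi> y + s\<^sup>2)\<^sup>2 \<le>
      cell_profile ((1 + \<eta>) / cos y0 ^ 6) C s \<xi> y + s\<^sup>2 * C"
    proof (cases "\<bar>\<xi>\<bar> \<le> y0 \<and> \<bar>y\<bar> \<le> y0")
      case True
      have "g ^ 4 * q \<le> \<rho>"
      proof -
        have "g ^ 4 * s\<^sup>2 \<le> 1 * s\<^sup>2" using g by (intro mult_right_mono power_le_one) (auto simp: g_def)
        then show ?thesis using cell_m_near(1)[OF y0, of \<xi> y] True by (simp add: g_def q_def \<rho>_def distrib_left)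
      qed
      have q4: "g ^ 4 * q > 0" using g q by simp
      have w8: "s\<^sup>2 / \<rho>\<^sup>2 \<le> w / g ^ 8"
      proof -
        have "(\<xi>\<^sup>2 + s\<^sup>2) * (y\<^sup>2 + s\<^sup>2) \<le> q\<^sup>2"
        proof -
          have "(X + S) * (Y + S) \<le> (X + Y + S)\<^sup>2" if "0 \<le> X" "0 \<le> Y" "0 \<le> S" for X Y S :: real
          proof -
            have "(X + Y + S)\<^sup>2 - (X + S) * (Y + S) = X * X + Y * Y + X * Y + X * S + Y * S"
              by (simp add: power2_eq_square algebra_simps)
            moreover have "0 \<le> X * X + Y * Y + X * Y + X * S + Y * S" using that by simp
            ultimately show ?thesis by linarith
          qed
          then show ?thesis unfolding q_def by simp
        qed
        then have "g ^ 8 * ((\<xi>\<^sup>2 + s\<^sup>2) * (y\<^sup>2 + s\<^sup>2)) \<le> g ^ 8 * q\<^sup>2"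
          using g by (intro mult_left_mono) auto
        also have "\<dots> = (g ^ 4 * q)\<^sup>2" by (simp add: power_mult_distrib flip: power_mult)
        also have "\<dots> \<le> \<rho>\<^sup>2" using \<open>g ^ 4 * q \<le> \<rho>\<close> q4 by (intro power_mono) auto
        finally have "s\<^sup>2 / \<rho>\<^sup>2 \<le> s\<^sup>2 / (g ^ 8 * ((\<xi>\<^sup>2 + s\<^sup>2) * (y\<^sup>2 + s\<^sup>2)))"
          using g s \<rho> by (intro divide_left_mono mult_pos_pos) (auto simp: add_nonneg_pos)
        then show ?thesis by (simp add: w_def mult.commute)
      qed
      have "cell_K s \<xi> y \<le> 1 / g\<^sup>2 / \<rho> + 2 * s\<^sup>2 / \<rho>\<^sup>2"
        unfolding \<rho>_def using cell_m_near(2)[OF y0, of \<xi> y] True g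
        by (intro cell_K_le(2) s) (auto simp: g_def)
      also have "1 / g\<^sup>2 / \<rho> \<le> 1 / g\<^sup>2 / (g ^ 4 * q)"
        using \<open>g ^ 4 * q \<le> \<rho>\<close> q4 \<rho> by (intro divide_left_mono) auto
      also have "1 / g\<^sup>2 / (g ^ 4 * q) = 1 / g ^ 6 / q"
        by (simp add: power_add[symmetric])
      also have "2 * s\<^sup>2 / \<rho>\<^sup>2 \<le> 2 * (w / g ^ 8)" using w8 by simp
      finally have "(1 + \<eta>) * cell_K s \<xi> y \<le> (1 + \<eta>) * (1 / g ^ 6 / q + 2 * (w / g ^ 8))"
        using \<eta> by (intro mult_left_mono) auto
      also have "\<dots> = (1 + \<eta>) / g ^ 6 / q + 2 * (1 + \<eta>) / g ^ 8 * w" by (simp add: distrib_left)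
      finally have "(1 + \<eta>) * cell_K s \<xi> y + s\<^sup>2 / \<rho>\<^sup>2 \<le> (1 + \<eta>) / g ^ 6 / q + (2 * (1 + \<eta>) + 1) / g ^ 8 * w"
        using w8 by (simp add: add_divide_distrib distrib_right)
      moreover have "(2 * (1 + \<eta>) + 1) / g ^ 8 * w \<le> C * w"
        using Cparts unfolding C_def by (intro mult_right_mono w) linarith
      moreover have "1 + 1 / \<eta> \<le> C" using Cparts unfolding C_def by linarith
      moreover have "0 \<le> s\<^sup>2 * C" using C0 by simp
      ultimately show ?thesis unfolding prof \<rho>_def by linarith
    next
      case False
      then have "m0 \<le> cell_m \<xi> y" unfolding m0_def using r by (intro cell_m_far[OF y0]) auto
      then have "m0 \<le> \<rho>" by (simp add: \<rho>_def add_increasing2)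
      have "cell_K s \<xi> y \<le> 2 / \<rho>" unfolding \<rho>_def by (rule cell_K_le(1)[OF s])
      also have "\<dots> \<le> 2 / m0" using \<open>m0 \<le> \<rho>\<close> m0 \<rho> by (intro divide_left_mono) auto
      finally have "(1 + \<eta>) * cell_K s \<xi> y \<le> (1 + \<eta>) * (2 / m0)" using \<eta> by (intro mult_left_mono) auto
      moreover have "s\<^sup>2 / \<rho>\<^sup>2 \<le> s\<^sup>2 * C"
      proof -
        have "s\<^sup>2 / \<rho>\<^sup>2 \<le> s\<^sup>2 / m0\<^sup>2" using \<open>m0 \<le> \<rho>\<close> m0 \<rho> by (intro divide_left_mono power_mono) auto
        also have "\<dots> = s\<^sup>2 * (1 / m0\<^sup>2)" by simp
        also have "\<dots> \<le> s\<^sup>2 * C" using Cparts unfolding C_def by (intro mult_left_mono) auto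
        finally show ?thesis .
      qed
      moreover have "0 \<le> (1 + \<eta>) / g ^ 6 / q" "0 \<le> C * w" using \<eta> g q C0 w by auto
      moreover have "(1 + \<eta>) * (2 / m0) + (1 + 1 / \<eta>) \<le> C" using Cparts unfolding C_def by linarith
      ultimately show ?thesis unfolding prof \<rho>_def by linarith
    qed
  qed
qed

text \<open>The square cell of side \<open>kk\<close> carries exactly one flux quantum \<open>2 pi\<close> of the unit field.\<close>

definition kk :: real where "kk = sqrt (2 * pi)"

lemma kk: "kk > 0" "kk * kk = 2 * pi" "kk\<^sup>2 = 2 * pi"
  by (simp_all add: kk_def)

text \<open>One arch of a squared cosine. For 0 \<le> a < kk the values at a and a - kk are cos^2
  and sin^2 of one angle, so neighbouring translates add up to 1, and the double zeros at both ends
  make the function C1.\<close>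

definition cs :: "real \<Rightarrow> real" where
  "cs t = (if \<bar>t\<bar> \<le> kk then (cos (kk * t / 4))\<^sup>2 else 0)"

text \<open>Clamping the argument replaces a case distinction: at the clamped ends the sine is that
  of pi or - pi, hence 0, and continuity is immediate.\<close>

definition cs' :: "real \<Rightarrow> real" where
  "cs' t = - (kk / 4) * sin (kk / 2 * max (- kk) (min kk t))"

lemma cs'_outside: "kk \<le> \<bar>t\<bar> \<Longrightarrow> cs' t = 0"
proof -
  assume "kk \<le> \<bar>t\<bar>"
  then have "max (- kk) (min kk t) = kk \<or> max (- kk) (min kk t) = - kk" using kk(1) by linarith
  moreover have "kk / 2 * kk = pi" using kk(2) by simp
  ultimately show ?thesis by (auto simp: cs'_def)
qed

text \<open>For the two gluing points of \<open>cs\<close>, where a double zero from both sides is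
  all that is needed.\<close>

lemma has_derivative_zero_quadratic:
  fixes f :: "real \<Rightarrow> real"
  assumes "\<And>t. \<bar>f t\<bar> \<le> C * (t - a)\<^sup>2"
  shows "(f has_real_derivative 0) (at a)"
  unfolding has_field_derivative_iff
proof (rule Lim_null_comparison)
  have fa: "f a = 0" using assms[of a] by simp
  have C: "0 \<le> C" using assms[of "a + 1"] by simp
  show "\<forall>\<^sub>F t in at a. norm ((f t - f a) / (t - a)) \<le> C * \<bar>t - a\<bar>"
  proof (rule eventually_at_filter[THEN iffD2], rule always_eventually, intro allI impI)
    fix t assume t: "t \<noteq> a"
    have "norm ((f t - f a) / (t - a)) = \<bar>f t\<bar> / \<bar>t - a\<bar>" by (simp add: fa)
    also have "\<dots> \<le> C * (t - a)\<^sup>2 / \<bar>t - a\<bar>" using assms[of t] by (intro divide_right_mono) auto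
    also have "(t - a)\<^sup>2 = \<bar>t - a\<bar> * \<bar>t - a\<bar>" by (simp add: power2_eq_square)
    also have "C * (\<bar>t - a\<bar> * \<bar>t - a\<bar>) / \<bar>t - a\<bar> = C * \<bar>t - a\<bar>"
    proof -
      have "C * (z * z) / z = C * z" if "z > 0" for z using that by simp
      from this[of "\<bar>t - a\<bar>"] t show ?thesis by (simp only: zero_less_abs_iff right_minus_eq not_False_eq_True)
    qed
    finally show "norm ((f t - f a) / (t - a)) \<le> C * \<bar>t - a\<bar>" .
  qed
  have "((\<lambda>t. C * \<bar>t - a\<bar>) \<longlongrightarrow> C * \<bar>a - a\<bar>) (at a)" by (intro tendsto_intros)
  then show "((\<lambda>t. C * \<bar>t - a\<bar>) \<longlongrightarrow> 0) (at a)" by simp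
qed

lemma cs_has_derivative: "(cs has_real_derivative cs' t) (at t)"
proof -
  consider "\<bar>t\<bar> < kk" | "kk < \<bar>t\<bar>" | "t = kk" | "t = - kk" by linarith
  then show ?thesis
  proof cases
    case 1
    have "((\<lambda>t. (cos (kk * t / 4))\<^sup>2) has_real_derivative - (kk / 4) * (2 * sin (kk * t / 4) * cos (kk * t / 4))) (at t)"
      by (auto intro!: derivative_eq_intros)
    also have "2 * sin (kk * t / 4) * cos (kk * t / 4) = sin (kk / 2 * t)"
      using sin_double[of "kk * t / 4"] by (simp add: mult_ac)
    also have "- (kk / 4) * sin (kk / 2 * t) = cs' t"
      using 1 by (simp add: cs'_def)
    finally have "((\<lambda>t. (cos (kk * t / 4))\<^sup>2) has_real_derivative cs' t) (at t)" .
    then show ?thesis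
      by (rule has_field_derivative_transform_within_open[where S = "{- kk<..<kk}"]) (use 1 in \<open>auto simp: cs_def\<close>)
  next
    case 2
    have "((\<lambda>t::real. 0) has_real_derivative 0) (at t)" by (auto intro!: derivative_eq_intros)
    then have "(cs has_real_derivative 0) (at t)"
      by (rule has_field_derivative_transform_within_open[where S = "- {- kk..kk}"])
        (use 2 in \<open>auto simp: cs_def\<close>)
    then show ?thesis using cs'_outside[of t] 2 by simp
  next
    case 3
    have "\<bar>cs x\<bar> \<le> (kk / 4)\<^sup>2 * (x - kk)\<^sup>2" for x
    proof -
      have "cos (kk * x / 4) = sin (kk / 4 * (kk - x))"
        unfolding cos_sin_eq using kk(2) by (simp add: field_simps)
      then have "\<bar>cs x\<bar> \<le> \<bar>sin (kk / 4 * (kk - x))\<bar>\<^sup>2" by (simp add: cs_def)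
      also have "\<dots> \<le> \<bar>kk / 4 * (kk - x)\<bar>\<^sup>2" by (intro power_mono abs_sin_x_le_abs_x) auto
      also have "\<dots> = (kk / 4)\<^sup>2 * (x - kk)\<^sup>2" by (simp only: power2_abs power_mult_distrib power2_commute[of kk x])
      finally show ?thesis .
    qed
    then have "(cs has_real_derivative 0) (at kk)" by (rule has_derivative_zero_quadratic)
    then show ?thesis using 3 cs'_outside[of t] by simp
  next
    case 4
    have "\<bar>cs x\<bar> \<le> (kk / 4)\<^sup>2 * (x - - kk)\<^sup>2" for x
    proof -
      have "cos (kk * x / 4) = cos (- (kk * x / 4))" by (rule cos_minus[symmetric])
      also have "\<dots> = sin (kk / 4 * (kk + x))"
        unfolding cos_sin_eq using kk(2) by (simp add: field_simps)
      finally have "\<bar>cs x\<bar> \<le> \<bar>sin (kk / 4 * (kk + x))\<bar>\<^sup>2" by (simp add: cs_def)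
      also have "\<dots> \<le> \<bar>kk / 4 * (kk + x)\<bar>\<^sup>2" by (intro power_mono abs_sin_x_le_abs_x) auto
      also have "\<dots> = (kk / 4)\<^sup>2 * (x - - kk)\<^sup>2"
        by (simp only: power2_abs power_mult_distrib diff_minus_eq_add add.commute[of kk x])
      finally show ?thesis .
    qed
    then have "(cs has_real_derivative 0) (at (- kk))" by (rule has_derivative_zero_quadratic)
    then show ?thesis using 4 cs'_outside[of t] by simp
  qed
qed

lemma continuous_on_cs [continuous_intros]: "continuous_on S g \<Longrightarrow> continuous_on S (\<lambda>x. cs (g x))"
  using cs_has_derivative DERIV_isCont continuous_at_imp_continuous_on continuous_on_compose2[of UNIV cs S g]
  by (metis subset_UNIV)

lemma continuous_on_cs' [continuous_intros]:
  fixes g :: "real^3 \<Rightarrow> real"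
  shows "continuous_on S g \<Longrightarrow> continuous_on S (\<lambda>x. cs' (g x))"
  unfolding cs'_def by (intro continuous_on_mult continuous_on_const continuous_on_sin continuous_on_max continuous_on_min)

text \<open>At every point at most two neighbouring terms of the sum are nonzero. They have equal modulus
  only midway between their centres, where their phases cancel once per period: hence one simple
  zero in each cell, as for the Abrikosov lattice.\<close>

definition latW :: "int \<Rightarrow> real^3 \<Rightarrow> complex" where
  "latW N x = (\<Sum>n::int\<in>{-N..N}. complex_of_real (cs (x $ 1 - real_of_int n * kk)) * cis (real_of_int n * kk * x $ 2))"

definition latW1 :: "int \<Rightarrow> real^3 \<Rightarrow> complex" where
  "latW1 N x = (\<Sum>n::int\<in>{-N..N}. complex_of_real (cs' (x $ 1 - real_of_int n * kk)) * cis (real_of_int n * kk * x $ 2))"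

definition latW2 :: "int \<Rightarrow> real^3 \<Rightarrow> complex" where
  "latW2 N x = (\<Sum>n::int\<in>{-N..N}. \<i> * complex_of_real (real_of_int n * kk) * complex_of_real (cs (x $ 1 - real_of_int n * kk)) * cis (real_of_int n * kk * x $ 2))"

lemma has_derivative_vec_nth: "((\<lambda>x::real^3. x $ i) has_derivative (\<lambda>d. d $ i)) (at x)"
  by (rule bounded_linear_imp_has_derivative[OF bounded_linear_vec_nth])

lemma has_derivative_cis:
  assumes "(g has_derivative g') (at x)"
  shows "((\<lambda>x. cis (g x)) has_derivative (\<lambda>d. g' d *\<^sub>R (\<i> * cis (g x)))) (at x)"
proof -
  have "(cis has_vector_derivative \<i> * cis t) (at t)" for t
    unfolding cis_conv_exp by (auto intro!: derivative_eq_intros has_vector_derivative_real_field)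
  then show ?thesis
    using has_derivative_compose[OF assms] unfolding has_vector_derivative_def by blast
qed

lemma latW_has_derivative:
  "(latW N has_derivative (\<lambda>d. d $ 1 *\<^sub>R latW1 N x + d $ 2 *\<^sub>R latW2 N x)) (at x)"
proof -
  have "((\<lambda>x. complex_of_real (cs (x $ 1 - n * kk)) * cis (n * kk * x $ 2)) has_derivative
     (\<lambda>d. d $ 1 *\<^sub>R (complex_of_real (cs' (x $ 1 - n * kk)) * cis (n * kk * x $ 2)) +
       d $ 2 *\<^sub>R (\<i> * complex_of_real (n * kk) * complex_of_real (cs (x $ 1 - n * kk)) * cis (n * kk * x $ 2)))) (at x)"
    for n :: int
  proof -
    have "((\<lambda>x::real^3. x $ 1 - n * kk) has_derivative (\<lambda>d. d $ 1)) (at x)"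
      using has_derivative_diff[OF has_derivative_vec_nth has_derivative_const] by simp
    from has_derivative_compose[OF this cs_has_derivative[unfolded has_field_derivative_def]]
    have 1: "((\<lambda>x. complex_of_real (cs (x $ 1 - n * kk))) has_derivative (\<lambda>d. complex_of_real (cs' (x $ 1 - n * kk) * d $ 1))) (at x)"
      by (rule bounded_linear.has_derivative[OF bounded_linear_of_real])
    have "((\<lambda>x::real^3. n * kk * x $ 2) has_derivative (\<lambda>d. n * kk * d $ 2)) (at x)"
      by (rule has_derivative_mult_right[OF has_derivative_vec_nth])
    from has_derivative_mult[OF 1 has_derivative_cis[OF this]]
    show ?thesis by (simp add: scaleR_conv_of_real mult_ac add.commute)
  qed
  from has_derivative_sum[OF this]
  show ?thesis unfolding latW_def[abs_def] latW1_def latW2_def by (simp add: scaleR_sum_right sum.distrib)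
qed

lemma continuous_latW: "continuous_on UNIV (latW N)" "continuous_on UNIV (latW1 N)" "continuous_on UNIV (latW2 N)"
  unfolding latW_def[abs_def] latW1_def[abs_def] latW2_def[abs_def]
  by (intro continuous_intros)+

text \<open>The phase passes from the symmetric gauge F to the Landau gauge (0, x_1, 0), in which
  the lattice sum is written; compare \<open>trial_covD\<close>.\<close>

definition trialU :: "real \<Rightarrow> int \<Rightarrow> real^3 \<Rightarrow> complex" where
  "trialU s N x = cis (- (x $ 1 * x $ 2 / 2)) * sat s (latW N x)"

definition trialG :: "real \<Rightarrow> int \<Rightarrow> 3 \<Rightarrow> real^3 \<Rightarrow> complex" where
  "trialG s N j x = (if j = 1 then cis (- (x $ 1 * x $ 2 / 2)) *
        (dsat s (latW N x) (latW1 N x) - \<i> * complex_of_real (x $ 2 / 2) * sat s (latW N x))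
     else if j = 2 then cis (- (x $ 1 * x $ 2 / 2)) *
        (dsat s (latW N x) (latW2 N x) - \<i> * complex_of_real (x $ 1 / 2) * sat s (latW N x))
     else 0)"

lemma continuous_on_sat: "s > 0 \<Longrightarrow> continuous_on S g \<Longrightarrow> continuous_on S (\<lambda>x. sat s (g x))"
  unfolding sat_def using sat_root_pos by (intro continuous_intros) (auto simp: less_le)

lemma continuous_on_dsat:
  "s > 0 \<Longrightarrow> continuous_on S g \<Longrightarrow> continuous_on S h \<Longrightarrow> continuous_on S (\<lambda>x. dsat s (g x) (h x))"
  unfolding dsat_def using sat_root_pos by (intro continuous_intros) (auto simp: less_le)

lemma trial_H1_weak_grad:
  assumes s: "s > 0"
  shows "H1_weak_grad (cubeQ R) (trialU s N) (trialG s N)"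
proof (rule C1_imp_H1_weak_grad)
  note cW = continuous_latW[of N]
  show "continuous_on UNIV (trialU s N)"
    unfolding trialU_def[abs_def] by (intro continuous_intros continuous_on_sat s cW)
      auto
  show "continuous_on UNIV (trialG s N j)" for j
    unfolding trialG_def[abs_def]
    by (cases "j = 1"; cases "j = 2"; simp; intro continuous_intros continuous_on_sat continuous_on_dsat s cW; simp)
  fix x
  have phase: "((\<lambda>x::real^3. cis (- (x $ 1 * x $ 2 / 2))) has_derivative
      (\<lambda>d. (- ((x $ 1 * d $ 2 + d $ 1 * x $ 2) / 2)) *\<^sub>R (\<i> * cis (- (x $ 1 * x $ 2 / 2))))) (at x)"
  proof (rule has_derivative_cis)
    show "((\<lambda>x::real^3. - (x $ 1 * x $ 2 / 2)) has_derivative (\<lambda>d. - ((x $ 1 * d $ 2 + d $ 1 * x $ 2) / 2))) (at x)"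
      unfolding divide_inverse
      by (intro has_derivative_minus has_derivative_mult_left has_derivative_mult has_derivative_vec_nth)
  qed
  have "((\<lambda>x. sat s (latW N x)) has_derivative (\<lambda>d. dsat s (latW N x) (d $ 1 *\<^sub>R latW1 N x + d $ 2 *\<^sub>R latW2 N x))) (at x)"
    by (rule has_derivative_compose[OF latW_has_derivative sat_has_derivative[OF s]])
  then have S: "((\<lambda>x. sat s (latW N x)) has_derivative
      (\<lambda>d. d $ 1 *\<^sub>R dsat s (latW N x) (latW1 N x) + d $ 2 *\<^sub>R dsat s (latW N x) (latW2 N x))) (at x)"
    unfolding dsat_add dsat_scaleR .
  show "(trialU s N has_derivative (\<lambda>d. \<Sum>j\<in>UNIV. d $ j *\<^sub>R trialG s N j x)) (at x)"
    using has_derivative_mult[OF phase S]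
    unfolding trialU_def[abs_def] trialG_def sum_3
    by (simp add: scaleR_conv_of_real algebra_simps add_divide_distrib)
qed

lemma trial_covD:
  "cmod (covD (trialU s N) (trialG s N) 1 x) = cmod (dsat s (latW N x) (latW1 N x))"
  "cmod (covD (trialU s N) (trialG s N) 2 x) = cmod (dsat s (latW N x) (latW2 N x) - \<i> * complex_of_real (x $ 1) * sat s (latW N x))"
  "covD (trialU s N) (trialG s N) 3 x = 0"
proof -
  have "covD (trialU s N) (trialG s N) 1 x = cis (- (x $ 1 * x $ 2 / 2)) * dsat s (latW N x) (latW1 N x)"
    by (simp add: covD_def trialU_def trialG_def algebra_simps)
  then show "cmod (covD (trialU s N) (trialG s N) 1 x) = cmod (dsat s (latW N x) (latW1 N x))"
    by (simp add: norm_mult)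
  have "covD (trialU s N) (trialG s N) 2 x = cis (- (x $ 1 * x $ 2 / 2)) * (dsat s (latW N x) (latW2 N x) - \<i> * complex_of_real (x $ 1) * sat s (latW N x))"
    by (simp add: covD_def trialU_def trialG_def algebra_simps)
  then show "cmod (covD (trialU s N) (trialG s N) 2 x) = cmod (dsat s (latW N x) (latW2 N x) - \<i> * complex_of_real (x $ 1) * sat s (latW N x))"
    by (simp add: norm_mult)
  show "covD (trialU s N) (trialG s N) 3 x = 0" by (simp add: covD_def trialG_def)
qed

text \<open>The coordinate inside a cell of width kk, stretched by pi / kk = kk / 2 and centred so
  that the zero of the lattice function sits at 0.\<close>

definition red :: "real \<Rightarrow> real" where
  "red t = pi * frac (t / kk) - pi / 2"

lemma red_bound: "\<bar>red t\<bar> \<le> pi / 2"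
proof -
  have "0 \<le> pi * frac (t / kk)" "pi * frac (t / kk) \<le> pi * 1"
    using frac_ge_0[of "t / kk"] frac_lt_1[of "t / kk"] by (auto intro!: mult_left_mono)
  then show ?thesis unfolding red_def abs_le_iff by (intro conjI) linarith+
qed

lemma sum_two_terms:
  fixes f :: "int \<Rightarrow> complex"
  assumes "\<And>m. m \<noteq> n \<Longrightarrow> m \<noteq> n + 1 \<Longrightarrow> f m = 0" "\<bar>n\<bar> + 1 \<le> N"
  shows "(\<Sum>m\<in>{-N..N}. f m) = f n + f (n + 1)"
proof -
  have "(\<Sum>m\<in>{-N..N}. f m) = (\<Sum>m\<in>{n, n + 1}. f m)"
    using assms by (intro sum.mono_neutral_right) auto
  then show ?thesis by simp
qed

text \<open>Only the summands n and n + 1 survive. Taking out the mean \<open>p\<close> of their two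
  phases leaves the explicit h of the cell. The frequency (n + 1 / 2) kk of \<open>p\<close> follows
  x_1 to within kk / 2, so it cancels the Landau potential up to a bounded remainder.\<close>

lemma lattice_local:
  assumes n: "n = \<lfloor>x $ 1 / kk\<rfloor>" and N: "\<bar>n\<bar> + 1 \<le> N"
  defines "\<xi> \<equiv> red (x $ 1)" and "y \<equiv> kk * x $ 2 / 2 - pi / 2"
    and "p \<equiv> cis ((n + 1 / 2) * kk * x $ 2)"
  shows "latW N x = p * Complex (- sin y) (sin \<xi> * cos y)"
    and "latW1 N x = p * ((kk / 2) *\<^sub>R Complex 0 (cos \<xi> * cos y))"
    and "latW2 N x = p * (\<i> * complex_of_real ((n + 1 / 2) * kk) * Complex (- sin y) (sin \<xi> * cos y)
       + (kk / 2) *\<^sub>R Complex (- cos y) (- (sin \<xi> * sin y)))"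
    and "\<bar>(n + 1 / 2) * kk - x $ 1\<bar> \<le> kk / 2"
proof -
  define a where "a = x $ 1 - n * kk"
  have "of_int n \<le> x $ 1 / kk" "x $ 1 / kk < of_int n + 1" unfolding n by linarith+
  then have a: "0 \<le> a" "a < kk" using kk(1) by (simp_all add: a_def field_simps)
  show "\<bar>(n + 1 / 2) * kk - x $ 1\<bar> \<le> kk / 2" 
  proof -
    have "(n + 1 / 2) * kk = n * kk + kk / 2" by (simp add: algebra_simps)
    then show ?thesis using a unfolding a_def abs_le_iff by (intro conjI) linarith+
  qed
  have \<xi>: "\<xi> = kk * a / 2 - pi / 2"
  proof -
    have "pi * frac (x $ 1 / kk) = pi * (a / kk)"
      using kk(1) by (simp add: frac_def n[symmetric] a_def field_simps)
    also have "\<dots> = kk * a / 2" using kk(1,2) by (simp add: field_simps)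
    finally show ?thesis by (simp add: \<xi>_def red_def)
  qed
  have sc: "sin \<xi> = - cos (kk * a / 2)" "cos \<xi> = sin (kk * a / 2)"
    unfolding \<xi> by (simp_all add: sin_diff cos_diff)
  have cos_double': "cos (kk * a / 2) = 2 * (cos (kk * a / 4))\<^sup>2 - 1"
    using cos_double_cos[of "kk * a / 4"] by simp
  have kk4: "kk * (a - kk) / 4 = kk * a / 4 - pi / 2" "kk / 2 * (a - kk) = kk * a / 2 - pi"
  proof -
    have e: "kk * (a - kk) = kk * a - 2 * pi" using kk(2) by (simp add: right_diff_distrib)
    show "kk * (a - kk) / 4 = kk * a / 4 - pi / 2" unfolding e by (simp add: diff_divide_distrib)
    have "kk / 2 * (a - kk) = kk * (a - kk) / 2" by simp
    also have "\<dots> = kk * a / 2 - pi" unfolding e by (simp add: diff_divide_distrib)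
    finally show "kk / 2 * (a - kk) = kk * a / 2 - pi" .
  qed
  have c0: "cs a = (1 - sin \<xi>) / 2" using a cos_double' by (simp add: cs_def sc)
  have c1: "cs (a - kk) = (1 + sin \<xi>) / 2"
  proof -
    have "\<bar>a - kk\<bar> \<le> kk" using a by simp
    then have "cs (a - kk) = (cos (kk * (a - kk) / 4))\<^sup>2" by (simp only: cs_def if_True)
    then have "cs (a - kk) = (sin (kk * a / 4))\<^sup>2" unfolding kk4 by (simp add: cos_diff)
    then show ?thesis using cos_double' by (simp add: sc sin_squared_eq)
  qed
  have d0: "cs' a = - (kk / 4) * cos \<xi>" using a by (simp add: cs'_def sc)
  have d1: "cs' (a - kk) = (kk / 4) * cos \<xi>"
  proof -
    have "max (- kk) (min kk (a - kk)) = a - kk" using a by simp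
    then show ?thesis unfolding cs'_def kk4(2)[symmetric] sc by (simp only: kk4 sin_diff) simp
  qed
  have far: "kk \<le> \<bar>x $ 1 - m * kk\<bar>" if "m \<noteq> n" "m \<noteq> n + 1" for m :: int
  proof (cases "m < n")
    case True
    then have "real_of_int m \<le> real_of_int n - 1" by linarith
    then have "m * kk \<le> (real_of_int n - 1) * kk" using kk(1) by (intro mult_right_mono) auto
    then show ?thesis using a unfolding a_def by (simp add: algebra_simps)
  next
    case False
    then have "real_of_int n + 2 \<le> real_of_int m" using that by linarith
    then have "(real_of_int n + 2) * kk \<le> m * kk" using kk(1) by (intro mult_right_mono) auto
    then show ?thesis using a unfolding a_def by (simp add: algebra_simps)
  qed
  have far_cs: "cs (x $ 1 - m * kk) = 0" if "m \<noteq> n" "m \<noteq> n + 1" for m :: int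
  proof -
    have "cs t = 0" if "kk \<le> \<bar>t\<bar>" for t
    proof -
      have z: "(cos (kk * t / 4))\<^sup>2 = 0" if t: "\<bar>t\<bar> = kk"
      proof -
        have "t = kk \<or> t = - kk" using t by linarith
        then have "kk * t / 4 = pi / 2 \<or> kk * t / 4 = - (pi / 2)" using kk(2) by auto
        then have "cos (kk * t / 4) = 0" by (metis cos_minus cos_pi_half)
        then show ?thesis by simp
      qed
      show ?thesis using that z by (auto simp: cs_def)
    qed
    then show ?thesis using far[OF that] by blast
  qed
  have far_cs': "cs' (x $ 1 - m * kk) = 0" if "m \<noteq> n" "m \<noteq> n + 1" for m :: int
    by (rule cs'_outside[OF far[OF that]])
  define \<alpha> where "\<alpha> = kk * x $ 2"
  have y2: "y = \<alpha> / 2 - pi / 2" by (simp add: y_def \<alpha>_def)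
  have scy: "sin y = - cos (\<alpha> / 2)" "cos y = sin (\<alpha> / 2)"
    unfolding y2 by (simp_all add: sin_diff cos_diff)
  have ph: "cis (n * kk * x $ 2) = p * cis (- \<alpha> / 2)" "cis (of_int (n + 1) * kk * x $ 2) = p * cis (\<alpha> / 2)"
    unfolding p_def \<alpha>_def by (simp_all add: cis_mult algebra_simps add_divide_distrib)
  have xa: "x $ 1 - n * kk = a" "x $ 1 - of_int (n + 1) * kk = a - kk"
    by (simp_all add: a_def algebra_simps)
  show "latW N x = p * Complex (- sin y) (sin \<xi> * cos y)"
  proof -
    have "latW N x = complex_of_real (cs a) * (p * cis (- \<alpha> / 2)) + complex_of_real (cs (a - kk)) * (p * cis (\<alpha> / 2))"
      unfolding latW_def using far_cs by (subst sum_two_terms[OF _ N]) (simp_all only: ph xa, simp)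
    also have "\<dots> = p * (complex_of_real (cs a) * cis (- \<alpha> / 2) + complex_of_real (cs (a - kk)) * cis (\<alpha> / 2))"
      by (simp add: algebra_simps)
    also have "complex_of_real (cs a) * cis (- \<alpha> / 2) + complex_of_real (cs (a - kk)) * cis (\<alpha> / 2) = Complex (- sin y) (sin \<xi> * cos y)"
      unfolding c0 c1 scy by (simp add: complex_eq_iff field_simps)
    finally show ?thesis .
  qed
  show "latW1 N x = p * ((kk / 2) *\<^sub>R Complex 0 (cos \<xi> * cos y))"
  proof -
    have "latW1 N x = complex_of_real (cs' a) * (p * cis (- \<alpha> / 2)) + complex_of_real (cs' (a - kk)) * (p * cis (\<alpha> / 2))"
      unfolding latW1_def using far_cs' by (subst sum_two_terms[OF _ N]) (simp_all only: ph xa, simp)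
    also have "\<dots> = p * (complex_of_real (cs' a) * cis (- \<alpha> / 2) + complex_of_real (cs' (a - kk)) * cis (\<alpha> / 2))"
      by (simp add: algebra_simps)
    also have "complex_of_real (cs' a) * cis (- \<alpha> / 2) + complex_of_real (cs' (a - kk)) * cis (\<alpha> / 2) = (kk / 2) *\<^sub>R Complex 0 (cos \<xi> * cos y)"
      unfolding d0 d1 scy by (simp add: complex_eq_iff field_simps)
    finally show ?thesis .
  qed
  show "latW2 N x = p * (\<i> * complex_of_real ((n + 1 / 2) * kk) * Complex (- sin y) (sin \<xi> * cos y)
       + (kk / 2) *\<^sub>R Complex (- cos y) (- (sin \<xi> * sin y)))"
  proof -
    have "latW2 N x = \<i> * complex_of_real (n * kk) * complex_of_real (cs a) * (p * cis (- \<alpha> / 2))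
        + \<i> * complex_of_real (of_int (n + 1) * kk) * complex_of_real (cs (a - kk)) * (p * cis (\<alpha> / 2))"
      unfolding latW2_def using far_cs by (subst sum_two_terms[OF _ N]) (simp_all only: ph xa, simp)
    also have "\<dots> = p * (\<i> * complex_of_real (n * kk) * complex_of_real (cs a) * cis (- \<alpha> / 2)
        + \<i> * complex_of_real (of_int (n + 1) * kk) * complex_of_real (cs (a - kk)) * cis (\<alpha> / 2))"
      by (simp add: algebra_simps)
    also have "\<i> * complex_of_real (n * kk) * complex_of_real (cs a) * cis (- \<alpha> / 2)
        + \<i> * complex_of_real (of_int (n + 1) * kk) * complex_of_real (cs (a - kk)) * cis (\<alpha> / 2)
      = \<i> * complex_of_real ((n + 1 / 2) * kk) * Complex (- sin y) (sin \<xi> * cos y)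
       + (kk / 2) *\<^sub>R Complex (- cos y) (- (sin \<xi> * sin y))"
      unfolding c0 c1 scy by (simp add: complex_eq_iff field_simps)
    finally show ?thesis .
  qed
qed

text \<open>The second coordinate and its reduction differ by a multiple of pi, so sine and cosine
  change by a common sign, and both cell quantities are even in that sign.\<close>

lemma cell_phase_periodic:
  assumes "e\<^sup>2 = 1" "sin y' = e * sin y" "cos y' = e * cos y"
  shows "cell_m \<xi> y' = cell_m \<xi> y" "cell_K s \<xi> y' = cell_K s \<xi> y"
proof -
  have sq: "(sin y')\<^sup>2 = (sin y)\<^sup>2" "(cos y')\<^sup>2 = (cos y)\<^sup>2" "(sin y' * cos y' * z)\<^sup>2 = (sin y * cos y * z)\<^sup>2" for z
    using assms by (simp_all add: power_mult_distrib)
  show "cell_m \<xi> y' = cell_m \<xi> y" by (simp add: cell_m_def sq)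
  then show "cell_K s \<xi> y' = cell_K s \<xi> y" unfolding cell_K_def sq by simp
qed

lemma red_phase: obtains e where "e\<^sup>2 = 1" "sin (kk * t / 2 - pi / 2) = e * sin (red t)" "cos (kk * t / 2 - pi / 2) = e * cos (red t)"
proof -
  define m where "m = \<lfloor>t / kk\<rfloor>"
  define e where "e = cos (pi * of_int m)"
  have s0: "sin (pi * of_int m) = 0" by (simp add: sin_zero_iff_int2 mult.commute)
  then have e: "e\<^sup>2 = 1" using sin_cos_squared_add[of "pi * of_int m"] by (simp add: e_def)
  have "kk * t / 2 = pi * (t / kk)" using kk(1,2) by (simp add: field_simps)
  then have eq: "kk * t / 2 - pi / 2 = red t + pi * of_int m"
    by (simp add: red_def frac_def m_def algebra_simps)
  show ?thesis
  proof
    show "e\<^sup>2 = 1" by (rule e)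
    show "sin (kk * t / 2 - pi / 2) = e * sin (red t)" "cos (kk * t / 2 - pi / 2) = e * cos (red t)"
      unfolding eq sin_add cos_add by (simp_all add: s0 e_def)
  qed
qed

lemma norm_dsat_pair:
  assumes s: "s > 0"
  shows "(cmod (dsat s (Complex (- sin y) (sin \<xi> * cos y)) (Complex 0 (cos \<xi> * cos y))))\<^sup>2 +
    (cmod (dsat s (Complex (- sin y) (sin \<xi> * cos y)) (Complex (- cos y) (- (sin \<xi> * sin y)))))\<^sup>2 = cell_K s \<xi> y"
proof -
  define h where "h = Complex (- sin y) (sin \<xi> * cos y)"
  have m: "(cmod h)\<^sup>2 = cell_m \<xi> y"
    by (simp add: h_def cell_m_def cmod_power2 power_mult_distrib)
  have n: "(cmod (Complex 0 (cos \<xi> * cos y)))\<^sup>2 = (cos \<xi>)\<^sup>2 * (cos y)\<^sup>2"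
     "(cmod (Complex (- cos y) (- (sin \<xi> * sin y))))\<^sup>2 = (cos y)\<^sup>2 + (sin \<xi>)\<^sup>2 * (sin y)\<^sup>2"
    by (simp_all add: cmod_power2 power_mult_distrib)
  have r1: "Re (cnj h * Complex 0 (cos \<xi> * cos y)) = sin \<xi> * cos \<xi> * (cos y)\<^sup>2"
    by (simp add: h_def power2_eq_square)
  have r2: "Re (cnj h * Complex (- cos y) (- (sin \<xi> * sin y))) = sin y * cos y * (cos \<xi>)\<^sup>2"
  proof -
    have "Re (cnj h * Complex (- cos y) (- (sin \<xi> * sin y))) = sin y * cos y * (1 - (sin \<xi>)\<^sup>2)"
      by (simp add: h_def power2_eq_square algebra_simps)
    then show ?thesis by (simp add: cos_squared_eq)
  qed
  show ?thesis
    unfolding h_def[symmetric] norm_dsat_sq[OF s] m n r1 r2 cell_K_def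
    by (simp add: add_divide_distrib diff_divide_distrib distrib_right add.assoc)
qed

text \<open>The prefactor pi / 2 is (kk / 2)^2, from the scaling of the cell. The leftover potential
  c - x_1 has modulus at most kk / 2; Young's inequality splits it from the main part and produces
  the factors 1 + \<eta> and 1 + 1 / \<eta>.\<close>

lemma trial_density_le:
  assumes s: "s > 0" and \<eta>: "\<eta> > 0" and N: "\<bar>\<lfloor>x $ 1 / kk\<rfloor>\<bar> + 1 \<le> N"
  shows "GL_density (s\<^sup>2) (trialU s N) (trialG s N) x \<le> s\<^sup>2 * (pi / 2) *
    ((1 + \<eta>) * cell_K s (red (x $ 1)) (red (x $ 2)) + (1 + 1 / \<eta>) + s\<^sup>2 / (cell_m (red (x $ 1)) (red (x $ 2)) + s\<^sup>2)\<^sup>2)"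
proof -
  define n where "n = \<lfloor>x $ 1 / kk\<rfloor>"
  define \<xi> where "\<xi> = red (x $ 1)"
  define y' where "y' = kk * x $ 2 / 2 - pi / 2"
  define p where "p = cis ((n + 1 / 2) * kk * x $ 2)"
  define c where "c = (n + 1 / 2) * kk"
  define h where "h = Complex (- sin y') (sin \<xi> * cos y')"
  define h1 where "h1 = Complex 0 (cos \<xi> * cos y')"
  define h2 where "h2 = Complex (- cos y') (- (sin \<xi> * sin y'))"
  have p: "cmod p = 1" by (simp add: p_def)
  have loc: "latW N x = p * h" "latW1 N x = p * ((kk / 2) *\<^sub>R h1)"
    "latW2 N x = p * (\<i> * complex_of_real c * h + (kk / 2) *\<^sub>R h2)" "\<bar>c - x $ 1\<bar> \<le> kk / 2"
    using lattice_local[OF n_def N[folded n_def]]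
    unfolding \<xi>_def y'_def p_def c_def h_def h1_def h2_def by auto
  have k4: "(kk / 2)\<^sup>2 = pi / 2" using kk(3) by (simp add: power_divide)
  have D1: "(cmod (covD (trialU s N) (trialG s N) 1 x))\<^sup>2 = pi / 2 * (cmod (dsat s h h1))\<^sup>2"
    unfolding trial_covD loc dsat_mult_phase[OF p] dsat_scaleR
    using k4 by (simp add: norm_mult p power_mult_distrib power_divide)
  have D2: "(cmod (covD (trialU s N) (trialG s N) 2 x))\<^sup>2 \<le> (1 + \<eta>) * (pi / 2 * (cmod (dsat s h h2))\<^sup>2) + (1 + 1 / \<eta>) * (pi / 2)"
  proof -
    define z where "z = (kk / 2) *\<^sub>R dsat s h h2 + \<i> * complex_of_real (c - x $ 1) * sat s h"
    have "dsat s (latW N x) (latW2 N x) - \<i> * complex_of_real (x $ 1) * sat s (latW N x) = p * z"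
      unfolding loc dsat_mult_phase[OF p] sat_mult_phase[OF p] dsat_add dsat_scaleR dsat_tangential z_def
      by (simp add: algebra_simps)
    then have "(cmod (covD (trialU s N) (trialG s N) 2 x))\<^sup>2 = (cmod z)\<^sup>2"
      unfolding trial_covD by (simp add: norm_mult p)
    also have "\<dots> \<le> (1 + \<eta>) * (cmod ((kk / 2) *\<^sub>R dsat s h h2))\<^sup>2 + (1 + 1 / \<eta>) * (cmod (z - (kk / 2) *\<^sub>R dsat s h h2))\<^sup>2"
      by (rule cmod_square_perturb[OF \<eta>])
    also have "(cmod ((kk / 2) *\<^sub>R dsat s h h2))\<^sup>2 = pi / 2 * (cmod (dsat s h h2))\<^sup>2"
      using k4 by (simp add: power_mult_distrib power_divide)
    also have "(cmod (z - (kk / 2) *\<^sub>R dsat s h h2))\<^sup>2 \<le> pi / 2"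
    proof -
      have "cmod (z - (kk / 2) *\<^sub>R dsat s h h2) = \<bar>c - x $ 1\<bar> * cmod (sat s h)"
        by (simp add: z_def norm_mult flip: of_real_diff)
      also have "\<dots> \<le> kk / 2 * 1" using loc(4) norm_sat_le[OF s, of h] kk(1) by (intro mult_mono) auto
      finally have "(cmod (z - (kk / 2) *\<^sub>R dsat s h h2))\<^sup>2 \<le> (kk / 2)\<^sup>2" by (intro power_mono) auto
      then show ?thesis by (simp only: k4)
    qed
    finally show ?thesis using \<eta> by (simp add: mult_left_mono)
  qed
  have K: "(cmod (dsat s h h1))\<^sup>2 + (cmod (dsat s h h2))\<^sup>2 = cell_K s \<xi> y'"
    unfolding h_def h1_def h2_def by (rule norm_dsat_pair[OF s])
  obtain e where e: "e\<^sup>2 = 1" "sin y' = e * sin (red (x $ 2))" "cos y' = e * cos (red (x $ 2))"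
    unfolding y'_def using red_phase by blast
  note per = cell_phase_periodic[OF e]
  have hm: "(cmod h)\<^sup>2 = cell_m \<xi> (red (x $ 2))"
    using per(1)[of \<xi>] by (simp add: h_def cell_m_def cmod_power2 power_mult_distrib)
  have pot: "(1 - (cmod (trialU s N x))\<^sup>2)\<^sup>2 / 2 \<le> s\<^sup>2 * (pi / 2) * (s\<^sup>2 / (cell_m \<xi> (red (x $ 2)) + s\<^sup>2)\<^sup>2)"
  proof -
    have "(1 - (cmod (trialU s N x))\<^sup>2)\<^sup>2 = s ^ 4 / (cell_m \<xi> (red (x $ 2)) + s\<^sup>2)\<^sup>2"
      unfolding trialU_def loc sat_mult_phase[OF p] using sat_potential[OF s, of h] by (simp add: norm_mult p hm)
    also have "\<dots> / 2 = 1 / 2 * (s\<^sup>2 * (s\<^sup>2 / (cell_m \<xi> (red (x $ 2)) + s\<^sup>2)\<^sup>2))"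
      by (simp flip: power_add)
    \<comment> \<open>The factor 1 / 2 of the potential is enlarged so that it shares the prefactor
      of the kinetic part.\<close>
    also have "\<dots> \<le> pi / 2 * (s\<^sup>2 * (s\<^sup>2 / (cell_m \<xi> (red (x $ 2)) + s\<^sup>2)\<^sup>2))"
      using pi_gt3 by (intro mult_right_mono) auto
    finally show ?thesis by (simp add: mult_ac)
  qed
  have "(cmod (covD (trialU s N) (trialG s N) 1 x))\<^sup>2 + (cmod (covD (trialU s N) (trialG s N) 2 x))\<^sup>2
     \<le> pi / 2 * ((1 + \<eta>) * cell_K s \<xi> (red (x $ 2)) + (1 + 1 / \<eta>))"
  proof -
    have "pi / 2 * (cmod (dsat s h h1))\<^sup>2 \<le> (1 + \<eta>) * (pi / 2 * (cmod (dsat s h h1))\<^sup>2)"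
      using \<eta> mult_right_mono[of 1 "1 + \<eta>" "pi / 2 * (cmod (dsat s h h1))\<^sup>2"] by simp
    have "(cmod (covD (trialU s N) (trialG s N) 1 x))\<^sup>2 + (cmod (covD (trialU s N) (trialG s N) 2 x))\<^sup>2 \<le>
      pi / 2 * ((1 + \<eta>) * ((cmod (dsat s h h1))\<^sup>2 + (cmod (dsat s h h2))\<^sup>2) + (1 + 1 / \<eta>))"
    proof -
      have "(1 + \<eta>) * (k * X) + ((1 + \<eta>) * (k * Y) + r * k) = k * ((1 + \<eta>) * (X + Y) + r)" for k X Y r
        by (simp add: algebra_simps)
      from this[of "pi / 2" "(cmod (dsat s h h1))\<^sup>2" "(cmod (dsat s h h2))\<^sup>2" "1 + 1 / \<eta>"] show ?thesis
        using D1 D2 \<open>pi / 2 * (cmod (dsat s h h1))\<^sup>2 \<le> _\<close> by linarith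
    qed
    then show ?thesis unfolding K per(2) .
  qed
  then have "s\<^sup>2 * ((cmod (covD (trialU s N) (trialG s N) 1 x))\<^sup>2 + (cmod (covD (trialU s N) (trialG s N) 2 x))\<^sup>2)
     \<le> s\<^sup>2 * (pi / 2 * ((1 + \<eta>) * cell_K s \<xi> (red (x $ 2)) + (1 + 1 / \<eta>)))"
    by (intro mult_left_mono) auto
  then have "GL_density (s\<^sup>2) (trialU s N) (trialG s N) x \<le> s\<^sup>2 * (pi / 2 * ((1 + \<eta>) * cell_K s \<xi> (red (x $ 2)) + (1 + 1 / \<eta>)))
      + s\<^sup>2 * (pi / 2) * (s\<^sup>2 / (cell_m \<xi> (red (x $ 2)) + s\<^sup>2)\<^sup>2)"
    using pot by (simp add: GL_density_def sum_3 trial_covD(3) del: times_divide_eq_right times_divide_eq_left)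
  then show ?thesis unfolding \<xi>_def by (simp add: distrib_left mult.assoc)
qed

section \<open>Integration of cell bounds over the cube\<close>

lemma vector3_eq: "(vector [a, b, c] :: real^3) = a *\<^sub>R axis 1 1 + b *\<^sub>R axis 2 1 + c *\<^sub>R axis 3 (1::real)" for a b c :: real
  by (simp add: vec_eq_iff forall_3 axis_def)

text \<open>The image of the threefold product measure agrees with Lebesgue measure on boxes, which
  determines it; Tonelli then applies.\<close>

lemma nn_integral_vec3:
  fixes f :: "real^3 \<Rightarrow> ennreal"
  assumes f: "f \<in> borel_measurable borel"
  shows "(\<integral>\<^sup>+x. f x \<partial>lborel) = (\<integral>\<^sup>+a. \<integral>\<^sup>+b. \<integral>\<^sup>+c. f (vector [a, b, c]) \<partial>lborel \<partial>lborel \<partial>lborel)"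
proof -
  let ?P = "lborel \<Otimes>\<^sub>M (lborel \<Otimes>\<^sub>M lborel) :: (real \<times> real \<times> real) measure"
  define T where "T = (\<lambda>(a, b, c). vector [a, b, c] :: real^3)"
  have s2: "sigma_finite_measure (lborel \<Otimes>\<^sub>M lborel :: (real \<times> real) measure)"
    unfolding lborel_prod by (rule sigma_finite_lborel)
  have T[measurable]: "T \<in> ?P \<rightarrow>\<^sub>M borel"
    unfolding T_def vector3_eq by measurable
  have lb: "lborel = distr ?P borel T"
  proof (rule lborel_eqI)
    fix l u :: "real^3" assume lu: "\<And>b. b \<in> Basis \<Longrightarrow> l \<bullet> b \<le> u \<bullet> b"
    have le: "l $ i \<le> u $ i" for i using lu[of "axis i 1"] by (simp add: inner_axis)
    have "T -` box l u \<inter> space ?P = {l $ 1<..<u $ 1} \<times> ({l $ 2<..<u $ 2} \<times> {l $ 3<..<u $ 3})"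
      by (auto simp: T_def mem_box_cart forall_3 space_pair_measure)
    then have "emeasure (distr ?P borel T) (box l u) = emeasure ?P ({l $ 1<..<u $ 1} \<times> ({l $ 2<..<u $ 2} \<times> {l $ 3<..<u $ 3}))"
      by (subst emeasure_distr) auto
    also have "\<dots> = emeasure lborel {l $ 1<..<u $ 1} * (emeasure lborel {l $ 2<..<u $ 2} * emeasure lborel {l $ 3<..<u $ 3})"
      by (subst sigma_finite_measure.emeasure_pair_measure_Times[OF s2], simp, simp, subst lborel.emeasure_pair_measure_Times) simp_all
    also have "\<dots> = ennreal ((u $ 1 - l $ 1) * ((u $ 2 - l $ 2) * (u $ 3 - l $ 3)))"
      using le by (simp add: ennreal_mult)
    also have "(u $ 1 - l $ 1) * ((u $ 2 - l $ 2) * (u $ 3 - l $ 3)) = (\<Prod>b\<in>Basis. (u - l) \<bullet> b)"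
    proof -
      have "(\<Prod>b\<in>Basis. (u - l) \<bullet> b) = (\<Prod>i\<in>UNIV. (u - l) \<bullet> axis i 1)"
      proof (rule prod.reindex_cong[where l = "\<lambda>i. axis i 1"])
        show "inj_on (\<lambda>i::3. axis i (1::real)) UNIV" by (auto simp: inj_on_def axis_eq_axis)
        show "(Basis :: (real^3) set) = range (\<lambda>i. axis i 1)" by (auto simp: Basis_vec_def)
      qed simp
      also have "\<dots> = (u - l) $ 1 * ((u - l) $ 2 * (u - l) $ 3)"
        unfolding inner_axis UNIV_3 by simp
      finally show ?thesis by simp
    qed
    finally show "emeasure (distr ?P borel T) (box l u) = ennreal (\<Prod>b\<in>Basis. (u - l) \<bullet> b)" .
  next
    show "sets (distr ?P borel T) = sets borel" by (rule sets_distr)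
  qed
  have "(\<integral>\<^sup>+x. f x \<partial>lborel) = (\<integral>\<^sup>+x. f x \<partial>distr ?P borel T)"
    by (rule arg_cong[where f = "\<lambda>M. \<integral>\<^sup>+x. f x \<partial>M", OF lb])
  also have "\<dots> = (\<integral>\<^sup>+x. f (T x) \<partial>?P)"
    by (rule nn_integral_distr[OF T]) (simp add: f)
  also have "\<dots> = (\<integral>\<^sup>+a. \<integral>\<^sup>+bc. f (T (a, bc)) \<partial>(lborel \<Otimes>\<^sub>M lborel) \<partial>lborel)"
    using f by (intro sigma_finite_measure.nn_integral_fst[OF s2, symmetric]) simp
  also have "\<dots> = (\<integral>\<^sup>+a. \<integral>\<^sup>+b. \<integral>\<^sup>+c. f (T (a, b, c)) \<partial>lborel \<partial>lborel \<partial>lborel)"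
    using f by (intro nn_integral_cong lborel.nn_integral_fst[symmetric]) simp
  finally show ?thesis by (simp add: T_def)
qed

lemma red_measurable [measurable]: "red \<in> borel_measurable borel"
  unfolding red_def[abs_def] frac_def by measurable

text \<open>The interval is covered by 2 M full cells of length kk, and each contributes at most kk
  / pi times the same integral. Rounding R / (2 kk) up on both sides lengthens the interval by at
  most 2 kk.\<close>

lemma nn_integral_red_le:
  fixes \<phi> :: "real \<Rightarrow> ennreal"
  assumes [measurable]: "\<phi> \<in> borel_measurable borel" and R: "R > 0"
  shows "(\<integral>\<^sup>+a. \<phi> (red a) * indicator {- R / 2<..<R / 2} a \<partial>lborel) \<le>
    ennreal ((R + 2 * kk) / pi) * (\<integral>\<^sup>+\<xi>. \<phi> \<xi> * indicator {- (pi / 2)..pi / 2} \<xi> \<partial>lborel)"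
proof -
  define I where "I = (\<integral>\<^sup>+\<xi>. \<phi> \<xi> * indicator {- (pi / 2)..pi / 2} \<xi> \<partial>lborel)"
  define M where "M = \<lceil>R / (2 * kk)\<rceil>"
  have "0 \<le> R / (2 * kk)" using R kk(1) by simp
  then have M0: "M \<ge> 0" unfolding M_def by linarith
  have M1: "R / (2 * kk) \<le> real_of_int M" "real_of_int M \<le> R / (2 * kk) + 1"
    unfolding M_def by (rule le_of_int_ceiling, rule of_int_ceiling_le_add_one)
  have M: "R / 2 \<le> real_of_int M * kk" "2 * real_of_int M * kk \<le> R + 2 * kk"
  proof -
    have e: "R / (2 * kk) * kk = R / 2" using kk(1) by simp
    show "R / 2 \<le> real_of_int M * kk"
      using mult_right_mono[OF M1(1), of kk] kk(1) unfolding e by simp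
    show "2 * real_of_int M * kk \<le> R + 2 * kk"
      using mult_right_mono[OF M1(2), of kk] kk(1) unfolding distrib_right e by simp
  qed
  define P where "P n = {a. \<lfloor>a / kk\<rfloor> = n}" for n :: int
  have P[measurable]: "P n \<in> sets borel" for n unfolding P_def by measurable
  have piece: "(\<integral>\<^sup>+a. \<phi> (red a) * indicator (P n) a \<partial>lborel) \<le> ennreal (kk / pi) * I" for n
  proof -
    \<comment> \<open>The centre of the n-th cell: as \<xi> runs over [- pi / 2, pi / 2], the point
      t + kk \<xi> / pi runs over the cell.\<close>
    define t where "t = real_of_int n * kk + kk / 2"
    have eq: "(t + kk / pi * \<xi>) / kk = real_of_int n + (1 / 2 + \<xi> / pi)" for \<xi>
      using kk(1) by (simp add: t_def field_simps)
    have "(\<integral>\<^sup>+a. \<phi> (red a) * indicator (P n) a \<partial>lborel) =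
      ennreal \<bar>kk / pi\<bar> * (\<integral>\<^sup>+\<xi>. \<phi> (red (t + kk / pi * \<xi>)) * indicator (P n) (t + kk / pi * \<xi>) \<partial>lborel)"
      using kk(1) by (intro nn_integral_real_affine) auto
    also have "(\<integral>\<^sup>+\<xi>. \<phi> (red (t + kk / pi * \<xi>)) * indicator (P n) (t + kk / pi * \<xi>) \<partial>lborel) \<le> I"
      unfolding I_def
    proof (intro nn_integral_mono)
      fix \<xi> :: real
      show "\<phi> (red (t + kk / pi * \<xi>)) * indicator (P n) (t + kk / pi * \<xi>) \<le> \<phi> \<xi> * indicator {- (pi / 2)..pi / 2} \<xi>"
      proof (cases "t + kk / pi * \<xi> \<in> P n")
        case True
        then have fl: "\<lfloor>real_of_int n + (1 / 2 + \<xi> / pi)\<rfloor> = n" unfolding P_def mem_Collect_eq eq .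
        then have "0 \<le> 1 / 2 + \<xi> / pi" "1 / 2 + \<xi> / pi < 1" by linarith+
        then have b: "- (pi / 2) \<le> \<xi>" "\<xi> \<le> pi / 2" by (auto simp: field_simps)
        have "red (t + kk / pi * \<xi>) = \<xi>"
          unfolding red_def frac_def eq fl by (simp add: field_simps)
        then show ?thesis using b True by simp
      qed simp
    qed
    finally show ?thesis using kk(1) by (simp add: mult_left_mono)
  qed
  have "(\<integral>\<^sup>+a. \<phi> (red a) * indicator {- R / 2<..<R / 2} a \<partial>lborel) \<le>
     (\<integral>\<^sup>+a. (\<Sum>n\<in>{- M..<M}. \<phi> (red a) * indicator (P n) a) \<partial>lborel)"
  proof (intro nn_integral_mono)
    fix a :: real
    show "\<phi> (red a) * indicator {- R / 2<..<R / 2} a \<le> (\<Sum>n\<in>{- M..<M}. \<phi> (red a) * indicator (P n) a)"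
    proof (cases "a \<in> {- R / 2<..<R / 2}")
      case True
      then have "- (real_of_int M * kk) < a" "a < real_of_int M * kk" using M(1) by auto
      then have "- real_of_int M < a / kk" "a / kk < real_of_int M" using kk(1) by (auto simp: field_simps)
      then have n: "\<lfloor>a / kk\<rfloor> \<in> {- M..<M}" by (auto simp: le_floor_iff floor_less_iff)
      have "\<phi> (red a) * indicator {- R / 2<..<R / 2} a = \<phi> (red a) * indicator (P \<lfloor>a / kk\<rfloor>) a"
        using True by (simp add: P_def)
      also have "\<dots> \<le> (\<Sum>n\<in>{- M..<M}. \<phi> (red a) * indicator (P n) a)"
        by (rule member_le_sum[OF n]) auto
      finally show ?thesis .
    qed simp
  qed
  also have "\<dots> = (\<Sum>n\<in>{- M..<M}. \<integral>\<^sup>+a. \<phi> (red a) * indicator (P n) a \<partial>lborel)"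
    by (intro nn_integral_sum) simp
  also have "\<dots> \<le> (\<Sum>n\<in>{- M..<M}. ennreal (kk / pi) * I)"
    by (intro sum_mono piece)
  also have "\<dots> = ennreal (2 * real_of_int M * (kk / pi)) * I"
  proof -
    have c: "of_nat (card {- M..<M}) = ennreal (2 * real_of_int M)"
      using M0 by (simp add: ennreal_of_nat_eq_real_of_nat)
    have "(\<Sum>n\<in>{- M..<M}. ennreal (kk / pi) * I) = of_nat (card {- M..<M}) * (ennreal (kk / pi) * I)"
      by (rule sum_constant)
    also have "\<dots> = ennreal (2 * real_of_int M * (kk / pi)) * I"
      unfolding c mult.assoc[symmetric] using M0 kk(1) by (subst ennreal_mult) auto
    finally show ?thesis .
  qed
  also have "\<dots> \<le> ennreal ((R + 2 * kk) / pi) * I"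
    using M(2) by (intro mult_right_mono ennreal_leI) (auto simp: divide_right_mono)
  finally show ?thesis unfolding I_def .
qed

lemma arctan_scaled_deriv:
  fixes c :: real
  assumes "c > 0"
  shows "((\<lambda>y. arctan (y / c) / c) has_real_derivative 1 / (c\<^sup>2 + y\<^sup>2)) (at y within S)"
proof -
  have "inverse (1 + (y / c)\<^sup>2) / c / c = 1 / (c\<^sup>2 + y\<^sup>2)"
  proof -
    have "(1 + (y / c)\<^sup>2) * (c * c) = c\<^sup>2 + y\<^sup>2"
      using assms by (simp add: distrib_right power2_eq_square)
    then show ?thesis using assms by (simp add: divide_inverse mult.assoc flip: inverse_mult_distrib)
  qed
  moreover have "((\<lambda>y. arctan (y / c) / c) has_real_derivative inverse (1 + (y / c)\<^sup>2) / c / c) (at y within S)"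
    using assms by (auto intro!: derivative_eq_intros simp: divide_inverse)
  ultimately show ?thesis by simp
qed

lemma arsinh_scaled_deriv:
  fixes c :: real
  assumes "c > 0"
  shows "((\<lambda>y. arsinh (y / c)) has_real_derivative 1 / sqrt (y\<^sup>2 + c\<^sup>2)) (at y within S)"
proof -
  have "sqrt (y\<^sup>2 + c\<^sup>2) = sqrt (((y / c)\<^sup>2 + 1) * c\<^sup>2)"
    using assms by (simp add: field_simps)
  also have "\<dots> = sqrt ((y / c)\<^sup>2 + 1) * c"
    using assms by (simp add: real_sqrt_mult)
  finally have "1 / sqrt ((y / c)\<^sup>2 + 1) * (1 / c) = 1 / sqrt (y\<^sup>2 + c\<^sup>2)" by simp
  moreover have "((\<lambda>y. arsinh (y / c)) has_real_derivative 1 / sqrt ((y / c)\<^sup>2 + 1) * (1 / c)) (at y within S)"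
    by (rule DERIV_chain2[OF arsinh_real_has_field_derivative DERIV_cdivide[OF DERIV_ident]])
  ultimately show ?thesis by (simp only:)
qed

text \<open>Bounding each difference of arctangents by pi leaves a function of \<xi> that again has
  an elementary primitive.\<close>

lemma cell_profile_inner_integral:
  assumes A: "A \<ge> 0" and C: "C \<ge> 0" and s: "s > 0"
  shows "(\<integral>\<^sup>+y. ennreal (cell_profile A C s \<xi> y + C) * indicator {- (pi / 2)..pi / 2} y \<partial>lborel)
    \<le> ennreal (A * pi / sqrt (\<xi>\<^sup>2 + s\<^sup>2) + C * pi * s / (s\<^sup>2 + \<xi>\<^sup>2) + 2 * C * pi)"
proof -
  define c where "c = sqrt (\<xi>\<^sup>2 + s\<^sup>2)"
  have c: "c > 0" unfolding c_def using s by (simp add: add_nonneg_pos)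
  have c2: "c\<^sup>2 = \<xi>\<^sup>2 + s\<^sup>2" by (simp add: c_def)
  define B where "B = C * s\<^sup>2 / c\<^sup>2"
  have B: "B \<ge> 0" using C by (simp add: B_def)
  define F where "F y = A * (arctan (y / c) / c) + B * (arctan (y / s) / s) + 2 * C * y" for y
  define f where "f y = A * (1 / (c\<^sup>2 + y\<^sup>2)) + B * (1 / (s\<^sup>2 + y\<^sup>2)) + 2 * C" for y
  have f: "cell_profile A C s \<xi> y + C = f y" for y
    by (simp add: cell_profile_def f_def B_def c2 add_ac)
  have "(\<integral>\<^sup>+y. ennreal (f y) * indicator {- (pi / 2)..pi / 2} y \<partial>lborel) = ennreal (F (pi / 2) - F (- (pi / 2)))"
  proof (rule nn_integral_FTC_Icc)
    show "f \<in> borel_measurable borel" unfolding f_def[abs_def] by measurable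
    show "(F has_real_derivative f y) (at y)" if "y \<in> {- (pi / 2)..pi / 2}" for y
      unfolding F_def[abs_def] f_def
      by (rule DERIV_add[OF DERIV_add[OF DERIV_cmult[OF arctan_scaled_deriv[OF c]] DERIV_cmult[OF arctan_scaled_deriv[OF s]]]])
        (auto intro!: derivative_eq_intros)
    show "0 \<le> f y" if "y \<in> {- (pi / 2)..pi / 2}" for y unfolding f_def using A B C by (intro add_nonneg_nonneg mult_nonneg_nonneg) auto
  qed simp
  also have "\<dots> \<le> ennreal (A * pi / c + C * pi * s / (s\<^sup>2 + \<xi>\<^sup>2) + 2 * C * pi)"
  proof (rule ennreal_leI)
    have at: "arctan (pi / 2 / r) / r - arctan (- (pi / 2) / r) / r \<le> pi / r" if "r > 0" for r :: real
    proof -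
      have "arctan (pi / 2 / r) - arctan (- (pi / 2) / r) \<le> pi"
        using arctan_bounded[of "pi / 2 / r"] by (simp add: arctan_minus)
      then show ?thesis using that by (simp add: divide_right_mono flip: diff_divide_distrib)
    qed
    have "F (pi / 2) - F (- (pi / 2)) = A * (arctan (pi / 2 / c) / c - arctan (- (pi / 2) / c) / c) +
       B * (arctan (pi / 2 / s) / s - arctan (- (pi / 2) / s) / s) + 2 * C * pi"
      unfolding F_def by (simp add: algebra_simps)
    also have "\<dots> \<le> A * (pi / c) + B * (pi / s) + 2 * C * pi"
      using A B C by (intro add_mono mult_left_mono at c s) auto
    also have "B * (pi / s) = C * pi * s / (s\<^sup>2 + \<xi>\<^sup>2)"
      unfolding B_def c2 power2_eq_square[of s] using s by (simp add: add.commute mult_ac)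
    finally show "F (pi / 2) - F (- (pi / 2)) \<le> A * pi / c + C * pi * s / (s\<^sup>2 + \<xi>\<^sup>2) + 2 * C * pi" by simp
  qed
  finally show ?thesis unfolding f c_def .
qed

text \<open>The logarithm appears here: 1 / sqrt (\<xi>^2 + s^2) has the primitive arsinh (\<xi> /
  s), while the core term contributes an arctangent.\<close>

lemma cell_profile_outer_integral:
  assumes A: "A \<ge> 0" and C: "C \<ge> 0" and s: "s > 0"
  shows "(\<integral>\<^sup>+\<xi>. ennreal (A * pi / sqrt (\<xi>\<^sup>2 + s\<^sup>2) + C * pi * s / (s\<^sup>2 + \<xi>\<^sup>2) + 2 * C * pi) * indicator {- (pi / 2)..pi / 2} \<xi> \<partial>lborel)
    \<le> ennreal (2 * pi * A * arsinh (pi / (2 * s)) + 3 * C * pi\<^sup>2)"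
proof -
  define F where "F y = A * pi * arsinh (y / s) + C * pi * s * (arctan (y / s) / s) + 2 * C * pi * y" for y
  define f where "f y = A * pi * (1 / sqrt (y\<^sup>2 + s\<^sup>2)) + C * pi * s * (1 / (s\<^sup>2 + y\<^sup>2)) + 2 * C * pi" for y
  have "(\<integral>\<^sup>+y. ennreal (f y) * indicator {- (pi / 2)..pi / 2} y \<partial>lborel) = ennreal (F (pi / 2) - F (- (pi / 2)))"
  proof (rule nn_integral_FTC_Icc)
    show "f \<in> borel_measurable borel" unfolding f_def[abs_def] by measurable
    show "(F has_real_derivative f y) (at y)" if "y \<in> {- (pi / 2)..pi / 2}" for y
      unfolding F_def[abs_def] f_def
      by (rule DERIV_add[OF DERIV_add[OF DERIV_cmult[OF arsinh_scaled_deriv[OF s]] DERIV_cmult[OF arctan_scaled_deriv[OF s]]]])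
        (auto intro!: derivative_eq_intros)
    show "0 \<le> f y" if "y \<in> {- (pi / 2)..pi / 2}" for y unfolding f_def using A C s by (intro add_nonneg_nonneg mult_nonneg_nonneg) auto
  qed simp
  also have "\<dots> \<le> ennreal (2 * pi * A * arsinh (pi / (2 * s)) + 3 * C * pi\<^sup>2)"
  proof (rule ennreal_leI)
    have e: "F (pi / 2) - F (- (pi / 2)) = 2 * pi * A * arsinh (pi / (2 * s)) + C * pi * (2 * arctan (pi / (2 * s))) + 2 * C * pi\<^sup>2"
      unfolding F_def using s by (simp add: arctan_minus power2_eq_square algebra_simps)
    have "2 * arctan (pi / (2 * s)) \<le> pi" using arctan_bounded[of "pi / (2 * s)"] by simp
    then have "C * pi * (2 * arctan (pi / (2 * s))) \<le> C * pi * pi"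
      using C by (intro mult_left_mono) auto
    then show "F (pi / 2) - F (- (pi / 2)) \<le> 2 * pi * A * arsinh (pi / (2 * s)) + 3 * C * pi\<^sup>2"
      unfolding e by (simp add: power2_eq_square algebra_simps)
  qed
  finally show ?thesis unfolding f_def by simp
qed

text \<open>The third coordinate contributes the length R, each horizontal one a factor (R + 2 kk) /
  pi. Then s^2 pi / 2, 1 / pi^2 and 2 pi A multiply to s^2 A, so the leading coefficient is A
  itself.\<close>

lemma trial_energy_le:
  assumes A: "A \<ge> 0" and C: "C \<ge> 0" and s: "s > 0" and R: "R > 0"
    and dens: "\<And>x. x \<in> cubeQ R \<Longrightarrow> GL_density (s\<^sup>2) u g x \<le> s\<^sup>2 * (pi / 2) * (cell_profile A C s (red (x $ 1)) (red (x $ 2)) + C)"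
  shows "GL_energy (s\<^sup>2) R u g \<le> ennreal (s\<^sup>2 * R * (R + 2 * kk)\<^sup>2 * (A * arsinh (pi / (2 * s)) + 3 * pi * C / 2))"
proof -
  define q where "q = s\<^sup>2 * (pi / 2)"
  define L where "L = (R + 2 * kk) / pi"
  define P where "P \<xi> y = ennreal (cell_profile A C s \<xi> y + C)" for \<xi> y
  define J where "J = {- R / 2<..<R / 2}"
  define B where "B = {- (pi / 2)..pi / 2}"
  define V where "V \<xi> = A * pi / sqrt (\<xi>\<^sup>2 + s\<^sup>2) + C * pi * s / (s\<^sup>2 + \<xi>\<^sup>2) + 2 * C * pi" for \<xi>
  have q: "q \<ge> 0" by (simp add: q_def)
  have L: "L \<ge> 0" using R kk(1) by (simp add: L_def)
  have J[measurable]: "J \<in> sets borel" by (simp add: J_def)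
  have Pm[measurable]: "(\<lambda>(\<xi>, y). P \<xi> y) \<in> borel_measurable (borel \<Otimes>\<^sub>M borel)"
    unfolding P_def cell_profile_def by measurable
  have Pm2[measurable]: "P \<xi> \<in> borel_measurable borel" for \<xi>
    unfolding P_def cell_profile_def by measurable
  have comp[measurable]: "(\<lambda>x::real^3. x $ i) \<in> borel_measurable borel" for i
    by (intro borel_measurable_continuous_onI continuous_intros)
  define H where "H x = ennreal q * (P (red (x $ 1)) (red (x $ 2)) * indicator J (x $ 1) * indicator J (x $ 2) * indicator J (x $ 3))" for x :: "real^3"
  have Hm: "H \<in> borel_measurable borel"
    unfolding H_def[abs_def] P_def cell_profile_def by measurable
  have "GL_energy (s\<^sup>2) R u g = (\<integral>\<^sup>+x. ennreal (GL_density (s\<^sup>2) u g x) * indicator (cubeQ R) x \<partial>lborel)"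
    unfolding GL_energy_def GL_density_def covD_def nn_integral_completion ..
  also have "\<dots> \<le> (\<integral>\<^sup>+x. H x \<partial>lborel)"
  proof (intro nn_integral_mono)
    fix x :: "real^3"
    show "ennreal (GL_density (s\<^sup>2) u g x) * indicator (cubeQ R) x \<le> H x"
    proof (cases "x \<in> cubeQ R")
      case True
      then have "x $ i \<in> J" for i by (simp add: cubeQ_def J_def)
      then have "H x = ennreal q * P (red (x $ 1)) (red (x $ 2))" by (simp add: H_def)
      also have "\<dots> = ennreal (q * (cell_profile A C s (red (x $ 1)) (red (x $ 2)) + C))"
        unfolding P_def by (rule ennreal_mult'[OF q, symmetric])
      finally show ?thesis using dens[OF True] True by (simp add: q_def ennreal_leI)
    qed simp
  qed
  also have "\<dots> = (\<integral>\<^sup>+a. \<integral>\<^sup>+b. \<integral>\<^sup>+c. H (vector [a, b, c]) \<partial>lborel \<partial>lborel \<partial>lborel)"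
    by (rule nn_integral_vec3[OF Hm])
  also have "\<dots> = (\<integral>\<^sup>+a. \<integral>\<^sup>+b. ennreal (q * R) * (P (red a) (red b) * indicator J a * indicator J b) \<partial>lborel \<partial>lborel)"
  proof (intro nn_integral_cong)
    fix a b :: real
    have "(\<integral>\<^sup>+c. H (vector [a, b, c]) \<partial>lborel) = (\<integral>\<^sup>+c. (ennreal q * (P (red a) (red b) * indicator J a * indicator J b)) * indicator J c \<partial>lborel)"
      by (simp add: H_def mult.assoc)
    also have "\<dots> = (ennreal q * (P (red a) (red b) * indicator J a * indicator J b)) * emeasure lborel J"
      by (rule nn_integral_cmult_indicator) simp
    also have "emeasure lborel J = ennreal R" using R by (simp add: J_def)
    also have "(ennreal q * (P (red a) (red b) * indicator J a * indicator J b)) * ennreal R = ennreal (q * R) * (P (red a) (red b) * indicator J a * indicator J b)"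
      using q R by (simp add: ennreal_mult mult_ac)
    finally show "(\<integral>\<^sup>+c. H (vector [a, b, c]) \<partial>lborel) = ennreal (q * R) * (P (red a) (red b) * indicator J a * indicator J b)" .
  qed
  also have "\<dots> \<le> (\<integral>\<^sup>+a. ennreal (q * R * L) * (ennreal (V (red a)) * indicator J a) \<partial>lborel)"
  proof (intro nn_integral_mono)
    fix a :: real
    have "(\<integral>\<^sup>+b. ennreal (q * R) * (P (red a) (red b) * indicator J a * indicator J b) \<partial>lborel) =
      (\<integral>\<^sup>+b. (ennreal (q * R) * indicator J a) * (P (red a) (red b) * indicator J b) \<partial>lborel)"
      by (intro nn_integral_cong) (simp add: mult_ac)
    also have "\<dots> = (ennreal (q * R) * indicator J a) * (\<integral>\<^sup>+b. P (red a) (red b) * indicator J b \<partial>lborel)"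
      by (rule nn_integral_cmult) simp
    also have "\<dots> \<le> (ennreal (q * R) * indicator J a) * (ennreal L * (\<integral>\<^sup>+y. P (red a) y * indicator B y \<partial>lborel))"
      unfolding J_def L_def B_def by (intro mult_left_mono nn_integral_red_le R) auto
    also have "\<dots> \<le> (ennreal (q * R) * indicator J a) * (ennreal L * ennreal (V (red a)))"
      unfolding P_def V_def B_def by (intro mult_left_mono cell_profile_inner_integral A C s) auto
    also have "\<dots> = ennreal (q * R * L) * (ennreal (V (red a)) * indicator J a)"
      using q R L by (simp add: ennreal_mult mult_ac)
    finally show "(\<integral>\<^sup>+b. ennreal (q * R) * (P (red a) (red b) * indicator J a * indicator J b) \<partial>lborel) \<le>
      ennreal (q * R * L) * (ennreal (V (red a)) * indicator J a)" .
  qed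
  also have "\<dots> = ennreal (q * R * L) * (\<integral>\<^sup>+a. ennreal (V (red a)) * indicator J a \<partial>lborel)"
    unfolding V_def by (rule nn_integral_cmult) measurable
  also have "\<dots> \<le> ennreal (q * R * L) * (ennreal L * (\<integral>\<^sup>+\<xi>. ennreal (V \<xi>) * indicator B \<xi> \<partial>lborel))"
  proof -
    have Vm: "(\<lambda>\<xi>. ennreal (V \<xi>)) \<in> borel_measurable borel" unfolding V_def by measurable
    show ?thesis unfolding J_def L_def B_def by (intro mult_left_mono nn_integral_red_le[OF Vm R]) auto
  qed
  also have "\<dots> \<le> ennreal (q * R * L) * (ennreal L * ennreal (2 * pi * A * arsinh (pi / (2 * s)) + 3 * C * pi\<^sup>2))"
    unfolding V_def B_def by (intro mult_left_mono cell_profile_outer_integral A C s) auto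
  also have "\<dots> = ennreal (q * R * L * (L * (2 * pi * A * arsinh (pi / (2 * s)) + 3 * C * pi\<^sup>2)))"
  proof -
    have "ennreal X * (ennreal Y * ennreal Z) = ennreal (X * (Y * Z))" if "0 \<le> X" "0 \<le> Y" for X Y Z
      using that by (simp add: ennreal_mult')
    then show ?thesis using q R L by simp
  qed
  also have "q * R * L * (L * (2 * pi * A * arsinh (pi / (2 * s)) + 3 * C * pi\<^sup>2)) =
     s\<^sup>2 * R * (R + 2 * kk)\<^sup>2 * (A * arsinh (pi / (2 * s)) + 3 * pi * C / 2)"
  proof -
    have "S * (p / 2) * R * (X / p) * (X / p * (2 * p * A * Y + 3 * C * p\<^sup>2)) = S * R * X\<^sup>2 * (A * Y + 3 * p * C / 2)"
      if "p > 0" for S p X Y :: real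
      using that by (simp add: field_simps power2_eq_square)
    from this[OF pi_gt_zero] show ?thesis unfolding q_def L_def by blast
  qed
  finally show ?thesis .
qed

text \<open>Young's inequality is used with \<eta> / 2, and y0 is taken so small that dividing by
  the sixth power of its cosine stays within 1 + \<eta>. The constant C depends on \<eta>
  alone.\<close>

theorem GL_upper_bound:
  assumes \<eta>: "\<eta> > 0"
  obtains C where "C \<ge> 0" "\<And>s R. 0 < s \<Longrightarrow> s \<le> 1 \<Longrightarrow> 0 < R \<Longrightarrow>
    \<exists>u g. H1_weak_grad (cubeQ R) u g \<and>
      GL_energy (s\<^sup>2) R u g \<le> ennreal (s\<^sup>2 * R * (R + 2 * kk)\<^sup>2 * ((1 + \<eta>) * arsinh (pi / (2 * s)) + C))"
proof -
  have "\<exists>y0. 0 < y0 \<and> y0 < pi / 2 \<and> (1 + \<eta> / 2) / cos y0 ^ 6 \<le> 1 + \<eta>"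
  proof -
    have "((\<lambda>y. (1 + \<eta> / 2) / cos y ^ 6) \<longlongrightarrow> (1 + \<eta> / 2) / cos 0 ^ 6) (at_right 0)"
      by (intro tendsto_intros) auto
    then have "\<forall>\<^sub>F y in at_right 0. (1 + \<eta> / 2) / cos y ^ 6 < 1 + \<eta>"
      using \<eta> by (intro order_tendstoD(2)) auto
    moreover have "\<forall>\<^sub>F y in at_right (0::real). y \<in> {0<..<pi / 2}"
      by (rule eventually_at_right_real) simp
    ultimately have "\<forall>\<^sub>F y in at_right 0. 0 < y \<and> y < pi / 2 \<and> (1 + \<eta> / 2) / cos y ^ 6 \<le> 1 + \<eta>"
      by eventually_elim auto
    then show ?thesis using eventually_happens'[OF trivial_limit_at_right_real] by blast
  qed
  then obtain y0 where y0: "0 < y0" "y0 < pi / 2" "(1 + \<eta> / 2) / cos y0 ^ 6 \<le> 1 + \<eta>" by blast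
  define A where "A = (1 + \<eta> / 2) / cos y0 ^ 6"
  have A: "A \<ge> 0" unfolding A_def using \<eta> by simp
  have \<eta>2: "\<eta> / 2 > 0" using \<eta> by simp
  obtain C where C: "C \<ge> 0" and cell: "\<And>s \<xi> y. 0 < s \<Longrightarrow> \<bar>\<xi>\<bar> \<le> pi / 2 \<Longrightarrow> \<bar>y\<bar> \<le> pi / 2 \<Longrightarrow>
    (1 + \<eta> / 2) * cell_K s \<xi> y + (1 + 1 / (\<eta> / 2)) + s\<^sup>2 / (cell_m \<xi> y + s\<^sup>2)\<^sup>2 \<le> cell_profile A C s \<xi> y + s\<^sup>2 * C"
    unfolding A_def by (rule cell_bound[OF y0(1,2) \<eta>2]) blast
  show ?thesis
  proof (rule that)
    show "0 \<le> 3 * pi * C / 2" using C by simp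
    fix s R :: real assume s: "0 < s" "s \<le> 1" and R: "0 < R"
    \<comment> \<open>Enough summands that both surviving neighbours occur for every cell that meets
      the cube.\<close>
    define N where "N = \<lceil>R / (2 * kk)\<rceil> + 2"
    have N: "\<bar>\<lfloor>x $ 1 / kk\<rfloor>\<bar> + 1 \<le> N" if "x \<in> cubeQ R" for x
    proof -
      have "- R / 2 < x $ 1" "x $ 1 < R / 2" using that by (auto simp: cubeQ_def)
      then have "- (R / 2) / kk \<le> x $ 1 / kk" "x $ 1 / kk \<le> R / 2 / kk"
        using kk(1) by (intro divide_right_mono; simp)+
      then have "- (R / (2 * kk)) \<le> x $ 1 / kk" "x $ 1 / kk \<le> R / (2 * kk)" by simp_all
      then show ?thesis unfolding N_def by linarith
    qed
    have dens: "GL_density (s\<^sup>2) (trialU s N) (trialG s N) x \<le> s\<^sup>2 * (pi / 2) * (cell_profile A C s (red (x $ 1)) (red (x $ 2)) + C)"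
      if x: "x \<in> cubeQ R" for x
    proof -
      have "s\<^sup>2 * C \<le> 1 * C" using s C by (intro mult_right_mono) (auto simp: power_le_one)
      then have "(1 + \<eta> / 2) * cell_K s (red (x $ 1)) (red (x $ 2)) + (1 + 1 / (\<eta> / 2)) + s\<^sup>2 / (cell_m (red (x $ 1)) (red (x $ 2)) + s\<^sup>2)\<^sup>2
        \<le> cell_profile A C s (red (x $ 1)) (red (x $ 2)) + C"
        using cell[OF s(1) red_bound[of "x $ 1"] red_bound[of "x $ 2"]] by linarith
      then have "s\<^sup>2 * (pi / 2) * ((1 + \<eta> / 2) * cell_K s (red (x $ 1)) (red (x $ 2)) + (1 + 1 / (\<eta> / 2)) + s\<^sup>2 / (cell_m (red (x $ 1)) (red (x $ 2)) + s\<^sup>2)\<^sup>2)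
        \<le> s\<^sup>2 * (pi / 2) * (cell_profile A C s (red (x $ 1)) (red (x $ 2)) + C)"
        by (intro mult_left_mono) auto
      then show ?thesis using trial_density_le[OF s(1) \<eta>2 N[OF x]] by (rule order_trans[rotated])
    qed
    have "GL_energy (s\<^sup>2) R (trialU s N) (trialG s N) \<le> ennreal (s\<^sup>2 * R * (R + 2 * kk)\<^sup>2 * (A * arsinh (pi / (2 * s)) + 3 * pi * C / 2))"
      by (rule trial_energy_le[OF A C s(1) R dens])
    also have "\<dots> \<le> ennreal (s\<^sup>2 * R * (R + 2 * kk)\<^sup>2 * ((1 + \<eta>) * arsinh (pi / (2 * s)) + 3 * pi * C / 2))"
    proof -
      have "arsinh (pi / (2 * s)) \<ge> 0"
        using arsinh_less_iff_real[of "pi / (2 * s)" 0] s by (simp add: not_less[symmetric] del: arsinh_less_iff_real) (simp add: not_less)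
      then show ?thesis using y0(3) R kk(1) unfolding A_def
        by (intro ennreal_leI mult_left_mono add_right_mono mult_right_mono) auto
    qed
    finally show "\<exists>u g. H1_weak_grad (cubeQ R) u g \<and>
      GL_energy (s\<^sup>2) R u g \<le> ennreal (s\<^sup>2 * R * (R + 2 * kk)\<^sup>2 * ((1 + \<eta>) * arsinh (pi / (2 * s)) + 3 * pi * C / 2))"
      using trial_H1_weak_grad[OF s(1)] by blast
  qed
qed

section \<open>Asymptotics of the ground state energy\<close>

text \<open>Here arsinh z \<le> ln (2 z + 1) turns the trial energy into ln (1 / sqrt b) plus a
  constant. Finiteness of the infimum is recorded because \<open>enn2real\<close> sends infinity to
  0, so that \<open>M0_lower\<close> could otherwise fail.\<close>

lemma M0_upper:
  assumes \<eta>: "\<eta> > 0"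
  obtains C where "C \<ge> 0" "\<And>b R. 0 < b \<Longrightarrow> b \<le> 1 \<Longrightarrow> 0 < R \<Longrightarrow>
    M0 b R \<le> b * R * (R + 2 * kk)\<^sup>2 * ((1 + \<eta>) * ln (1 / sqrt b) + C)"
    "\<And>b R. 0 < b \<Longrightarrow> b \<le> 1 \<Longrightarrow> 0 < R \<Longrightarrow>
    (INF ug \<in> {(u, g). H1_weak_grad (cubeQ R) u g}. GL_energy b R (fst ug) (snd ug)) < \<infinity>"
proof -
  obtain C where C: "C \<ge> 0" and trial: "\<And>s R. 0 < s \<Longrightarrow> s \<le> 1 \<Longrightarrow> 0 < R \<Longrightarrow>
    \<exists>u g. H1_weak_grad (cubeQ R) u g \<and>
      GL_energy (s\<^sup>2) R u g \<le> ennreal (s\<^sup>2 * R * (R + 2 * kk)\<^sup>2 * ((1 + \<eta>) * arsinh (pi / (2 * s)) + C))"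
    by (rule GL_upper_bound[OF \<eta>]) blast
  define C' where "C' = (1 + \<eta>) * ln (pi + 1) + C"
  have C': "C' \<ge> 0" unfolding C'_def using C \<eta> by simp
  have inf: "(INF ug \<in> {(u, g). H1_weak_grad (cubeQ R) u g}. GL_energy b R (fst ug) (snd ug))
      \<le> ennreal (b * R * (R + 2 * kk)\<^sup>2 * ((1 + \<eta>) * ln (1 / sqrt b) + C'))"
    (is "?I b R \<le> _") if b: "0 < b" "b \<le> 1" and R: "0 < R" for b R
  proof -
    have s: "0 < sqrt b" "sqrt b \<le> 1" "(sqrt b)\<^sup>2 = b" using b by auto
    have "arsinh (pi / (2 * sqrt b)) \<le> ln ((pi + 1) / sqrt b)"
    proof -
      define z where "z = pi / (2 * sqrt b)"
      have z: "z > 0" using s by (simp add: z_def)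
      have "sqrt (z\<^sup>2 + 1) \<le> z + 1" using z by (intro real_le_lsqrt) (auto simp: power2_eq_square algebra_simps)
      then have "z + sqrt (z\<^sup>2 + 1) \<le> pi / sqrt b + 1" by (simp add: z_def)
      also have "\<dots> \<le> pi / sqrt b + 1 / sqrt b" using s by simp
      finally have "z + sqrt (z\<^sup>2 + 1) \<le> (pi + 1) / sqrt b" by (simp add: add_divide_distrib)
      then show ?thesis unfolding arsinh_real_def z_def[symmetric] using arsinh_real_aux[of z] by (rule ln_mono)
    qed
    also have "\<dots> = ln (1 / sqrt b) + ln (pi + 1)"
    proof -
      have "pi + 1 > 0" using pi_gt_zero by linarith
      then show ?thesis using s by (simp add: ln_div)
    qed
    finally have le: "(1 + \<eta>) * arsinh (pi / (2 * sqrt b)) + C \<le> (1 + \<eta>) * ln (1 / sqrt b) + C'"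
      using \<eta> mult_left_mono[of "arsinh (pi / (2 * sqrt b))" "ln (1 / sqrt b) + ln (pi + 1)" "1 + \<eta>"]
      unfolding C'_def distrib_left[of "1 + \<eta>"] by linarith
    obtain u g where ug: "H1_weak_grad (cubeQ R) u g"
      "GL_energy b R u g \<le> ennreal (b * R * (R + 2 * kk)\<^sup>2 * ((1 + \<eta>) * arsinh (pi / (2 * sqrt b)) + C))"
      using trial[OF s(1,2) R] unfolding s(3) by blast
    have "?I b R \<le> GL_energy b R u g"
      by (rule INF_lower2[where i = "(u, g)"]) (use ug in auto)
    also note ug(2)
    also have "ennreal (b * R * (R + 2 * kk)\<^sup>2 * ((1 + \<eta>) * arsinh (pi / (2 * sqrt b)) + C)) \<le>
       ennreal (b * R * (R + 2 * kk)\<^sup>2 * ((1 + \<eta>) * ln (1 / sqrt b) + C'))"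
      using le b R by (intro ennreal_leI mult_left_mono) auto
    finally show ?thesis .
  qed
  show ?thesis
  proof (rule that[OF C'])
    fix b R :: real assume b: "0 < b" "b \<le> 1" and R: "0 < R"
    show "M0 b R \<le> b * R * (R + 2 * kk)\<^sup>2 * ((1 + \<eta>) * ln (1 / sqrt b) + C')"
    proof -
      have "0 \<le> ln (1 / sqrt b)" using b by (intro ln_ge_zero) auto
      then show ?thesis unfolding M0_def using inf[OF b R] b R \<eta> C'
        by (intro enn2real_leI) auto
    qed
    show "?I b R < \<infinity>" using inf[OF b R] by (rule le_less_trans) (simp add: less_top)
  qed
qed

lemma M0_lower:
  assumes "0 < b" "b \<le> 1" "0 < R" and E: "0 \<le> E"
    and no: "\<And>u g. H1_weak_grad (cubeQ R) u g \<Longrightarrow> \<not> GL_energy b R u g \<le> ennreal E"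
  shows "E \<le> M0 b R"
proof -
  let ?I = "INF ug \<in> {(u, g). H1_weak_grad (cubeQ R) u g}. GL_energy b R (fst ug) (snd ug)"
  have "?I < \<infinity>" by (rule M0_upper[OF zero_less_one]) (use assms(1-3) in blast)
  moreover have "ennreal E \<le> ?I" using no by (intro INF_greatest) (auto simp: not_le intro: less_imp_le)
  ultimately have "enn2real (ennreal E) \<le> M0 b R" unfolding M0_def by (intro enn2real_mono) auto
  then show ?thesis using E by simp
qed

text \<open>Relative to b \<Lambda> R^3, the incomplete cells at the boundary cost the factor (1 + 2
  kk / R)^2 and the constant C only C / \<Lambda>.\<close>

lemma M0_upper_asymp:
  fixes b R :: "'a \<Rightarrow> real"
  defines "\<Lambda> \<equiv> \<lambda>t. ln (1 / sqrt (b t))"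
  assumes b: "\<forall>\<^sub>F t in F. 0 < b t" "\<forall>\<^sub>F t in F. b t \<le> 1"
    and R: "filterlim R at_top F" and \<Lambda>: "filterlim \<Lambda> at_top F" and \<eta>: "0 < \<eta>"
  shows "\<forall>\<^sub>F t in F. M0 (b t) (R t) / R t ^ 3 \<le> (1 + \<eta>) * (b t * \<Lambda> t)"
proof -
  have \<eta>2: "\<eta> / 2 > 0" using \<eta> by simp
  obtain C where up: "\<And>b R. 0 < b \<Longrightarrow> b \<le> 1 \<Longrightarrow> 0 < R \<Longrightarrow>
    M0 b R \<le> b * R * (R + 2 * kk)\<^sup>2 * ((1 + \<eta> / 2) * ln (1 / sqrt b) + C)"
    by (rule M0_upper[OF \<eta>2]) blast
  have Ri: "((\<lambda>t. K / R t) \<longlongrightarrow> 0) F" for K by (rule tendsto_divide_0[OF tendsto_const filterlim_at_top_imp_at_infinity[OF R]])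
  have \<Lambda>i: "((\<lambda>t. K / \<Lambda> t) \<longlongrightarrow> 0) F" for K by (rule tendsto_divide_0[OF tendsto_const filterlim_at_top_imp_at_infinity[OF \<Lambda>]])
  have "((\<lambda>t. (1 + 2 * kk / R t)\<^sup>2 * ((1 + \<eta> / 2) + C / \<Lambda> t)) \<longlongrightarrow> (1 + 0)\<^sup>2 * ((1 + \<eta> / 2) + 0)) F"
    by (intro tendsto_intros Ri \<Lambda>i)
  then have lim: "\<forall>\<^sub>F t in F. (1 + 2 * kk / R t)\<^sup>2 * ((1 + \<eta> / 2) + C / \<Lambda> t) < 1 + \<eta>"
    using \<eta> by (intro order_tendstoD(2)) auto
  have Rp: "\<forall>\<^sub>F t in F. 0 < R t" and \<Lambda>p: "\<forall>\<^sub>F t in F. 0 < \<Lambda> t"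
    using R \<Lambda> by (auto simp: filterlim_at_top_dense)
  show ?thesis using lim b Rp \<Lambda>p
  proof eventually_elim
    case (elim t)
    have "b t * R t * (R t + 2 * kk)\<^sup>2 * ((1 + \<eta> / 2) * \<Lambda> t + C) / R t ^ 3 =
       ((1 + 2 * kk / R t)\<^sup>2 * ((1 + \<eta> / 2) + C / \<Lambda> t)) * (b t * \<Lambda> t)"
    proof -
      have "\<beta> * r * (r + k)\<^sup>2 * (h * L + C) / r ^ 3 = ((1 + k / r)\<^sup>2 * (h + C / L)) * (\<beta> * L)"
        if "0 < r" "0 < L" for \<beta> r k h L :: real
      proof -
        have e: "r + k = r * (1 + k / r)" "h * L + C = L * (h + C / L)" using that by (auto simp: algebra_simps)
        show ?thesis unfolding e power_mult_distrib using that by (simp add: power2_eq_square power3_eq_cube)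
      qed
      from this[OF elim(4,5)] show ?thesis by blast
    qed
    also have "\<dots> \<le> (1 + \<eta>) * (b t * \<Lambda> t)"
      using elim by (intro mult_right_mono) auto
    finally have "b t * R t * (R t + 2 * kk)\<^sup>2 * ((1 + \<eta> / 2) * \<Lambda> t + C) / R t ^ 3 \<le> (1 + \<eta>) * (b t * \<Lambda> t)" .
    moreover have "M0 (b t) (R t) / R t ^ 3 \<le> b t * R t * (R t + 2 * kk)\<^sup>2 * ((1 + \<eta> / 2) * \<Lambda> t + C) / R t ^ 3"
      using up[OF elim(2,3,4)] elim(4) unfolding \<Lambda>_def by (intro divide_right_mono) auto
    ultimately show ?case by (rule order_trans[rotated])
  qed
qed

text \<open>A competitor of energy at most (1 - \<eta>) b \<Lambda> R^3 would turn
  \<open>GL_lower_bound\<close>, divided by \<Lambda> R^3, into a contradiction with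
  \<open>gap\<close> in the limit. The radii from K sqrt b to r1 exhaust the logarithm up to the
  bounded term ln (r1 / K).\<close>

lemma M0_lower_asymp:
  fixes b R :: "'a \<Rightarrow> real"
  defines "\<Lambda> \<equiv> \<lambda>t. ln (1 / sqrt (b t))"
  assumes b: "\<forall>\<^sub>F t in F. 0 < b t" "(b \<longlongrightarrow> 0) F"
    and R: "filterlim R at_top F" and \<Lambda>: "filterlim \<Lambda> at_top F"
    and \<Lambda>R: "((\<lambda>t. sqrt (\<Lambda> t) / R t) \<longlongrightarrow> 0) F" and \<eta>: "0 < \<eta>" "\<eta> < 1"
  shows "\<forall>\<^sub>F t in F. (1 - \<eta>) * (b t * \<Lambda> t) \<le> M0 (b t) (R t) / R t ^ 3"
proof -
  \<comment> \<open>Each loss is given its share of \<eta>: c for the truncation of the current, K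
    for circles of low modulus, r1 for the factor 1 - r^2, \<delta> for the volume lost to the
    cutoff. K is exactly what makes 64 pi / ((1 - c)^2 K) equal to \<eta> / 4.\<close>
  define c where "c = 1 - \<eta> / 4"
  define K where "K = 4096 * pi / \<eta> ^ 3"
  define r1 where "r1 = \<eta> / 4"
  define \<delta> where "\<delta> = \<eta> / 32"
  have c: "0 < c" "c < 1" using \<eta> by (auto simp: c_def)
  have K: "1 \<le> K"
  proof -
    have "\<eta> ^ 3 \<le> 1" using \<eta> by (simp add: power_le_one)
    then show ?thesis using \<eta> pi_gt3 unfolding K_def by (simp add: pos_le_divide_eq)
  qed
  have r1: "0 < r1" "r1 \<le> 1" using \<eta> by (auto simp: r1_def)
  have \<delta>: "0 < \<delta>" "\<delta> < 1 / 4" using \<eta> by (auto simp: \<delta>_def)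
  have gap: "(1 - \<eta>) * (1 / c + 64 * pi / ((1 - c)\<^sup>2 * K)) < (1 - r1\<^sup>2) * (1 - 2 * \<delta>) ^ 3"
  proof -
    have "(1 - \<eta>) * (1 / c) \<le> 1 - 3 * \<eta> / 4"
    proof -
      have "1 - \<eta> \<le> (1 - 3 * \<eta> / 4) * c"
        unfolding c_def using zero_le_power2[of \<eta>] by (simp add: power2_eq_square algebra_simps)
      then show ?thesis using c by (simp add: pos_divide_le_eq)
    qed
    moreover have "(1 - \<eta>) * (64 * pi / ((1 - c)\<^sup>2 * K)) \<le> \<eta> / 4"
    proof -
      have "64 * pi / ((1 - c)\<^sup>2 * K) = \<eta> / 4"
        unfolding c_def K_def using \<eta> by (simp add: field_simps power2_eq_square power3_eq_cube)
      moreover have "(1 - \<eta>) * (\<eta> / 4) \<le> 1 * (\<eta> / 4)" using \<eta> by (intro mult_right_mono) auto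
      ultimately show ?thesis by (simp only: mult_1)
    qed
    ultimately have "(1 - \<eta>) * (1 / c + 64 * pi / ((1 - c)\<^sup>2 * K)) \<le> 1 - \<eta> / 2"
      unfolding distrib_left by linarith
    also have "\<dots> < (1 - \<eta> / 16) * (1 - 3 * \<eta> / 16)"
      using \<eta> by (simp add: algebra_simps add_pos_pos)
    also have "\<dots> \<le> (1 - r1\<^sup>2) * (1 - 2 * \<delta>) ^ 3"
    proof (rule mult_mono)
      have "\<eta>\<^sup>2 \<le> \<eta>" using \<eta> by (simp add: power2_eq_square mult_left_le)
      then show "1 - \<eta> / 16 \<le> 1 - r1\<^sup>2" by (simp add: r1_def power_divide)
      have "1 + real 3 * (- 2 * \<delta>) \<le> (1 + (- 2 * \<delta>)) ^ 3"
        using \<delta> by (intro Bernoulli_inequality) simp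
      then show "1 - 3 * \<eta> / 16 \<le> (1 - 2 * \<delta>) ^ 3" by (simp add: \<delta>_def)
    qed (use \<eta> r1 in \<open>auto simp: power_le_one\<close>)
    finally show ?thesis .
  qed
  have Ri: "((\<lambda>t. k / R t) \<longlongrightarrow> 0) F" for k by (rule tendsto_divide_0[OF tendsto_const filterlim_at_top_imp_at_infinity[OF R]])
  have \<Lambda>i: "((\<lambda>t. k / \<Lambda> t) \<longlongrightarrow> 0) F" for k by (rule tendsto_divide_0[OF tendsto_const filterlim_at_top_imp_at_infinity[OF \<Lambda>]])
  have "((\<lambda>t. (1 - r1\<^sup>2) * ((1 + ln (r1 / K) / \<Lambda> t) * ((1 - 5 / R t - 2 * \<delta>) ^ 3 -
      (sqrt (\<Lambda> t) / R t) * (((1 - 1 / R t) ^ 3 + (1 - \<eta>) / c) / \<delta>)))) \<longlongrightarrow>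
      (1 - r1\<^sup>2) * ((1 + 0) * ((1 - 0 - 2 * \<delta>) ^ 3 - 0 * (((1 - 0) ^ 3 + (1 - \<eta>) / c) / \<delta>)))) F"
    using \<delta> by (intro tendsto_intros Ri \<Lambda>i \<Lambda>R) auto
  then have lim: "\<forall>\<^sub>F t in F. (1 - \<eta>) * (1 / c + 64 * pi / ((1 - c)\<^sup>2 * K)) <
     (1 - r1\<^sup>2) * ((1 + ln (r1 / K) / \<Lambda> t) * ((1 - 5 / R t - 2 * \<delta>) ^ 3 -
      (sqrt (\<Lambda> t) / R t) * (((1 - 1 / R t) ^ 3 + (1 - \<eta>) / c) / \<delta>)))"
    using gap by (intro order_tendstoD(1)) auto
  have R10: "\<forall>\<^sub>F t in F. 10 < R t" and \<Lambda>p: "\<forall>\<^sub>F t in F. 0 < \<Lambda> t"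
    using R \<Lambda> by (auto simp: filterlim_at_top_dense)
  have small: "\<forall>\<^sub>F t in F. b t < (r1 / K)\<^sup>2" "\<forall>\<^sub>F t in F. b t < 1"
    using b(2) r1 K by (auto intro: order_tendstoD(2))
  show ?thesis using lim R10 \<Lambda>p small b(1)
  proof eventually_elim
    case (elim t)
    define s where "s = sqrt (b t)"
    have s: "0 < s" "b t = s\<^sup>2" using elim(6) by (auto simp: s_def)
    have rp: "0 < R t" using elim(2) by simp
    define E where "E = (1 - \<eta>) * (b t * \<Lambda> t) * R t ^ 3"
    have E: "0 \<le> E" unfolding E_def using elim(3,6) \<eta> rp by simp
    have "E \<le> M0 (b t) (R t)"
    proof (rule M0_lower)
      show "0 < b t" "b t \<le> 1" "0 < R t" "0 \<le> E" using elim(5,6) E rp by auto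
      show "\<not> GL_energy (b t) (R t) u g \<le> ennreal E" if ug: "H1_weak_grad (cubeQ (R t)) u g" for u g
      proof
        assume le: "GL_energy (b t) (R t) u g \<le> ennreal E"
        have Ks: "K * s \<le> r1"
        proof -
          have "s < r1 / K" unfolding s_def using elim(4) r1 K by (intro real_less_lsqrt) auto
          then show ?thesis using K by (simp add: field_simps)
        qed
        have "s \<le> K * s" using K s mult_right_mono[of 1 K s] by simp
        then have r0: "sqrt (b t) \<le> K * s" by (simp add: s_def)
        have l: "0 < \<delta> * R t" "0 \<le> R t - 5 - 2 * (\<delta> * R t)"
        proof -
          show "0 < \<delta> * R t" using \<delta> rp by simp
          have "\<delta> * R t \<le> 1 / 4 * R t" using \<delta> rp by (intro mult_right_mono) auto
          then show "0 \<le> R t - 5 - 2 * (\<delta> * R t)" using elim(2) by linarith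
        qed
        have lnr: "ln (r1 / (K * s)) = \<Lambda> t + ln (r1 / K)"
          using r1 K s(1) unfolding \<Lambda>_def s_def[symmetric] by (simp add: ln_div ln_mult)
        \<comment> \<open>The parameter of Young's inequality in \<open>int_f\<close>. As E / b is
          of order \<Lambda> R^3, the value sqrt \<Lambda> balances the two error terms: both are of
          order sqrt \<Lambda> / R relative to R^3.\<close>
        define L where "L = sqrt (\<Lambda> t)"
        have L: "0 < L" "\<Lambda> t = L\<^sup>2" using elim(3) by (auto simp: L_def)
        have "(1 - r1\<^sup>2) * ln (r1 / (K * s)) * ((R t - 5 - 2 * (\<delta> * R t)) ^ 3 - (L * (R t - 1) ^ 3 + E / (b t * c) / L) / (\<delta> * R t))
          \<le> E * (1 / (b t * c) + 64 * pi / ((1 - c)\<^sup>2 * sqrt (b t) * (K * s)))"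
          by (rule GL_lower_bound[OF ug elim(6) c le E r0 Ks r1(2) l L(1)])
        then have "(1 - r1\<^sup>2) * (L\<^sup>2 + ln (r1 / K)) * ((R t - 5 - 2 * (\<delta> * R t)) ^ 3 -
            (L * (R t - 1) ^ 3 + ((1 - \<eta>) * (s\<^sup>2 * L\<^sup>2) * R t ^ 3) / (s\<^sup>2 * c) / L) / (\<delta> * R t))
          \<le> ((1 - \<eta>) * (s\<^sup>2 * L\<^sup>2) * R t ^ 3) * (1 / (s\<^sup>2 * c) + 64 * pi / ((1 - c)\<^sup>2 * s * (K * s)))"
          unfolding lnr E_def s(2) L(2) real_sqrt_abs using s(1) by simp
        moreover have "(1 - r1\<^sup>2) * (L\<^sup>2 + ln (r1 / K)) * ((R t - 5 - 2 * (\<delta> * R t)) ^ 3 -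
            (L * (R t - 1) ^ 3 + ((1 - \<eta>) * (s\<^sup>2 * L\<^sup>2) * R t ^ 3) / (s\<^sup>2 * c) / L) / (\<delta> * R t)) =
          (R t ^ 3 * L\<^sup>2) * ((1 - r1\<^sup>2) * ((1 + ln (r1 / K) / L\<^sup>2) * ((1 - 5 / R t - 2 * \<delta>) ^ 3 -
      (L / R t) * (((1 - 1 / R t) ^ 3 + (1 - \<eta>) / c) / \<delta>))))"
        proof -
          have "a * (L\<^sup>2 + k) * ((r - 5 - 2 * (\<delta> * r)) ^ 3 -
              (L * (r - 1) ^ 3 + (h * (s\<^sup>2 * L\<^sup>2) * r ^ 3) / (s\<^sup>2 * c) / L) / (\<delta> * r)) =
            (r ^ 3 * L\<^sup>2) * (a * ((1 + k / L\<^sup>2) * ((1 - 5 / r - 2 * \<delta>) ^ 3 - (L / r) * (((1 - 1 / r) ^ 3 + h / c) / \<delta>))))"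
            if r: "0 < r" for a k r h :: real
          proof -
            have e1: "L\<^sup>2 + k = L\<^sup>2 * (1 + k / L\<^sup>2)" using L by (simp add: distrib_left)
            have e2: "r - 5 - 2 * (\<delta> * r) = r * (1 - 5 / r - 2 * \<delta>)" "r - 1 = r * (1 - 1 / r)"
              using r by (auto simp: algebra_simps)
            have e3: "(h * (s\<^sup>2 * L\<^sup>2) * r ^ 3) / (s\<^sup>2 * c) / L = L * r ^ 3 * (h / c)"
              using s L by (simp add: power2_eq_square)
            have e4: "(L * (r ^ 3 * X) + L * r ^ 3 * (h / c)) / (\<delta> * r) = r ^ 3 * ((L / r) * ((X + h / c) / \<delta>))" for X
            proof -
              have "L * (r ^ 3 * X) + L * r ^ 3 * (h / c) = L * r ^ 3 * (X + h / c)" by (simp only: distrib_left mult.assoc)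
              then show ?thesis by (simp add: mult_ac)
            qed
            show ?thesis unfolding e3 e1 e2 power_mult_distrib e4 by (simp only: right_diff_distrib mult_ac)
          qed
          from this[OF rp] show ?thesis by blast
        qed
        moreover have "((1 - \<eta>) * (s\<^sup>2 * L\<^sup>2) * R t ^ 3) * (1 / (s\<^sup>2 * c) + 64 * pi / ((1 - c)\<^sup>2 * s * (K * s))) =
          (R t ^ 3 * L\<^sup>2) * ((1 - \<eta>) * (1 / c + 64 * pi / ((1 - c)\<^sup>2 * K)))"
        proof -
          have e1: "1 / (s\<^sup>2 * c) = 1 / c / s\<^sup>2" by simp
          have e2: "64 * pi / ((1 - c)\<^sup>2 * s * (K * s)) = 64 * pi / ((1 - c)\<^sup>2 * K) / s\<^sup>2"
            by (simp add: power2_eq_square mult_ac)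
          have "(h * (S * L\<^sup>2) * r) * (X / S + Y / S) = (r * L\<^sup>2) * (h * (X + Y))" if "S > 0" for h S r X Y :: real
            using that by (simp add: field_simps)
          moreover have "0 < s\<^sup>2" using s(1) by simp
          ultimately show ?thesis unfolding e1 e2 by blast
        qed
        ultimately have "(R t ^ 3 * L\<^sup>2) * ((1 - r1\<^sup>2) * ((1 + ln (r1 / K) / L\<^sup>2) * ((1 - 5 / R t - 2 * \<delta>) ^ 3 -
            (L / R t) * (((1 - 1 / R t) ^ 3 + (1 - \<eta>) / c) / \<delta>)))) \<le> (R t ^ 3 * L\<^sup>2) * ((1 - \<eta>) * (1 / c + 64 * pi / ((1 - c)\<^sup>2 * K)))"
          by (simp only:)
        moreover have "0 < R t ^ 3 * L\<^sup>2" using rp L by simp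
        ultimately have "(1 - r1\<^sup>2) * ((1 + ln (r1 / K) / L\<^sup>2) * ((1 - 5 / R t - 2 * \<delta>) ^ 3 -
            (L / R t) * (((1 - 1 / R t) ^ 3 + (1 - \<eta>) / c) / \<delta>))) \<le> (1 - \<eta>) * (1 / c + 64 * pi / ((1 - c)\<^sup>2 * K))"
          by (rule mult_left_le_imp_le)
        then show False using elim(1) unfolding L(2)[symmetric] L_def[symmetric] by linarith
      qed
    qed
    then show ?case using rp by (simp add: E_def pos_le_divide_eq)
  qed
qed

theorem theorem2p6:
  fixes b R :: "real \<Rightarrow> real"
  assumes pos: "\<forall>\<epsilon>>0. b \<epsilon> > 0 \<and> R \<epsilon> > 0"
    and b0: "(b \<longlongrightarrow> 0) (at_right 0)"
    and Rinf: "filterlim R at_top (at_right 0)"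
    and cond: "((\<lambda>\<epsilon>. ln (R \<epsilon> / sqrt (b \<epsilon>)) / (R \<epsilon>)^2) \<longlongrightarrow> 0) (at_right 0)"
  shows "(\<lambda>\<epsilon>. M0 (b \<epsilon>) (R \<epsilon>) / (R \<epsilon>)^3) \<sim>[at_right 0] (\<lambda>\<epsilon>. b \<epsilon> * ln (1 / sqrt (b \<epsilon>)))"
proof -
  define \<Lambda> where "\<Lambda> = (\<lambda>\<epsilon>. ln (1 / sqrt (b \<epsilon>)))"
  have p: "\<forall>\<^sub>F \<epsilon> in at_right 0. 0 < b \<epsilon>"
    using pos by (auto simp: eventually_at_filter)
  have b1: "\<forall>\<^sub>F \<epsilon> in at_right 0. b \<epsilon> < 1"
    using b0 by (rule order_tendstoD(2)) simp
  then have b1': "\<forall>\<^sub>F \<epsilon> in at_right 0. b \<epsilon> \<le> 1" by eventually_elim simp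
  have R1: "\<forall>\<^sub>F \<epsilon> in at_right 0. 1 < R \<epsilon>"
    using Rinf by (simp add: filterlim_at_top_dense)
  have "((\<lambda>\<epsilon>. sqrt (b \<epsilon>)) \<longlongrightarrow> 0) (at_right 0)"
    using tendsto_real_sqrt[OF b0] by simp
  moreover have "\<forall>\<^sub>F \<epsilon> in at_right 0. 0 < sqrt (b \<epsilon>)" using p by eventually_elim simp
  ultimately have "filterlim (\<lambda>\<epsilon>. inverse (sqrt (b \<epsilon>))) at_top (at_right 0)"
    by (rule filterlim_inverse_at_top)
  then have L: "filterlim \<Lambda> at_top (at_right 0)"
    unfolding \<Lambda>_def inverse_eq_divide by (rule filterlim_compose[OF ln_at_top])
  \<comment> \<open>For R > 1 the hypothesis dominates ln (1 / sqrt b) / R^2; its square root is the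
    error rate that \<open>M0_lower_asymp\<close> requires.\<close>
  have "((\<lambda>\<epsilon>. \<Lambda> \<epsilon> / (R \<epsilon>)\<^sup>2) \<longlongrightarrow> 0) (at_right 0)"
  proof (rule tendsto_sandwich[OF _ _ tendsto_const cond])
    show "\<forall>\<^sub>F \<epsilon> in at_right 0. 0 \<le> \<Lambda> \<epsilon> / (R \<epsilon>)\<^sup>2"
      using p b1' unfolding \<Lambda>_def by eventually_elim (auto intro!: divide_nonneg_nonneg ln_ge_zero)
    show "\<forall>\<^sub>F \<epsilon> in at_right 0. \<Lambda> \<epsilon> / (R \<epsilon>)\<^sup>2 \<le> ln (R \<epsilon> / sqrt (b \<epsilon>)) / (R \<epsilon>)\<^sup>2"
      using p R1 unfolding \<Lambda>_def by eventually_elim (auto intro!: divide_right_mono ln_mono)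
  qed
  from tendsto_real_sqrt[OF this]
  have "((\<lambda>\<epsilon>. sqrt (\<Lambda> \<epsilon> / (R \<epsilon>)\<^sup>2)) \<longlongrightarrow> 0) (at_right 0)" by simp
  then have LR: "((\<lambda>\<epsilon>. sqrt (\<Lambda> \<epsilon>) / R \<epsilon>) \<longlongrightarrow> 0) (at_right 0)"
  proof (rule Lim_transform_eventually)
    show "\<forall>\<^sub>F \<epsilon> in at_right 0. sqrt (\<Lambda> \<epsilon> / (R \<epsilon>)\<^sup>2) = sqrt (\<Lambda> \<epsilon>) / R \<epsilon>"
      using R1 by eventually_elim (simp add: real_sqrt_divide)
  qed
  have Lp: "\<forall>\<^sub>F \<epsilon> in at_right 0. 0 < \<Lambda> \<epsilon>" using L by (simp add: filterlim_at_top_dense)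
  show ?thesis unfolding \<Lambda>_def[symmetric]
  proof (rule asymp_equivI', rule tendstoI)
    fix e :: real assume e: "0 < e"
    define \<eta> where "\<eta> = min (e / 2) (1 / 2)"
    have \<eta>: "0 < \<eta>" "\<eta> < 1" "\<eta> < e" using e by (auto simp: \<eta>_def)
    have "\<forall>\<^sub>F \<epsilon> in at_right 0. (1 - \<eta>) * (b \<epsilon> * \<Lambda> \<epsilon>) \<le> M0 (b \<epsilon>) (R \<epsilon>) / R \<epsilon> ^ 3"
      using M0_lower_asymp[OF p b0 Rinf L[unfolded \<Lambda>_def] LR[unfolded \<Lambda>_def] \<eta>(1,2)] unfolding \<Lambda>_def .
    moreover have "\<forall>\<^sub>F \<epsilon> in at_right 0. M0 (b \<epsilon>) (R \<epsilon>) / R \<epsilon> ^ 3 \<le> (1 + \<eta>) * (b \<epsilon> * \<Lambda> \<epsilon>)"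
      using M0_upper_asymp[OF p b1' Rinf L[unfolded \<Lambda>_def] \<eta>(1)] unfolding \<Lambda>_def .
    ultimately show "\<forall>\<^sub>F \<epsilon> in at_right 0. dist (M0 (b \<epsilon>) (R \<epsilon>) / R \<epsilon> ^ 3 / (b \<epsilon> * ln (1 / sqrt (b \<epsilon>)))) 1 < e"
      using p Lp
    proof eventually_elim
      case (elim \<epsilon>)
      have "0 < b \<epsilon> * \<Lambda> \<epsilon>" using elim by simp
      then have "1 - \<eta> \<le> M0 (b \<epsilon>) (R \<epsilon>) / R \<epsilon> ^ 3 / (b \<epsilon> * \<Lambda> \<epsilon>)" "M0 (b \<epsilon>) (R \<epsilon>) / R \<epsilon> ^ 3 / (b \<epsilon> * \<Lambda> \<epsilon>) \<le> 1 + \<eta>"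
        using elim(1,2) by (simp_all only: pos_le_divide_eq pos_divide_le_eq)
      then show ?case unfolding \<Lambda>_def[symmetric] dist_real_def using \<eta>(3) by (simp add: \<Lambda>_def abs_less_iff)
    qed
  qed
qed

end
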